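(* Let $L,T,\mu>0$ and let $v_{in},v_L,S_0:[0,T]\to\mathbb{R}$ and $S_1:[0,L]\to\mathbb{R}$ satisfy $$S_0\in W^{2,\infty}(0,T),\quad S_1\in H^2(0,L),\quad v_{in},v_L\in W^{1,\infty}(0,T),$$ and, for some constants $v_m,V_M,S_m,S_M$, $$0<v_m\le v_{in}(t)<v_L(t)\le V_M \ \text{ for any } t\in(0,T),$$ $$0<S_m\le S_0(t),\,S_1(x)\le S_M\ \text{ for all }(t,x)\in(0,T)\times(0,L),\qquad S_0(0)=S_1(0).$$ Then the initial-boundary value problem $$\partial_t A+\partial_x(vA)=0,\qquad \partial_x(3\mu A\,\partial_x v)=0\qquad\text{in } Q_T=(0,T)\times(0,L),$$ $$A(t,0)=S_0(t),\quad v(t,0)=v_{in}(t),\quad v(t,L)=v_L(t)\ \text{ for } t\in(0,T),\qquad A(0,x)=S_1(x)\ \text{ for } x\in(0,L),$$ possesses a unique strong solution $(A,v)$ on $\overline{Q_T}$, belonging to the class $$A,\ \partial_tA,\ \partial_xA\in L^\infty(Q_T),\qquad v,\ \partial_tv,\ \partial^2_{t,x}v,\ \partial^2_{x,x}v\in L^\infty(Q_T).$$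
   Context: A pair $(A,v)$ defined on $Q_T=(0,T)\times(0,L)$ is a strong solution of the problem if: $A\in W^{1,\infty}(Q_T)$; $v,\partial_tv,\partial_xv,\partial^2_{tx}v,\partial^2_xv\in L^\infty(Q_T)$; $(A,v)$ satisfies the two differential equations almost everywhere in $Q_T$; $A>0$ on $Q_T$; and $A$ and $v$ satisfy their respective initial and boundary conditions pointwise. Here $W^{k,p}$ are the usual Sobolev spaces and $H^2=W^{2,2}$. *)

theory Defs
  imports "HOL-Analysis.Analysis"
begin

section \<open>Weak derivatives and Sobolev spaces on an open subset of a Euclidean space\<close>

definition partial_deriv :: "'a::euclidean_space \<Rightarrow> ('a \<Rightarrow> real) \<Rightarrow> 'a \<Rightarrow> real" where
  "partial_deriv b f x = frechet_derivative f (at x) b"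

text \<open>A multi-index is encoded as the list of the basis vectors in whose directions one
  differentiates; its order is the length of the list.\<close>

primrec iter_partial :: "'a::euclidean_space list \<Rightarrow> ('a \<Rightarrow> real) \<Rightarrow> 'a \<Rightarrow> real" where
  "iter_partial [] f = f"
| "iter_partial (b # bs) f = partial_deriv b (iter_partial bs f)"

definition smooth_fun :: "('a::euclidean_space \<Rightarrow> real) \<Rightarrow> bool" where
  "smooth_fun f \<longleftrightarrow> (\<forall>bs. set bs \<subseteq> Basis \<longrightarrow> iter_partial bs f differentiable_on UNIV)"

definition test_fun :: "'a::euclidean_space set \<Rightarrow> ('a \<Rightarrow> real) \<Rightarrow> bool" where
  "test_fun U \<phi> \<longleftrightarrow> smooth_fun \<phi> \<and> (\<exists>K. compact K \<and> K \<subseteq> U \<and> (\<forall>x. x \<notin> K \<longrightarrow> \<phi> x = 0))"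

definition loc_integrable :: "'a::euclidean_space set \<Rightarrow> ('a \<Rightarrow> real) \<Rightarrow> bool" where
  "loc_integrable U u \<longleftrightarrow> (\<forall>K. compact K \<and> K \<subseteq> U \<longrightarrow> u absolutely_integrable_on K)"

definition weak_deriv ::
  "'a::euclidean_space set \<Rightarrow> 'a list \<Rightarrow> ('a \<Rightarrow> real) \<Rightarrow> ('a \<Rightarrow> real) \<Rightarrow> bool" where
  "weak_deriv U bs u w \<longleftrightarrow> loc_integrable U u \<and> loc_integrable U w \<and>
     (\<forall>\<phi>. test_fun U \<phi> \<longrightarrow>
        (\<integral>x. u x * iter_partial bs \<phi> x \<partial>lebesgue_on U)
          = (- 1) ^ length bs * (\<integral>x. w x * \<phi> x \<partial>lebesgue_on U))"

definition Lp_on :: "ennreal \<Rightarrow> 'a::euclidean_space set \<Rightarrow> ('a \<Rightarrow> real) \<Rightarrow> bool" where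
  "Lp_on p U f \<longleftrightarrow> f \<in> borel_measurable (lebesgue_on U) \<and>
     (if p = \<infinity> then \<exists>C. AE x in lebesgue_on U. \<bar>f x\<bar> \<le> C
      else integrable (lebesgue_on U) (\<lambda>x. \<bar>f x\<bar> powr enn2real p))"

definition sobolev :: "nat \<Rightarrow> ennreal \<Rightarrow> 'a::euclidean_space set \<Rightarrow> ('a \<Rightarrow> real) \<Rightarrow> bool" where
  "sobolev k p U u \<longleftrightarrow> Lp_on p U u \<and>
     (\<forall>bs. set bs \<subseteq> Basis \<and> length bs \<le> k \<longrightarrow> (\<exists>w. Lp_on p U w \<and> weak_deriv U bs u w))"

definition weak_deriv_in_Linf ::
  "'a::euclidean_space set \<Rightarrow> 'a list \<Rightarrow> ('a \<Rightarrow> real) \<Rightarrow> bool" where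
  "weak_deriv_in_Linf U bs u \<longleftrightarrow> (\<exists>w. Lp_on \<infinity> U w \<and> weak_deriv U bs u w)"


section \<open>The initial-boundary value problem\<close>

text \<open>Points of the space-time rectangle are pairs \<open>(t, x)\<close>.\<close>

abbreviation dir_t :: "real \<times> real" where "dir_t \<equiv> (1, 0)"
abbreviation dir_x :: "real \<times> real" where "dir_x \<equiv> (0, 1)"

definition QT :: "real \<Rightarrow> real \<Rightarrow> (real \<times> real) set" where
  "QT T L = {0<..<T} \<times> {0<..<L}"

text \<open>The two balance laws, almost everywhere.  Weak derivatives are determined only up to null
  sets, so the choice of the representatives \<open>At\<close>, \<open>F\<close>, \<open>vx\<close>, \<open>G\<close> is immaterial.\<close>

definition solves_pde ::
  "real \<Rightarrow> (real \<times> real) set \<Rightarrow> (real \<times> real \<Rightarrow> real) \<Rightarrow> (real \<times> real \<Rightarrow> real) \<Rightarrow> bool" where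
  "solves_pde \<mu> Q A v \<longleftrightarrow>
     (\<exists>At F. weak_deriv Q [dir_t] A At \<and> weak_deriv Q [dir_x] (\<lambda>q. v q * A q) F \<and>
        (AE q in lebesgue_on Q. At q + F q = 0)) \<and>
     (\<exists>vx G. weak_deriv Q [dir_x] v vx \<and> weak_deriv Q [dir_x] (\<lambda>q. 3 * \<mu> * A q * vx q) G \<and>
        (AE q in lebesgue_on Q. G q = 0))"

text \<open>Elements of \<open>L\<^sup>\<infinity>\<close> are classes of functions, but pointwise initial and boundary values refer
  to the representative that is continuous up to the boundary (\<open>A\<close> and \<open>v\<close> have one, being in
  \<open>W\<^sup>1\<^sup>,\<^sup>\<infinity>\<close> of a rectangle).  The continuity condition selects this representative.\<close>

definition strong_solution ::
  "real \<Rightarrow> real \<Rightarrow> real \<Rightarrow> (real \<Rightarrow> real) \<Rightarrow> (real \<Rightarrow> real) \<Rightarrow> (real \<Rightarrow> real) \<Rightarrow> (real \<Rightarrow> real) \<Rightarrow>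
    (real \<times> real \<Rightarrow> real) \<Rightarrow> (real \<times> real \<Rightarrow> real) \<Rightarrow> bool" where
  "strong_solution \<mu> T L S0 S1 vin vL A v \<longleftrightarrow>
     continuous_on (closure (QT T L)) A \<and> continuous_on (closure (QT T L)) v \<and>
     sobolev 1 \<infinity> (QT T L) A \<and>
     Lp_on \<infinity> (QT T L) v \<and>
     weak_deriv_in_Linf (QT T L) [dir_t] v \<and>
     weak_deriv_in_Linf (QT T L) [dir_x] v \<and>
     weak_deriv_in_Linf (QT T L) [dir_t, dir_x] v \<and>
     weak_deriv_in_Linf (QT T L) [dir_x, dir_x] v \<and>
     solves_pde \<mu> (QT T L) A v \<and>
     (\<forall>q\<in>QT T L. A q > 0) \<and>
     (\<forall>t\<in>{0<..<T}. A (t, 0) = S0 t \<and> v (t, 0) = vin t \<and> v (t, L) = vL t) \<and>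
     (\<forall>x\<in>{0<..<L}. A (0, x) = S1 x)"

end

theory Submission
  imports Defs "HOL-Computational_Algebra.Polynomial"
begin

text \<open>The second equation says that \<open>A v\<^sub>x = c\<close> depends on time only, where
  \<open>c = (v\<^sub>L - v\<^sub>i\<^sub>n) / \<integral> dx / A\<close>.  Label the particles by the mass coordinate \<open>m = \<integral> A dx - N t\<close>, the
  integral extending from the inlet to the particle, with \<open>N t\<close> the mass that has entered up to
  time \<open>t\<close>.  Then \<open>m\<^sub>x = A\<close> and \<open>m\<^sub>t = - v A\<close>, and the area of a fixed particle decreases at the
  rate \<open>c\<close>, so that \<open>A = b m - (C t - C (\<tau> m))\<close> with \<open>C' = c\<close>, the entrance time \<open>\<tau> m\<close> of the particle
  and its area \<open>b m\<close> at that time.  The whole problem thus becomes a fixed point equation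
  \<open>C' = F C\<close> for a single function of time.

  If the area is truncated from below at \<open>\<delta>\<close>, then \<open>F\<close> is Lipschitz in the history of \<open>C\<close>, and
  Banach's theorem applies in an exponentially weighted norm.  Since \<open>A\<close> is Lipschitz in \<open>m\<close>, its
  logarithm is Lipschitz in \<open>x\<close>; hence \<open>c\<close> is at most a multiple of \<open>A\<close> that does not depend on
  \<open>\<delta>\<close>, the area decays at most exponentially, and for small \<open>\<delta>\<close> the truncation is inactive.
  Conversely, testing with products shows that a strong solution satisfies both equations in
  integrated form, and its area is positive up to the outlet because \<open>v\<^sub>x = c / A\<close> is bounded.
  It therefore solves the same fixed point problem, which gives uniqueness.\<close>

text \<open>The inlet flux is prescribed, so labels and entrance times are known before the solution
  is; the areas depend on the unknown through \<open>C\<close> alone. Two obstacles shape the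
  details. The truncated area has a corner at \<delta>, whereas the passage to Eulerian coordinates
  needs classical derivatives in time; the reciprocal is therefore continued below \<delta> by its
  tangent line, which changes nothing inside the fibre. And the derivatives of the area are bounded
  but may jump, for instance across the path of the particle that starts at the corner (0, 0) of the
  rectangle. Functions are therefore carried together with a bounded density; since particles move
  to the right, every line parallel to an axis meets only finitely many such jumps. The data are
  frozen outside their intervals, so that primitives, inverses and continuity live on the whole
  line. Uniqueness is argued on [0, t] with t < T: positivity is known on the open rectangle only,
  and a positive minimum of the area is available only away from the final time. The time T itself
  is reached by continuity.\<close>

definition clamp_real :: "real \<Rightarrow> real \<Rightarrow> real \<Rightarrow> real" where
  "clamp_real a b x = max a (min b x)"

lemma clamp_real_in: "a \<le> b \<Longrightarrow> clamp_real a b x \<in> {a..b}"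
  by (auto simp: clamp_real_def)

lemma clamp_real_id: "x \<in> {a..b} \<Longrightarrow> clamp_real a b x = x"
  by (auto simp: clamp_real_def)

lemma continuous_on_clamp_real [continuous_intros]:
  "continuous_on S f \<Longrightarrow> continuous_on S (\<lambda>x. clamp_real a b (f x))"
  unfolding clamp_real_def by (intro continuous_intros)

lemma abs_clamp_real_diff: "\<bar>clamp_real a b x - clamp_real a b y\<bar> \<le> \<bar>x - y\<bar>"
  by (auto simp: clamp_real_def)

lemma continuous_on_compose_clamp:
  fixes f :: "real \<Rightarrow> real"
  assumes "continuous_on {a..b} f" "a \<le> b"
  shows "continuous_on S (\<lambda>x. f (clamp_real a b x))"
  by (rule continuous_on_compose2[OF assms(1)])
    (use clamp_real_in[OF assms(2)] in \<open>auto intro!: continuous_intros\<close>)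

text \<open>The integral oriented from 0: for \<open>x\<close> of either sign one of the two terms
  runs over an empty interval, so no case distinction is needed.\<close>

definition prim :: "(real \<Rightarrow> real) \<Rightarrow> real \<Rightarrow> real" where
  "prim f x = integral {0..x} f - integral {x..0} f"

lemma prim_0 [simp]: "prim f 0 = 0"
  by (simp add: prim_def)

lemma integral_combine_cont:
  fixes f :: "real \<Rightarrow> real"
  assumes "continuous_on UNIV f" "a \<le> b" "b \<le> c"
  shows "integral {a..b} f + integral {b..c} f = integral {a..c} f"
  by (rule Henstock_Kurzweil_Integration.integral_combine)
    (use assms in \<open>auto intro!: integrable_continuous_real intro: continuous_on_subset\<close>)

lemma prim_diff:
  assumes "continuous_on UNIV f" "a \<le> b"
  shows "prim f b - prim f a = integral {a..b} f"
proof -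
  consider "0 \<le> a" | "a \<le> 0" "0 \<le> b" | "b \<le> 0" using assms(2) by linarith
  then show ?thesis
  proof cases
    case 1
    then show ?thesis using integral_combine_cont[OF assms(1), of 0 a b] assms(2)
      by (cases "a = 0"; cases "b = 0") (auto simp: prim_def)
  next
    case 2
    then show ?thesis using integral_combine_cont[OF assms(1), of a 0 b] assms(2)
      by (cases "a = 0"; cases "b = 0") (auto simp: prim_def)
  next
    case 3
    then show ?thesis using integral_combine_cont[OF assms(1), of a b 0] assms(2)
      by (cases "a = 0"; cases "b = 0") (auto simp: prim_def)
  qed
qed

lemma prim_deriv:
  assumes "continuous_on UNIV f"
  shows "(prim f has_real_derivative f x) (at x)"
proof -
  have c: "continuous_on {x-1..x+1} f" using assms continuous_on_subset by blast
  \<comment> \<open>Starting at \<open>x - 1\<close> keeps \<open>x\<close> interior to the interval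
    of integration, whatever its sign.\<close>
  have "((\<lambda>u. integral {x-1..u} f) has_real_derivative f x) (at x within {x-1..x+1})"
    by (rule integral_has_real_derivative[OF c]) auto
  then have "((\<lambda>u. integral {x-1..u} f) has_real_derivative f x) (at x)"
    using at_within_interior[of x "{x-1..x+1}"] by simp
  then have "((\<lambda>u. prim f (x-1) + integral {x-1..u} f) has_real_derivative f x) (at x)"
    by (auto intro!: derivative_eq_intros)
  moreover have "\<forall>\<^sub>F u in nhds x. prim f (x-1) + integral {x-1..u} f = prim f u"
  proof -
    have "\<forall>\<^sub>F u in nhds x. u \<in> {x-1<..<x+1}"
      by (rule eventually_nhds_in_open) auto
    then show ?thesis
      proof eventually_elim
      case (elim u)
      then show ?case using prim_diff[OF assms, of "x-1" u] by simp
    qed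
  qed
  ultimately show ?thesis using DERIV_cong_ev[OF refl _ refl, of "\<lambda>u. prim f (x-1) + integral {x-1..u} f" "prim f" x "f x"] by simp
qed

lemma continuous_on_prim:
  assumes "continuous_on UNIV f"
  shows "continuous_on S (prim f)"
  using prim_deriv[OF assms] by (meson DERIV_continuous continuous_at_imp_continuous_on)

text \<open>The mean value theorem for \<open>g - f\<close>. It turns pointwise bounds on
  derivatives into bounds on increments and, used in both directions, identifies
  antiderivatives.\<close>

lemma deriv_mono_le:
  fixes f g :: "real \<Rightarrow> real"
  assumes "a \<le> b" "continuous_on {a..b} f" "continuous_on {a..b} g"
    and "\<And>x. a < x \<Longrightarrow> x < b \<Longrightarrow> (f has_real_derivative f' x) (at x)"
    and "\<And>x. a < x \<Longrightarrow> x < b \<Longrightarrow> (g has_real_derivative g' x) (at x)"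
    and "\<And>x. a < x \<Longrightarrow> x < b \<Longrightarrow> f' x \<le> g' x"
  shows "f b - f a \<le> g b - g a"
proof (cases "a = b")
  case False
  then have ab: "a < b" using assms by simp
  have "\<exists>l z. a < z \<and> z < b \<and> ((\<lambda>x. g x - f x) has_real_derivative l) (at z) \<and>
      (g b - f b) - (g a - f a) = (b - a) * l"
  proof (rule MVT[OF ab])
    show "continuous_on {a..b} (\<lambda>x. g x - f x)" using assms by (intro continuous_intros)
    show "(\<lambda>x. g x - f x) differentiable at x" if "a < x" "x < b" for x
      using DERIV_diff[OF assms(5)[OF that] assms(4)[OF that]] by (auto simp: real_differentiable_def)
  qed
  then obtain l z where z: "a < z" "z < b" "((\<lambda>x. g x - f x) has_real_derivative l) (at z)"
      "(g b - f b) - (g a - f a) = (b - a) * l" by blast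
  have "l = g' z - f' z"
    by (rule DERIV_unique[OF z(3)]) (use assms z in \<open>auto intro!: derivative_intros\<close>)
  then have "0 \<le> (b - a) * l" using assms(6)[OF z(1,2)] ab by simp
  then show ?thesis using z by linarith
qed simp

lemma prim_lower:
  assumes "continuous_on UNIV f" and "\<And>x. k \<le> f x" and "a \<le> b"
  shows "k * (b - a) \<le> prim f b - prim f a"
proof -
  have "k * b - k * a \<le> prim f b - prim f a"
    by (rule deriv_mono_le[where f'="\<lambda>_. k" and g'=f])
      (use assms prim_deriv[OF assms(1)] continuous_on_prim[OF assms(1)] in
        \<open>auto intro!: derivative_eq_intros continuous_intros\<close>)
  then show ?thesis by (simp add: algebra_simps)
qed

lemma prim_upper:
  assumes "continuous_on UNIV f" and "\<And>x. f x \<le> k" and "a \<le> b"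
  shows "prim f b - prim f a \<le> k * (b - a)"
proof -
  have "prim f b - prim f a \<le> k * b - k * a"
    by (rule deriv_mono_le[where g'="\<lambda>_. k" and f'=f])
      (use assms prim_deriv[OF assms(1)] continuous_on_prim[OF assms(1)] in
        \<open>auto intro!: derivative_eq_intros continuous_intros\<close>)
  then show ?thesis by (simp add: algebra_simps)
qed

text \<open>A slope bounded below by \<open>k\<close> forces at least linear growth in both
  directions, so the intermediate value theorem on [-r, r] with r = |y - f 0| / k reaches every
  value \<open>y\<close>.\<close>

lemma slope_bij:
  fixes f :: "real \<Rightarrow> real"
  assumes cont: "continuous_on UNIV f" and k: "0 < k"
    and slope: "\<And>a b. a \<le> b \<Longrightarrow> k * (b - a) \<le> f b - f a"
  shows "bij f" and "strict_mono f"
proof -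
  show sm: "strict_mono f"
  proof (rule strict_monoI)
    fix x y :: real assume "x < y"
    then have "0 < k * (y - x)" using k by simp
    then show "f x < f y" using slope[of x y] \<open>x < y\<close> by linarith
  qed
  have "\<exists>x. f x = y" for y
  proof -
    define r where "r = (\<bar>y - f 0\<bar>) / k"
    have r: "0 \<le> r" "k * r = \<bar>y - f 0\<bar>" using k by (auto simp: r_def)
    have 1: "f (-r) \<le> y" using slope[of "-r" 0] r by simp
    have 2: "y \<le> f r" using slope[of 0 r] r by simp
    have "\<exists>x\<ge>-r. x \<le> r \<and> f x = y"
      by (rule IVT'[of f, OF 1 2]) (use r cont continuous_on_subset in auto)
    then show ?thesis by blast
  qed
  then have "surj f" by (metis surj_def)
  with sm show "bij f" by (simp add: bij_def strict_mono_imp_inj_on)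
qed

text \<open>Lipschitz functions on \<open>[a, b]\<close>, presented through a bounded Borel density.\<close>

definition lac :: "real \<Rightarrow> real \<Rightarrow> (real \<Rightarrow> real) \<Rightarrow> (real \<Rightarrow> real) \<Rightarrow> bool" where
  "lac a b f d \<longleftrightarrow> d \<in> borel_measurable borel \<and> (\<exists>M. \<forall>x\<in>{a..b}. \<bar>d x\<bar> \<le> M) \<and>
     (\<forall>s t. a \<le> s \<and> s \<le> t \<and> t \<le> b \<longrightarrow> (d has_integral (f t - f s)) {s..t})"

section \<open>Calculus of Lipschitz functions through their densities\<close>

lemma bounded_borel_abs_integrable:
  fixes d :: "real \<Rightarrow> real"
  assumes "d \<in> borel_measurable borel" "\<And>x. x \<in> {a..b} \<Longrightarrow> \<bar>d x\<bar> \<le> M"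
  shows "set_integrable lborel {a..b} d"
  unfolding set_integrable_def
proof (rule Bochner_Integration.integrable_bound)
  show "integrable lborel (\<lambda>x. indicat_real {a..b} x * M)"
    by (rule integrable_mult_left) (simp add: integrable_real_indicator emeasure_lborel_Icc_eq)
  show "AE x in lborel. norm (indicat_real {a..b} x *\<^sub>R d x) \<le> norm (indicat_real {a..b} x * M)"
    using order_trans[OF assms(2) abs_ge_self] by (intro AE_I2) (auto simp: indicator_def split: if_splits)
qed (use assms in measurable)

lemma bounded_borel_integrable:
  fixes d :: "real \<Rightarrow> real"
  assumes "d \<in> borel_measurable borel" "\<And>x. x \<in> {a..b} \<Longrightarrow> \<bar>d x\<bar> \<le> M"
  shows "d integrable_on {a..b}"
  using set_borel_integral_eq_integral(1)[OF bounded_borel_abs_integrable[OF assms]] by simp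

lemma lac_D:
  assumes "lac a b f d"
  shows "d \<in> borel_measurable borel"
    and "a \<le> s \<Longrightarrow> s \<le> t \<Longrightarrow> t \<le> b \<Longrightarrow> (d has_integral (f t - f s)) {s..t}"
  using assms by (auto simp: lac_def)

lemma lac_bound: "lac a b f d \<Longrightarrow> \<exists>M\<ge>0. \<forall>x\<in>{a..b}. \<bar>d x\<bar> \<le> M"
  unfolding lac_def by (meson abs_ge_zero abs_le_D1 linorder_le_cases order_trans)

lemma lac_lipschitz:
  assumes "lac a b f d" and M: "\<And>x. x \<in> {a..b} \<Longrightarrow> \<bar>d x\<bar> \<le> M"
    and "a \<le> s" "s \<le> t" "t \<le> b"
  shows "\<bar>f t - f s\<bar> \<le> M * (t - s)"
proof -
  have "norm (f t - f s) \<le> M * measure lborel (cbox s t)"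
  proof (rule has_integral_bound)
    show "0 \<le> M" using M[of s] assms by force
    show "(d has_integral (f t - f s)) (cbox s t)" using lac_D(2)[OF assms(1)] assms by simp
    show "norm (d x) \<le> M" if "x \<in> cbox s t" for x using M that assms by auto
  qed
  then show ?thesis using assms by simp
qed

lemma lac_continuous:
  assumes "lac a b f d"
  shows "continuous_on {a..b} f"
proof -
  obtain M where M: "M \<ge> 0" "\<And>x. x \<in> {a..b} \<Longrightarrow> \<bar>d x\<bar> \<le> M" using lac_bound[OF assms] by blast
  have "M-lipschitz_on {a..b} f"
  proof (rule lipschitz_onI)
    fix x y assume "x \<in> {a..b}" "y \<in> {a..b}"
    then show "dist (f x) (f y) \<le> M * dist x y"
      using lac_lipschitz[OF assms M(2), of x y] lac_lipschitz[OF assms M(2), of y x]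
      by (cases "x \<le> y") (auto simp: dist_real_def abs_minus_commute)
  qed (use M in auto)
  then show ?thesis by (rule lipschitz_on_continuous_on)
qed

text \<open>Increments of second order make every difference quotient tend to 0, so the derivative
  vanishes throughout.\<close>

lemma quadratic_const:
  fixes e :: "real \<Rightarrow> real"
  assumes K: "\<And>s t. a \<le> s \<Longrightarrow> s \<le> t \<Longrightarrow> t \<le> b \<Longrightarrow> \<bar>e t - e s\<bar> \<le> K * (t - s)\<^sup>2"
    and "a \<le> s" "s \<le> t" "t \<le> b"
  shows "e t = e s"
proof -
  have "\<exists>c. \<forall>x\<in>{a..b}. e x = c"
  proof (rule has_field_derivative_zero_constant)
    fix x assume x: "x \<in> {a..b}"
    have "((\<lambda>y. (e y - e x) / (y - x)) \<longlongrightarrow> 0) (at x within {a..b})"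
    proof (rule Lim_null_comparison)
      show "\<forall>\<^sub>F y in at x within {a..b}. norm ((e y - e x) / (y - x)) \<le> K * \<bar>y - x\<bar>"
        unfolding eventually_at_filter
      proof (rule always_eventually, intro allI impI)
        fix y assume y: "y \<noteq> x" "y \<in> {a..b}"
        have "\<bar>e y - e x\<bar> \<le> K * (y - x)\<^sup>2"
          using K[of x y] K[of y x] x y by (cases "x \<le> y") (auto simp: abs_minus_commute power2_commute)
        then show "norm ((e y - e x) / (y - x)) \<le> K * \<bar>y - x\<bar>"
          using y by (simp add: divide_le_eq power2_eq_square abs_mult_self_eq mult.assoc)
      qed
      have "((\<lambda>y. K * \<bar>y - x\<bar>) \<longlongrightarrow> K * \<bar>x - x\<bar>) (at x within {a..b})"
        by (intro tendsto_intros)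
      then show "((\<lambda>y. K * \<bar>y - x\<bar>) \<longlongrightarrow> 0) (at x within {a..b})" by simp
    qed
    then show "(e has_field_derivative 0) (at x within {a..b})"
      by (simp add: has_field_derivative_iff)
  qed auto
  then show ?thesis using assms by (metis atLeastAtMost_iff order_trans)
qed

text \<open>Recognizes a density from local information: the increment of \<open>f\<close> has to
  match the integral of \<open>d\<close> only up to second order in the length, because the
  difference of \<open>f\<close> and the primitive of \<open>d\<close> is then constant.\<close>

lemma lacI_quadratic:
  assumes d: "d \<in> borel_measurable borel" and M: "\<And>x. x \<in> {a..b} \<Longrightarrow> \<bar>d x\<bar> \<le> M"
    and K: "\<And>s t. a \<le> s \<Longrightarrow> s \<le> t \<Longrightarrow> t \<le> b \<Longrightarrow> \<bar>f t - f s - integral {s..t} d\<bar> \<le> K * (t - s)\<^sup>2"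
  shows "lac a b f d"
proof -
  have main: "(d has_integral (f t - f s)) {s..t}" if st: "a \<le> s" "s \<le> t" "t \<le> b" for s t
  proof -
  define e where "e x = f x - integral {a..x} d" for x
  have int: "d integrable_on {a..b}" by (rule bounded_borel_integrable[OF d M])
  have comb: "integral {a..t} d - integral {a..s} d = integral {s..t} d"
    if "a \<le> s" "s \<le> t" "t \<le> b" for s t
    using Henstock_Kurzweil_Integration.integral_combine[OF that(1,2), of d]
      integrable_subinterval_real[OF int, of a t] that by (simp add: algebra_simps)
  have "e t = e s"
  proof (rule quadratic_const[where e=e and K=K and a=a and b=b])
    fix s t assume "a \<le> s" "s \<le> t" "t \<le> b"
    then show "\<bar>e t - e s\<bar> \<le> K * (t - s)\<^sup>2" using K[of s t] comb[of s t] by (simp add: e_def algebra_simps)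
  qed (use st in auto)
  then have "integral {s..t} d = f t - f s" using comb[of s t] st by (simp add: e_def)
  moreover have "d integrable_on {s..t}" using integrable_subinterval_real[OF int] st by auto
  ultimately show ?thesis by (metis integrable_integral)
  qed
  then show ?thesis using d M unfolding lac_def by blast
qed

lemma cong_lac:
  assumes "lac a b f d" "\<And>x. x \<in> {a..b} \<Longrightarrow> f x = g x"
  shows "lac a b g d"
  using assms unfolding lac_def by (metis atLeastAtMost_iff order_trans)

lemma cont_bounded_Icc:
  fixes f :: "real \<Rightarrow> real"
  assumes "continuous_on {a..b} f"
  obtains M where "M \<ge> 0" "\<And>x. x \<in> {a..b} \<Longrightarrow> \<bar>f x\<bar> \<le> M"
proof -
  have "bounded (f ` {a..b})" using assms compact_continuous_image compact_imp_bounded by blast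
  then obtain M where "\<And>x. x \<in> {a..b} \<Longrightarrow> \<bar>f x\<bar> \<le> M" by (force simp: bounded_iff)
  then show thesis using that[of "max 0 M"] by force
qed

text \<open>With one factor frozen at an endpoint, the increment of the product is exactly the
  integral of \<open>d x * g s + f t * h x\<close>; unfreezing changes the integrand by at most a
  multiple of the length, so the error is of second order. The density is a separate function
  \<open>k\<close> because \<open>f\<close> and \<open>g\<close> are controlled on [a, b] only, so
  that the formula for it need not be Borel on the line.\<close>

lemma lac_mult:
  assumes f: "lac a b f d" and g: "lac a b g h"
    and k: "k \<in> borel_measurable borel" and keq: "\<And>x. x \<in> {a..b} \<Longrightarrow> k x = d x * g x + f x * h x"
  shows "lac a b (\<lambda>x. f x * g x) k"
proof -
  obtain M1 where M1: "M1 \<ge> 0" "\<And>x. x \<in> {a..b} \<Longrightarrow> \<bar>d x\<bar> \<le> M1" using lac_bound[OF f] by blast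
  obtain M2 where M2: "M2 \<ge> 0" "\<And>x. x \<in> {a..b} \<Longrightarrow> \<bar>h x\<bar> \<le> M2" using lac_bound[OF g] by blast
  obtain M3 where M3: "M3 \<ge> 0" "\<And>x. x \<in> {a..b} \<Longrightarrow> \<bar>f x\<bar> \<le> M3"
    using cont_bounded_Icc[OF lac_continuous[OF f]] by blast
  obtain M4 where M4: "M4 \<ge> 0" "\<And>x. x \<in> {a..b} \<Longrightarrow> \<bar>g x\<bar> \<le> M4"
    using cont_bounded_Icc[OF lac_continuous[OF g]] by blast
  show ?thesis
  proof (rule lacI_quadratic[where M="M1 * M4 + M3 * M2" and K="M1 * M2 + M1 * M2"])
    show kb: "\<bar>k x\<bar> \<le> M1 * M4 + M3 * M2" if "x \<in> {a..b}" for x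
    proof -
      have "\<bar>d x * g x\<bar> \<le> M1 * M4" unfolding abs_mult
        by (intro mult_mono) (use M1 M4 that in auto)
      moreover have "\<bar>f x * h x\<bar> \<le> M3 * M2" unfolding abs_mult
        by (intro mult_mono) (use M2 M3 that in auto)
      ultimately show ?thesis using keq[OF that] by linarith
    qed
    fix s t assume st: "a \<le> s" "s \<le> t" "t \<le> b"
    have 1: "((\<lambda>x. d x * g s) has_integral ((f t - f s) * g s)) {s..t}"
      using lac_D(2)[OF f st] by (rule has_integral_mult_left)
    have 2: "((\<lambda>x. f t * h x) has_integral (f t * (g t - g s))) {s..t}"
      using lac_D(2)[OF g st] by (rule has_integral_mult_right)
    have 3: "(k has_integral integral {s..t} k) {s..t}"
      by (rule integrable_integral, rule bounded_borel_integrable[OF k kb]) (use st in auto)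
    have 4: "((\<lambda>x. d x * g s + f t * h x - k x) has_integral
        ((f t - f s) * g s + f t * (g t - g s) - integral {s..t} k)) (cbox s t)"
      unfolding box_real using 1 2 3 by (intro has_integral_add has_integral_diff)
    have "norm ((f t - f s) * g s + f t * (g t - g s) - integral {s..t} k)
        \<le> ((M1 * M2 + M1 * M2) * (t - s)) * measure lborel (cbox s t)"
    proof (rule has_integral_bound[OF _ 4])
      show "0 \<le> (M1 * M2 + M1 * M2) * (t - s)" using M1 M2 st by simp
      fix x assume x: "x \<in> cbox s t"
      then have xi: "x \<in> {a..b}" using st by auto
      have "\<bar>d x * (g x - g s)\<bar> \<le> M1 * (M2 * (t - s))" unfolding abs_mult
      proof (intro mult_mono)
        have "\<bar>g x - g s\<bar> \<le> M2 * (x - s)" using lac_lipschitz[OF g M2(2), of s x] x st by auto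
        also have "\<dots> \<le> M2 * (t - s)" using M2 x by (intro mult_left_mono) auto
        finally show "\<bar>g x - g s\<bar> \<le> M2 * (t - s)" .
      qed (use M1 M2 xi in auto)
      moreover have "\<bar>(f t - f x) * h x\<bar> \<le> (M1 * (t - s)) * M2" unfolding abs_mult
      proof (intro mult_mono)
        have "\<bar>f t - f x\<bar> \<le> M1 * (t - x)" using lac_lipschitz[OF f M1(2), of x t] x st by auto
        also have "\<dots> \<le> M1 * (t - s)" using M1 x by (intro mult_left_mono) auto
        finally show "\<bar>f t - f x\<bar> \<le> M1 * (t - s)" .
      qed (use M1 M2 xi st in auto)
      moreover have "d x * g s + f t * h x - k x = (f t - f x) * h x - d x * (g x - g s)"
        using keq[OF xi] by (simp add: algebra_simps)
      moreover have "M1 * (M2 * (t - s)) + (M1 * (t - s)) * M2 = (M1 * M2 + M1 * M2) * (t - s)"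
        by (simp add: algebra_simps)
      ultimately show "norm (d x * g s + f t * h x - k x) \<le> (M1 * M2 + M1 * M2) * (t - s)"
        unfolding real_norm_def by linarith
    qed
    moreover have "(f t - f s) * g s + f t * (g t - g s) = f t * g t - f s * g s"
      by (simp add: algebra_simps)
    ultimately show "\<bar>f t * g t - f s * g s - integral {s..t} k\<bar> \<le> (M1 * M2 + M1 * M2) * (t - s)\<^sup>2"
      using st by (simp add: power2_eq_square mult.assoc)
  qed (use k in simp)
qed

text \<open>As for products, with the factor \<open>-1 / (f s * f t)\<close> frozen: against it
  \<open>d\<close> integrates exactly to the increment of \<open>1 / f\<close>, and replacing it by
  \<open>-1 / (f x)\<^sup>2\<close> costs second order.\<close>

lemma lac_inverse:
  assumes f: "lac a b f d" and m: "0 < m" "\<And>x. x \<in> {a..b} \<Longrightarrow> m \<le> f x"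
    and k: "k \<in> borel_measurable borel" and keq: "\<And>x. x \<in> {a..b} \<Longrightarrow> k x = - d x / (f x)\<^sup>2"
  shows "lac a b (\<lambda>x. 1 / f x) k"
proof -
  obtain M where M: "M \<ge> 0" "\<And>x. x \<in> {a..b} \<Longrightarrow> \<bar>d x\<bar> \<le> M" using lac_bound[OF f] by blast
  show ?thesis
  proof (rule lacI_quadratic[where M="M / m\<^sup>2" and K="M * (2 * M / m ^ 3)"])
    show kb: "\<bar>k x\<bar> \<le> M / m\<^sup>2" if "x \<in> {a..b}" for x
      unfolding keq[OF that] abs_divide abs_minus
      by (rule frac_le) (use M m that in \<open>auto intro!: power_mono\<close>)
    fix s t assume st: "a \<le> s" "s \<le> t" "t \<le> b"
    have fs: "m \<le> f s" "m \<le> f t" using m st by auto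
    have 1: "((\<lambda>x. d x * (- 1 / (f s * f t))) has_integral ((f t - f s) * (- 1 / (f s * f t)))) {s..t}"
      using lac_D(2)[OF f st] by (rule has_integral_mult_left)
    have 3: "(k has_integral integral {s..t} k) {s..t}"
      by (rule integrable_integral, rule bounded_borel_integrable[OF k kb]) (use st in auto)
    have 4: "((\<lambda>x. d x * (- 1 / (f s * f t)) - k x) has_integral
        ((f t - f s) * (- 1 / (f s * f t)) - integral {s..t} k)) (cbox s t)"
      unfolding box_real using 1 3 by (intro has_integral_diff)
    have "norm ((f t - f s) * (- 1 / (f s * f t)) - integral {s..t} k)
        \<le> (M * (2 * M / m ^ 3) * (t - s)) * measure lborel (cbox s t)"
    proof (rule has_integral_bound[OF _ 4])
      show "0 \<le> M * (2 * M / m ^ 3) * (t - s)" using M m st by simp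
      fix x assume x: "x \<in> cbox s t"
      then have xi: "x \<in> {a..b}" using st by auto
      then have fx: "m \<le> f x" using m by auto
      have pos: "0 < f s" "0 < f t" "0 < f x" using fs fx m by auto
      have e: "d x * (- 1 / (f s * f t)) - k x
        = d x * ((f s - f x) / (f x * (f x * f s)) + (f t - f x) / (f x * (f s * f t)))"
        using keq[OF xi] pos by (simp add: field_simps power2_eq_square)
      have l1: "\<bar>f s - f x\<bar> \<le> M * (t - s)"
      proof -
        have "\<bar>f x - f s\<bar> \<le> M * (x - s)" using lac_lipschitz[OF f M(2), of s x] x st by auto
        also have "\<dots> \<le> M * (t - s)" using M x by (intro mult_left_mono) auto
        finally show ?thesis by (simp add: abs_minus_commute)
      qed
      have l2: "\<bar>f t - f x\<bar> \<le> M * (t - s)"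
      proof -
        have "\<bar>f t - f x\<bar> \<le> M * (t - x)" using lac_lipschitz[OF f M(2), of x t] x st by auto
        also have "\<dots> \<le> M * (t - s)" using M x by (intro mult_left_mono) auto
        finally show ?thesis .
      qed
      have b1: "\<bar>(f s - f x) / (f x * (f x * f s))\<bar> \<le> M * (t - s) / m ^ 3"
        unfolding abs_divide power3_eq_cube mult.assoc
        by (rule frac_le) (use l1 pos fs fx m in \<open>auto intro!: mult_mono simp: abs_mult\<close>)
      have b2: "\<bar>(f t - f x) / (f x * (f s * f t))\<bar> \<le> M * (t - s) / m ^ 3"
        unfolding abs_divide power3_eq_cube mult.assoc
        by (rule frac_le) (use l2 pos fs fx m in \<open>auto intro!: mult_mono simp: abs_mult\<close>)
      have "\<bar>d x * (- 1 / (f s * f t)) - k x\<bar> \<le> M * (M * (t - s) / m ^ 3 + M * (t - s) / m ^ 3)"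
        unfolding e abs_mult using order_trans[OF abs_triangle_ineq add_mono[OF b1 b2]] M xi by (intro mult_mono) auto
      then show "norm (d x * (- 1 / (f s * f t)) - k x) \<le> M * (2 * M / m ^ 3) * (t - s)"
        by (simp add: field_simps)
    qed
    moreover have "(f t - f s) * (- 1 / (f s * f t)) = 1 / f t - 1 / f s"
      using fs m by (simp add: field_simps)
    ultimately show "\<bar>1 / f t - 1 / f s - integral {s..t} k\<bar> \<le> M * (2 * M / m ^ 3) * (t - s)\<^sup>2"
      using st by (simp add: power2_eq_square mult.assoc)
  qed (rule k)
qed

lemma lac_add:
  assumes "lac a b f d" "lac a b g h"
  shows "lac a b (\<lambda>x. f x + g x) (\<lambda>x. d x + h x)"
  unfolding lac_def
proof (intro conjI allI impI)
  show "(\<lambda>x. d x + h x) \<in> borel_measurable borel" using assms[THEN lac_D(1)] by measurable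
  obtain M1 M2 where "\<And>x. x \<in> {a..b} \<Longrightarrow> \<bar>d x\<bar> \<le> M1" "\<And>x. x \<in> {a..b} \<Longrightarrow> \<bar>h x\<bar> \<le> M2"
    using assms[THEN lac_bound] by blast
  then have "\<forall>x\<in>{a..b}. \<bar>d x + h x\<bar> \<le> M1 + M2"
    by (meson abs_triangle_ineq add_mono order_trans)
  then show "\<exists>M. \<forall>x\<in>{a..b}. \<bar>d x + h x\<bar> \<le> M" by blast
  fix s t assume "a \<le> s \<and> s \<le> t \<and> t \<le> b"
  then show "((\<lambda>x. d x + h x) has_integral (f t + g t - (f s + g s))) {s..t}"
    using has_integral_add[OF lac_D(2)[OF assms(1), of s t] lac_D(2)[OF assms(2), of s t]]
    by (simp add: algebra_simps)
qed

lemma lac_const [simp]: "lac a b (\<lambda>_. c) (\<lambda>_. 0)"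
  by (auto simp: lac_def)

lemma lac_deriv:
  assumes "continuous_on {a..b} f" and "finite E"
    and "\<And>x. a < x \<Longrightarrow> x < b \<Longrightarrow> x \<notin> E \<Longrightarrow> (f has_real_derivative d x) (at x)"
    and "d \<in> borel_measurable borel" and "\<And>x. x \<in> {a..b} \<Longrightarrow> \<bar>d x\<bar> \<le> M"
  shows "lac a b f d"
  unfolding lac_def
proof (intro conjI allI impI assms(4))
  show "\<exists>M. \<forall>x\<in>{a..b}. \<bar>d x\<bar> \<le> M" using assms(5) by blast
  fix s t assume st: "a \<le> s \<and> s \<le> t \<and> t \<le> b"
  show "(d has_integral (f t - f s)) {s..t}"
  proof (rule fundamental_theorem_of_calculus_interior_strong[OF assms(2)])
    show "continuous_on {s..t} f" using assms(1) st by (auto intro: continuous_on_subset)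
    show "(f has_vector_derivative d x) (at x)" if "x \<in> {s<..<t} - E" for x
      using assms(3)[of x] that st by (auto simp: has_real_derivative_iff_has_vector_derivative)
  qed (use st in auto)
qed

section \<open>Test functions\<close>

text \<open>Phrased by the existence of a derivative and not by iterates of \<open>deriv\<close>, so
  that closure under sums, products and affine substitutions is a plain induction on
  \<open>n\<close>.\<close>

primrec ndiff :: "nat \<Rightarrow> (real \<Rightarrow> real) \<Rightarrow> bool" where
  "ndiff 0 f \<longleftrightarrow> True"
| "ndiff (Suc n) f \<longleftrightarrow> (\<exists>f'. (\<forall>x. (f has_real_derivative f' x) (at x)) \<and> ndiff n f')"

definition smooth1 :: "(real \<Rightarrow> real) \<Rightarrow> bool" where
  "smooth1 f \<longleftrightarrow> (\<forall>n. ndiff n f)"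

lemma ndiff_SucI:
  "(\<And>x. (f has_real_derivative f' x) (at x)) \<Longrightarrow> ndiff n f' \<Longrightarrow> ndiff (Suc n) f"
  by (auto intro!: exI[of _ f'])

lemma ndiff_SucE:
  assumes "ndiff (Suc n) f"
  obtains f' where "\<And>x. (f has_real_derivative f' x) (at x)" "ndiff n f'"
  using assms by auto

declare ndiff.simps(2) [simp del]

lemma ndiff_SucD: "ndiff (Suc n) f \<Longrightarrow> ndiff n f"
proof (induction n arbitrary: f)
  case (Suc n)
  obtain f' where "\<And>x. (f has_real_derivative f' x) (at x)" "ndiff (Suc n) f'"
    using ndiff_SucE[OF Suc.prems] by blast
  then show ?case using Suc.IH by (blast intro: ndiff_SucI)
qed simp

lemma ndiff_const: "ndiff n (\<lambda>_. c)"
  by (induction n arbitrary: c) (auto intro!: ndiff_SucI[where f'="\<lambda>_. 0"])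

lemma ndiff_add: "ndiff n f \<Longrightarrow> ndiff n g \<Longrightarrow> ndiff n (\<lambda>x. f x + g x)"
proof (induction n arbitrary: f g)
  case (Suc n)
  obtain f' where f: "\<And>x. (f has_real_derivative f' x) (at x)" "ndiff n f'"
    using ndiff_SucE[OF Suc.prems(1)] by blast
  obtain g' where g: "\<And>x. (g has_real_derivative g' x) (at x)" "ndiff n g'"
    using ndiff_SucE[OF Suc.prems(2)] by blast
  show ?case
    by (rule ndiff_SucI[OF DERIV_add[OF f(1) g(1)] Suc.IH[OF f(2) g(2)]])
qed simp

lemma ndiff_mult: "ndiff n f \<Longrightarrow> ndiff n g \<Longrightarrow> ndiff n (\<lambda>x. f x * g x)"
proof (induction n arbitrary: f g)
  case (Suc n)
  obtain f' where f: "\<And>x. (f has_real_derivative f' x) (at x)" "ndiff n f'"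
    using ndiff_SucE[OF Suc.prems(1)] by blast
  obtain g' where g: "\<And>x. (g has_real_derivative g' x) (at x)" "ndiff n g'"
    using ndiff_SucE[OF Suc.prems(2)] by blast
  have "ndiff n (\<lambda>x. f' x * g x + g' x * f x)"
    using ndiff_SucD[OF Suc.prems(1)] ndiff_SucD[OF Suc.prems(2)] f g by (intro ndiff_add Suc.IH)
  then show ?case by (rule ndiff_SucI[OF DERIV_mult[OF f(1) g(1)]])
qed simp

lemma ndiff_affine: "ndiff n f \<Longrightarrow> ndiff n (\<lambda>x. f (a * x + b))"
proof (induction n arbitrary: f)
  case (Suc n)
  obtain f' where d: "\<And>x. (f has_real_derivative f' x) (at x)" "ndiff n f'"
    using ndiff_SucE[OF Suc.prems(1)] by blast
  have "((\<lambda>x. f (a * x + b)) has_real_derivative f' (a * x + b) * a) (at x)" for x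
    by (rule DERIV_chain2[OF d(1)]) (auto intro!: derivative_eq_intros)
  moreover have "ndiff n (\<lambda>x. f' (a * x + b) * a)"
    by (rule ndiff_mult[OF Suc.IH[OF d(2)] ndiff_const])
  ultimately show ?case by (rule ndiff_SucI)
qed simp

lemma smooth1_const: "smooth1 (\<lambda>_. c)"
  and smooth1_add: "smooth1 f \<Longrightarrow> smooth1 g \<Longrightarrow> smooth1 (\<lambda>x. f x + g x)"
  and smooth1_mult: "smooth1 f \<Longrightarrow> smooth1 g \<Longrightarrow> smooth1 (\<lambda>x. f x * g x)"
  and smooth1_affine: "smooth1 f \<Longrightarrow> smooth1 (\<lambda>x. f (a * x + b))"
  by (auto simp: smooth1_def intro: ndiff_const ndiff_add ndiff_mult ndiff_affine)

lemma smooth1_deriv: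
  assumes "smooth1 f"
  shows "(f has_real_derivative deriv f x) (at x)" and "smooth1 (deriv f)"
proof -
  have 1: "(f has_real_derivative deriv f x) (at x) \<and> ndiff n (deriv f)" for n x
  proof -
    obtain f' where d: "\<And>x. (f has_real_derivative f' x) (at x)" "ndiff n f'"
      using assms ndiff_SucE[of n f] unfolding smooth1_def by blast
    then have "deriv f = f'" by (auto intro: DERIV_imp_deriv)
    then show ?thesis using d by simp
  qed
  then show "(f has_real_derivative deriv f x) (at x)" and "smooth1 (deriv f)"
    by (auto simp: smooth1_def)
qed

lemma smooth1_antideriv:
  assumes "\<And>x. (F has_real_derivative f x) (at x)" "smooth1 f"
  shows "smooth1 F"
  unfolding smooth1_def
proof
  fix n show "ndiff n F"
    using assms by (cases n) (auto simp: smooth1_def intro: ndiff_SucI)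
qed

lemma smooth1_continuous: "smooth1 f \<Longrightarrow> continuous_on S f"
  using smooth1_deriv(1) by (meson DERIV_continuous continuous_at_imp_continuous_on)

text \<open>The functions p(1/x) exp(-1/x), continued by 0. The family is closed under
  differentiation, which makes all members smooth at once; \<open>p = 1\<close> is the classical
  flat function.\<close>

definition expinv :: "real poly \<Rightarrow> real \<Rightarrow> real" where
  "expinv p x = (if x > 0 then poly p (1 / x) * exp (- (1 / x)) else 0)"

lemma poly_times_exp_tendsto_0:
  fixes p :: "real poly"
  shows "((\<lambda>y. poly p y * exp (- y)) \<longlongrightarrow> 0) at_top"
proof -
  have "((\<lambda>y. \<Sum>i\<le>degree p. coeff p i * (y ^ i / exp y)) \<longlongrightarrow> (\<Sum>i\<le>degree p. coeff p i * 0)) at_top"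
    by (intro tendsto_sum tendsto_mult tendsto_const tendsto_power_div_exp_0)
  moreover have "(\<lambda>y. \<Sum>i\<le>degree p. coeff p i * (y ^ i / exp y)) = (\<lambda>y. poly p y * exp (- y))"
    by (auto simp: poly_altdef sum_distrib_right exp_minus divide_inverse mult.assoc)
  ultimately show ?thesis by simp
qed

text \<open>With y = 1/x one has d/dx = - y^2 d/dy, which sends p(y) exp(-y) to y^2 (p - p')(y)
  exp(-y). At 0 only the limit of the difference quotient needs work.\<close>

lemma expinv_deriv:
  "(expinv p has_real_derivative expinv ([:0, 0, 1:] * (p - pderiv p)) x) (at x)"
proof -
  consider "x > 0" | "x < 0" | "x = 0" by linarith
  then show ?thesis
  proof cases
    case 1
    have "((\<lambda>x. poly p (1 / x) * exp (- (1 / x))) has_real_derivative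
        expinv ([:0, 0, 1:] * (p - pderiv p)) x) (at x)"
      using 1 by (auto intro!: derivative_eq_intros DERIV_chain2[OF poly_DERIV]
        simp: expinv_def field_simps power2_eq_square)
    moreover have "\<forall>\<^sub>F u in nhds x. poly p (1 / u) * exp (- (1 / u)) = expinv p u"
      using eventually_nhds_in_open[of "{0<..}" x] 1
      by (auto elim!: eventually_mono simp: expinv_def)
    ultimately show ?thesis
      using DERIV_cong_ev[OF refl _ refl, of "\<lambda>x. poly p (1 / x) * exp (- (1 / x))" "expinv p" x] by simp
  next
    case 2
    have "((\<lambda>x. 0) has_real_derivative expinv ([:0, 0, 1:] * (p - pderiv p)) x) (at x)"
      using 2 by (simp add: expinv_def)
    moreover have "\<forall>\<^sub>F u in nhds x. 0 = expinv p u"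
      using eventually_nhds_in_open[of "{..<0}" x] 2
      by (auto elim!: eventually_mono simp: expinv_def)
    ultimately show ?thesis
      using DERIV_cong_ev[OF refl _ refl, of "\<lambda>x. 0" "expinv p" x] by simp
  next
    case 3
    \<comment> \<open>The right difference quotient at 0 is y p(y) exp(-y) with y = 1/h, and the
      exponential beats every polynomial.\<close>
    have 1: "((\<lambda>h. poly ([:0, 1:] * p) (1 / h) * exp (- (1 / h))) \<longlongrightarrow> 0) (at_right 0)"
      using filterlim_compose[OF poly_times_exp_tendsto_0[of "[:0, 1:] * p"] filterlim_inverse_at_top_right]
      by (simp add: inverse_eq_divide)
    have "((\<lambda>h. (expinv p h - expinv p 0) / (h - 0)) \<longlongrightarrow> 0) (at_right 0)"
      by (rule Lim_transform_eventually[OF 1])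
        (auto simp: eventually_at_filter expinv_def intro!: always_eventually)
    moreover have "((\<lambda>h. (expinv p h - expinv p 0) / (h - 0)) \<longlongrightarrow> 0) (at_left 0)"
      by (rule Lim_transform_eventually[OF tendsto_const])
        (auto simp: eventually_at_filter expinv_def intro!: always_eventually)
    ultimately have "((\<lambda>h. (expinv p h - expinv p 0) / (h - 0)) \<longlongrightarrow> 0) (at 0)"
      by (simp add: filterlim_split_at)
    then show ?thesis using 3 by (simp add: has_field_derivative_iff expinv_def)
  qed
qed

lemma smooth1_expinv: "smooth1 (expinv p)"
proof -
  have "ndiff n (expinv p)" for n p
    by (induction n arbitrary: p) (auto intro: ndiff_SucI[OF expinv_deriv])
  then show ?thesis by (simp add: smooth1_def)
qed

definition bump_raw :: "real \<Rightarrow> real" where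
  "bump_raw x = expinv 1 x * expinv 1 (- 1 * x + 1)"

definition bump :: "real \<Rightarrow> real" where
  "bump x = bump_raw x * (1 / integral {0..1} bump_raw)"

definition sstep :: "real \<Rightarrow> real" where
  "sstep = prim bump"

lemma smooth1_bump: "smooth1 bump"
  unfolding bump_def bump_raw_def
  by (rule smooth1_mult[OF smooth1_mult[OF smooth1_expinv smooth1_affine[OF smooth1_expinv]] smooth1_const])

lemma bump_raw_pos: "0 < x \<Longrightarrow> x < 1 \<Longrightarrow> 0 < bump_raw x"
  and bump_raw_nonneg: "0 \<le> bump_raw x"
  and bump_raw_0: "x \<notin> {0<..<1} \<Longrightarrow> bump_raw x = 0"
  by (auto simp: bump_raw_def expinv_def)

lemma smooth1_bump_raw: "smooth1 bump_raw"
  unfolding bump_raw_def by (rule smooth1_mult[OF smooth1_expinv smooth1_affine[OF smooth1_expinv]])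

lemma integral_bump_raw_pos: "0 < integral {0..1} bump_raw"
proof -
  have c: "continuous_on {0..1} bump_raw" by (rule smooth1_continuous[OF smooth1_bump_raw])
  then have "0 \<le> integral {0..1} bump_raw"
    by (intro integral_nonneg integrable_continuous_real) (auto simp: bump_raw_nonneg)
  moreover have "integral {0..1} bump_raw \<noteq> 0"
    using integral_eq_0_iff[OF c] bump_raw_nonneg bump_raw_pos[of "1/2"] by fastforce
  ultimately show ?thesis by linarith
qed

lemma bump_nonneg: "0 \<le> bump x"
  and bump_0: "x \<notin> {0<..<1} \<Longrightarrow> bump x = 0"
  using integral_bump_raw_pos by (auto simp: bump_def bump_raw_nonneg bump_raw_0)

lemma bump_cont: "continuous_on S bump"
  by (rule smooth1_continuous[OF smooth1_bump])

lemma integral_bump: "integral {0..1} bump = 1"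
  using integral_bump_raw_pos unfolding bump_def by (subst integral_mult_left) auto

lemma sstep_deriv: "(sstep has_real_derivative bump x) (at x)"
  unfolding sstep_def by (rule prim_deriv[OF bump_cont])

lemma smooth1_sstep: "smooth1 sstep"
  by (rule smooth1_antideriv[OF sstep_deriv smooth1_bump])

lemma sstep_mono: "x \<le> y \<Longrightarrow> sstep x \<le> sstep y"
  using prim_lower[OF bump_cont bump_nonneg, of x y] by (simp add: sstep_def)

lemma sstep_le0: "x \<le> 0 \<Longrightarrow> sstep x = 0"
proof -
  assume "x \<le> 0"
  then have "integral {x..0} bump = integral {x..0} (\<lambda>_. 0)"
    by (intro integral_cong) (auto simp: bump_0)
  then show ?thesis using prim_diff[OF bump_cont, of x 0] \<open>x \<le> 0\<close> by (simp add: sstep_def)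
qed

lemma sstep_ge1: "1 \<le> x \<Longrightarrow> sstep x = 1"
proof -
  assume "1 \<le> x"
  then have "integral {1..x} bump = integral {1..x} (\<lambda>_. 0)"
    by (intro integral_cong) (auto simp: bump_0)
  then show ?thesis using prim_diff[OF bump_cont, of 1 x] prim_diff[OF bump_cont, of 0 1] \<open>1 \<le> x\<close>
    by (simp add: sstep_def integral_bump)
qed

lemma sstep_bounds: "0 \<le> sstep x" "sstep x \<le> 1"
  using sstep_mono[of x 1] sstep_mono[of 0 x] sstep_ge1[of 1] sstep_le0[of 0]
  by (cases "x \<le> 0"; cases "1 \<le> x"; auto simp: sstep_le0 sstep_ge1)+

text \<open>Its ramps have width 1/(n+1) and lie inside (a, b), so the support stays in [a, b] for
  every \<open>n\<close>. It serves to pass from test functions to integrals over intervals.\<close>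

definition inner_cutoff :: "real \<Rightarrow> real \<Rightarrow> nat \<Rightarrow> real \<Rightarrow> real" where
  "inner_cutoff a b n x = sstep (real (Suc n) * x + (- real (Suc n) * a)) * sstep (- real (Suc n) * x + real (Suc n) * b)"

text \<open>Equal to 1 on [a, b], with the ramps outside. Adding the two steps and subtracting 1, in
  place of multiplying them, makes the derivative a difference of two rescaled bumps, and these
  recover point values at \<open>a\<close> and \<open>b\<close>.\<close>

definition outer_cutoff :: "real \<Rightarrow> real \<Rightarrow> nat \<Rightarrow> real \<Rightarrow> real" where
  "outer_cutoff a b n x = sstep (real (Suc n) * x + (1 - real (Suc n) * a)) +
      (sstep (- real (Suc n) * x + (1 + real (Suc n) * b)) + -1)"

lemma smooth1_inner_cutoff: "smooth1 (inner_cutoff a b n)"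
  unfolding inner_cutoff_def by (rule smooth1_mult[OF smooth1_affine[OF smooth1_sstep] smooth1_affine[OF smooth1_sstep]])

lemma smooth1_outer_cutoff: "smooth1 (outer_cutoff a b n)"
  unfolding outer_cutoff_def by (rule smooth1_add[OF smooth1_affine[OF smooth1_sstep]
      smooth1_add[OF smooth1_affine[OF smooth1_sstep] smooth1_const]])

lemma inner_cutoff_bounds: "0 \<le> inner_cutoff a b n x" "inner_cutoff a b n x \<le> 1"
  unfolding inner_cutoff_def using sstep_bounds by (auto intro: mult_nonneg_nonneg mult_le_one)

lemma inner_cutoff_0: "x \<notin> {a<..<b} \<Longrightarrow> inner_cutoff a b n x = 0"
proof -
  assume "x \<notin> {a<..<b}"
  then consider "x \<le> a" | "b \<le> x" by force
  then show ?thesis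
  proof cases
    case 1
    then have "real (Suc n) * x \<le> real (Suc n) * a" by (intro mult_left_mono) auto
    then have "real (Suc n) * x + (- real (Suc n) * a) \<le> 0" by linarith
    then show ?thesis unfolding inner_cutoff_def by (simp only: sstep_le0 mult_zero_left)
  next
    case 2
    then have "real (Suc n) * b \<le> real (Suc n) * x" by (intro mult_left_mono) auto
    then have "- real (Suc n) * x + real (Suc n) * b \<le> 0" by linarith
    then show ?thesis unfolding inner_cutoff_def by (simp only: sstep_le0 mult_zero_right)
  qed
qed

lemma eventually_Suc_mult_ge: "0 < d \<Longrightarrow> \<forall>\<^sub>F n in sequentially. c \<le> real (Suc n) * d"
proof -
  assume "0 < d"
  obtain N where N: "c / d \<le> real N" using real_arch_simple by blast
  show ?thesis unfolding eventually_sequentially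
  proof (intro exI allI impI)
    fix n assume "N \<le> n"
    then have "c / d \<le> real (Suc n)" using N by linarith
    then show "c \<le> real (Suc n) * d" using \<open>0 < d\<close> by (simp add: divide_le_eq)
  qed
qed

lemma inner_cutoff_tendsto:
  "(\<lambda>n. inner_cutoff a b n x) \<longlonglongrightarrow> indicat_real {a<..<b} x"
proof (cases "x \<in> {a<..<b}")
  case True
  have "\<forall>\<^sub>F n in sequentially. 1 \<le> real (Suc n) * (x - a) \<and> 1 \<le> real (Suc n) * (b - x)"
    using True by (intro eventually_conj eventually_Suc_mult_ge) auto
  then have "\<forall>\<^sub>F n in sequentially. inner_cutoff a b n x = 1"
  proof eventually_elim
    case (elim n)
    then have "1 \<le> real (Suc n) * x + (- real (Suc n) * a)" "1 \<le> - real (Suc n) * x + real (Suc n) * b"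
      by (auto simp: algebra_simps)
    then show ?case unfolding inner_cutoff_def by (simp only: sstep_ge1)
  qed
  then show ?thesis using True by (simp add: tendsto_eventually)
next
  case False
  then show ?thesis by (simp add: inner_cutoff_0)
qed

lemma outer_cutoff_props:
  assumes "a \<le> b"
  shows "x \<in> {a..b} \<Longrightarrow> outer_cutoff a b n x = 1"
    and "x \<notin> {a - 1 / real (Suc n)<..<b + 1 / real (Suc n)} \<Longrightarrow> outer_cutoff a b n x = 0"
    and "0 \<le> outer_cutoff a b n x" and "outer_cutoff a b n x \<le> 1"
proof -
  let ?N = "real (Suc n)"
  have N: "?N > 0" by simp
  have ge1: "a \<le> x \<Longrightarrow> sstep (?N * x + (1 - ?N * a)) = 1" 
    using mult_left_mono[of a x ?N] N by (intro sstep_ge1) linarith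
  have ge2: "x \<le> b \<Longrightarrow> sstep (- ?N * x + (1 + ?N * b)) = 1"
    using mult_left_mono[of x b ?N] N by (intro sstep_ge1) linarith
  have le1: "x \<le> a - 1 / ?N \<Longrightarrow> sstep (?N * x + (1 - ?N * a)) = 0"
    using mult_left_mono[of x "a - 1 / ?N" ?N] N by (intro sstep_le0) (simp add: field_simps)
  have le2: "b + 1 / ?N \<le> x \<Longrightarrow> sstep (- ?N * x + (1 + ?N * b)) = 0"
    using mult_left_mono[of "b + 1 / ?N" x ?N] N by (intro sstep_le0) (simp add: field_simps)
  have pos: "1 / ?N > 0" by simp
  show "x \<in> {a..b} \<Longrightarrow> outer_cutoff a b n x = 1"
    using ge1 ge2 by (auto simp: outer_cutoff_def)
  show "x \<notin> {a - 1 / ?N<..<b + 1 / ?N} \<Longrightarrow> outer_cutoff a b n x = 0"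
  proof -
    assume "x \<notin> {a - 1 / ?N<..<b + 1 / ?N}"
    then consider "x \<le> a - 1 / ?N" | "b + 1 / ?N \<le> x" by force
    then show ?thesis
    proof cases
      case 1
      then have "x \<le> b" using assms pos by linarith
      then show ?thesis unfolding outer_cutoff_def using le1[OF 1] ge2 by linarith
    next
      case 2
      then have "a \<le> x" using assms pos by linarith
      then show ?thesis unfolding outer_cutoff_def using le2[OF 2] ge1 by linarith
    qed
  qed
  show "0 \<le> outer_cutoff a b n x"
  proof (cases "a \<le> x")
    case True
    then show ?thesis unfolding outer_cutoff_def using ge1 sstep_bounds(1)[of "- ?N * x + (1 + ?N * b)"] by linarith
  next
    case False
    then have "x \<le> b" using assms by linarith
    then show ?thesis unfolding outer_cutoff_def using ge2 sstep_bounds(1)[of "?N * x + (1 - ?N * a)"] by linarith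
  qed
  show "outer_cutoff a b n x \<le> 1"
    unfolding outer_cutoff_def using sstep_bounds(2)[of "- ?N * x + (1 + ?N * b)"]
      sstep_bounds(2)[of "?N * x + (1 - ?N * a)"] by linarith
qed

lemma sstep_affine_deriv:
  "((\<lambda>x. sstep (a * x + b)) has_real_derivative bump (a * x + b) * a) (at x)"
  by (rule DERIV_chain2[OF sstep_deriv]) (auto intro!: derivative_eq_intros)

lemma outer_cutoff_deriv:
  "(outer_cutoff a b n has_real_derivative
     real (Suc n) * bump (real (Suc n) * x + (1 - real (Suc n) * a)) -
     real (Suc n) * bump (- real (Suc n) * x + (1 + real (Suc n) * b))) (at x)"
  unfolding outer_cutoff_def
  by (rule DERIV_cong[OF DERIV_add[OF sstep_affine_deriv DERIV_add[OF sstep_affine_deriv DERIV_const]]])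
    algebra

lemma outer_cutoff_tendsto:
  assumes "a \<le> b"
  shows "(\<lambda>n. outer_cutoff a b n x) \<longlonglongrightarrow> indicat_real {a..b} x"
proof (cases "x \<in> {a..b}")
  case True
  then show ?thesis by (simp add: outer_cutoff_props(1)[OF assms])
next
  case False
  define d where "d = max (a - x) (x - b)"
  have "d > 0" using False by (auto simp: d_def)
  then have "\<forall>\<^sub>F n in sequentially. 1 \<le> real (Suc n) * d" by (rule eventually_Suc_mult_ge)
  then have "\<forall>\<^sub>F n in sequentially. outer_cutoff a b n x = 0"
  proof eventually_elim
    case (elim n)
    then have "1 / real (Suc n) \<le> d" by (simp add: field_simps)
    then show ?case by (intro outer_cutoff_props(2)[OF assms]) (auto simp: d_def)
  qed
  then show ?thesis using False by (simp add: tendsto_eventually)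
qed

section \<open>Test functions on the line and of product form in the plane\<close>

lemma partial_deriv_real:
  assumes "(f has_real_derivative d) (at x)"
  shows "partial_deriv 1 f x = d"
  unfolding partial_deriv_def
  using frechet_derivative_at[OF assms[unfolded has_field_derivative_def]] by (metis mult.right_neutral)

lemma smooth_fun_real:
  assumes "smooth1 f"
  shows "smooth_fun f"
proof -
  have "smooth1 (iter_partial bs f)" if "set bs \<subseteq> Basis" for bs
    using that
  proof (induction bs)
    case (Cons b bs)
    then have s: "smooth1 (iter_partial bs f)" and b: "b = 1" by auto
    have "partial_deriv 1 (iter_partial bs f) = deriv (iter_partial bs f)"
      by (rule ext, rule partial_deriv_real, rule smooth1_deriv[OF s])
    then show ?case using smooth1_deriv(2)[OF s] b by simp
  qed (use assms in simp)
  then show ?thesis unfolding smooth_fun_def differentiable_on_def differentiable_def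
    using smooth1_deriv(1) unfolding has_field_derivative_def by blast
qed

lemma test_fun_real:
  assumes "smooth1 f" "{a..b} \<subseteq> U" "\<And>x. x \<notin> {a..b} \<Longrightarrow> f x = 0"
  shows "test_fun U f"
  unfolding test_fun_def using smooth_fun_real[OF assms(1)] assms(2,3) by blast

lemma prod_deriv:
  fixes f g :: "real \<Rightarrow> real"
  assumes "(f has_real_derivative f') (at t)" "(g has_real_derivative g') (at x)"
  shows "((\<lambda>q. f (fst q) * g (snd q)) has_derivative (\<lambda>h. f' * fst h * g x + f t * (g' * snd h))) (at (t, x))"
proof -
  have 1: "((\<lambda>q::real \<times> real. f (fst q)) has_derivative (\<lambda>h. fst h * f')) (at (t, x))"
    by (rule DERIV_compose_FDERIV) (use assms in \<open>auto intro!: derivative_intros\<close>)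
  have 2: "((\<lambda>q::real \<times> real. g (snd q)) has_derivative (\<lambda>h. snd h * g')) (at (t, x))"
    by (rule DERIV_compose_FDERIV) (use assms in \<open>auto intro!: derivative_intros\<close>)
  show ?thesis by (rule has_derivative_eq_rhs[OF has_derivative_mult[OF 1 2]]) (auto simp: algebra_simps)
qed

lemma partial_deriv_prod:
  assumes "smooth1 f" "smooth1 g"
  shows "partial_deriv dir_t (\<lambda>q. f (fst q) * g (snd q)) = (\<lambda>q. deriv f (fst q) * g (snd q))"
    and "partial_deriv dir_x (\<lambda>q. f (fst q) * g (snd q)) = (\<lambda>q. f (fst q) * deriv g (snd q))"
    and "(\<lambda>q. f (fst q) * g (snd q)) differentiable at q"
proof -
  have d: "((\<lambda>q. f (fst q) * g (snd q)) has_derivative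
    (\<lambda>h. deriv f (fst q) * fst h * g (snd q) + f (fst q) * (deriv g (snd q) * snd h))) (at q)" for q
    using prod_deriv[OF smooth1_deriv(1)[OF assms(1)] smooth1_deriv(1)[OF assms(2)], of "fst q" "snd q"] by simp
  show "partial_deriv dir_t (\<lambda>q. f (fst q) * g (snd q)) = (\<lambda>q. deriv f (fst q) * g (snd q))"
    and "partial_deriv dir_x (\<lambda>q. f (fst q) * g (snd q)) = (\<lambda>q. f (fst q) * deriv g (snd q))"
    unfolding partial_deriv_def using frechet_derivative_at[OF d, symmetric] by (auto intro!: ext)
  show "(\<lambda>q. f (fst q) * g (snd q)) differentiable at q"
    using d unfolding differentiable_def by blast
qed

lemma Basis_real_pair: "(Basis :: (real \<times> real) set) = {dir_t, dir_x}"
  by (auto simp: Basis_prod_def)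

text \<open>Every iterated partial derivative of a product of functions of one variable is again
  such a product, so an induction on the multi-index suffices.\<close>

lemma smooth_fun_prod:
  assumes "smooth1 f" "smooth1 g"
  shows "smooth_fun (\<lambda>q. f (fst q) * g (snd q))"
proof -
  have ex: "\<exists>f' g'. smooth1 f' \<and> smooth1 g' \<and>
      iter_partial bs (\<lambda>q. f (fst q) * g (snd q)) = (\<lambda>q. f' (fst q) * g' (snd q))"
    if "set bs \<subseteq> Basis" for bs
    using that
  proof (induction bs)
    case (Cons b bs)
    then obtain f' g' where s: "smooth1 f'" "smooth1 g'" and
      e: "iter_partial bs (\<lambda>q. f (fst q) * g (snd q)) = (\<lambda>q. f' (fst q) * g' (snd q))" by auto
    from Cons have "b = dir_t \<or> b = dir_x" by (auto simp: Basis_real_pair)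
    then show ?case
    proof
      assume "b = dir_t"
      then show ?thesis using s smooth1_deriv(2)[OF s(1)] e partial_deriv_prod(1)[OF s]
        by (intro exI[of _ "deriv f'"] exI[of _ g']) simp
    next
      assume "b = dir_x"
      then show ?thesis using s smooth1_deriv(2)[OF s(2)] e partial_deriv_prod(2)[OF s]
        by (intro exI[of _ f'] exI[of _ "deriv g'"]) simp
    qed
  qed (use assms in auto)
  show ?thesis unfolding smooth_fun_def differentiable_on_def
  proof (intro allI impI ballI)
    fix bs :: "(real \<times> real) list" and q assume "set bs \<subseteq> Basis"
    then obtain f' g' where "smooth1 f'" "smooth1 g'" and
      e: "iter_partial bs (\<lambda>q. f (fst q) * g (snd q)) = (\<lambda>q. f' (fst q) * g' (snd q))"
      using ex by blast
    then show "iter_partial bs (\<lambda>q. f (fst q) * g (snd q)) differentiable at q"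
      unfolding e by (intro partial_deriv_prod(3))
  qed
qed

lemma test_fun_prod:
  assumes "smooth1 f" "smooth1 g" "{a..b} \<times> {c..d} \<subseteq> U"
    "\<And>x. x \<notin> {a..b} \<Longrightarrow> f x = 0" "\<And>x. x \<notin> {c..d} \<Longrightarrow> g x = 0"
  shows "test_fun U (\<lambda>q. f (fst q) * g (snd q))"
  unfolding test_fun_def
proof (intro conjI exI[of _ "{a..b} \<times> {c..d}"])
  show "compact ({a..b} \<times> {c..d})" by (intro compact_Times compact_Icc)
  show "\<forall>x. x \<notin> {a..b} \<times> {c..d} \<longrightarrow> f (fst x) * g (snd x) = 0"
    using assms(4,5) by (auto simp: mem_Times_iff)
qed (use assms smooth_fun_prod in auto)

lemma smooth_fun_differentiable: "smooth_fun \<phi> \<Longrightarrow> \<phi> differentiable at x"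
  unfolding smooth_fun_def differentiable_on_def by (auto dest: spec[of _ "[]"])

lemma iter_partial_append: "iter_partial (bs @ cs) \<phi> = iter_partial bs (iter_partial cs \<phi>)"
  by (induction bs) auto

lemma smooth_fun_iter_partial: "smooth_fun \<phi> \<Longrightarrow> set cs \<subseteq> Basis \<Longrightarrow> smooth_fun (iter_partial cs \<phi>)"
  unfolding smooth_fun_def
proof (intro allI impI)
  fix bs :: "'a list" assume "\<forall>bs. set bs \<subseteq> Basis \<longrightarrow> iter_partial bs \<phi> differentiable_on UNIV"
    "set cs \<subseteq> Basis" "set bs \<subseteq> Basis"
  then show "iter_partial bs (iter_partial cs \<phi>) differentiable_on UNIV"
    unfolding iter_partial_append[symmetric] by simp
qed

lemma smooth_fun_continuous: "smooth_fun \<phi> \<Longrightarrow> continuous_on S \<phi>"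
  using smooth_fun_differentiable by (meson continuous_at_imp_continuous_on differentiable_imp_continuous_within)

text \<open>The same compact set works: off \<open>K\<close>, which is closed, the function vanishes
  on a neighbourhood, hence so does each derivative.\<close>

lemma test_fun_iter_partial:
  assumes "test_fun U \<phi>" "set cs \<subseteq> Basis"
  shows "test_fun U (iter_partial cs \<phi>)"
proof -
  obtain K where K: "compact K" "K \<subseteq> U" "\<And>x. x \<notin> K \<Longrightarrow> \<phi> x = 0"
    using assms(1) unfolding test_fun_def by blast
  have "iter_partial cs \<phi> x = 0" if "x \<notin> K" for x
    using that
  proof (induction cs arbitrary: x)
    case (Cons b cs)
    have "\<forall>\<^sub>F y in nhds x. y \<in> - K"
      using Cons.prems compact_imp_closed[OF K(1)] by (intro eventually_nhds_in_open) auto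
    then have e: "\<forall>\<^sub>F y in nhds x. iter_partial cs \<phi> y = 0"
      by eventually_elim (use Cons.IH in auto)
    have "((\<lambda>_. 0) has_derivative (\<lambda>_. 0)) (at x)" by simp
    then have "(iter_partial cs \<phi> has_derivative (\<lambda>_. 0)) (at x)"
      by (rule has_derivative_transform_eventually)
        (use e Cons in \<open>auto simp: eventually_nhds_conv_at elim: eventually_mono\<close>)
    then show ?case using frechet_derivative_at[of "iter_partial cs \<phi>" "\<lambda>_. 0" x]
      by (simp add: partial_deriv_def fun_eq_iff)
  qed (use K in auto)
  then show ?thesis using K smooth_fun_iter_partial assms unfolding test_fun_def by blast
qed

lemma test_fun_bounded:
  assumes "test_fun U \<phi>"
  obtains M where "\<And>x. \<bar>\<phi> x\<bar> \<le> M"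
proof -
  obtain K where K: "compact K" "K \<subseteq> U" "\<And>x. x \<notin> K \<Longrightarrow> \<phi> x = 0"
    using assms(1) unfolding test_fun_def by blast
  have "bounded (\<phi> ` K)"
    using K(1) smooth_fun_continuous assms unfolding test_fun_def
    by (meson compact_continuous_image compact_imp_bounded)
  then obtain M where M: "\<And>x. x \<in> K \<Longrightarrow> \<bar>\<phi> x\<bar> \<le> M" by (force simp: bounded_iff)
  have "\<bar>\<phi> x\<bar> \<le> max 0 M" for x using M[of x] K(3)[of x] by (cases "x \<in> K") auto
  then show thesis using that by blast
qed

text \<open>Since \<open>iter_partial cs \<phi>\<close> is again a test function, it may be used to
  test the derivative of \<open>u\<close> in the directions \<open>bs\<close>. This is how the
  second derivatives of the velocity are reached from first ones.\<close>

lemma weak_deriv_append: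
  assumes "weak_deriv U bs u w" "weak_deriv U cs w z" "set cs \<subseteq> Basis"
  shows "weak_deriv U (bs @ cs) u z"
  unfolding weak_deriv_def
proof (intro conjI allI impI)
  fix \<phi> assume t: "test_fun U \<phi>"
  then have "(\<integral>x. u x * iter_partial (bs @ cs) \<phi> x \<partial>lebesgue_on U)
      = (- 1) ^ length bs * (\<integral>x. w x * iter_partial cs \<phi> x \<partial>lebesgue_on U)"
    using assms(1) test_fun_iter_partial[OF t assms(3)] unfolding weak_deriv_def iter_partial_append by blast
  also have "\<dots> = (- 1) ^ length bs * ((- 1) ^ length cs * (\<integral>x. z x * \<phi> x \<partial>lebesgue_on U))"
    using assms(2) t unfolding weak_deriv_def by auto
  finally show "(\<integral>x. u x * iter_partial (bs @ cs) \<phi> x \<partial>lebesgue_on U)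
      = (- 1) ^ length (bs @ cs) * (\<integral>x. z x * \<phi> x \<partial>lebesgue_on U)" by (simp add: power_add)
qed (use assms in \<open>auto simp: weak_deriv_def\<close>)

text \<open>The given notions are about Lebesgue measure, which is not a product measure; Fubini
  needs Borel functions and \<open>lborel\<close>. An exhaustion of \<open>U\<close> by compact sets
  makes the function extended by 0 measurable, and the completion theorem gives a Borel version,
  again set to 0 off \<open>U\<close>.\<close>

lemma loc_integrable_borel_rep:
  fixes u :: "'a::euclidean_space \<Rightarrow> real"
  assumes U: "open U" and u: "loc_integrable U u"
  obtains u' where "u' \<in> borel_measurable borel" "AE x in lebesgue. x \<in> U \<longrightarrow> u x = u' x"
    "\<And>x. x \<notin> U \<Longrightarrow> u' x = 0" "\<And>K. compact K \<Longrightarrow> K \<subseteq> U \<Longrightarrow> set_integrable lborel K u'"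
    "\<And>\<psi>. \<psi> \<in> borel_measurable borel \<Longrightarrow>
       (\<integral>x. u x * \<psi> x \<partial>lebesgue_on U) = (\<integral>x. u' x * \<psi> x \<partial>lborel)"
proof -
  obtain D where D: "\<And>n. compact (D n)" "\<And>n. D n \<subseteq> U" "\<And>n. D n \<subseteq> interior (D (Suc n))"
      "\<Union>(range D) = U"
    using open_Union_compact_subsets[OF U] by metis
  have DS: "D n \<subseteq> D (Suc n)" for n using D(3)[of n] interior_subset by blast
  define v where "v x = indicator U x * u x" for x
  have "(\<lambda>x. indicator (D n) x *\<^sub>R u x) \<in> borel_measurable lebesgue" for n
    using u D(1,2) unfolding loc_integrable_def set_integrable_def by (meson borel_measurable_integrable)
  moreover have "(\<lambda>n. indicator (D n) x *\<^sub>R u x) \<longlonglongrightarrow> v x" for x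
  proof (cases "x \<in> U")
    case True
    then obtain n where n: "x \<in> D n" using D(4) by blast
    have "x \<in> D m" if "n \<le> m" for m using that lift_Suc_mono_le[of D, OF DS that] n by blast
    then have "\<forall>\<^sub>F m in sequentially. indicator (D m) x *\<^sub>R u x = v x"
      using True unfolding eventually_sequentially v_def by (intro exI[of _ n]) auto
    then show ?thesis by (rule tendsto_eventually)
  next
    case False
    then have "x \<notin> D n" for n using D(2) by blast
    then show ?thesis using False by (simp add: v_def)
  qed
  ultimately have v: "v \<in> borel_measurable lebesgue"
    by (rule borel_measurable_LIMSEQ_metric)
  obtain w where w: "w \<in> borel_measurable lborel" "AE x in lborel. v x = w x"
    using completion_ex_borel_measurable_real[OF v] by blast
  define u' where "u' x = indicator U x * w x" for x
  have wl: "AE x in lebesgue. v x = w x" using w(2) by (rule AE_completion)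
  have m: "u' \<in> borel_measurable borel" using w(1) U unfolding u'_def
    by (intro borel_measurable_times borel_measurable_indicator) (auto simp: borel_open)
  have ae: "AE x in lebesgue. x \<in> U \<longrightarrow> u x = u' x"
    using wl by eventually_elim (auto simp: v_def u'_def)
  show thesis
  proof (rule that[OF m ae])
    show "u' x = 0" if "x \<notin> U" for x using that by (simp add: u'_def)
    fix K assume K: "compact K" "K \<subseteq> U"
    have "integrable lebesgue (\<lambda>x. indicator K x *\<^sub>R u x)"
      using u K unfolding loc_integrable_def set_integrable_def by blast
    then have "integrable lebesgue (\<lambda>x. indicator K x *\<^sub>R u' x)"
    proof (rule integrable_cong_AE_imp)
      show "AE x in lebesgue. indicator K x *\<^sub>R u x = indicator K x *\<^sub>R u' x"
        using ae by eventually_elim (use K in \<open>auto simp: indicator_def\<close>)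
      have "K \<in> sets borel" using K by (simp add: borel_compact)
      then show "(\<lambda>x. indicator K x *\<^sub>R u' x) \<in> borel_measurable lebesgue"
        using m by (intro measurable_completion borel_measurable_scaleR borel_measurable_indicator) auto
    qed
    moreover have "(\<lambda>x. indicator K x *\<^sub>R u' x) \<in> borel_measurable lborel"
      using m K by (intro borel_measurable_scaleR borel_measurable_indicator) (auto simp: borel_compact)
    ultimately show "set_integrable lborel K u'"
      unfolding set_integrable_def by (simp add: integrable_completion)
  next
    fix \<psi> :: "'a \<Rightarrow> real" assume p: "\<psi> \<in> borel_measurable borel"
    have Us: "U \<in> sets lebesgue" using U by (simp add: borel_open)
    have "(\<integral>x. u x * \<psi> x \<partial>lebesgue_on U) = (\<integral>x. indicator U x *\<^sub>R (u x * \<psi> x) \<partial>lebesgue)"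
      using Us by (subst integral_restrict_space) auto
    also have "\<dots> = (\<integral>x. u' x * \<psi> x \<partial>lebesgue)"
    proof (rule integral_cong_AE)
      have pl: "\<psi> \<in> borel_measurable lebesgue" using p by (intro measurable_completion) simp
      have "(\<lambda>x. v x * \<psi> x) \<in> borel_measurable lebesgue" using v pl by (rule borel_measurable_times)
      then show "(\<lambda>x. indicator U x *\<^sub>R (u x * \<psi> x)) \<in> borel_measurable lebesgue"
        by (simp add: v_def mult.assoc)
      show "(\<lambda>x. u' x * \<psi> x) \<in> borel_measurable lebesgue"
        using m p by (intro measurable_completion) simp
      show "AE x in lebesgue. indicator U x *\<^sub>R (u x * \<psi> x) = u' x * \<psi> x"
        using ae by eventually_elim (auto simp: indicator_def u'_def)
    qed
    also have "\<dots> = (\<integral>x. u' x * \<psi> x \<partial>lborel)"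
      using m p by (intro integral_completion) simp
    finally show "(\<integral>x. u x * \<psi> x \<partial>lebesgue_on U) = (\<integral>x. u' x * \<psi> x \<partial>lborel)" .
  qed
qed

section \<open>Weak derivatives in one dimension\<close>

definition test1 :: "real \<Rightarrow> real \<Rightarrow> (real \<Rightarrow> real) \<Rightarrow> bool" where
  "test1 p r \<phi> \<longleftrightarrow> smooth1 \<phi> \<and> (\<exists>a b. p < a \<and> b < r \<and> (\<forall>x. x \<notin> {a..b} \<longrightarrow> \<phi> x = 0))"

lemma test1I: "smooth1 \<phi> \<Longrightarrow> p < a \<Longrightarrow> b < r \<Longrightarrow> (\<And>x. x \<notin> {a..b} \<Longrightarrow> \<phi> x = 0) \<Longrightarrow> test1 p r \<phi>"
  unfolding test1_def by blast

lemma test1E: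
  assumes "test1 p r \<phi>"
  obtains a b where "smooth1 \<phi>" "p < a" "b < r" "\<And>x. x \<notin> {a..b} \<Longrightarrow> \<phi> x = 0"
proof -
  obtain a b where "smooth1 \<phi>" "p < a" "b < r" "\<forall>x. x \<notin> {a..b} \<longrightarrow> \<phi> x = 0"
    using assms unfolding test1_def by auto
  then show thesis using that[of a b] by simp
qed

lemma test1_inner_cutoff: "p < a \<Longrightarrow> b < r \<Longrightarrow> test1 p r (inner_cutoff a b n)"
  by (rule test1I[OF smooth1_inner_cutoff]) (auto intro: inner_cutoff_0)

lemma test1_test_fun: "test1 p r \<phi> \<Longrightarrow> test_fun {p<..<r} \<phi>"
proof -
  assume "test1 p r \<phi>"
  then obtain a b where "smooth1 \<phi>" "p < a" "b < r" "\<forall>x. x \<notin> {a..b} \<longrightarrow> \<phi> x = 0"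
    unfolding test1_def by blast
  then show ?thesis by (intro test_fun_real[of \<phi> a b]) auto
qed

lemma test1_deriv:
  assumes "test1 p r \<phi>"
  shows "test1 p r (deriv \<phi>)"
proof -
  obtain a b where ab: "smooth1 \<phi>" "p < a" "b < r" "\<And>x. x \<notin> {a..b} \<Longrightarrow> \<phi> x = 0"
    by (rule test1E[OF assms]) (rule that)
  have "deriv \<phi> x = 0" if "x \<notin> {a..b}" for x
  proof -
    have "\<forall>\<^sub>F y in nhds x. y \<in> - {a..b}"
      by (rule eventually_nhds_in_open) (use that in auto)
    then have ev: "\<forall>\<^sub>F y in nhds x. \<phi> y = 0"
      by eventually_elim (simp add: ab(4))
    have "(\<phi> has_real_derivative 0) (at x) \<longleftrightarrow> ((\<lambda>_. 0) has_real_derivative 0) (at x)"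
      by (rule DERIV_cong_ev[OF refl ev refl])
    then have "(\<phi> has_real_derivative 0) (at x)" by simp
    then show ?thesis by (rule DERIV_imp_deriv)
  qed
  then show ?thesis using ab smooth1_deriv(2)[OF ab(1)] by (intro test1I[of _ p a b r]) auto
qed

lemma test1_measurable: "test1 p r \<phi> \<Longrightarrow> \<phi> \<in> borel_measurable borel"
  using smooth1_continuous unfolding test1_def by (blast intro: borel_measurable_continuous_onI)

lemma test1_bounded:
  assumes "test1 p r \<phi>"
  obtains M where "M \<ge> 0" "\<And>x. \<bar>\<phi> x\<bar> \<le> M"
  using test_fun_bounded[OF test1_test_fun[OF assms]] by (metis abs_ge_zero order_trans)

definition loc_int :: "real \<Rightarrow> real \<Rightarrow> (real \<Rightarrow> real) \<Rightarrow> bool" where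
  "loc_int p r f \<longleftrightarrow> f \<in> borel_measurable borel \<and>
     (\<forall>a b. p < a \<and> b < r \<longrightarrow> set_integrable lborel {a..b} f)"

lemma loc_int_measurable: "loc_int p r f \<Longrightarrow> f \<in> borel_measurable borel"
  by (simp add: loc_int_def)

lemma loc_int_test1_integrable:
  assumes f: "loc_int p r f" and \<phi>: "test1 p r \<phi>"
  shows "integrable lborel (\<lambda>x. f x * \<phi> x)"
proof -
  obtain a b where ab: "p < a" "b < r" "\<And>x. x \<notin> {a..b} \<Longrightarrow> \<phi> x = 0"
    by (rule test1E[OF \<phi>]) (rule that)
  obtain M where M: "M \<ge> 0" "\<And>x. \<bar>\<phi> x\<bar> \<le> M" using test1_bounded[OF \<phi>] by blast
  have i: "integrable lborel (\<lambda>x. M * (indicator {a..b} x *\<^sub>R f x))"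
    using f ab unfolding loc_int_def set_integrable_def by (intro integrable_mult_right) blast
  show ?thesis
  proof (rule Bochner_Integration.integrable_bound[OF i])
    show "(\<lambda>x. f x * \<phi> x) \<in> borel_measurable lborel"
      using f test1_measurable[OF \<phi>] unfolding loc_int_def by auto
    show "AE x in lborel. norm (f x * \<phi> x) \<le> norm (M * (indicator {a..b} x *\<^sub>R f x))"
    proof (rule AE_I2)
      fix x
      show "norm (f x * \<phi> x) \<le> norm (M * (indicator {a..b} x *\<^sub>R f x))"
        using ab(3)[of x] M(1) mult_right_mono[OF M(2)[of x], of "\<bar>f x\<bar>"]
        by (cases "x \<in> {a..b}") (auto simp: abs_mult mult.commute)
    qed
  qed
qed

lemma loc_int_diff: "loc_int p r f \<Longrightarrow> loc_int p r g \<Longrightarrow> loc_int p r (\<lambda>x. f x - g x)"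
  unfolding loc_int_def by (auto intro: set_integral_diff)

lemma loc_int_bounded:
  assumes "f \<in> borel_measurable borel" "\<And>a b x. p < a \<Longrightarrow> b < r \<Longrightarrow> \<exists>M. \<forall>x\<in>{a..b}. \<bar>f x\<bar> \<le> M"
  shows "loc_int p r f"
  unfolding loc_int_def using assms bounded_borel_abs_integrable by (metis (no_types))

lemma loc_int_continuous:
  assumes "f \<in> borel_measurable borel" "continuous_on {p<..<r} f"
  shows "loc_int p r f"
proof (rule loc_int_bounded[OF assms(1)])
  fix a b :: real assume "p < a" "b < r"
  then have "continuous_on {a..b} f" by (intro continuous_on_subset[OF assms(2)]) auto
  from cont_bounded_Icc[OF this] show "\<exists>M. \<forall>x\<in>{a..b}. \<bar>f x\<bar> \<le> M" by metis
qed

lemma inner_cutoff_integral_tendsto: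
  assumes f: "f \<in> borel_measurable borel" "set_integrable lborel {a..b} f"
  shows "(\<lambda>n. \<integral>x. f x * inner_cutoff a b n x \<partial>lborel) \<longlonglongrightarrow> (LINT x:{a..b}|lborel. f x)"
proof -
  have cm: "inner_cutoff a b n \<in> borel_measurable borel" for n
    by (intro borel_measurable_continuous_onI smooth1_continuous smooth1_inner_cutoff)
  have "(\<lambda>n. \<integral>x. f x * inner_cutoff a b n x \<partial>lborel) \<longlonglongrightarrow> (\<integral>x. f x * indicator {a<..<b} x \<partial>lborel)"
  proof (rule integral_dominated_convergence[where w="\<lambda>x. norm (indicator {a..b} x *\<^sub>R f x)"])
    show "integrable lborel (\<lambda>x. norm (indicator {a..b} x *\<^sub>R f x))"
      using f(2) unfolding set_integrable_def by (rule integrable_norm)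
    show "AE x in lborel. (\<lambda>n. f x * inner_cutoff a b n x) \<longlonglongrightarrow> f x * indicator {a<..<b} x"
      by (intro AE_I2 tendsto_mult tendsto_const inner_cutoff_tendsto)
    show "AE x in lborel. norm (f x * inner_cutoff a b n x) \<le> norm (indicator {a..b} x *\<^sub>R f x)" for n
    proof (rule AE_I2)
      fix x
      show "norm (f x * inner_cutoff a b n x) \<le> norm (indicator {a..b} x *\<^sub>R f x)"
        using inner_cutoff_0[of x a b n] inner_cutoff_bounds[of a b n x]
        by (cases "x \<in> {a..b}") (auto simp: abs_mult intro!: mult_left_le)
    qed
  qed (use f cm in auto)
  also have "(\<integral>x. f x * indicator {a<..<b} x \<partial>lborel) = (LINT x:{a..b}|lborel. f x)"
    unfolding set_lebesgue_integral_def
  proof (rule integral_cong_AE)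
    show "AE x in lborel. f x * indicator {a<..<b} x = indicator {a..b} x *\<^sub>R f x"
      using AE_lborel_singleton[of a] AE_lborel_singleton[of b]
      by eventually_elim (auto simp: indicator_def)
  qed (use f in auto)
  finally show ?thesis .
qed

text \<open>The vanishing of the integral passes from half lines, which form a stable generator, to
  all Borel sets; testing with the sets where the function is positive and where it is negative
  finishes the proof.\<close>

lemma AE_zero_of_intervals:
  fixes f :: "real \<Rightarrow> real"
  assumes f: "set_integrable lborel {a..b} f"
    and z: "\<And>c d. a \<le> c \<Longrightarrow> c \<le> d \<Longrightarrow> d \<le> b \<Longrightarrow> (LINT x:{c..d}|lborel. f x) = 0"
  shows "AE x in lborel. x \<in> {a..b} \<longrightarrow> f x = 0"
proof (cases "a \<le> b")
  case ab: True
  define g where "g x = indicator {a..b} x *\<^sub>R f x" for x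
  have g: "integrable lborel g" using f unfolding set_integrable_def g_def .
  have gA: "set_integrable lborel A g" if "A \<in> sets borel" for A
    using integrable_mult_indicator[OF _ g, of A] that unfolding set_integrable_def by simp
  have tot: "(\<integral>x. g x \<partial>lborel) = 0"
    using z[of a b] ab unfolding g_def set_lebesgue_integral_def by simp
  have all: "(LINT x:A|lborel. g x) = 0" if "A \<in> sets borel" for A :: "real set"
  proof -
    have "Int_stable (range (\<lambda>c::real. {..c}))"
      by (auto simp: Int_stable_def)
    moreover have "range (\<lambda>c::real. {..c}) \<subseteq> Pow UNIV" by simp
    moreover have "A \<in> sigma_sets UNIV (range (\<lambda>c::real. {..c}))"
      using that unfolding borel_eq_atMost by simp
    ultimately show ?thesis
    proof (induction rule: sigma_sets_induct_disjoint)
      case (basic A)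
      then obtain c where A: "A = {..c}" by auto
      \<comment> \<open>Cut by [a, b], the half line up to \<open>c\<close> becomes an interval,
        possibly empty, for which the hypothesis is available.\<close>
      have "(LINT x:A|lborel. g x) = (LINT x:{a..min b c}|lborel. f x)"
        unfolding set_lebesgue_integral_def g_def A
        by (rule Bochner_Integration.integral_cong) (auto simp: indicator_def)
      also have "\<dots> = 0" using z[of a "min b c"]
        by (cases "a \<le> min b c") (auto simp: set_lebesgue_integral_def)
      finally show ?case .
    next
      case empty then show ?case by (simp add: set_lebesgue_integral_def)
    next
      case (compl A)
      then have A: "A \<in> sets borel" unfolding borel_eq_atMost by simp
      have "(LINT x:A \<union> (UNIV - A)|lborel. g x) = (LINT x:A|lborel. g x) + (LINT x:(UNIV-A)|lborel. g x)"
        by (rule set_integral_Un) (use A gA in auto)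
      then show ?case using compl tot by (simp add: set_lebesgue_integral_def)
    next
      case (union A)
      then have A: "A i \<in> sets borel" for i unfolding borel_eq_atMost by auto
      have "(LINT x:(\<Union>i. A i)|lborel. g x) = (\<Sum>i. (LINT x:(A i)|lborel. g x))"
        by (rule lebesgue_integral_countable_add)
          (use A union gA in \<open>auto simp: disjoint_family_on_def\<close>)
      then show ?case using union by simp
    qed
  qed
  have half: "AE x in lborel. h x \<le> 0" if h: "integrable lborel h"
    and zh: "\<And>A. A \<in> sets borel \<Longrightarrow> (LINT x:A|lborel. h x) = 0" for h :: "real \<Rightarrow> real"
  proof -
    define A where "A = {x. h x > 0}"
    have hm: "h \<in> borel_measurable borel" using borel_measurable_integrable[OF h] by simp
    then have A: "A \<in> sets borel" unfolding A_def by measurable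
    have "integrable lborel (\<lambda>x. indicator A x *\<^sub>R h x)"
      using integrable_mult_indicator[OF _ h, of A] A by simp
    then have "AE x in lborel. indicator A x *\<^sub>R h x = 0"
      using integral_nonneg_eq_0_iff_AE[of lborel "\<lambda>x. indicator A x *\<^sub>R h x"] zh[OF A]
      unfolding set_lebesgue_integral_def by (auto simp: A_def indicator_def)
    then show ?thesis by eventually_elim (auto simp: A_def indicator_def split: if_splits)
  qed
  have "AE x in lborel. - g x \<le> 0"
    by (rule half) (use g all in \<open>auto simp: set_lebesgue_integral_def\<close>)
  moreover have "AE x in lborel. g x \<le> 0" by (rule half) (use g all in auto)
  ultimately have "AE x in lborel. g x = 0" by eventually_elim auto
  then show ?thesis by eventually_elim (auto simp: g_def)
qed auto

text \<open>Inner cutoffs turn the hypothesis into vanishing integrals over compact subintervals;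
  countably many of these exhaust (p, r).\<close>

lemma fundamental_lemma:
  assumes f: "loc_int p r f"
    and z: "\<And>\<phi>. test1 p r \<phi> \<Longrightarrow> (\<integral>x. f x * \<phi> x \<partial>lborel) = 0"
  shows "AE x in lborel. x \<in> {p<..<r} \<longrightarrow> f x = 0"
proof -
  have int0: "(LINT x:{c..d}|lborel. f x) = 0" if "p < c" "d < r" for c d
  proof -
    have "(\<lambda>n. \<integral>x. f x * inner_cutoff c d n x \<partial>lborel) \<longlonglongrightarrow> (LINT x:{c..d}|lborel. f x)"
      by (rule inner_cutoff_integral_tendsto) (use f that in \<open>auto simp: loc_int_def\<close>)
    then show ?thesis using z[OF test1_inner_cutoff[OF that]] by (simp add: LIMSEQ_const_iff)
  qed
  have "AE x in lborel. x \<in> {p + 1 / real (Suc n)..r - 1 / real (Suc n)} \<longrightarrow> f x = 0" for n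
  proof (rule AE_zero_of_intervals)
    have "0 < 1 / real (Suc n)" by simp
    then have n: "p < p + 1 / real (Suc n)" "r - 1 / real (Suc n) < r" by linarith+
    then show "set_integrable lborel {p + 1 / real (Suc n)..r - 1 / real (Suc n)} f"
      using f by (simp add: loc_int_def)
    show "(LINT x:{c..d}|lborel. f x) = 0"
      if "p + 1 / real (Suc n) \<le> c" "d \<le> r - 1 / real (Suc n)" for c d
      using n that by (intro int0) linarith+
  qed
  then have "AE x in lborel. \<forall>n. x \<in> {p + 1 / real (Suc n)..r - 1 / real (Suc n)} \<longrightarrow> f x = 0"
    by (subst AE_all_countable) blast
  then show ?thesis
  proof eventually_elim
    case (elim x)
    show ?case
    proof
      assume x: "x \<in> {p<..<r}"
      then have "0 < min (x - p) (r - x)" by simp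
      then obtain n where "1 / real (Suc n) < min (x - p) (r - x)" using nat_approx_posE by (metis of_nat_Suc)
      then show "f x = 0" using elim by (auto intro!: elim[rule_format, of n])
    qed
  qed
qed

text \<open>A function with weak derivative 0 has the same mean over any two intervals; the identity
  is free of division, so degenerate intervals are covered. A combination of two cutoffs with total
  integral 0 is the derivative of a test function.\<close>

lemma weak_deriv_zero_const:
  assumes f: "loc_int p r f"
    and z: "\<And>\<phi>. test1 p r \<phi> \<Longrightarrow> (\<integral>x. f x * deriv \<phi> x \<partial>lborel) = 0"
    and a: "p < a" "a \<le> a'" "a' < r" and b: "p < b" "b \<le> b'" "b' < r"
  shows "(b' - b) * (LINT x:{a..a'}|lborel. f x) = (a' - a) * (LINT x:{b..b'}|lborel. f x)"
proof -
  define lo hi where "lo = min a b" and "hi = max a' b'"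
  have lohi: "lo \<le> hi" "p < lo" "hi < r" "lo \<le> a" "lo \<le> b" "a' \<le> hi" "b' \<le> hi" using a b by (auto simp: lo_def hi_def)
  define E where "E n = (\<integral>x. inner_cutoff a a' n x \<partial>lborel)" for n
  define G where "G n = (\<integral>x. inner_cutoff b b' n x \<partial>lborel)" for n
  \<comment> \<open>The weights give \<open>\<psi> n\<close> total integral 0; only then does its
    primitive vanish to the right of the support as well.\<close>
  define \<psi> where "\<psi> n x = inner_cutoff a a' n x * G n + inner_cutoff b b' n x * (- E n)" for n x
  have s\<psi>: "smooth1 (\<psi> n)" for n unfolding \<psi>_def
    by (rule smooth1_add[OF smooth1_mult[OF smooth1_inner_cutoff smooth1_const] smooth1_mult[OF smooth1_inner_cutoff smooth1_const]])
  have c\<psi>: "continuous_on S (\<psi> n)" for n S by (rule smooth1_continuous[OF s\<psi>])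
  have z\<psi>: "\<psi> n x = 0" if "x \<notin> {lo<..<hi}" for n x
  proof -
    have "x \<notin> {a<..<a'}" "x \<notin> {b<..<b'}" using that lohi by auto
    then show ?thesis by (simp add: \<psi>_def inner_cutoff_0)
  qed
  have l1: "loc_int p r (\<lambda>_. 1)" by (rule loc_int_bounded) auto
  have int1: "integrable lborel (inner_cutoff c d n)" if "p < c" "d < r" for c d n
    using loc_int_test1_integrable[OF l1 test1_inner_cutoff[OF that]] by simp
  have "(\<integral>x. \<psi> n x \<partial>lborel) = 0" for n
  proof -
    have "(\<integral>x. \<psi> n x \<partial>lborel) = E n * G n + G n * (- E n)"
      unfolding \<psi>_def E_def G_def using int1 a b by simp
    then show ?thesis by simp
  qed
  moreover have "(\<integral>x. \<psi> n x \<partial>lborel) = integral {lo..hi} (\<psi> n)" for n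
  proof -
    have "(\<integral>x. \<psi> n x \<partial>lborel) = (LINT x:{lo..hi}|lborel. \<psi> n x)"
      unfolding set_lebesgue_integral_def
    proof (rule Bochner_Integration.integral_cong)
      fix x show "\<psi> n x = indicat_real {lo..hi} x *\<^sub>R \<psi> n x"
        using z\<psi>[of x n] by (cases "x \<in> {lo..hi}") auto
    qed simp
    also have "\<dots> = integral {lo..hi} (\<psi> n)"
      by (rule set_borel_integral_eq_integral(2), rule borel_integrable_atLeastAtMost') (rule c\<psi>)
    finally show ?thesis .
  qed
  ultimately have tot: "integral {lo..hi} (\<psi> n) = 0" for n by simp
  define \<phi> where "\<phi> n x = prim (\<psi> n) x + - prim (\<psi> n) lo" for n x
  have d\<phi>: "(\<phi> n has_real_derivative \<psi> n x) (at x)" for n x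
    unfolding \<phi>_def using prim_deriv[OF c\<psi>] by (auto intro!: derivative_eq_intros)
  have t\<phi>: "test1 p r (\<phi> n)" for n
  proof (rule test1I[of _ p lo hi])
    show "smooth1 (\<phi> n)" by (rule smooth1_antideriv[OF d\<phi> s\<psi>])
    fix x assume x: "x \<notin> {lo..hi}"
    have "integral {x..lo} (\<psi> n) = 0" if "x \<le> lo"
      using that z\<psi> by (subst integral_cong[where g="\<lambda>_. 0"]) auto
    moreover have "integral {hi..x} (\<psi> n) = 0" if "hi \<le> x"
      using that z\<psi> by (subst integral_cong[where g="\<lambda>_. 0"]) auto
    ultimately show "\<phi> n x = 0"
      using x prim_diff[OF c\<psi>, of x lo n] prim_diff[OF c\<psi>, of hi x n] prim_diff[OF c\<psi>, of lo hi n] tot lohi(1)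
      unfolding \<phi>_def by auto
  qed (use lohi in auto)
  have fin: "integrable lborel (\<lambda>x. f x * inner_cutoff c d n x)" if "p < c" "d < r" for c d n
    by (rule loc_int_test1_integrable[OF f test1_inner_cutoff[OF that]])
  have eq: "G n * (\<integral>x. f x * inner_cutoff a a' n x \<partial>lborel) - E n * (\<integral>x. f x * inner_cutoff b b' n x \<partial>lborel) = 0" for n
  proof -
    have dd: "deriv (\<phi> n) = \<psi> n" using DERIV_imp_deriv[OF d\<phi>] by blast
    have "0 = (\<integral>x. f x * \<psi> n x \<partial>lborel)" using z[OF t\<phi>, of n] dd by simp
    also have "\<dots> = (\<integral>x. G n * (f x * inner_cutoff a a' n x) - E n * (f x * inner_cutoff b b' n x) \<partial>lborel)"
      by (rule Bochner_Integration.integral_cong) (auto simp: \<psi>_def algebra_simps)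
    also have "\<dots> = G n * (\<integral>x. f x * inner_cutoff a a' n x \<partial>lborel) - E n * (\<integral>x. f x * inner_cutoff b b' n x \<partial>lborel)"
      using fin a b by simp
    finally show ?thesis by simp
  qed
  have len: "(\<lambda>n. \<integral>x. inner_cutoff c d n x \<partial>lborel) \<longlonglongrightarrow> d - c" if "c \<le> d" for c d
    using inner_cutoff_integral_tendsto[of "\<lambda>_. 1" c d] that
      borel_integrable_atLeastAtMost'[of c d "\<lambda>_. 1::real"]
    by (simp add: set_lebesgue_integral_def)
  have fl: "(\<lambda>n. \<integral>x. f x * inner_cutoff c d n x \<partial>lborel) \<longlonglongrightarrow> (LINT x:{c..d}|lborel. f x)"
    if "p < c" "d < r" for c d
    by (rule inner_cutoff_integral_tendsto) (use f that in \<open>auto simp: loc_int_def\<close>)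
  have "(\<lambda>n. G n * (\<integral>x. f x * inner_cutoff a a' n x \<partial>lborel) - E n * (\<integral>x. f x * inner_cutoff b b' n x \<partial>lborel))
     \<longlonglongrightarrow> (b' - b) * (LINT x:{a..a'}|lborel. f x) - (a' - a) * (LINT x:{b..b'}|lborel. f x)"
    unfolding E_def G_def by (intro tendsto_intros len fl a b)
  then show ?thesis unfolding eq by (simp add: LIMSEQ_const_iff)
qed

lemma bump_integral_lborel: "integrable lborel bump" "(\<integral>x. bump x \<partial>lborel) = 1"
proof -
  have e: "bump = (\<lambda>x. indicat_real {0..1} x *\<^sub>R bump x)"
  proof
    fix x show "bump x = indicat_real {0..1} x *\<^sub>R bump x"
      using bump_0[of x] by (cases "x \<in> {0..1}") auto
  qed
  have i: "set_integrable lborel {0..1} bump" by (rule borel_integrable_atLeastAtMost') (rule bump_cont)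
  then show "integrable lborel bump" using e unfolding set_integrable_def by simp
  show "(\<integral>x. bump x \<partial>lborel) = 1"
    using set_borel_integral_eq_integral(2)[OF i] e integral_bump unfolding set_lebesgue_integral_def by simp
qed

text \<open>The bumps of width \<open>1 / n\<close> to the left of a point (\<open>s = 1\<close>), or to its right (\<open>s = -1\<close>),
  form an approximate identity.\<close>

lemma bump_approximate_identity:
  assumes u: "u \<in> borel_measurable borel" "continuous_on {p<..<r} u" and a: "p < a" "a < r"
    and s: "s = 1 \<or> s = (-1::real)"
  shows "(\<lambda>n. \<integral>x. u x * (real (Suc n) * bump (s * real (Suc n) * x + (1 - s * real (Suc n) * a))) \<partial>lborel) \<longlonglongrightarrow> u a"
proof -
  define e where "e = min (a - p) (r - a) / 2"
  have e: "e > 0" using a by (simp add: e_def)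
  have sub: "{a - e..a + e} \<subseteq> {p<..<r}" using a by (auto simp: e_def min_def field_simps split: if_splits)
  obtain M where M: "M \<ge> 0" "\<And>x. x \<in> {a - e..a + e} \<Longrightarrow> \<bar>u x\<bar> \<le> M"
    using cont_bounded_Icc[OF continuous_on_subset[OF u(2) sub]] by blast
  have ss: "s * s = 1" "s \<noteq> 0" "\<bar>s\<bar> = 1" using s by auto
  have subst: "(\<integral>x. u x * (real (Suc n) * bump (s * real (Suc n) * x + (1 - s * real (Suc n) * a))) \<partial>lborel)
      = (\<integral>y. u (a - s / real (Suc n) + s / real (Suc n) * y) * bump y \<partial>lborel)" for n
  proof -
    let ?N = "real (Suc n)"
    have N: "?N > 0" by simp
    have "(\<integral>x. u x * (?N * bump (s * ?N * x + (1 - s * ?N * a))) \<partial>lborel)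
      = \<bar>s / ?N\<bar> *\<^sub>R (\<integral>y. u (a - s / ?N + s / ?N * y) *
          (?N * bump (s * ?N * (a - s / ?N + s / ?N * y) + (1 - s * ?N * a))) \<partial>lborel)"
      by (rule lborel_integral_real_affine) (use ss in auto)
    also have "(\<lambda>y. u (a - s / ?N + s / ?N * y) * (?N * bump (s * ?N * (a - s / ?N + s / ?N * y) + (1 - s * ?N * a))))
      = (\<lambda>y. ?N * (u (a - s / ?N + s / ?N * y) * bump y))"
    proof
      fix y
      have "s * ?N * (a - k + k * y) + (1 - s * ?N * a) = (s * ?N * k) * (y - 1) + 1" for k
        by algebra
      from this[of "s / ?N"] have "s * ?N * (a - s / ?N + s / ?N * y) + (1 - s * ?N * a) = (s * s) * (y - 1) + 1"
        using N by simp
      then show "u (a - s / ?N + s / ?N * y) * (?N * bump (s * ?N * (a - s / ?N + s / ?N * y) + (1 - s * ?N * a)))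
         = ?N * (u (a - s / ?N + s / ?N * y) * bump y)" using ss by simp
    qed
    finally show ?thesis using ss N by (simp add: abs_divide)
  qed
  \<comment> \<open>From index \<open>n0\<close> on, all sample points lie in the compact
    neighbourhood of \<open>a\<close> on which \<open>u\<close> is bounded by \<open>M\<close>, as
    the dominating function requires.\<close>
  obtain n0 where n0: "1 / real (Suc n0) < e" using nat_approx_posE[OF e] by (metis of_nat_Suc)
  have "(\<lambda>n. \<integral>y. u (a - s / real (Suc (n + n0)) + s / real (Suc (n + n0)) * y) * bump y \<partial>lborel)
      \<longlonglongrightarrow> (\<integral>y. u a * bump y \<partial>lborel)"
  proof (rule integral_dominated_convergence[where w="\<lambda>y. M * bump y"])
    show "integrable lborel (\<lambda>y. M * bump y)" using bump_integral_lborel by simp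
    show "(\<lambda>y. u a * bump y) \<in> borel_measurable lborel"
      using borel_measurable_integrable[OF bump_integral_lborel(1)] by measurable
    show "(\<lambda>y. u (a - s / real (Suc (n + n0)) + s / real (Suc (n + n0)) * y) * bump y) \<in> borel_measurable lborel" for n
      using borel_measurable_integrable[OF bump_integral_lborel(1)] u(1) by measurable
    show "AE y in lborel. (\<lambda>n. u (a - s / real (Suc (n + n0)) + s / real (Suc (n + n0)) * y) * bump y) \<longlonglongrightarrow> u a * bump y"
    proof (rule AE_I2)
      fix y
      have l0: "(\<lambda>n. s * inverse (real (Suc (n + n0)))) \<longlonglongrightarrow> s * 0"
        by (intro tendsto_mult tendsto_const LIMSEQ_ignore_initial_segment[OF LIMSEQ_inverse_real_of_nat])
      have "(\<lambda>n. a - s * inverse (real (Suc (n + n0))) + s * inverse (real (Suc (n + n0))) * y) \<longlonglongrightarrow> a - s * 0 + s * 0 * y"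
        by (intro tendsto_intros l0)
      then have l: "(\<lambda>n. a - s / real (Suc (n + n0)) + s / real (Suc (n + n0)) * y) \<longlonglongrightarrow> a"
        by (simp add: divide_inverse)
      have "isCont u a" using u(2) a by (simp add: continuous_on_eq_continuous_at)
      then show "(\<lambda>n. u (a - s / real (Suc (n + n0)) + s / real (Suc (n + n0)) * y) * bump y) \<longlonglongrightarrow> u a * bump y"
        by (intro tendsto_mult tendsto_const isCont_tendsto_compose[OF _ l])
    qed
    show "AE y in lborel. norm (u (a - s / real (Suc (n + n0)) + s / real (Suc (n + n0)) * y) * bump y) \<le> M * bump y" for n
    proof (rule AE_I2)
      fix y
      let ?N = "real (Suc (n + n0))"
      show "norm (u (a - s / ?N + s / ?N * y) * bump y) \<le> M * bump y"
      proof (cases "y \<in> {0<..<1}")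
        case True
        have "1 / ?N \<le> 1 / real (Suc n0)" by (intro divide_left_mono) auto
        then have N: "1 / ?N \<le> e" using n0 by linarith
        have "\<bar>s / ?N * (y - 1)\<bar> = 1 / ?N * (1 - y)" using ss True by (simp add: abs_mult abs_divide)
        also have "\<dots> \<le> 1 / ?N * 1" using True by (intro mult_left_mono) auto
        finally have h1: "\<bar>s / ?N * (y - 1)\<bar> \<le> e" using N by linarith
        have h2: "a - k + k * y = a + k * (y - 1)" for k by algebra
        have "a - s / ?N + s / ?N * y \<in> {a - e..a + e}"
          unfolding h2 atLeastAtMost_iff using h1 by linarith
        then show ?thesis using M(2) bump_nonneg by (simp add: abs_mult mult_right_mono)
      qed (simp add: bump_0)
    qed
  qed
  then have "(\<lambda>n. \<integral>y. u (a - s / real (Suc n) + s / real (Suc n) * y) * bump y \<partial>lborel) \<longlonglongrightarrow> u a"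
    unfolding bump_integral_lborel integral_mult_right_zero
    using LIMSEQ_offset[where k=n0 and f="\<lambda>n. \<integral>y. u (a - s / real (Suc n) + s / real (Suc n) * y) * bump y \<partial>lborel"]
    by (simp add: bump_integral_lborel)
  then show ?thesis unfolding subst .
qed

text \<open>Tested with outer cutoffs of [a, b], the left side tends to u a - u b, because the
  derivative of the cutoff is a bump to the left of \<open>a\<close> minus a bump to the right of
  \<open>b\<close>, and the right side tends to minus the integral of \<open>w\<close> over
  [a, b].\<close>

lemma weak_deriv_increment:
  assumes u: "u \<in> borel_measurable borel" "continuous_on {p<..<r} u" and w: "loc_int p r w"
    and z: "\<And>\<phi>. test1 p r \<phi> \<Longrightarrow> (\<integral>x. u x * deriv \<phi> x \<partial>lborel) = - (\<integral>x. w x * \<phi> x \<partial>lborel)"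
    and ab: "p < a" "a \<le> b" "b < r"
  shows "u b - u a = (LINT x:{a..b}|lborel. w x)"
proof -
  define e where "e = min (a - p) (r - b) / 2"
  have e: "e > 0" using ab by (simp add: e_def)
  have pe: "p < a - e" "b + e < r" using ab by (auto simp: e_def min_def field_simps)
  \<comment> \<open>The shift by \<open>n0\<close> keeps all cutoffs and bumps supported in
    [a - e, b + e], inside (p, r).\<close>
  obtain n0 where n0: "1 / real (Suc n0) < e" using nat_approx_posE[OF e] by (metis of_nat_Suc)
  define \<phi> where "\<phi> n = outer_cutoff a b (n + n0)" for n
  have supp: "\<phi> n x = 0" if "x \<notin> {a - e..b + e}" for n x
  proof -
    have "1 / real (Suc (n + n0)) \<le> 1 / real (Suc n0)" by (intro divide_left_mono) auto
    then have "1 / real (Suc (n + n0)) \<le> e" using n0 by linarith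
    then show ?thesis using that unfolding \<phi>_def by (intro outer_cutoff_props(2)[OF ab(2)]) auto
  qed
  have t: "test1 p r (\<phi> n)" for n
    by (rule test1I[of _ p "a - e" "b + e"]) (use pe supp smooth1_outer_cutoff in \<open>auto simp: \<phi>_def\<close>)
  define B where "B s c n x = real (Suc n) * bump (s * real (Suc n) * x + (1 - s * real (Suc n) * c))" for s c :: real and n x
  have d: "deriv (\<phi> n) x = B 1 a (n + n0) x - B (-1) b (n + n0) x" for n x
  proof -
    have "(-1) * real (Suc (n + n0)) * x + (1 - (-1) * real (Suc (n + n0)) * b)
        = - real (Suc (n + n0)) * x + (1 + real (Suc (n + n0)) * b)" by algebra
    then show ?thesis unfolding \<phi>_def B_def mult_1_left
      using DERIV_imp_deriv[OF outer_cutoff_deriv, of a b "n + n0" x] by presburger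
  qed
  have lu: "loc_int p r u" by (rule loc_int_continuous[OF u])
  have tB: "test1 p r (B s c (n + n0))" if "s = 1 \<or> s = -1" "a \<le> c" "c \<le> b" for s c n
  proof (rule test1I[of _ p "a - e" "b + e"])
    show "smooth1 (B s c (n + n0))" unfolding B_def
      by (rule smooth1_mult[OF smooth1_const smooth1_affine[OF smooth1_bump]])
    fix x assume x: "x \<notin> {a - e..b + e}"
    let ?N = "real (Suc (n + n0))"
    have "1 / ?N \<le> 1 / real (Suc n0)" by (intro divide_left_mono) auto
    then have N: "1 / ?N < e" using n0 by linarith
    have "s * ?N * x + (1 - s * ?N * c) \<notin> {0<..<1}"
    proof
      assume "s * ?N * x + (1 - s * ?N * c) \<in> {0<..<1}"
      then have i: "-1 < s * (?N * (x - c))" "s * (?N * (x - c)) < 0" by (auto simp: algebra_simps)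
      then have "\<bar>?N * (x - c)\<bar> < 1" using that(1) by auto
      then have "?N * \<bar>x - c\<bar> < 1" by (simp add: abs_mult)
      then have "\<bar>x - c\<bar> < 1 / ?N" by (simp add: field_simps)
      then show False using x N that by auto
    qed
    then show "B s c (n + n0) x = 0" unfolding B_def by (simp add: bump_0)
  qed (use pe in auto)
  have "(\<integral>x. u x * deriv (\<phi> n) x \<partial>lborel) = (\<integral>x. u x * B 1 a (n + n0) x \<partial>lborel) - (\<integral>x. u x * B (-1) b (n + n0) x \<partial>lborel)" for n
    using loc_int_test1_integrable[OF lu tB[of 1 a n]] loc_int_test1_integrable[OF lu tB[of "-1" b n]] ab(2)
    unfolding d by (simp add: right_diff_distrib)
  moreover have "(\<lambda>n. (\<integral>x. u x * B 1 a (n + n0) x \<partial>lborel) - (\<integral>x. u x * B (-1) b (n + n0) x \<partial>lborel)) \<longlonglongrightarrow> u a - u b"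
    unfolding B_def
    using LIMSEQ_ignore_initial_segment[OF bump_approximate_identity[OF u, of a 1], of n0]
      LIMSEQ_ignore_initial_segment[OF bump_approximate_identity[OF u, of b "-1"], of n0] ab
    by (intro tendsto_diff) auto
  ultimately have L1: "(\<lambda>n. \<integral>x. u x * deriv (\<phi> n) x \<partial>lborel) \<longlonglongrightarrow> u a - u b" by simp
  have L2: "(\<lambda>n. \<integral>x. w x * \<phi> n x \<partial>lborel) \<longlonglongrightarrow> (LINT x:{a..b}|lborel. w x)"
    unfolding set_lebesgue_integral_def
  proof (rule integral_dominated_convergence[where w="\<lambda>x. norm (indicator {a-e..b+e} x *\<^sub>R w x)"])
    have wi: "set_integrable lborel {a-e..b+e} w" using w pe by (simp add: loc_int_def)
    then show "integrable lborel (\<lambda>x. norm (indicator {a-e..b+e} x *\<^sub>R w x))"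
      unfolding set_integrable_def by (rule integrable_norm)
    show "(\<lambda>x. indicat_real {a..b} x *\<^sub>R w x) \<in> borel_measurable lborel"
      using loc_int_measurable[OF w] by simp
    show "(\<lambda>x. w x * \<phi> n x) \<in> borel_measurable lborel" for n
      using loc_int_measurable[OF w] test1_measurable[OF t] by simp
    show "AE x in lborel. (\<lambda>n. w x * \<phi> n x) \<longlonglongrightarrow> indicator {a..b} x *\<^sub>R w x"
    proof (rule AE_I2)
      fix x
      have "(\<lambda>n. w x * \<phi> n x) \<longlonglongrightarrow> w x * indicator {a..b} x"
        unfolding \<phi>_def
        by (intro tendsto_mult tendsto_const LIMSEQ_ignore_initial_segment[OF outer_cutoff_tendsto[OF ab(2)]])
      then show "(\<lambda>n. w x * \<phi> n x) \<longlonglongrightarrow> indicator {a..b} x *\<^sub>R w x" by (simp add: mult.commute)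
    qed
    show "AE x in lborel. norm (w x * \<phi> n x) \<le> norm (indicator {a-e..b+e} x *\<^sub>R w x)" for n
    proof (rule AE_I2)
      fix x
      show "norm (w x * \<phi> n x) \<le> norm (indicator {a-e..b+e} x *\<^sub>R w x)"
        using supp[of x n] outer_cutoff_props(3,4)[OF ab(2), of "n + n0" x]
        by (cases "x \<in> {a-e..b+e}") (auto simp: abs_mult \<phi>_def intro!: mult_left_le)
    qed
  qed
  from L1 have "(\<lambda>n. - (\<integral>x. w x * \<phi> n x \<partial>lborel)) \<longlonglongrightarrow> u a - u b" using z[OF t] by simp
  then have "u a - u b = - (LINT x:{a..b}|lborel. w x)"
    by (rule LIMSEQ_unique) (intro tendsto_minus L2)
  then show ?thesis by simp
qed

lemma integral_lebesgue_on_continuous: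
  fixes u \<psi> :: "'a::euclidean_space \<Rightarrow> real"
  assumes U: "open U" and u: "continuous_on U u" and \<psi>: "\<psi> \<in> borel_measurable borel"
  shows "(\<lambda>x. indicator U x *\<^sub>R u x) \<in> borel_measurable borel"
    and "(\<integral>x. u x * \<psi> x \<partial>lebesgue_on U) = (\<integral>x. (indicator U x *\<^sub>R u x) * \<psi> x \<partial>lborel)"
proof -
  show m: "(\<lambda>x. indicator U x *\<^sub>R u x) \<in> borel_measurable borel"
    by (rule borel_measurable_continuous_on_indicator) (use U u in \<open>auto simp: borel_open\<close>)
  have "(\<integral>x. u x * \<psi> x \<partial>lebesgue_on U) = (\<integral>x. indicator U x *\<^sub>R (u x * \<psi> x) \<partial>lebesgue)"
    using U by (subst integral_restrict_space) (auto simp: borel_open)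
  also have "\<dots> = (\<integral>x. (indicator U x *\<^sub>R u x) * \<psi> x \<partial>lebesgue)" by (simp add: mult.assoc)
  also have "\<dots> = (\<integral>x. (indicator U x *\<^sub>R u x) * \<psi> x \<partial>lborel)"
    by (rule integral_completion) (use m \<psi> in auto)
  finally show "(\<integral>x. u x * \<psi> x \<partial>lebesgue_on U) = (\<integral>x. (indicator U x *\<^sub>R u x) * \<psi> x \<partial>lborel)" .
qed

lemma test1_partial_deriv: "test1 p r \<phi> \<Longrightarrow> partial_deriv 1 \<phi> = deriv \<phi>"
  unfolding test1_def by (auto intro!: ext partial_deriv_real smooth1_deriv(1))

text \<open>Here \<open>w\<close> need not be bounded, as for the second derivative of a function in
  H^2; dominated convergence with dominating function |w| replaces a Lipschitz estimate.\<close>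

lemma primitive_cont:
  assumes w: "integrable lborel (w :: real \<Rightarrow> real)"
  shows "continuous_on S (\<lambda>x. \<integral>y. indicator {..x} y * w y \<partial>lborel)"
proof (rule continuous_at_imp_continuous_on, rule ballI, rule continuous_at_sequentiallyI)
  fix x :: real and u :: "nat \<Rightarrow> real" assume u: "u \<longlonglongrightarrow> x"
  have wm: "w \<in> borel_measurable borel" using borel_measurable_integrable[OF w] by simp
  show "(\<lambda>n. \<integral>y. indicator {..u n} y * w y \<partial>lborel) \<longlonglongrightarrow> (\<integral>y. indicator {..x} y * w y \<partial>lborel)"
  proof (rule integral_dominated_convergence[where w="\<lambda>y. norm (w y)"])
    show "AE y in lborel. (\<lambda>n. indicator {..u n} y * w y) \<longlonglongrightarrow> indicator {..x} y * w y"
      using AE_lborel_singleton[of x]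
    proof eventually_elim
      case (elim y)
      consider "y < x" | "y > x" using elim by linarith
      then have "\<forall>\<^sub>F n in sequentially. indicator {..u n} y * w y = indicator {..x} y * w y"
      proof cases
        case 1
        from order_tendstoD(1)[OF u 1] show ?thesis by eventually_elim (use 1 in auto)
      next
        case 2
        from order_tendstoD(2)[OF u 2] show ?thesis by eventually_elim (use 2 in auto)
      qed
      then show ?case by (rule tendsto_eventually)
    qed
    show "AE y in lborel. norm (indicator {..u n} y * w y) \<le> norm (w y)" for n
      by (rule AE_I2) (auto simp: indicator_def)
  qed (use w wm in auto)
qed

lemma integrable_times_lborel:
  fixes f g :: "real \<Rightarrow> real"
  assumes f: "integrable lborel f" and g: "integrable lborel g"
  shows "integrable (lborel \<Otimes>\<^sub>M lborel) (\<lambda>(x, y). f x * g y)"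
proof (rule lborel_pair.Fubini_integrable)
  have "f \<in> borel_measurable lborel" "g \<in> borel_measurable lborel" using f g by auto
  then show "(\<lambda>(x, y). f x * g y) \<in> borel_measurable (lborel \<Otimes>\<^sub>M lborel)" by measurable
  have "integrable lborel (\<lambda>x. \<bar>f x\<bar> * (\<integral>y. \<bar>g y\<bar> \<partial>lborel))" using f by (intro integrable_mult_left) auto
  then show "integrable lborel (\<lambda>x. \<integral>y. norm (case (x, y) of (x, y) \<Rightarrow> f x * g y) \<partial>lborel)"
    by (simp add: abs_mult)
  show "AE x in lborel. integrable lborel (\<lambda>y. case (x, y) of (x, y) \<Rightarrow> f x * g y)"
    using g by simp
qed

text \<open>Fubini: the integral of \<open>deriv \<phi>\<close> over [y, infinity) is - \<phi>
  y.\<close>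

lemma primitive_parts:
  assumes w: "integrable lborel (w :: real \<Rightarrow> real)" and \<phi>: "test1 p r \<phi>"
  shows "(\<integral>x. (\<integral>y. indicator {..x} y * w y \<partial>lborel) * deriv \<phi> x \<partial>lborel) = - (\<integral>y. w y * \<phi> y \<partial>lborel)"
proof -
  have wm: "w \<in> borel_measurable borel" using borel_measurable_integrable[OF w] by simp
  have t': "test1 p r (deriv \<phi>)" by (rule test1_deriv[OF \<phi>])
  have pm: "deriv \<phi> \<in> borel_measurable borel" by (rule test1_measurable[OF t'])
  have pi: "integrable lborel (deriv \<phi>)"
    using loc_int_test1_integrable[OF loc_int_bounded[of "\<lambda>_. 1"] t'] by auto
  obtain a b where ab: "smooth1 \<phi>" "p < a" "b < r" "\<And>x. x \<notin> {a..b} \<Longrightarrow> \<phi> x = 0"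
    by (rule test1E[OF \<phi>]) (rule that)
  have inner: "(\<integral>x. indicator {..x} y * deriv \<phi> x \<partial>lborel) = - \<phi> y" for y
  proof -
    \<comment> \<open>A point beyond both \<open>y\<close> and the support, so that the boundary
      term \<open>\<phi> B\<close> is 0.\<close>
    define B where "B = max y b + 1"
    have B: "y \<le> B" "\<And>x. B \<le> x \<Longrightarrow> \<phi> x = 0"
      by (auto simp: B_def intro!: ab(4))
    have z: "deriv \<phi> x = 0" if "x > B" for x
    proof -
      have "\<forall>\<^sub>F z in nhds x. z \<in> {B<..}" by (rule eventually_nhds_in_open) (use that in auto)
      then have ev: "\<forall>\<^sub>F z in nhds x. \<phi> z = 0" by eventually_elim (simp add: B(2))
      have "(\<phi> has_real_derivative 0) (at x) \<longleftrightarrow> ((\<lambda>_. 0) has_real_derivative 0) (at x)"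
        by (rule DERIV_cong_ev[OF refl ev refl])
      then show ?thesis by (simp add: DERIV_imp_deriv)
    qed
    have "(\<integral>x. indicator {..x} y * deriv \<phi> x \<partial>lborel) = (LINT x:{y..B}|lborel. deriv \<phi> x)"
      unfolding set_lebesgue_integral_def
      by (rule Bochner_Integration.integral_cong) (use z in \<open>auto simp: indicator_def not_le\<close>)
    also have "\<dots> = integral {y..B} (deriv \<phi>)"
      by (rule set_borel_integral_eq_integral(2), rule borel_integrable_atLeastAtMost')
        (rule smooth1_continuous[OF smooth1_deriv(2)[OF ab(1)]])
    also have "\<dots> = \<phi> B - \<phi> y"
      by (rule integral_unique, rule fundamental_theorem_of_calculus[OF B(1)])
        (use smooth1_deriv(1)[OF ab(1)] in \<open>auto simp: has_real_derivative_iff_has_vector_derivative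
          intro: has_vector_derivative_at_within\<close>)
    finally show ?thesis using B(2)[of B] by simp
  qed
  let ?h = "\<lambda>(x, y). indicator {..x} y * w y * deriv \<phi> x"
  have "integrable (lborel \<Otimes>\<^sub>M lborel) (\<lambda>(x, y). deriv \<phi> x * w y)"
    by (rule integrable_times_lborel[OF pi w])
  then have hi: "integrable (lborel \<Otimes>\<^sub>M lborel) ?h"
  proof (rule Bochner_Integration.integrable_bound)
    have "(\<lambda>q::real \<times> real. indicator {q. snd q \<le> fst q} q * w (snd q) * deriv \<phi> (fst q)) \<in> borel_measurable (borel \<Otimes>\<^sub>M borel)"
      using wm pm by measurable
    moreover have "(\<lambda>q::real \<times> real. indicator {q. snd q \<le> fst q} q * w (snd q) * deriv \<phi> (fst q)) = ?h"
      by (auto simp: fun_eq_iff indicator_def)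
    ultimately show "?h \<in> borel_measurable (lborel \<Otimes>\<^sub>M lborel)"
      by (simp add: measurable_def sets_pair_measure space_pair_measure)
    show "AE q in lborel \<Otimes>\<^sub>M lborel. norm (?h q) \<le> norm ((\<lambda>(x, y). deriv \<phi> x * w y) q)"
      by (rule AE_I2) (auto simp: indicator_def abs_mult split: prod.splits)
  qed
  have "(\<integral>x. (\<integral>y. indicator {..x} y * w y \<partial>lborel) * deriv \<phi> x \<partial>lborel)
      = (\<integral>x. (\<integral>y. indicator {..x} y * w y * deriv \<phi> x \<partial>lborel) \<partial>lborel)" by simp
  also have "\<dots> = (\<integral>y. (\<integral>x. indicator {..x} y * w y * deriv \<phi> x \<partial>lborel) \<partial>lborel)"
    using lborel_pair.Fubini_integral[OF hi] by simp
  also have "\<dots> = (\<integral>y. w y * (- \<phi> y) \<partial>lborel)"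
  proof (rule Bochner_Integration.integral_cong[OF refl])
    fix y
    have "(\<integral>x. indicator {..x} y * w y * deriv \<phi> x \<partial>lborel) = (\<integral>x. w y * (indicator {..x} y * deriv \<phi> x) \<partial>lborel)"
      by (simp add: ac_simps)
    then show "(\<integral>x. indicator {..x} y * w y * deriv \<phi> x \<partial>lborel) = w y * (- \<phi> y)"
      using inner[of y] by simp
  qed
  finally show ?thesis by simp
qed

lemma constant_on_Icc:
  fixes e :: "real \<Rightarrow> real"
  assumes "continuous_on {a..b} e" "\<And>s t. a < s \<Longrightarrow> s \<le> t \<Longrightarrow> t < b \<Longrightarrow> e s = e t" "a < b"
    "s \<in> {a..b}" "t \<in> {a..b}"
  shows "e s = e t"
proof -
  define m where "m = (a + b) / 2"
  have m: "a < m" "m < b" using assms(3) by (auto simp: m_def)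
  have 1: "e x = e m" if "x \<in> {a<..<b}" for x
  proof (cases "x \<le> m")
    case True
    then show ?thesis using that m by (intro assms(2)) auto
  next
    case False
    have "e m = e x" by (rule assms(2)) (use that m False in auto)
    then show ?thesis by simp
  qed
  have "closure {a<..<b} = {a..b}" using assms(3) by simp
  then have "e x = e m" if "x \<in> {a..b}" for x
    by (intro continuous_constant_on_closure[of "{a<..<b}" e "e m" x]) (use assms(1) 1 that in auto)
  then show ?thesis using assms(4,5) by simp
qed

lemma weak_deriv_real_rep:
  assumes w: "weak_deriv {p<..<r} bs u w"
  obtains w' where "loc_int p r w'" "AE x in lebesgue. x \<in> {p<..<r} \<longrightarrow> w x = w' x"
    "\<And>x. x \<notin> {p<..<r} \<Longrightarrow> w' x = 0"
    "\<And>\<phi>. test1 p r \<phi> \<Longrightarrow> (\<integral>x. u x * iter_partial bs \<phi> x \<partial>lebesgue_on {p<..<r}) = (- 1) ^ length bs * (\<integral>x. w' x * \<phi> x \<partial>lborel)"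
proof -
  have lw: "loc_integrable {p<..<r} w" using w by (simp add: weak_deriv_def)
  obtain w' where w': "w' \<in> borel_measurable borel" "AE x in lebesgue. x \<in> {p<..<r} \<longrightarrow> w x = w' x"
    "\<And>x. x \<notin> {p<..<r} \<Longrightarrow> w' x = 0" "\<And>K. compact K \<Longrightarrow> K \<subseteq> {p<..<r} \<Longrightarrow> set_integrable lborel K w'"
    "\<And>\<psi>. \<psi> \<in> borel_measurable borel \<Longrightarrow>
       (\<integral>x. w x * \<psi> x \<partial>lebesgue_on {p<..<r}) = (\<integral>x. w' x * \<psi> x \<partial>lborel)"
    by (rule loc_integrable_borel_rep[OF open_greaterThanLessThan lw]) (rule that)
  show thesis
  proof (rule that[of w'])
    show "loc_int p r w'" unfolding loc_int_def
      using w'(1) by (intro conjI allI impI w'(4)) auto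
    fix \<phi> assume t: "test1 p r \<phi>"
    show "(\<integral>x. u x * iter_partial bs \<phi> x \<partial>lebesgue_on {p<..<r}) = (- 1) ^ length bs * (\<integral>x. w' x * \<phi> x \<partial>lborel)"
      using w test1_test_fun[OF t] w'(5)[OF test1_measurable[OF t]] unfolding weak_deriv_def by simp
  qed (use w' in auto)
qed

text \<open>The increment formula holds on the open interval for a Borel version of the weak
  derivative, and continuity of \<open>v\<close> carries it to the endpoints.\<close>

lemma sobolev_1_Linf_lac:
  assumes T: "0 < T" and v: "continuous_on {0..T} v" and s: "sobolev 1 \<infinity> {0<..<T} v"
  obtains w where "lac 0 T v w"
proof -
  let ?U = "{0<..<T}"
  obtain w where w: "Lp_on \<infinity> ?U w" "weak_deriv ?U [1] v w"
    using s unfolding sobolev_def by (auto dest!: spec[of _ "[1]"])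
  obtain C where C: "AE x in lebesgue_on ?U. \<bar>w x\<bar> \<le> C" using w(1) unfolding Lp_on_def by auto
  then have C: "AE x in lebesgue. x \<in> ?U \<longrightarrow> \<bar>w x\<bar> \<le> C"
    by (subst (asm) AE_restrict_space_iff) auto
  obtain w' where w': "loc_int 0 T w'" "AE x in lebesgue. x \<in> ?U \<longrightarrow> w x = w' x" "\<And>x. x \<notin> ?U \<Longrightarrow> w' x = 0"
    "\<And>\<phi>. test1 0 T \<phi> \<Longrightarrow> (\<integral>x. v x * iter_partial [1] \<phi> x \<partial>lebesgue_on ?U) = (- 1) ^ length [1::real] * (\<integral>x. w' x * \<phi> x \<partial>lborel)"
    by (rule weak_deriv_real_rep[OF w(2)]) (rule that)
  \<comment> \<open>Resetting the representative on the null set where it violates the essential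
    bound makes the density bounded everywhere, as \<open>lac\<close> demands.\<close>
  define d where "d x = (if \<bar>w' x\<bar> \<le> \<bar>C\<bar> then w' x else 0)" for x
  have w'm: "w' \<in> borel_measurable borel" using w'(1) by (simp add: loc_int_def)
  have dm: "d \<in> borel_measurable borel" unfolding d_def using w'm by measurable
  have db: "\<bar>d x\<bar> \<le> \<bar>C\<bar>" for x by (auto simp: d_def)
  have "AE x in lebesgue. w' x = d x"
    using C w'(2) by eventually_elim (use w'(3) in \<open>auto simp: d_def\<close>)
  then have ae: "AE x in lborel. w' x = d x"
    using w'm dm by (subst (asm) AE_completion_iff) auto
  have ld: "loc_int 0 T d" by (rule loc_int_bounded[OF dm]) (use db in blast)
  define u where "u x = indicator ?U x *\<^sub>R v x" for x
  have vU: "continuous_on ?U v" using v by (rule continuous_on_subset) auto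
  have um: "u \<in> borel_measurable borel"
    using integral_lebesgue_on_continuous(1)[OF open_greaterThanLessThan vU, of "\<lambda>_. 0"] unfolding u_def by simp
  have uc: "continuous_on ?U u" by (rule continuous_on_eq[OF vU]) (simp add: u_def)
  have inc: "u b - u a = (LINT x:{a..b}|lborel. d x)" if "0 < a" "a \<le> b" "b < T" for a b
  proof (rule weak_deriv_increment[OF um uc ld _ that])
    fix \<phi> assume t: "test1 0 T \<phi>"
    have "(\<integral>x. u x * deriv \<phi> x \<partial>lborel) = (\<integral>x. v x * deriv \<phi> x \<partial>lebesgue_on ?U)"
      using integral_lebesgue_on_continuous(2)[OF open_greaterThanLessThan vU test1_measurable[OF test1_deriv[OF t]]]
      by (simp add: u_def)
    also have "\<dots> = - (\<integral>x. w' x * \<phi> x \<partial>lborel)"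
      using w'(4)[OF t] test1_partial_deriv[OF t] by simp
    also have "(\<integral>x. w' x * \<phi> x \<partial>lborel) = (\<integral>x. d x * \<phi> x \<partial>lborel)"
      by (rule integral_cong_AE) (use ae w'm dm test1_measurable[OF t] in \<open>auto elim: eventually_mono\<close>)
    finally show "(\<integral>x. u x * deriv \<phi> x \<partial>lborel) = - (\<integral>x. d x * \<phi> x \<partial>lborel)" .
  qed
  define e where "e x = v x - integral {0..x} d" for x
  have di: "d integrable_on {a..b}" for a b by (rule bounded_borel_integrable[OF dm db])
  have comb: "integral {0..t} d - integral {0..s} d = integral {s..t} d" if "0 \<le> s" "s \<le> t" for s t
    using Henstock_Kurzweil_Integration.integral_combine[OF that di] by simp
  have ec: "continuous_on {0..T} e" unfolding e_def
    by (intro continuous_on_diff v indefinite_integral_continuous_1 di)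
  have "e s = e t" if "0 < s" "s \<le> t" "t < T" for s t
  proof -
    have "(LINT x:{s..t}|lborel. d x) = integral {s..t} d"
      by (rule set_borel_integral_eq_integral(2), rule bounded_borel_abs_integrable[OF dm db])
    then show ?thesis using inc[OF that] comb[of s t] that unfolding e_def u_def by simp
  qed
  from constant_on_Icc[OF ec this T] have const: "\<And>s t. s \<in> {0..T} \<Longrightarrow> t \<in> {0..T} \<Longrightarrow> e s = e t" by blast
  have "lac 0 T v d"
    unfolding lac_def
  proof (intro conjI allI impI dm)
    show "\<exists>M. \<forall>x\<in>{0..T}. \<bar>d x\<bar> \<le> M" using db by blast
    fix s t assume st: "0 \<le> s \<and> s \<le> t \<and> t \<le> T"
    then have "integral {s..t} d = v t - v s" using const[of s t] comb[of s t] unfolding e_def by auto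
    then show "(d has_integral (v t - v s)) {s..t}" using di by (metis integrable_integral)
  qed
  then show thesis by (rule that)
qed

lemma Lp_on_integrable:
  assumes p: "p = \<infinity> \<or> p = 2" and w: "Lp_on p {a<..<b} w"
  shows "integrable (lebesgue_on {a<..<b}) (w :: real \<Rightarrow> real)"
proof -
  have m: "w \<in> borel_measurable (lebesgue_on {a<..<b})" using w by (simp add: Lp_on_def)
  have fm: "integrable (lebesgue_on {a<..<b}) (\<lambda>_. c)" for c :: real
    by (rule finite_measure.integrable_const, rule finite_measureI)
      (cases "a \<le> b"; simp add: space_restrict_space emeasure_restrict_space)
  show ?thesis
  proof (cases "p = \<infinity>")
    case True
    then obtain C where C: "AE x in lebesgue_on {a<..<b}. \<bar>w x\<bar> \<le> C" using w unfolding Lp_on_def by auto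
    show ?thesis
      by (rule Bochner_Integration.integrable_bound[OF fm[of C] m]) (use C in \<open>auto elim!: eventually_mono\<close>)
  next
    case False
    then have "p = 2" using p by simp
    then have i: "integrable (lebesgue_on {a<..<b}) (\<lambda>x. \<bar>w x\<bar> powr 2)"
      using w unfolding Lp_on_def by simp
    show ?thesis
    proof (rule Bochner_Integration.integrable_bound[OF Bochner_Integration.integrable_add[OF fm[of 1] i] m])
      show "AE x in lebesgue_on {a<..<b}. norm (w x) \<le> norm (1 + \<bar>w x\<bar> powr 2)"
      proof (rule AE_I2)
        fix x
        have "\<bar>w x\<bar> powr 2 = \<bar>w x\<bar> ^ 2" by (cases "w x = 0") (auto simp: powr_numeral)
        \<comment> \<open>On an interval of finite length L^2 embeds into L^1 because |w| is at most
          1 + |w|^2.\<close>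
        moreover have "0 \<le> (\<bar>w x\<bar> - 1/2) ^ 2" by simp
        then have "\<bar>w x\<bar> \<le> 1 + \<bar>w x\<bar> ^ 2" by (simp add: power2_eq_square algebra_simps)
        ultimately show "norm (w x) \<le> norm (1 + \<bar>w x\<bar> powr 2)" by simp
      qed
    qed
  qed
qed

text \<open>Only integrability of the second weak derivative enters, so both kinds of data are
  covered. Its primitive \<open>W\<close> differs from the first weak derivative by a constant,
  hence \<open>v\<close> is an integral of the continuous function \<open>W + k\<close>.\<close>

lemma sobolev_2_C1:
  assumes T: "0 < T" and v: "continuous_on {0..T} v" and p: "p = \<infinity> \<or> p = 2"
    and s: "sobolev 2 p {0<..<T} v"
  obtains D where "continuous_on {0..T} D" "\<And>t. t \<in> {0<..<T} \<Longrightarrow> (v has_real_derivative D t) (at t)"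
proof -
  let ?U = "{0<..<T}"
  obtain w where w: "weak_deriv ?U [1] v w"
    using s unfolding sobolev_def by (auto dest!: spec[of _ "[1]"])
  obtain z where z: "Lp_on p ?U z" "weak_deriv ?U [1, 1] v z"
    using s unfolding sobolev_def by (auto dest!: spec[of _ "[1, 1]"])
  obtain w' where w': "loc_int 0 T w'" "AE x in lebesgue. x \<in> ?U \<longrightarrow> w x = w' x" "\<And>x. x \<notin> ?U \<Longrightarrow> w' x = 0"
    "\<And>\<phi>. test1 0 T \<phi> \<Longrightarrow> (\<integral>x. v x * iter_partial [1] \<phi> x \<partial>lebesgue_on ?U) = (- 1) ^ length [1::real] * (\<integral>x. w' x * \<phi> x \<partial>lborel)"
    by (rule weak_deriv_real_rep[OF w]) (rule that)
  obtain z' where z': "loc_int 0 T z'" "AE x in lebesgue. x \<in> ?U \<longrightarrow> z x = z' x" "\<And>x. x \<notin> ?U \<Longrightarrow> z' x = 0"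
    "\<And>\<phi>. test1 0 T \<phi> \<Longrightarrow> (\<integral>x. v x * iter_partial [1, 1] \<phi> x \<partial>lebesgue_on ?U) = (- 1) ^ length [1, 1::real] * (\<integral>x. z' x * \<phi> x \<partial>lborel)"
    by (rule weak_deriv_real_rep[OF z(2)]) (rule that)
  have z'm: "z' \<in> borel_measurable borel" using z'(1) by (simp add: loc_int_def)
  have "integrable lebesgue (\<lambda>x. indicator ?U x *\<^sub>R z x)"
    using Lp_on_integrable[OF p z(1)] by (subst (asm) integrable_restrict_space) auto
  then have "integrable lebesgue z'"
  proof (rule integrable_cong_AE_imp)
    show "z' \<in> borel_measurable lebesgue" using z'm by (intro measurable_completion) simp
    show "AE x in lebesgue. indicator ?U x *\<^sub>R z x = z' x"
      using z'(2) by eventually_elim (use z'(3) in \<open>auto simp: indicator_def\<close>)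
  qed
  then have zi: "integrable lborel z'" using z'm by (simp add: integrable_completion)
  define W where "W x = (\<integral>y. indicator {..x} y * z' y \<partial>lborel)" for x
  have Wc: "continuous_on S W" for S unfolding W_def by (rule primitive_cont[OF zi])
  have lW: "loc_int 0 T W" by (rule loc_int_continuous[OF borel_measurable_continuous_onI[OF Wc] Wc])
  define u where "u x = indicator ?U x *\<^sub>R v x" for x
  have vU: "continuous_on ?U v" using v by (rule continuous_on_subset) auto
  have um: "u \<in> borel_measurable borel"
    using integral_lebesgue_on_continuous(1)[OF open_greaterThanLessThan vU, of "\<lambda>_. 0"] unfolding u_def by simp
  have uc: "continuous_on ?U u" by (rule continuous_on_eq[OF vU]) (simp add: u_def)
  have inc: "u b - u a = (LINT x:{a..b}|lborel. w' x)" if "0 < a" "a \<le> b" "b < T" for a b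
  proof (rule weak_deriv_increment[OF um uc w'(1) _ that])
    fix \<phi> assume t: "test1 0 T \<phi>"
    have "(\<integral>x. u x * deriv \<phi> x \<partial>lborel) = (\<integral>x. v x * deriv \<phi> x \<partial>lebesgue_on ?U)"
      using integral_lebesgue_on_continuous(2)[OF open_greaterThanLessThan vU test1_measurable[OF test1_deriv[OF t]]]
      by (simp add: u_def)
    also have "\<dots> = - (\<integral>x. w' x * \<phi> x \<partial>lborel)"
      using w'(4)[OF t] test1_partial_deriv[OF t] by simp
    finally show "(\<integral>x. u x * deriv \<phi> x \<partial>lborel) = - (\<integral>x. w' x * \<phi> x \<partial>lborel)" .
  qed
  have zero: "(\<integral>x. (w' x - W x) * deriv \<phi> x \<partial>lborel) = 0" if t: "test1 0 T \<phi>" for \<phi>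
  proof -
    have t': "test1 0 T (deriv \<phi>)" by (rule test1_deriv[OF t])
    have "(\<integral>x. (w' x - W x) * deriv \<phi> x \<partial>lborel) = (\<integral>x. w' x * deriv \<phi> x \<partial>lborel) - (\<integral>x. W x * deriv \<phi> x \<partial>lborel)"
      using loc_int_test1_integrable[OF w'(1) t'] loc_int_test1_integrable[OF lW t'] by (simp add: left_diff_distrib)
    also have "(\<integral>x. W x * deriv \<phi> x \<partial>lborel) = - (\<integral>x. z' x * \<phi> x \<partial>lborel)"
      unfolding W_def by (rule primitive_parts[OF zi t])
    also have "(\<integral>x. z' x * \<phi> x \<partial>lborel) = (\<integral>x. v x * deriv (deriv \<phi>) x \<partial>lebesgue_on ?U)"
      using z'(4)[OF t] test1_partial_deriv[OF t] test1_partial_deriv[OF t'] by simp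
    also have "\<dots> = - (\<integral>x. w' x * deriv \<phi> x \<partial>lborel)"
      using w'(4)[OF t'] test1_partial_deriv[OF t'] by simp
    finally show ?thesis by simp
  qed
  \<comment> \<open>The constant value of \<open>w' - W\<close>, read off as a mean over the middle
    third.\<close>
  define k where "k = (LINT x:{T/3..2*T/3}|lborel. w' x - W x) / (2*T/3 - T/3)"
  have kk: "(LINT x:{a..b}|lborel. w' x - W x) = (b - a) * k" if "0 < a" "a \<le> b" "b < T" for a b
    using weak_deriv_zero_const[OF loc_int_diff[OF w'(1) lW] zero that, of "T/3" "2*T/3"] T
    by (simp add: k_def field_simps)
  have incr: "v b - v a = integral {a..b} (\<lambda>x. W x + k)" if "0 < a" "a \<le> b" "b < T" for a b
  proof -
    have i: "set_integrable lborel {a..b} w'" "set_integrable lborel {a..b} W"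
      using w'(1) lW that by (auto simp: loc_int_def)
    have "v b - v a = (LINT x:{a..b}|lborel. w' x)" using inc[OF that] that by (simp add: u_def)
    also have "\<dots> = (LINT x:{a..b}|lborel. W x) + (b - a) * k"
      using kk[OF that] set_integral_diff(2)[OF i] by simp
    also have "(LINT x:{a..b}|lborel. W x) = integral {a..b} W"
      by (rule set_borel_integral_eq_integral(2)[OF i(2)])
    also have "integral {a..b} W + (b - a) * k = integral {a..b} (\<lambda>x. W x + k)"
      using that by (subst integral_add) (auto intro!: integrable_continuous_real Wc)
    finally show ?thesis .
  qed
  have Dc: "continuous_on UNIV (\<lambda>x. W x + k)" by (intro continuous_intros Wc)
  show thesis
  proof (rule that[of "\<lambda>x. W x + k"])
    show "continuous_on {0..T} (\<lambda>x. W x + k)" by (intro continuous_intros Wc)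
    fix t assume t: "t \<in> {0<..<T}"
    define t0 where "t0 = t / 2"
    have t0: "0 < t0" "t0 < t" using t by (auto simp: t0_def)
    let ?P = "prim (\<lambda>x. W x + k)"
    have "((\<lambda>x. v t0 + (?P x - ?P t0)) has_real_derivative W t + k) (at t)"
      using prim_deriv[OF Dc] by (auto intro!: derivative_eq_intros)
    moreover have "\<forall>\<^sub>F x in nhds t. x \<in> {t0<..<T}" by (rule eventually_nhds_in_open) (use t t0 in auto)
    then have ev: "\<forall>\<^sub>F x in nhds t. v t0 + (?P x - ?P t0) = v x"
    proof eventually_elim
      case (elim x)
      show ?case
      proof (cases "t0 \<le> x")
        case True
        then show ?thesis using incr[of t0 x] t0 elim prim_diff[OF Dc, of t0 x] by auto
      qed (use elim in auto)
    qed
    ultimately show "(v has_real_derivative W t + k) (at t)"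
      using DERIV_cong_ev[OF refl ev refl] by blast
  qed
qed

section \<open>The fixed point problem in Lagrangian coordinates\<close>

text \<open>Rescaling to the fixed interval [0, 1], where the primitive is the integral of
  \<open>x * f t (s * x)\<close> in \<open>s\<close>, reduces joint continuity to that of a
  parameter integral.\<close>

lemma continuous_on_prim_joint:
  fixes f :: "real \<Rightarrow> real \<Rightarrow> real"
  assumes f: "continuous_on UNIV (\<lambda>q. f (fst q) (snd q))"
  shows "continuous_on UNIV (\<lambda>q. prim (f (fst q)) (snd q))"
proof -
  have fc: "continuous_on S (f t)" for t S
    by (rule continuous_on_compose2[OF f, of S "\<lambda>x. (t, x)", simplified]) (auto intro!: continuous_intros)
  have eq: "prim (f t) x = integral {0..1} (\<lambda>s. x * f t (s * x))" for t x
  proof -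
    have "((\<lambda>s. prim (f t) (s * x)) has_real_derivative f t (s * x) * x) (at s)" for s
      by (rule DERIV_chain2[OF prim_deriv[OF fc]]) (auto intro!: derivative_eq_intros)
    then have "((\<lambda>s. prim (f t) (s * x)) has_vector_derivative x * f t (s * x)) (at s within {0..1})" for s
      by (simp add: has_real_derivative_iff_has_vector_derivative has_vector_derivative_at_within mult.commute)
    then have "((\<lambda>s. x * f t (s * x)) has_integral (prim (f t) (1 * x) - prim (f t) (0 * x))) {0..1}"
      by (intro fundamental_theorem_of_calculus) auto
    from integral_unique[OF this] show ?thesis by (simp only: mult_zero_left mult_1 prim_0 diff_zero)
  qed
  have "continuous_on UNIV (\<lambda>q::real \<times> real. integral (cbox 0 1) (\<lambda>s. snd q * f (fst q) (s * snd q)))"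
  proof (rule integral_continuous_on_param)
    show "continuous_on (UNIV \<times> cbox 0 1) (\<lambda>(q, s). snd q * f (fst q) (s * snd q))"
      unfolding split_beta
      by (intro continuous_on_mult continuous_on_compose2[OF f, of _ "\<lambda>p. (fst (fst p), snd p * snd (fst p))", simplified]
          continuous_intros) 
  qed
  then show ?thesis by (simp add: eq)
qed

text \<open>The slope bound controls the distance of two preimages by the residual of the old
  preimage in the new equation, and that residual is continuous.\<close>

lemma continuous_on_inv_joint:
  fixes H :: "real \<Rightarrow> real \<Rightarrow> real"
  assumes H: "continuous_on UNIV (\<lambda>q. H (fst q) (snd q))" and k: "0 < k"
    and slope: "\<And>t a b. a \<le> b \<Longrightarrow> k * (b - a) \<le> H t b - H t a"
  shows "continuous_on UNIV (\<lambda>q. inv (H (fst q)) (snd q))"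
proof -
  have Hc: "continuous_on S (H t)" for t S
    by (rule continuous_on_compose2[OF H, of S "\<lambda>x. (t, x)", simplified]) (auto intro!: continuous_intros)
  have Ht: "continuous_on S (\<lambda>t. H t x)" for x S
    by (rule continuous_on_compose2[OF H, of S "\<lambda>t. (t, x)", simplified]) (auto intro!: continuous_intros)
  have bij: "bij (H t)" for t by (rule slope_bij(1)[OF Hc k slope])
  have inv: "H t (inv (H t) y) = y" for t y using bij by (simp add: bij_is_surj surj_f_inv_f)
  have abs: "k * \<bar>b - a\<bar> \<le> \<bar>H t b - H t a\<bar>" for t a b
    using slope[of a b t] slope[of b a t] by (cases "a \<le> b") (auto simp: abs_if algebra_simps)
  show ?thesis
    unfolding continuous_on_def
  proof
    fix q0 :: "real \<times> real"
    let ?m = "\<lambda>q. inv (H (fst q)) (snd q)"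
    have "((\<lambda>q. \<bar>snd q - H (fst q) (?m q0)\<bar>) \<longlongrightarrow> \<bar>snd q0 - H (fst q0) (?m q0)\<bar>) (at q0)"
    proof (intro tendsto_intros)
      have "isCont (\<lambda>t. H t (?m q0)) (fst q0)" using Ht[of UNIV] by (simp add: continuous_on_eq_continuous_at)
      then show "((\<lambda>q. H (fst q) (?m q0)) \<longlongrightarrow> H (fst q0) (?m q0)) (at q0)"
        by (rule isCont_tendsto_compose) (intro tendsto_intros)
    qed
    then have l: "((\<lambda>q. \<bar>snd q - H (fst q) (?m q0)\<bar> / k) \<longlongrightarrow> 0) (at q0)"
      unfolding inv using tendsto_divide_zero[where c=k] by auto
    have "((\<lambda>q. ?m q - ?m q0) \<longlongrightarrow> 0) (at q0)"
    proof (rule Lim_null_comparison[OF always_eventually l], rule allI)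
      fix q
      have "k * \<bar>?m q - ?m q0\<bar> \<le> \<bar>snd q - H (fst q) (?m q0)\<bar>"
        using abs[of "?m q" "?m q0" "fst q"] by (simp add: inv)
      then show "norm (?m q - ?m q0) \<le> \<bar>snd q - H (fst q) (?m q0)\<bar> / k"
        using k by (simp add: field_simps)
    qed
    then show "(?m \<longlongrightarrow> ?m q0) (at q0 within UNIV)" by (simp add: LIM_zero_iff)
  qed
qed

lemma inv_slope_lipschitz:
  assumes "bij f" and k: "0 < k" and slope: "\<And>a b. a \<le> b \<Longrightarrow> k * (b - a) \<le> f b - f (a::real)"
  shows "\<bar>inv f y - inv f z\<bar> \<le> \<bar>y - z\<bar> / k"
proof -
  have inv: "f (inv f y) = y" for y using assms(1) by (simp add: bij_is_surj surj_f_inv_f)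
  have "k * \<bar>inv f y - inv f z\<bar> \<le> \<bar>y - z\<bar>"
    using slope[of "inv f y" "inv f z"] slope[of "inv f z" "inv f y"]
    by (cases "inv f y \<le> inv f z") (auto simp: abs_if algebra_simps inv)
  then show ?thesis using k by (simp add: field_simps)
qed

section \<open>The data and the labels of the particles\<close>

locale fibre =
  fixes L vm VM Sm SM :: real and vin vL S0 S1 :: "real \<Rightarrow> real"
  assumes L: "0 < L" and vm: "0 < vm" and Sm: "0 < Sm"
    and vin_cont: "continuous_on UNIV vin" and vL_cont: "continuous_on UNIV vL"
    and S0_cont: "continuous_on UNIV S0" and S1_cont: "continuous_on UNIV S1"
    and v_bounds: "\<And>t. vm \<le> vin t" "\<And>t. vin t \<le> vL t" "\<And>t. vL t \<le> VM"
    and S0_bounds: "\<And>t. Sm \<le> S0 t" "\<And>t. S0 t \<le> SM"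
    and S1_bounds: "\<And>t. Sm \<le> S1 t" "\<And>t. S1 t \<le> SM"
    and S_compat: "S0 0 = S1 0"
begin

text \<open>A particle is labelled by the mass \<open>m\<close> between it and the one that sits at the inlet at
  time \<open>0\<close>: it starts at \<open>\<xi> m\<close> if \<open>m \<ge> 0\<close>, and enters at time \<open>\<tau> m\<close> if \<open>m \<le> 0\<close>.\<close>

definition "q t = vin t * S0 t"
definition "N = prim q"
definition "R = prim S1"
definition "\<tau> m = inv N (max 0 (- m))"
definition "\<xi> m = inv R (max 0 m)"
text \<open>For either sign of \<open>m\<close> one of the terms with \<open>S1\<close> and
  \<open>S0\<close> has its compatibility value \<open>S0 0 = S1 0\<close>, which is subtracted; a
  single formula thus covers initial and entering particles and is continuous across 0.\<close>

definition "b m = S1 (\<xi> m) + S0 (\<tau> m) - S0 0"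

lemma VM: "0 < VM" using vm v_bounds[of 0] by linarith
lemma SM: "0 < SM" "Sm \<le> SM" using Sm S0_bounds[of 0] by linarith+

lemma q_cont: "continuous_on S q"
  unfolding q_def by (intro continuous_intros continuous_on_subset[OF vin_cont] continuous_on_subset[OF S0_cont]) auto

lemma q_lower: "vm * Sm \<le> q t"
  unfolding q_def using v_bounds S0_bounds vm Sm by (intro mult_mono) (auto intro: less_imp_le order_trans)

lemma q_pos: "0 < q t" using q_lower[of t] vm Sm by (metis mult_pos_pos order_less_le_trans)

lemma N_slope: "x \<le> y \<Longrightarrow> vm * Sm * (y - x) \<le> N y - N x"
  unfolding N_def by (rule prim_lower[OF q_cont q_lower])

lemma R_slope: "x \<le> y \<Longrightarrow> Sm * (y - x) \<le> R y - R x"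
  unfolding R_def by (rule prim_lower[OF S1_cont S1_bounds(1)])

lemma N_cont: "continuous_on S N" unfolding N_def by (rule continuous_on_prim[OF q_cont])
lemma R_cont: "continuous_on S R" unfolding R_def by (rule continuous_on_prim[OF S1_cont])
lemma N_deriv: "(N has_real_derivative q t) (at t)" unfolding N_def by (rule prim_deriv[OF q_cont])
lemma R_deriv: "(R has_real_derivative S1 t) (at t)" unfolding R_def by (rule prim_deriv[OF S1_cont])

lemma vmSm: "0 < vm * Sm" using vm Sm by simp

lemma N_bij: "bij N" "strict_mono N" using slope_bij[OF N_cont vmSm N_slope] by auto
lemma R_bij: "bij R" "strict_mono R" using slope_bij[OF R_cont Sm R_slope] by auto

lemma N_0 [simp]: "N 0 = 0" and R_0 [simp]: "R 0 = 0" by (auto simp: N_def R_def)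

lemma inv_N [simp]: "inv N (N t) = t" "N (inv N y) = y"
  using N_bij(1) by (auto simp: bij_is_inj bij_is_surj surj_f_inv_f)

lemma inv_R [simp]: "inv R (R t) = t" "R (inv R y) = y"
  using R_bij(1) by (auto simp: bij_is_inj bij_is_surj surj_f_inv_f)

lemma N_le_iff [simp]: "N s \<le> N t \<longleftrightarrow> s \<le> t" and R_le_iff [simp]: "R s \<le> R t \<longleftrightarrow> s \<le> t"
  using N_bij(2) R_bij(2) by (auto simp: strict_mono_less_eq)

lemma N_nonneg: "0 \<le> t \<Longrightarrow> 0 \<le> N t" using N_le_iff[of 0 t] by simp

lemma N_\<tau>: "N (\<tau> m) = max 0 (- m)" by (simp add: \<tau>_def)
lemma R_\<xi>: "R (\<xi> m) = max 0 m" by (simp add: \<xi>_def)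

lemma \<tau>_nonneg: "0 \<le> \<tau> m" using N_le_iff[of 0 "\<tau> m"] by (simp add: N_\<tau>)

lemma \<tau>_N: "0 \<le> t \<Longrightarrow> \<tau> (- N t) = t"
  using N_nonneg[of t] by (simp add: \<tau>_def max_def)

lemma \<tau>_pos: "0 \<le> m \<Longrightarrow> \<tau> m = 0" using inv_N(1)[of 0] by (simp add: \<tau>_def max_def)
lemma \<xi>_neg: "m \<le> 0 \<Longrightarrow> \<xi> m = 0" using inv_R(1)[of 0] by (auto simp: \<xi>_def max_def)
lemma \<xi>_R: "0 \<le> x \<Longrightarrow> \<xi> (R x) = x" using R_le_iff[of 0 x] by (simp add: \<xi>_def max_def)

lemma \<tau>_le_iff: "0 \<le> t \<Longrightarrow> \<tau> m \<le> t \<longleftrightarrow> - N t \<le> m"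
  using N_le_iff[of "\<tau> m" t] N_nonneg[of t] unfolding N_\<tau> by auto

lemma \<tau>_lipschitz: "\<bar>\<tau> m - \<tau> m'\<bar> \<le> \<bar>m - m'\<bar> / (vm * Sm)"
proof -
  have "\<bar>\<tau> m - \<tau> m'\<bar> \<le> \<bar>max 0 (- m) - max 0 (- m')\<bar> / (vm * Sm)"
    unfolding \<tau>_def by (rule inv_slope_lipschitz[OF N_bij(1) vmSm N_slope])
  also have "\<dots> \<le> \<bar>m - m'\<bar> / (vm * Sm)" using vmSm by (intro divide_right_mono) auto
  finally show ?thesis .
qed

lemma \<xi>_lipschitz: "\<bar>\<xi> m - \<xi> m'\<bar> \<le> \<bar>m - m'\<bar> / Sm"
proof -
  have "\<bar>\<xi> m - \<xi> m'\<bar> \<le> \<bar>max 0 m - max 0 m'\<bar> / Sm"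
    unfolding \<xi>_def by (rule inv_slope_lipschitz[OF R_bij(1) Sm R_slope])
  also have "\<dots> \<le> \<bar>m - m'\<bar> / Sm" using Sm by (intro divide_right_mono) auto
  finally show ?thesis .
qed

lemma \<tau>_cont: "continuous_on S \<tau>"
proof (rule lipschitz_on_continuous_on[OF lipschitz_onI])
  show "dist (\<tau> x) (\<tau> y) \<le> 1 / (vm * Sm) * dist x y" for x y
    using \<tau>_lipschitz[of x y] by (simp add: dist_real_def)
qed (use vmSm in auto)

lemma \<xi>_cont: "continuous_on S \<xi>"
proof (rule lipschitz_on_continuous_on[OF lipschitz_onI])
  show "dist (\<xi> x) (\<xi> y) \<le> 1 / Sm * dist x y" for x y
    using \<xi>_lipschitz[of x y] by (simp add: dist_real_def)
qed (use Sm in auto)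

lemma b_neg: "m \<le> 0 \<Longrightarrow> b m = S0 (\<tau> m)" by (simp add: b_def \<xi>_neg S_compat)
lemma b_pos: "0 \<le> m \<Longrightarrow> b m = S1 (\<xi> m)" by (simp add: b_def \<tau>_pos)

lemma b_bounds: "Sm \<le> b m" "b m \<le> SM"
  using b_neg[of m] b_pos[of m] S0_bounds S1_bounds by (cases "m \<le> 0"; simp)+

lemma b_cont: "continuous_on S b"
  unfolding b_def
  by (intro continuous_intros continuous_on_compose2[OF S0_cont \<tau>_cont] continuous_on_compose2[OF S1_cont \<xi>_cont]) auto

end

section \<open>The truncated fixed point map\<close>

locale fibre_trunc = fibre +
  fixes \<delta> :: real
  assumes \<delta>: "0 < \<delta>" "\<delta> \<le> Sm"
begin

text \<open>The inner \<open>max 0\<close> keeps the area at most \<open>SM\<close> for candidates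
  \<open>C\<close> that are not monotone, as they occur in the function space of the fixed point
  argument.\<close>

definition "\<alpha> C t m = max \<delta> (b m - max 0 (C t - C (\<tau> m)))"
definition "w C t m = 1 / \<alpha> C t m"
text \<open>The position of the label \<open>m\<close>: since m_x is the area, dx = w dm, counted
  from the inlet, which carries the label \<open>- N t\<close>.\<close>

definition "X C t m = prim (w C t) m - prim (w C t) (- N t)"
definition "mL C t = inv (X C t) L"
text \<open>By dx = w dm this is the integral of 1 / A over [0, L], the denominator in the formula
  for the rate.\<close>

definition "I C t = integral {- N t..mL C t} (\<lambda>m. (w C t m)\<^sup>2)"
definition "F C t = (vL t - vin t) / I C t"

lemma \<alpha>_bounds: "\<delta> \<le> \<alpha> C t m" "\<alpha> C t m \<le> SM" "0 < \<alpha> C t m"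
  using b_bounds[of m] \<delta> SM by (auto simp: \<alpha>_def)

lemma w_bounds: "1 / SM \<le> w C t m" "w C t m \<le> 1 / \<delta>" "0 < w C t m"
  using \<alpha>_bounds[of C t m] \<delta> by (auto simp: w_def intro!: divide_left_mono)

context
  fixes C :: "real \<Rightarrow> real"
  assumes C: "continuous_on UNIV C"
begin

lemma \<alpha>_joint_cont: "continuous_on UNIV (\<lambda>q. \<alpha> C (fst q) (snd q))"
  unfolding \<alpha>_def
  by (intro continuous_intros continuous_on_compose2[OF b_cont] continuous_on_compose2[OF C]
      continuous_on_compose2[OF \<tau>_cont]) auto

lemma w_joint_cont: "continuous_on UNIV (\<lambda>q. w C (fst q) (snd q))"
  unfolding w_def using \<alpha>_bounds(3) by (intro continuous_intros \<alpha>_joint_cont) (auto simp: less_imp_neq[THEN not_sym])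

lemma w_cont: "continuous_on S (w C t)"
  by (rule continuous_on_compose2[OF w_joint_cont, of S "\<lambda>x. (t, x)", simplified]) (auto intro!: continuous_intros)

lemma X_joint_cont: "continuous_on UNIV (\<lambda>q. X C (fst q) (snd q))"
proof -
  note p = continuous_on_prim_joint[of "w C", OF w_joint_cont]
  show ?thesis unfolding X_def
    by (intro continuous_on_diff p continuous_on_compose2[OF p, of _ "\<lambda>q. (fst q, - N (fst q))", simplified]
        continuous_intros continuous_on_compose2[OF N_cont]) auto
qed

lemma X_slope: "x \<le> y \<Longrightarrow> 1 / SM * (y - x) \<le> X C t y - X C t x"
  using prim_lower[OF w_cont[of UNIV t] w_bounds(1)] by (simp add: X_def)

lemma X_bij: "bij (X C t)" "strict_mono (X C t)"
proof -
  have c: "continuous_on UNIV (X C t)"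
    by (rule continuous_on_compose2[OF X_joint_cont, of UNIV "\<lambda>x. (t, x)", simplified]) (auto intro!: continuous_intros)
  show "bij (X C t)" "strict_mono (X C t)"
    using slope_bij[OF c _ X_slope] SM by auto
qed

lemma X_mL: "X C t (mL C t) = L"
  unfolding mL_def using X_bij(1) by (simp add: bij_is_surj surj_f_inv_f)

lemma X_inlet: "X C t (- N t) = 0" by (simp add: X_def)

lemma X_le_iff: "X C t x \<le> X C t y \<longleftrightarrow> x \<le> y"
  using X_bij(2) by (simp add: strict_mono_less_eq)

lemma mL_ge: "- N t \<le> mL C t"
  using X_le_iff[of t "- N t" "mL C t"] L by (simp add: X_mL X_inlet)

lemma X_integral: "- N t \<le> m \<Longrightarrow> X C t m = integral {- N t..m} (w C t)"
  unfolding X_def by (rule prim_diff[OF w_cont])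

lemma mL_eqI: "- N t \<le> m \<Longrightarrow> integral {- N t..m} (w C t) = L \<Longrightarrow> m = mL C t"
  using X_integral[of t m] X_mL[of t] X_le_iff[of t m "mL C t"] X_le_iff[of t "mL C t" m] by simp

lemma mL_len: "mL C t + N t \<le> SM * L"
  using X_slope[OF mL_ge, of t t] SM by (simp add: X_mL X_inlet field_simps)

lemma mL_cont: "continuous_on S (mL C)"
proof -
  have "continuous_on UNIV (\<lambda>q. inv (X C (fst q)) (snd q))"
    by (rule continuous_on_inv_joint[where k="1/SM"]) (use SM X_joint_cont X_slope in auto)
  from continuous_on_compose2[OF this, of S "\<lambda>t. (t, L)"]
  show ?thesis unfolding mL_def[abs_def] by (simp add: continuous_on_Pair continuous_on_id continuous_on_const)
qed

lemma w2_joint_cont: "continuous_on UNIV (\<lambda>q. (w C (fst q) (snd q))\<^sup>2)"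
  by (intro continuous_intros w_joint_cont)

lemma w2_cont: "continuous_on S (\<lambda>m. (w C t m)\<^sup>2)"
  by (intro continuous_intros w_cont)

lemma I_prim: "I C t = prim (\<lambda>m. (w C t m)\<^sup>2) (mL C t) - prim (\<lambda>m. (w C t m)\<^sup>2) (- N t)"
  unfolding I_def by (rule prim_diff[OF w2_cont mL_ge, symmetric])

lemma I_cont: "continuous_on S (I C)"
proof -
  note p = continuous_on_prim_joint[of "\<lambda>t m. (w C t m)\<^sup>2", OF w2_joint_cont]
  show ?thesis unfolding I_prim[abs_def]
    by (intro continuous_on_diff continuous_on_compose2[OF p, of _ "\<lambda>t. (t, mL C t)", simplified]
       continuous_on_compose2[OF p, of _ "\<lambda>t. (t, - N t)", simplified] continuous_intros mL_cont N_cont)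
qed

text \<open>One factor of the squared integrand is bounded below by \<open>k\<close>; the other
  integrates to the length L of the fibre.\<close>

lemma I_ge: 
  assumes "\<And>m. - N t \<le> m \<Longrightarrow> m \<le> mL C t \<Longrightarrow> k \<le> w C t m"
  shows "k * L \<le> I C t"
proof -
  have "integral {- N t..mL C t} (\<lambda>m. k * w C t m) \<le> I C t"
    unfolding I_def
    by (rule integral_le) (use assms w_bounds(3)[of C t] in \<open>auto intro!: integrable_continuous_real continuous_intros w_cont
      mult_right_mono less_imp_le simp: power2_eq_square\<close>)
  then show ?thesis using X_integral[OF mL_ge, of t] by (simp add: X_mL)
qed

lemma I_lower: "L / SM \<le> I C t"
  using I_ge[where k="1 / SM" and t=t] w_bounds(1) by simp

lemma I_pos: "0 < I C t" using I_lower[of t] L SM by (metis divide_pos_pos order_less_le_trans)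

lemma F_cont: "continuous_on S (F C)"
  unfolding F_def using I_pos
  by (intro continuous_intros I_cont continuous_on_subset[OF vin_cont] continuous_on_subset[OF vL_cont])
    (auto simp: less_imp_neq[THEN not_sym])

lemma F_nonneg: "0 \<le> F C t" using I_pos[of t] v_bounds(2)[of t] by (simp add: F_def)

lemma F_upper: "F C t \<le> VM * SM / L"
proof -
  have "F C t \<le> VM / (L / SM)"
    unfolding F_def using I_lower v_bounds[of t] vm L SM by (intro frac_le) auto
  then show ?thesis by simp
qed

end

text \<open>Both \<open>C t\<close> and \<open>C (\<tau> m)\<close> move by at most
  \<open>d\<close>, hence the factor 2. On the fibre \<tau> m <= t, so only the history up to
  \<open>t\<close> matters.\<close>

lemma \<alpha>_diff:
  assumes "0 \<le> t" "- N t \<le> m" and d: "\<forall>s\<in>{0..t}. \<bar>C s - D s\<bar> \<le> d"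
  shows "\<bar>\<alpha> C t m - \<alpha> D t m\<bar> \<le> 2 * d"
proof -
  have "\<tau> m \<in> {0..t}" using \<tau>_nonneg[of m] \<tau>_le_iff[of t m] assms by simp
  then have "\<bar>C t - D t\<bar> \<le> d" "\<bar>C (\<tau> m) - D (\<tau> m)\<bar> \<le> d" using d assms(1) by auto
  then show ?thesis unfolding \<alpha>_def by linarith
qed

lemma w_diff:
  assumes "0 \<le> t" "- N t \<le> m" and d: "\<forall>s\<in>{0..t}. \<bar>C s - D s\<bar> \<le> d"
  shows "\<bar>w C t m - w D t m\<bar> \<le> 2 * d / \<delta>\<^sup>2"
proof -
  have "w C t m - w D t m = (\<alpha> D t m - \<alpha> C t m) / (\<alpha> C t m * \<alpha> D t m)"
    using \<alpha>_bounds(3)[of C t m] \<alpha>_bounds(3)[of D t m] by (simp add: w_def field_simps)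
  then have "\<bar>w C t m - w D t m\<bar> = \<bar>\<alpha> C t m - \<alpha> D t m\<bar> / (\<alpha> C t m * \<alpha> D t m)"
    using \<alpha>_bounds(3)[of C t m] \<alpha>_bounds(3)[of D t m] by (simp add: abs_divide abs_mult abs_minus_commute)
  also have "\<dots> \<le> 2 * d / \<delta>\<^sup>2"
    unfolding power2_eq_square
    using \<alpha>_diff[OF assms] \<alpha>_bounds[of C t m] \<alpha>_bounds[of D t m] \<delta> abs_ge_zero[of "\<alpha> C t m - \<alpha> D t m"]
    by (intro frac_le mult_mono) (auto simp del: abs_ge_zero)
  finally show ?thesis .
qed

text \<open>The first term is the change of the integrand over the common part of the two fibres,
  the second one the shift of the outlet label.\<close>

definition "Klip_I = 4 * SM * L / \<delta> ^ 3 + 2 * SM\<^sup>2 * L / \<delta> ^ 4"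

text \<open>The outlet labels are compared through the common length: both fibres have length L, so
  the surplus of the longer label range equals the difference of the integrands over the shorter
  one.\<close>

lemma I_diff_aux:
  assumes C: "continuous_on UNIV C" and D: "continuous_on UNIV D"
    and t: "0 \<le> t" and d: "\<forall>s\<in>{0..t}. \<bar>C s - D s\<bar> \<le> d" and le: "mL C t \<le> mL D t"
  shows "\<bar>I C t - I D t\<bar> \<le> Klip_I * d"
proof -
  define n m1 m2 where "n = - N t" and "m1 = mL C t" and "m2 = mL D t"
  have nm: "n \<le> m1" "m1 \<le> m2" using mL_ge[OF C] le by (auto simp: n_def m1_def m2_def)
  have d0: "0 \<le> d" using bspec[OF d, of 0] t by auto
  have len: "m1 - n \<le> SM * L" using mL_len[OF C, of t] by (simp add: n_def m1_def)
  have ic: "(\<lambda>m. w C t m) integrable_on {x..y}" "(\<lambda>m. w D t m) integrable_on {x..y}"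
     "(\<lambda>m. (w C t m)\<^sup>2) integrable_on {x..y}" "(\<lambda>m. (w D t m)\<^sup>2) integrable_on {x..y}" for x y
    by (auto intro!: integrable_continuous_real w_cont w2_cont C D)
  have LC: "integral {n..m1} (w C t) = L" and LD: "integral {n..m2} (w D t) = L"
    using X_integral[OF C mL_ge[OF C]] X_integral[OF D mL_ge[OF D]] X_mL[OF C] X_mL[OF D]
    by (auto simp: n_def m1_def m2_def)
  have split: "integral {n..m1} (w D t) + integral {m1..m2} (w D t) = integral {n..m2} (w D t)"
    "integral {n..m1} (\<lambda>m. (w D t m)\<^sup>2) + integral {m1..m2} (\<lambda>m. (w D t m)\<^sup>2) = integral {n..m2} (\<lambda>m. (w D t m)\<^sup>2)"
    using integral_combine_cont[OF w_cont[OF D] nm] integral_combine_cont[OF w2_cont[OF D] nm] by auto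
  have bnd: "\<bar>integral {x..y} f\<bar> \<le> M * (y - x)"
    if "x \<le> y" "f integrable_on {x..y}" "\<And>m. m \<in> {x..y} \<Longrightarrow> \<bar>f m\<bar> \<le> M" for f :: "real \<Rightarrow> real" and x y M
  proof -
    have "0 \<le> M" using that(3)[of x] that(1) by force
    from has_integral_bound[OF this, of f _ x y] that show ?thesis
      by (metis atLeastAtMost_iff box_real(2) content_real integrable_integral real_norm_def)
  qed
  \<comment> \<open>Subtracting the two equations for the length L.\<close>
  have "integral {m1..m2} (w D t) = integral {n..m1} (\<lambda>m. w C t m - w D t m)"
    using LC LD split(1) ic by (subst integral_diff) auto
  also have "\<dots> \<le> \<bar>integral {n..m1} (\<lambda>m. w C t m - w D t m)\<bar>" by simp
  also have "\<dots> \<le> 2 * d / \<delta>\<^sup>2 * (m1 - n)"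
  proof (rule bnd[OF nm(1)])
    show "\<bar>w C t m - w D t m\<bar> \<le> 2 * d / \<delta>\<^sup>2" if "m \<in> {n..m1}" for m
      using w_diff[OF t _ d, of m] that by (simp add: n_def)
  qed (use ic in \<open>auto intro!: integrable_diff\<close>)
  also have "\<dots> \<le> 2 * d / \<delta>\<^sup>2 * (SM * L)" using len d0 by (intro mult_left_mono) auto
  finally have 1: "integral {m1..m2} (w D t) \<le> 2 * d / \<delta>\<^sup>2 * (SM * L)" .
  have "1 / SM * (m2 - m1) \<le> integral {m1..m2} (w D t)"
    using prim_lower[OF w_cont[OF D] w_bounds(1) nm(2)] prim_diff[OF w_cont[OF D] nm(2)] by simp
  then have "m2 - m1 \<le> SM * integral {m1..m2} (w D t)" using SM by (simp add: field_simps)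
  also have "\<dots> \<le> SM * (2 * d / \<delta>\<^sup>2 * (SM * L))" using 1 SM by (intro mult_left_mono) auto
  finally have m21: "m2 - m1 \<le> SM * (2 * d / \<delta>\<^sup>2 * (SM * L))" .
  have "\<bar>integral {m1..m2} (\<lambda>m. (w D t m)\<^sup>2)\<bar> \<le> (1 / \<delta>)\<^sup>2 * (m2 - m1)"
  proof (rule bnd[OF nm(2) ic(4)])
    fix m
    have "(w D t m)\<^sup>2 \<le> (1 / \<delta>)\<^sup>2" using w_bounds[of D t m] by (intro power_mono) auto
    then show "\<bar>(w D t m)\<^sup>2\<bar> \<le> (1 / \<delta>)\<^sup>2" by simp
  qed
  also have "\<dots> \<le> (1 / \<delta>)\<^sup>2 * (SM * (2 * d / \<delta>\<^sup>2 * (SM * L)))" using m21 by (intro mult_left_mono) auto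
  also have "\<dots> = 2 * SM\<^sup>2 * L / \<delta> ^ 4 * d" by (simp add: power2_eq_square power4_eq_xxxx ac_simps)
  finally have 2: "\<bar>integral {m1..m2} (\<lambda>m. (w D t m)\<^sup>2)\<bar> \<le> 2 * SM\<^sup>2 * L / \<delta> ^ 4 * d" .
  have "\<bar>integral {n..m1} (\<lambda>m. (w C t m)\<^sup>2 - (w D t m)\<^sup>2)\<bar> \<le> (2 * d / \<delta>\<^sup>2 * (2 / \<delta>)) * (m1 - n)"
  proof (rule bnd[OF nm(1)])
    show "(\<lambda>m. (w C t m)\<^sup>2 - (w D t m)\<^sup>2) integrable_on {n..m1}" using ic by (intro integrable_diff)
    fix m assume m: "m \<in> {n..m1}"
    have "(w C t m)\<^sup>2 - (w D t m)\<^sup>2 = (w C t m - w D t m) * (w C t m + w D t m)"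
      by (simp add: power2_eq_square algebra_simps)
    also have "\<bar>\<dots>\<bar> \<le> 2 * d / \<delta>\<^sup>2 * (2 / \<delta>)"
      unfolding abs_mult
    proof (intro mult_mono)
      show "\<bar>w C t m - w D t m\<bar> \<le> 2 * d / \<delta>\<^sup>2" using w_diff[OF t _ d] m by (simp add: n_def)
      show "\<bar>w C t m + w D t m\<bar> \<le> 2 / \<delta>" using w_bounds[of C t m] w_bounds[of D t m] by simp
    qed (use d0 in auto)
    finally show "\<bar>(w C t m)\<^sup>2 - (w D t m)\<^sup>2\<bar> \<le> 2 * d / \<delta>\<^sup>2 * (2 / \<delta>)" .
  qed
  also have "\<dots> \<le> (2 * d / \<delta>\<^sup>2 * (2 / \<delta>)) * (SM * L)" using len d0 \<delta> by (intro mult_left_mono) auto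
  also have "\<dots> = 4 * SM * L / \<delta> ^ 3 * d" by (simp add: power2_eq_square power3_eq_cube)
  finally have 3: "\<bar>integral {n..m1} (\<lambda>m. (w C t m)\<^sup>2 - (w D t m)\<^sup>2)\<bar> \<le> 4 * SM * L / \<delta> ^ 3 * d" .
  have "I C t - I D t = integral {n..m1} (\<lambda>m. (w C t m)\<^sup>2 - (w D t m)\<^sup>2) - integral {m1..m2} (\<lambda>m. (w D t m)\<^sup>2)"
    unfolding I_def n_def[symmetric] m1_def[symmetric] m2_def[symmetric]
    using split(2) ic by (subst integral_diff) auto
  then show ?thesis using 2 3 unfolding Klip_I_def by (simp add: distrib_right) 
qed

lemma I_diff:
  assumes C: "continuous_on UNIV C" and D: "continuous_on UNIV D"
    and t: "0 \<le> t" and d: "\<forall>s\<in>{0..t}. \<bar>C s - D s\<bar> \<le> d"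
  shows "\<bar>I C t - I D t\<bar> \<le> Klip_I * d"
proof (cases "mL C t \<le> mL D t")
  case False
  have "\<bar>I D t - I C t\<bar> \<le> Klip_I * d"
    by (rule I_diff_aux[OF D C t]) (use d False in \<open>auto simp: abs_minus_commute\<close>)
  then show ?thesis by (simp add: abs_minus_commute)
qed (use I_diff_aux[OF C D t d] in simp)

text \<open>In the difference of the quotients \<open>(vL - vin) / I\<close> the numerator is at
  most \<open>VM\<close>, and each of the two denominators is at least
  \<open>L / SM\<close>.\<close>

definition "Klip = VM * (SM / L)\<^sup>2 * Klip_I"

lemma Klip_nonneg: "0 \<le> Klip"
  using VM SM L \<delta> by (simp add: Klip_def Klip_I_def)

lemma F_diff:
  assumes C: "continuous_on UNIV C" and D: "continuous_on UNIV D"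
    and t: "0 \<le> t" and d: "\<forall>s\<in>{0..t}. \<bar>C s - D s\<bar> \<le> d"
  shows "\<bar>F C t - F D t\<bar> \<le> Klip * d"
proof -
  have pos: "0 < I C t" "0 < I D t" by (rule I_pos[OF C], rule I_pos[OF D])
  have "F C t - F D t = (vL t - vin t) * ((I D t - I C t) / (I C t * I D t))"
    using pos by (simp add: F_def field_simps)
  then have "\<bar>F C t - F D t\<bar> = (vL t - vin t) * (\<bar>I C t - I D t\<bar> / (I C t * I D t))"
    using pos v_bounds(2)[of t] by (simp add: abs_mult abs_divide abs_minus_commute)
  also have "\<dots> \<le> VM * ((Klip_I * d) / (L / SM * (L / SM)))"
    using I_diff[OF assms] I_lower[OF C, of t] I_lower[OF D, of t] L SM v_bounds[of t] vm pos VM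
    by (intro mult_mono frac_le) (auto intro!: mult_mono)
  also have "\<dots> = Klip * d" using L SM by (simp add: Klip_def power2_eq_square field_simps)
  finally show ?thesis .
qed

text \<open>The weight exp (lam t) absorbs the Lipschitz constant: integrating Klip exp (lam s)
  gives at most (Klip / lam) exp (lam t), and Klip / lam is below 1/2.\<close>

definition "lam = 2 * Klip + 1"

lemma lam: "0 < lam" using Klip_nonneg by (simp add: lam_def)

text \<open>The map has memory but does not look ahead, so a bound with a growing exponential is
  reproduced with half the constant. The pointwise form serves existence and uniqueness
  alike.\<close>

lemma contraction:
  assumes C: "continuous_on UNIV C" and D: "continuous_on UNIV D"
    and t: "0 \<le> t" and M: "0 \<le> M" and d: "\<And>s. 0 \<le> s \<Longrightarrow> s \<le> t \<Longrightarrow> \<bar>C s - D s\<bar> \<le> M * exp (lam * s)"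
  shows "\<bar>prim (F C) t - prim (F D) t\<bar> \<le> M / 2 * exp (lam * t)"
proof -
  have "\<bar>F C r - F D r\<bar> \<le> Klip * (M * exp (lam * r))" if r: "0 \<le> r" "r \<le> t" for r
  proof (rule F_diff[OF C D r(1)])
    show "\<forall>s\<in>{0..r}. \<bar>C s - D s\<bar> \<le> M * exp (lam * r)"
    proof
    fix s assume "s \<in> {0..r}"
    then have s: "0 \<le> s" "s \<le> r" by auto
    have "\<bar>C s - D s\<bar> \<le> M * exp (lam * s)" using d s r by simp
    also have "\<dots> \<le> M * exp (lam * r)" using M lam s by (intro mult_left_mono) auto
    finally show "\<bar>C s - D s\<bar> \<le> M * exp (lam * r)" .
    qed
  qed
  moreover have "Klip * (M * exp (lam * r)) \<le> M / 2 * (lam * exp (lam * r))" for r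
  proof -
    have "Klip * (M * exp (lam * r)) * 2 \<le> lam * (M * exp (lam * r))"
      using M by (simp add: lam_def algebra_simps)
    then show ?thesis by (simp add: algebra_simps)
  qed
  ultimately have Fd: "\<bar>F C r - F D r\<bar> \<le> M / 2 * (lam * exp (lam * r))" if "0 \<le> r" "r \<le> t" for r
    using that order_trans by blast
  have Fd1: "F C r - F D r \<le> M / 2 * (lam * exp (lam * r))"
    and Fd2: "F D r - F C r \<le> M / 2 * (lam * exp (lam * r))" if "0 < r" "r < t" for r
    using abs_le_D1[OF Fd[of r]] abs_le_D2[OF Fd[of r]] that by auto
  define g where "g r = M / 2 * exp (lam * r)" for r
  have gd: "(g has_real_derivative M / 2 * (lam * exp (lam * r))) (at r)" for r
    unfolding g_def by (auto intro!: derivative_eq_intros)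
  have gc: "continuous_on {0..t} g" unfolding g_def by (intro continuous_intros)
  have pc: "continuous_on {0..t} (\<lambda>r. prim (F C) r - prim (F D) r)" "continuous_on {0..t} (\<lambda>r. prim (F D) r - prim (F C) r)"
    by (intro continuous_intros continuous_on_prim F_cont C D)+
  have pd: "((\<lambda>r. prim (F C) r - prim (F D) r) has_real_derivative F C r - F D r) (at r)"
    "((\<lambda>r. prim (F D) r - prim (F C) r) has_real_derivative F D r - F C r) (at r)" for r
    by (intro DERIV_diff prim_deriv F_cont C D)+
  have "(prim (F C) t - prim (F D) t) - (prim (F C) 0 - prim (F D) 0) \<le> g t - g 0"
    by (rule deriv_mono_le[OF t pc(1) gc pd(1) gd Fd1])
  moreover have "(prim (F D) t - prim (F C) t) - (prim (F D) 0 - prim (F C) 0) \<le> g t - g 0"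
    by (rule deriv_mono_le[OF t pc(2) gc pd(2) gd Fd2])
  moreover have "0 \<le> g 0" using M by (simp add: g_def)
  ultimately have "\<bar>prim (F C) t - prim (F D) t\<bar> \<le> g t" unfolding prim_0 by linarith
  then show ?thesis by (simp add: g_def)
qed

text \<open>At a maximum point of the weighted difference the contraction estimate bounds that
  maximum by half of itself.\<close>

lemma fixed_point_unique:
  assumes C: "continuous_on UNIV C" and D: "continuous_on UNIV D" and T: "0 \<le> T"
    and fC: "\<And>t. t \<in> {0..T} \<Longrightarrow> C t = prim (F C) t" and fD: "\<And>t. t \<in> {0..T} \<Longrightarrow> D t = prim (F D) t"
    and t: "t \<in> {0..T}"
  shows "C t = D t"
proof -
  define e where "e s = exp (- lam * s) * \<bar>C s - D s\<bar>" for s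
  have ec: "continuous_on {0..T} e" unfolding e_def
    by (intro continuous_intros continuous_on_subset[OF C] continuous_on_subset[OF D]) auto
  obtain t0 where t0: "t0 \<in> {0..T}" "\<And>s. s \<in> {0..T} \<Longrightarrow> e s \<le> e t0"
    using continuous_attains_sup[OF compact_Icc _ ec] T by auto
  have e0: "0 \<le> e t0" by (simp add: e_def)
  have ee: "\<bar>C s - D s\<bar> = e s * exp (lam * s)" for s
    by (simp add: e_def mult.commute mult.left_commute flip: exp_add)
  have "\<bar>prim (F C) t0 - prim (F D) t0\<bar> \<le> e t0 / 2 * exp (lam * t0)"
  proof (rule contraction[OF C D _ e0])
    show "0 \<le> t0" using t0 by simp
    fix s assume "0 \<le> s" "s \<le> t0"
    then show "\<bar>C s - D s\<bar> \<le> e t0 * exp (lam * s)" unfolding ee using t0 by (intro mult_right_mono) auto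
  qed
  then have "e t0 * exp (lam * t0) \<le> e t0 / 2 * exp (lam * t0)"
    using ee[of t0] fC[OF t0(1)] fD[OF t0(1)] by simp
  then have "e t0 * exp (lam * t0) \<le> 0" by simp
  then have "e t0 \<le> 0" by (simp add: mult_le_0_iff)
  then have "e t \<le> 0" using t0(2)[OF t] by linarith
  then have "e t * exp (lam * t) \<le> 0" by (intro mult_nonpos_nonneg) auto
  then show ?thesis using ee[of t] by simp
qed

text \<open>The Lipschitz estimate with distance 0: values of \<open>C\<close> outside [0, t] are
  invisible at time \<open>t\<close>.\<close>

lemma F_cong:
  assumes C: "continuous_on UNIV C" and D: "continuous_on UNIV D" and "0 \<le> t"
    and "\<And>s. 0 \<le> s \<Longrightarrow> s \<le> t \<Longrightarrow> C s = D s"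
  shows "F C t = F D t"
  using F_diff[OF C D assms(3), of 0] assms(4) by simp

text \<open>The unknown is \<open>E\<close> with C = exp (lam t) E, so that the weighted norm
  becomes the sup norm of bounded continuous functions, a complete space. Clamping the time makes
  everything bounded on the whole line.\<close>

lemma fixed_point_exists:
  assumes T: "0 < T"
  shows "\<exists>C. continuous_on UNIV C \<and> (\<forall>t\<in>{0..T}. C t = prim (F C) t)"
proof -
  define k where "k = clamp_real 0 T"
  have k: "k t \<in> {0..T}" for t unfolding k_def by (rule clamp_real_in) (use T in simp)
  have kid: "t \<in> {0..T} \<Longrightarrow> k t = t" for t unfolding k_def by (rule clamp_real_id)
  have kc: "continuous_on S k" for S unfolding k_def by (intro continuous_intros)
  define CE :: "(real \<Rightarrow>\<^sub>C real) \<Rightarrow> real \<Rightarrow> real" where "CE E t = exp (lam * k t) * apply_bcontfun E (k t)" for E t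
  have CEc: "continuous_on UNIV (CE E)" for E
  proof -
    have "continuous_on UNIV (apply_bcontfun E)" using apply_bcontfun[of E] by (simp add: bcontfun_def)
    then show ?thesis unfolding CE_def by (intro continuous_intros kc continuous_on_compose2[OF _ kc]) auto
  qed
  define G where "G E t = exp (- lam * k t) * prim (F (CE E)) (k t)" for E t
  have Gb: "G E \<in> bcontfun" for E
  proof -
    have c0: "continuous_on S (\<lambda>t. exp (- lam * t) * prim (F (CE E)) t)" for S
      by (intro continuous_intros continuous_on_prim F_cont CEc)
    obtain M where M: "\<And>t. t \<in> {0..T} \<Longrightarrow> \<bar>exp (- lam * t) * prim (F (CE E)) t\<bar> \<le> M"
      using cont_bounded_Icc[OF c0] by metis
    show ?thesis
    proof (rule bcontfun_normI)
      show "continuous_on UNIV (G E)" unfolding G_def by (rule continuous_on_compose2[OF c0 kc]) auto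
      show "norm (G E x) \<le> M" for x using M[OF k[of x]] by (simp add: G_def)
    qed
  qed
  define \<Psi> where "\<Psi> E = Bcontfun (G E)" for E
  have \<Psi>: "apply_bcontfun (\<Psi> E) = G E" for E unfolding \<Psi>_def by (rule Bcontfun_inverse[OF Gb])
  have "\<exists>!E. \<Psi> E = E"
  proof (rule banach_fix_type[where c="1/2"])
    show "\<forall>E E'. dist (\<Psi> E) (\<Psi> E') \<le> 1/2 * dist E E'"
    proof (intro allI)
      fix E E'
      show "dist (\<Psi> E) (\<Psi> E') \<le> 1/2 * dist E E'"
      proof (rule dist_bound)
        fix x
        define t where "t = k x"
        have t: "0 \<le> t" "t \<le> T" using k[of x] by (auto simp: t_def)
        have "\<bar>prim (F (CE E)) t - prim (F (CE E')) t\<bar> \<le> dist E E' / 2 * exp (lam * t)"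
        proof (rule contraction[OF CEc CEc t(1)])
          fix s assume s: "0 \<le> s" "s \<le> t"
          have "\<bar>CE E s - CE E' s\<bar> = exp (lam * k s) * \<bar>apply_bcontfun E (k s) - apply_bcontfun E' (k s)\<bar>"
            by (simp add: CE_def abs_mult flip: right_diff_distrib)
          also have "\<dots> \<le> exp (lam * k s) * dist E E'"
            using dist_bounded[of E "k s" E'] by (intro mult_left_mono) (auto simp: dist_real_def)
          finally show "\<bar>CE E s - CE E' s\<bar> \<le> dist E E' * exp (lam * s)"
            using kid[of s] s t by (simp add: mult.commute)
        qed simp
        then have "exp (- lam * t) * \<bar>prim (F (CE E)) t - prim (F (CE E')) t\<bar> \<le> exp (- lam * t) * (dist E E' / 2 * exp (lam * t))"
          by (intro mult_left_mono) auto
        also have "\<dots> = 1/2 * dist E E'" by (simp add: mult.commute mult.left_commute flip: exp_add)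
        finally show "dist (apply_bcontfun (\<Psi> E) x) (apply_bcontfun (\<Psi> E') x) \<le> 1/2 * dist E E'"
          unfolding \<Psi> G_def t_def[symmetric] dist_real_def right_diff_distrib[symmetric] abs_mult by simp
      qed
    qed
  qed auto
  then obtain E where E: "\<Psi> E = E" by blast
  have "CE E t = prim (F (CE E)) t" if t: "t \<in> {0..T}" for t
  proof -
    have "apply_bcontfun E t = exp (- lam * t) * prim (F (CE E)) t"
      using \<Psi>[of E] E kid[OF t] by (simp add: G_def)
    then show ?thesis using kid[OF t] by (simp add: CE_def flip: exp_add mult.assoc)
  qed
  then show ?thesis using CEc by blast
qed

text \<open>Replaces the fixed point by the primitive of a nonnegative density on the whole line.
  The boundedness of that primitive later keeps the area of every label, inside or outside the
  fibre, below one constant.\<close>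

lemma fixed_point_density:
  assumes T: "0 < T"
  obtains c where "continuous_on UNIV c" "\<And>t. 0 \<le> c t" "\<And>t. c t \<le> VM * SM / L"
    "\<And>t. t \<in> {0..T} \<Longrightarrow> c t = F (prim c) t" "\<exists>M. \<forall>t. \<bar>prim c t\<bar> \<le> M"
proof -
  obtain C where C: "continuous_on UNIV C" "\<And>t. t \<in> {0..T} \<Longrightarrow> C t = prim (F C) t"
    using fixed_point_exists[OF T] by blast
  \<comment> \<open>A plateau equal to 1 on [0, T] and to 0 at distance at least 1 from it, which
    gives the density compact support.\<close>
  define h where "h t = max 0 (1 - \<bar>t - clamp_real 0 T t\<bar>)" for t
  have h: "0 \<le> h t" "h t \<le> 1" for t by (auto simp: h_def)
  have h1: "h t = 1" if "t \<in> {0..T}" for t using that by (simp add: h_def clamp_real_id)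
  have h0: "h t = 0" if "t \<notin> {-1..T+1}" for t using that T by (auto simp: h_def clamp_real_def)
  define c where "c t = F C (clamp_real 0 T t) * h t" for t
  have cc: "continuous_on UNIV c" unfolding c_def h_def
    by (intro continuous_intros continuous_on_compose2[OF F_cont[OF C(1)]]) auto
  have c0: "0 \<le> c t" for t using F_nonneg[OF C(1)] h by (simp add: c_def)
  have cb: "c t \<le> VM * SM / L" for t
  proof -
    have "c t \<le> F C (clamp_real 0 T t)"
      unfolding c_def using F_nonneg[OF C(1)] h by (intro mult_left_le) auto
    then show ?thesis using F_upper[OF C(1)] order_trans by blast
  qed
  have pc: "prim c t = C t" if t: "t \<in> {0..T}" for t
  proof -
    have "prim c t = integral {0..t} c" using prim_diff[OF cc, of 0 t] t by simp
    also have "\<dots> = integral {0..t} (F C)"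
      by (rule integral_cong) (use t in \<open>auto simp: c_def h1 clamp_real_id\<close>)
    also have "\<dots> = C t" using prim_diff[OF F_cont[OF C(1)], of 0 t] t C(2) by simp
    finally show ?thesis .
  qed
  have fp: "c t = F (prim c) t" if t: "t \<in> {0..T}" for t
  proof -
    have "c t = F C t" using t by (simp add: c_def h1 clamp_real_id)
    also have "\<dots> = F (prim c) t"
      by (rule F_cong[OF C(1) continuous_on_prim[OF cc]]) (use t pc in auto)
    finally show ?thesis .
  qed
  have "\<bar>prim c t\<bar> \<le> \<bar>prim c (-1)\<bar> + \<bar>prim c (T + 1)\<bar>" for t
  proof -
    have mono: "x \<le> y \<Longrightarrow> prim c x \<le> prim c y" for x y using prim_lower[OF cc c0] by force
    have z: "integral {x..y} c = 0" if "\<forall>z\<in>{x<..<y}. c z = 0" for x y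
    proof -
      have "integral {x..y} c = integral {x<..<y} c" by (rule integral_open_interval_real)
      also have "\<dots> = integral {x<..<y} (\<lambda>_. 0)" using that by (intro integral_cong) auto
      finally show ?thesis by simp
    qed
    consider "t < -1" | "t \<in> {-1..T+1}" | "t > T + 1" by force
    then show ?thesis
    proof cases
      case 1
      then have "integral {t..-1} c = 0" by (intro z) (auto simp: c_def h0)
      then show ?thesis using prim_diff[OF cc, of t "-1"] 1 by simp
    next
      case 2 then show ?thesis using mono[of "-1" t] mono[of t "T + 1"] by simp
    next
      case 3
      then have "integral {T + 1..t} c = 0" by (intro z) (auto simp: c_def h0)
      then show ?thesis using prim_diff[OF cc, of "T + 1" t] 3 by simp
    qed
  qed
  then show thesis using that[OF cc c0 cb fp] by blast
qed

end

text \<open>The logarithm of \<open>f\<close> is Lipschitz as a function of the space coordinate \<open>\<integral> dm / f\<close>.\<close>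

lemma lipschitz_ratio_bound:
  fixes f :: "real \<Rightarrow> real"
  assumes m: "m1 \<le> m2" and f: "continuous_on {m1..m2} f" "\<And>m. m \<in> {m1..m2} \<Longrightarrow> 0 < f m" and B: "0 < B"
    and lip: "\<And>m m'. m \<in> {m1..m2} \<Longrightarrow> m' \<in> {m1..m2} \<Longrightarrow> \<bar>f m - f m'\<bar> \<le> B * \<bar>m - m'\<bar>"
    and int: "integral {m1..m2} (\<lambda>m. 1 / f m) \<le> l"
  shows "f m2 \<le> f m1 * exp (B * l)" and "f m1 \<le> f m2 * exp (B * l)"
proof -
  have pos: "0 < f m1" "0 < f m2" using f(2) m by auto
  have fi: "(\<lambda>m. 1 / f m) integrable_on {m1..m2}"
    using f by (intro integrable_continuous_real continuous_intros) (auto simp: less_imp_neq[THEN not_sym])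
  \<comment> \<open>Comparison with the steepest admissible line through the left end point: the
    reciprocal of a line integrates to a logarithm, while the integral of 1 / f is at most
    \<open>l\<close>.\<close>
  have "(\<lambda>m. 1 / (f m1 + B * (m - m1))) integrable_on {m1..m2}" and
    i1: "((\<lambda>m. 1 / (f m1 + B * (m - m1))) has_integral (ln (f m1 + B * (m2 - m1)) / B - ln (f m1 + B * (m1 - m1)) / B)) {m1..m2}"
  proof -
    show *: "((\<lambda>m. 1 / (f m1 + B * (m - m1))) has_integral (ln (f m1 + B * (m2 - m1)) / B - ln (f m1 + B * (m1 - m1)) / B)) {m1..m2}"
    proof (rule fundamental_theorem_of_calculus[OF m])
      fix x assume x: "x \<in> {m1..m2}"
      then have "0 < f m1 + B * (x - m1)" using pos B by (intro add_pos_nonneg) auto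
      then have "((\<lambda>x. ln (f m1 + B * (x - m1)) / B) has_real_derivative 1 / (f m1 + B * (x - m1))) (at x)"
        using B by (auto intro!: derivative_eq_intros)
      then show "((\<lambda>x. ln (f m1 + B * (x - m1)) / B) has_vector_derivative 1 / (f m1 + B * (x - m1))) (at x within {m1..m2})"
        by (simp add: has_real_derivative_iff_has_vector_derivative has_vector_derivative_at_within)
    qed
    then show "(\<lambda>m. 1 / (f m1 + B * (m - m1))) integrable_on {m1..m2}" by blast
  qed
  moreover have "integral {m1..m2} (\<lambda>m. 1 / (f m1 + B * (m - m1))) \<le> integral {m1..m2} (\<lambda>m. 1 / f m)"
  proof (rule integral_le)
    fix x assume x: "x \<in> {m1..m2}"
    have "f x \<le> f m1 + B * (x - m1)" using lip[of x m1] x by auto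
    then show "1 / (f m1 + B * (x - m1)) \<le> 1 / f x" using f(2)[OF x] by (intro divide_left_mono mult_pos_pos) auto
  qed (use calculation fi in auto)
  ultimately have "ln (f m1 + B * (m2 - m1)) / B - ln (f m1) / B \<le> l"
    using int by (simp add: integral_unique)
  then have "ln (f m1 + B * (m2 - m1)) \<le> ln (f m1) + B * l" using B by (simp add: field_simps)
  moreover have "f m2 \<le> f m1 + B * (m2 - m1)" using lip[of m2 m1] m by auto
  moreover have "0 < f m1 + B * (m2 - m1)" using pos B m by (intro add_pos_nonneg) auto
  ultimately have "f m2 \<le> exp (ln (f m1) + B * l)"
    by (metis exp_le_cancel_iff exp_ln order_trans)
  then show "f m2 \<le> f m1 * exp (B * l)" using pos by (simp add: exp_add)
  \<comment> \<open>The same comparison from the right end point.\<close>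
  have "(\<lambda>m. 1 / (f m2 + B * (m2 - m))) integrable_on {m1..m2}" and
    i2: "((\<lambda>m. 1 / (f m2 + B * (m2 - m))) has_integral (- ln (f m2 + B * (m2 - m2)) / B - - ln (f m2 + B * (m2 - m1)) / B)) {m1..m2}"
  proof -
    show *: "((\<lambda>m. 1 / (f m2 + B * (m2 - m))) has_integral (- ln (f m2 + B * (m2 - m2)) / B - - ln (f m2 + B * (m2 - m1)) / B)) {m1..m2}"
    proof (rule fundamental_theorem_of_calculus[OF m])
      fix x assume x: "x \<in> {m1..m2}"
      then have "0 < f m2 + B * (m2 - x)" using pos B by (intro add_pos_nonneg) auto
      then have "((\<lambda>x. - ln (f m2 + B * (m2 - x)) / B) has_real_derivative 1 / (f m2 + B * (m2 - x))) (at x)"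
        using B by (auto intro!: derivative_eq_intros)
      then show "((\<lambda>x. - ln (f m2 + B * (m2 - x)) / B) has_vector_derivative 1 / (f m2 + B * (m2 - x))) (at x within {m1..m2})"
        by (simp add: has_real_derivative_iff_has_vector_derivative has_vector_derivative_at_within)
    qed
    then show "(\<lambda>m. 1 / (f m2 + B * (m2 - m))) integrable_on {m1..m2}" by blast
  qed
  moreover have "integral {m1..m2} (\<lambda>m. 1 / (f m2 + B * (m2 - m))) \<le> integral {m1..m2} (\<lambda>m. 1 / f m)"
  proof (rule integral_le)
    fix x assume x: "x \<in> {m1..m2}"
    have "f x \<le> f m2 + B * (m2 - x)" using lip[of x m2] x by (auto simp: abs_if split: if_splits)
    then show "1 / (f m2 + B * (m2 - x)) \<le> 1 / f x" using f(2)[OF x] by (intro divide_left_mono mult_pos_pos) auto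
  qed (use calculation fi in auto)
  ultimately have "ln (f m2 + B * (m2 - m1)) / B - ln (f m2) / B \<le> l"
    using int by (simp add: integral_unique)
  then have "ln (f m2 + B * (m2 - m1)) \<le> ln (f m2) + B * l" using B by (simp add: field_simps)
  moreover have "f m1 \<le> f m2 + B * (m2 - m1)" using lip[of m1 m2] m by auto
  moreover have "0 < f m2 + B * (m2 - m1)" using pos B m by (intro add_pos_nonneg) auto
  ultimately have "f m1 \<le> exp (ln (f m2) + B * l)"
    by (metis exp_le_cancel_iff exp_ln order_trans)
  then show "f m1 \<le> f m2 * exp (B * l)" using pos by (simp add: exp_add)
qed

section \<open>Constants of the bound on the area\<close>

context fibre
begin

definition "cbar = VM * SM / L"
text \<open>The Lipschitz constant of the area in the label: \<open>1 / Sm\<close> and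
  \<open>1 / (vm * Sm)\<close> are those of \<xi> and \<tau>, \<Lambda> is that of the data and
  \<open>cbar\<close> that of \<open>C\<close>.\<close>

definition "slope_bound \<Lambda> = \<Lambda> / Sm + (\<Lambda> + cbar) / (vm * Sm)"
text \<open>All areas of one fibre agree up to the factor exp (slope_bound L), so
  \<open>c = (vL - vin) / I\<close> is at most this constant times any one of them.\<close>

definition "rate_bound \<Lambda> = VM * exp (slope_bound \<Lambda> * L) / L"
text \<open>Exponential decay from the least initial value \<open>Sm\<close>. The time
  \<open>T + 1\<close> instead of \<open>T\<close> leaves the room for a strict inequality.\<close>

definition "floor_bound \<Lambda> T = Sm * exp (- rate_bound \<Lambda> * (T + 1))"

lemma cbar_pos: "0 < cbar" using VM SM L by (simp add: cbar_def)
lemma rate_bound_pos: "0 < rate_bound \<Lambda>" using VM L by (simp add: rate_bound_def)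

lemma floor_bound: "0 \<le> T \<Longrightarrow> 0 < floor_bound \<Lambda> T" "0 \<le> T \<Longrightarrow> floor_bound \<Lambda> T \<le> Sm"
  using Sm rate_bound_pos[of \<Lambda>] by (auto simp: floor_bound_def intro!: mult_left_le)

end

text \<open>The rate \<open>c\<close> is at most a fixed multiple of the area of every particle in the fibre, so no
  area decays faster than exponentially; the multiple does not depend on the truncation level.\<close>

lemma (in fibre_trunc) no_truncation:
  assumes T: "0 < T" and \<Lambda>: "0 \<le> \<Lambda>"
    and S0_lip: "\<And>s t. \<bar>S0 s - S0 t\<bar> \<le> \<Lambda> * \<bar>s - t\<bar>" and S1_lip: "\<And>s t. \<bar>S1 s - S1 t\<bar> \<le> \<Lambda> * \<bar>s - t\<bar>"
    and \<delta>_eq: "\<delta> = floor_bound \<Lambda> T"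
    and c: "continuous_on UNIV c" "\<And>t. 0 \<le> c t" "\<And>t. c t \<le> VM * SM / L" "\<And>t. t \<in> {0..T} \<Longrightarrow> c t = F (prim c) t"
    and t: "t \<in> {0..T}" and m: "- N t \<le> m" "m \<le> mL (prim c) t"
  shows "\<delta> \<le> b m - (prim c t - prim c (\<tau> m))"
proof -
  define C where "C = prim c"
  have Cc: "continuous_on UNIV C" unfolding C_def by (rule continuous_on_prim[OF c(1)])
  have Cd: "(C has_real_derivative c s) (at s)" for s unfolding C_def by (rule prim_deriv[OF c(1)])
  have C_mono: "s \<le> s' \<Longrightarrow> C s \<le> C s'" for s s' using prim_lower[OF c(1,2), of s s'] by (simp add: C_def)
  have C_lip: "\<bar>C s - C s'\<bar> \<le> cbar * \<bar>s - s'\<bar>" for s s'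
    using prim_upper[OF c(1,3), of s s'] prim_upper[OF c(1,3), of s' s] C_mono[of s s'] C_mono[of s' s]
    by (cases "s \<le> s'") (auto simp: C_def cbar_def abs_if)
  define B where "B = slope_bound \<Lambda>"
  have B: "0 < B" unfolding B_def slope_bound_def using \<Lambda> Sm vmSm cbar_pos by (intro add_nonneg_pos divide_pos_pos divide_nonneg_pos) auto
  have b_lip: "\<bar>b x - b y\<bar> \<le> \<Lambda> / Sm * \<bar>x - y\<bar> + \<Lambda> / (vm * Sm) * \<bar>x - y\<bar>" for x y
  proof -
    have "\<bar>S1 (\<xi> x) - S1 (\<xi> y)\<bar> \<le> \<Lambda> * (\<bar>x - y\<bar> / Sm)"
      by (rule order_trans[OF S1_lip]) (intro mult_left_mono \<xi>_lipschitz \<Lambda>)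
    moreover have "\<bar>S0 (\<tau> x) - S0 (\<tau> y)\<bar> \<le> \<Lambda> * (\<bar>x - y\<bar> / (vm * Sm))"
      by (rule order_trans[OF S0_lip]) (intro mult_left_mono \<tau>_lipschitz \<Lambda>)
    ultimately show ?thesis unfolding b_def by (simp add: abs_if split: if_splits)
  qed
  have \<alpha>_lip: "\<bar>\<alpha> C s x - \<alpha> C s y\<bar> \<le> B * \<bar>x - y\<bar>" for s x y
  proof -
    have "\<bar>C (\<tau> x) - C (\<tau> y)\<bar> \<le> cbar * (\<bar>x - y\<bar> / (vm * Sm))"
      by (rule order_trans[OF C_lip]) (intro mult_left_mono \<tau>_lipschitz less_imp_le[OF cbar_pos])
    moreover have "\<bar>\<alpha> C s x - \<alpha> C s y\<bar> \<le> \<bar>b x - b y\<bar> + \<bar>C (\<tau> x) - C (\<tau> y)\<bar>"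
      unfolding \<alpha>_def by linarith
    ultimately have "\<bar>\<alpha> C s x - \<alpha> C s y\<bar> \<le> \<Lambda> / Sm * \<bar>x - y\<bar> + \<Lambda> / (vm * Sm) * \<bar>x - y\<bar> + cbar * (\<bar>x - y\<bar> / (vm * Sm))"
      using b_lip[of x y] by linarith
    also have "\<dots> = B * \<bar>x - y\<bar>" by (simp add: B_def slope_bound_def algebra_simps add_divide_distrib)
    finally show ?thesis .
  qed
  \<comment> \<open>By the ratio bound the reciprocal areas of the whole fibre exceed a multiple of
    \<open>1 / \<alpha> C s x\<close>, so \<open>I C s\<close> is large when the area at
    \<open>x\<close> is small, and the rate is small.\<close>
  have rate: "c s \<le> rate_bound \<Lambda> * \<alpha> C s x" if s: "s \<in> {0..T}" and x: "- N s \<le> x" "x \<le> mL C s" for s x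
  proof -
    have ac: "continuous_on S (\<alpha> C s)" for S
      by (rule continuous_on_compose2[OF \<alpha>_joint_cont[OF Cc], of S "\<lambda>x. (s, x)", simplified]) (auto intro!: continuous_intros)
    have wint: "integral {x1..x2} (\<lambda>m. 1 / \<alpha> C s m) \<le> L" if "- N s \<le> x1" "x1 \<le> x2" "x2 \<le> mL C s" for x1 x2
    proof -
      have "integral {x1..x2} (w C s) = X C s x2 - X C s x1"
        unfolding X_def using prim_diff[OF w_cont[OF Cc] that(2)] by simp
      also have "\<dots> \<le> L - 0"
        using X_le_iff[OF Cc, of s x2 "mL C s"] X_le_iff[OF Cc, of s "- N s" x1] that
        by (intro diff_mono) (auto simp: X_mL[OF Cc] X_inlet[OF Cc])
      finally show ?thesis by (simp add: w_def[abs_def])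
    qed
    have ratio: "\<alpha> C s y \<le> \<alpha> C s x * exp (B * L)" if y: "- N s \<le> y" "y \<le> mL C s" for y
    proof (cases "x \<le> y")
      case True
      show ?thesis
        by (rule lipschitz_ratio_bound(1)[OF True ac _ B]) (use \<alpha>_bounds \<alpha>_lip wint x y True in auto)
    next
      case False
      then have "y \<le> x" by simp
      show ?thesis
        by (rule lipschitz_ratio_bound(2)[OF \<open>y \<le> x\<close> ac _ B]) (use \<alpha>_bounds \<alpha>_lip wint x y \<open>y \<le> x\<close> in auto)
    qed
    have apos: "0 < \<alpha> C s x" by (rule \<alpha>_bounds)
    have "1 / (\<alpha> C s x * exp (B * L)) * L \<le> I C s"
    proof (rule I_ge[OF Cc])
      fix y assume "- N s \<le> y" "y \<le> mL C s"
      from ratio[OF this] show "1 / (\<alpha> C s x * exp (B * L)) \<le> w C s y"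
        unfolding w_def using \<alpha>_bounds(3)[of C s y] apos by (intro divide_left_mono mult_pos_pos) auto
    qed
    then have "c s \<le> VM / (1 / (\<alpha> C s x * exp (B * L)) * L)"
      unfolding c(4)[OF s, folded C_def] F_def using v_bounds[of s] vm apos L by (intro frac_le) auto
    also have "\<dots> = rate_bound \<Lambda> * \<alpha> C s x" using apos L by (simp add: rate_bound_def B_def)
    finally show ?thesis .
  qed
  define kk where "kk = rate_bound \<Lambda>"
  have kk: "0 < kk" unfolding kk_def by (rule rate_bound_pos)
  define y where "y s = b m - (C s - C (\<tau> m))" for s
  have \<tau>t: "\<tau> m \<le> t" using \<tau>_le_iff[of t m] t m by simp
  \<comment> \<open>A particle in the fibre at time \<open>t\<close> has been there since its
    entrance: \<open>C\<close> is nondecreasing, so areas shrink and reciprocals grow, and the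
    labels that entered after \<open>s\<close> add nonnegative length. Hence its position at
    \<open>s\<close> does not exceed the one at \<open>t\<close>.\<close>
  have inside: "- N s \<le> m" "m \<le> mL C s" if s: "\<tau> m \<le> s" "s \<le> t" for s
  proof -
    have s0: "0 \<le> s" using s \<tau>_nonneg[of m] by linarith
    show ns: "- N s \<le> m" using \<tau>_le_iff[OF s0] s by simp
    have Nst: "- N t \<le> - N s" using s by simp
    have "X C s m = integral {- N s..m} (w C s)" by (rule X_integral[OF Cc ns])
    also have "\<dots> \<le> integral {- N s..m} (w C t)"
    proof (rule integral_le)
      fix x assume "x \<in> {- N s..m}"
      have "\<alpha> C t x \<le> \<alpha> C s x" unfolding \<alpha>_def using C_mono[OF s(2)] by auto
      then show "w C s x \<le> w C t x" unfolding w_def using \<alpha>_bounds(3) by (intro divide_left_mono mult_pos_pos) auto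
    qed (auto intro!: integrable_continuous_real w_cont Cc)
    also have "\<dots> = X C t m - X C t (- N s)"
      unfolding X_def using prim_diff[OF w_cont[OF Cc] ns] by simp
    also have "\<dots> \<le> L - 0"
      using X_le_iff[OF Cc, of t m "mL C t"] X_le_iff[OF Cc, of t "- N t" "- N s"] m(2)[folded C_def] Nst
      by (intro diff_mono) (auto simp: X_mL[OF Cc] X_inlet[OF Cc])
    finally show "m \<le> mL C s" using X_le_iff[OF Cc, of s m "mL C s"] by (simp add: X_mL[OF Cc])
  qed
  show ?thesis
  proof (rule ccontr)
    assume "\<not> ?thesis"
    then have lt: "y t < \<delta>" by (simp add: y_def C_def)
    have yc: "continuous_on S y" for S unfolding y_def by (intro continuous_intros continuous_on_subset[OF Cc]) auto
    have y\<tau>: "Sm \<le> y (\<tau> m)" using b_bounds by (simp add: y_def)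
    \<comment> \<open>Since \<open>y\<close> is nonincreasing, it stays at or above \<delta> until
      \<open>s1\<close>, and up to that time the truncated area is \<open>y\<close> itself.\<close>
    have "\<exists>s\<ge>\<tau> m. s \<le> t \<and> y s = \<delta>"
      by (rule IVT2'[OF _ _ \<tau>t yc]) (use lt y\<tau> \<delta> in auto)
    then obtain s1 where s1: "\<tau> m \<le> s1" "s1 \<le> t" "y s1 = \<delta>" by blast
    have y_ge: "\<delta> \<le> y s" if "\<tau> m \<le> s" "s \<le> s1" for s
      using C_mono[OF that(2)] s1(3) by (simp add: y_def)
    \<comment> \<open>Gronwall: because c <= kk y, the product \<open>y s * exp (kk * s)\<close> is
      nondecreasing from the entrance to \<open>s1\<close>.\<close>
    have "- y s1 * exp (kk * s1) - - y (\<tau> m) * exp (kk * \<tau> m) \<le> 0 - 0"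
    proof (rule deriv_mono_le[OF s1(1)])
      fix s assume s: "\<tau> m < s" "s < s1"
      show "((\<lambda>s. - y s * exp (kk * s)) has_real_derivative (c s - kk * y s) * exp (kk * s)) (at s)"
        unfolding y_def by (auto intro!: derivative_eq_intros Cd simp: algebra_simps)
      show "((\<lambda>s. 0::real) has_real_derivative 0) (at s)" by simp
      have "\<alpha> C s m = y s"
        unfolding \<alpha>_def using y_ge[of s] C_mono[of "\<tau> m" s] s by (simp add: y_def)
      moreover have "c s \<le> kk * \<alpha> C s m"
        unfolding kk_def using inside[of s] s s1 t \<tau>_nonneg[of m] by (intro rate) auto
      ultimately show "(c s - kk * y s) * exp (kk * s) \<le> 0" by (simp add: mult_nonpos_nonneg)
    qed (intro continuous_intros yc)+
    then have "y (\<tau> m) * exp (kk * \<tau> m) \<le> \<delta> * exp (kk * s1)" using s1 by simp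
    moreover have "Sm * 1 \<le> y (\<tau> m) * exp (kk * \<tau> m)"
      using y\<tau> kk \<tau>_nonneg[of m] Sm by (intro mult_mono) auto
    \<comment> \<open>The additional unit of time in \<open>floor_bound\<close> is the factor
      \<open>exp (- kk)\<close>, which makes the contradiction strict.\<close>
    moreover have "\<delta> * exp (kk * s1) \<le> Sm * exp (- kk)"
    proof -
      have "\<delta> * exp (kk * s1) = Sm * exp (- kk * (T + 1) + kk * s1)"
        unfolding exp_add by (simp add: \<delta>_eq floor_bound_def kk_def)
      also have "\<dots> \<le> Sm * exp (- kk)"
      proof -
        have "kk * s1 \<le> kk * T" using s1 t kk by (intro mult_left_mono) auto
        then have "- kk * (T + 1) + kk * s1 \<le> - kk" by (simp add: algebra_simps)
        then show ?thesis using Sm by (intro mult_left_mono) auto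
      qed
      finally show ?thesis .
    qed
    moreover have "Sm * exp (- kk) < Sm * 1" using Sm kk by (intro mult_strict_left_mono) auto
    ultimately show False by linarith
  qed
qed

section \<open>The solution of the fixed point problem in Eulerian coordinates\<close>

lemma continuous_on_compose_pair:
  fixes f :: "real \<Rightarrow> real \<Rightarrow> real"
  assumes "continuous_on UNIV (\<lambda>q. f (fst q) (snd q))" "continuous_on S y" "continuous_on S z"
  shows "continuous_on S (\<lambda>s. f (y s) (z s))"
  by (rule continuous_on_compose2[OF assms(1), of S "\<lambda>s. (y s, z s)", simplified]) (intro continuous_intros assms)

lemma prim_param_deriv:
  fixes f fy :: "real \<Rightarrow> real \<Rightarrow> real"
  assumes d: "\<And>y m. ((\<lambda>y. f y m) has_real_derivative fy y m) (at y)"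
    and f: "\<And>y. continuous_on UNIV (f y)" and fy: "continuous_on UNIV (\<lambda>q. fy (fst q) (snd q))"
  shows "((\<lambda>y. prim (f y) m) has_real_derivative prim (fy y) m) (at y)"
proof -
  have "((\<lambda>y. integral (cbox a b) (f y)) has_real_derivative integral (cbox a b) (fy y)) (at y within UNIV)" for a b
    by (rule leibniz_rule_field_derivative)
      (use d f fy in \<open>auto intro!: integrable_continuous_real continuous_on_subset[OF fy] continuous_on_subset[OF f] simp: split_beta\<close>)
  from DERIV_diff[OF this[of 0 m] this[of m 0]] show ?thesis
    unfolding prim_def by simp
qed

text \<open>The divided difference in the second variable written as an integral of the derivative
  (Hadamard's lemma); in this form it is jointly continuous and needs no separate value on the
  diagonal.\<close>

definition mean_slope :: "(real \<Rightarrow> real \<Rightarrow> real) \<Rightarrow> real \<Rightarrow> real \<Rightarrow> real \<Rightarrow> real" where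
  "mean_slope fm m0 y m = integral {0..1} (\<lambda>s. fm y (m0 + s * (m - m0)))"

lemma mean_slope:
  fixes f fm :: "real \<Rightarrow> real \<Rightarrow> real"
  assumes d: "\<And>y m. (f y has_real_derivative fm y m) (at m)"
    and fm: "continuous_on UNIV (\<lambda>q. fm (fst q) (snd q))"
  shows "f y m - f y m0 = (m - m0) * mean_slope fm m0 y m"
    and "continuous_on UNIV (\<lambda>q. mean_slope fm m0 (fst q) (snd q))"
    and "mean_slope fm m0 y m0 = fm y m0"
proof -
  have c: "continuous_on S (\<lambda>s. fm y (m0 + s * (m - m0)))" for S
    by (rule continuous_on_compose2[OF fm, of S "\<lambda>s. (y, m0 + s * (m - m0))", simplified]) (auto intro!: continuous_intros)
  have "((\<lambda>s. f y (m0 + s * (m - m0))) has_real_derivative fm y (m0 + s * (m - m0)) * (m - m0)) (at s)" for s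
    by (rule DERIV_chain2[OF d]) (auto intro!: derivative_eq_intros)
  then have "((\<lambda>s. f y (m0 + s * (m - m0))) has_vector_derivative (m - m0) * fm y (m0 + s * (m - m0))) (at s within {0..1})" for s
    by (simp add: has_real_derivative_iff_has_vector_derivative has_vector_derivative_at_within mult.commute)
  then have "((\<lambda>s. (m - m0) * fm y (m0 + s * (m - m0))) has_integral (f y (m0 + 1 * (m - m0)) - f y (m0 + 0 * (m - m0)))) {0..1}"
    by (intro fundamental_theorem_of_calculus) auto
  from integral_unique[OF this] show "f y m - f y m0 = (m - m0) * mean_slope fm m0 y m"
    unfolding mean_slope_def by (simp add: integral_mult_right)
  have "continuous_on UNIV (\<lambda>q::real \<times> real. integral (cbox 0 1) (\<lambda>s. fm (fst q) (m0 + s * (snd q - m0))))"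
  proof (rule integral_continuous_on_param)
    show "continuous_on (UNIV \<times> cbox 0 1) (\<lambda>(q, s). fm (fst q) (m0 + s * (snd q - m0)))"
      unfolding split_beta
      by (intro continuous_on_compose2[OF fm, of _ "\<lambda>p. (fst (fst p), m0 + snd p * (snd (fst p) - m0))", simplified]
          continuous_intros)
  qed
  then show "continuous_on UNIV (\<lambda>q. mean_slope fm m0 (fst q) (snd q))"
    by (simp add: mean_slope_def)
  show "mean_slope fm m0 y m0 = fm y m0" by (simp add: mean_slope_def)
qed

lemma isCont_compose_pair:
  fixes g :: "real \<Rightarrow> real \<Rightarrow> real"
  assumes "continuous_on UNIV (\<lambda>q. g (fst q) (snd q))" "isCont y t" "isCont z t"
  shows "isCont (\<lambda>t. g (y t) (z t)) t"
proof -
  have "isCont (\<lambda>q. g (fst q) (snd q)) (y t, z t)"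
    using assms(1) by (simp add: continuous_on_eq_continuous_at)
  moreover have "isCont (\<lambda>t. (y t, z t)) t" by (rule continuous_Pair[OF assms(2,3)])
  ultimately show ?thesis
    using isCont_o2[where f="\<lambda>t. (y t, z t)" and g="\<lambda>q. g (fst q) (snd q)" and a=t] by simp
qed

text \<open>The increment splits into one along \<open>y\<close> at the fixed second argument
  \<open>z t\<close>, where the ordinary chain rule applies, and one along \<open>z\<close>, which
  is the mean slope times the increment of \<open>z\<close>. Caratheodory's criterion differentiates
  the latter.\<close>

lemma total_deriv:
  fixes f fm :: "real \<Rightarrow> real \<Rightarrow> real"
  assumes d: "\<And>y m. (f y has_real_derivative fm y m) (at m)"
    and fm: "continuous_on UNIV (\<lambda>q. fm (fst q) (snd q))"
    and fy: "((\<lambda>y. f y (z t)) has_real_derivative fy) (at (y t))"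
    and y: "(y has_real_derivative y') (at t)" and z: "(z has_real_derivative z') (at t)"
  shows "((\<lambda>t. f (y t) (z t)) has_real_derivative fy * y' + fm (y t) (z t) * z') (at t)"
proof -
  let ?\<psi> = "\<lambda>s. mean_slope fm (z t) (y s) (z s)"
  obtain \<zeta> where \<zeta>: "\<And>s. z s - z t = \<zeta> s * (s - t)" "isCont \<zeta> t" "\<zeta> t = z'"
    using z unfolding CARAT_DERIV by blast
  have \<psi>: "isCont ?\<psi> t"
    using isCont_compose_pair[OF mean_slope(2)[OF d fm, of "z t"] DERIV_isCont[OF y] DERIV_isCont[OF z]] .
  have "((\<lambda>s. (z s - z t) * ?\<psi> s) has_real_derivative fm (y t) (z t) * z') (at t)"
    unfolding CARAT_DERIV
  proof (intro exI[of _ "\<lambda>s. \<zeta> s * ?\<psi> s"] conjI allI)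
    show "isCont (\<lambda>s. \<zeta> s * ?\<psi> s) t" by (intro continuous_mult \<zeta> \<psi>)
    show "\<zeta> t * ?\<psi> t = fm (y t) (z t) * z'" using mean_slope(3)[OF d fm] \<zeta>(3) by simp
  qed (simp add: \<zeta>(1))
  moreover have "((\<lambda>s. f (y s) (z t)) has_real_derivative fy * y') (at t)"
    by (rule DERIV_chain2[OF fy y])
  ultimately have "((\<lambda>s. f (y s) (z t) + (z s - z t) * ?\<psi> s) has_real_derivative fy * y' + fm (y t) (z t) * z') (at t)"
    by (intro DERIV_add)
  moreover have "f (y s) (z t) + (z s - z t) * ?\<psi> s = f (y s) (z s)" for s
    using mean_slope(1)[OF d fm, of "y s" "z s" "z t"] by simp
  ultimately show ?thesis by simp
qed

text \<open>Splitting f s (z s) = f t0 (z t0) as for the total derivative gives a linear equation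
  for the increment of \<open>z\<close>. The mean slope is positive and continuous, so it can be
  divided by; continuity of \<open>z\<close> is supplied beforehand by the joint continuity of
  inverses.\<close>

lemma implicit_deriv:
  fixes f fm :: "real \<Rightarrow> real \<Rightarrow> real"
  assumes d: "\<And>y m. (f y has_real_derivative fm y m) (at m)"
    and fm: "continuous_on UNIV (\<lambda>q. fm (fst q) (snd q))" and pos: "\<And>y m. 0 < fm y m"
    and ft: "((\<lambda>t. f t (z t0)) has_real_derivative ft) (at t0)"
    and z: "isCont z t0" and eq: "\<And>t. f t (z t) = k"
  shows "(z has_real_derivative - ft / fm t0 (z t0)) (at t0)"
proof -
  let ?\<psi> = "\<lambda>s. mean_slope fm (z t0) s (z s)"
  have \<psi>: "isCont ?\<psi> t0"
    using isCont_compose_pair[OF mean_slope(2)[OF d fm, of "z t0"] _ z, of "\<lambda>s. s"] by simp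
  have \<psi>pos: "0 < ?\<psi> s" for s
  proof -
    have c: "continuous_on {0..1} (\<lambda>r. fm s (z t0 + r * (z s - z t0)))"
      by (rule continuous_on_compose2[OF fm, of _ "\<lambda>r. (s, z t0 + r * (z s - z t0))", simplified]) (auto intro!: continuous_intros)
    have "0 \<le> ?\<psi> s" unfolding mean_slope_def
      by (intro integral_nonneg integrable_continuous_real c) (simp add: pos less_imp_le)
    moreover have "?\<psi> s \<noteq> 0" unfolding mean_slope_def
      using integral_eq_0_iff[OF c] pos by (auto simp: less_imp_le) (metis atLeastAtMost_iff less_irrefl zero_le_one order_refl)
    ultimately show ?thesis by linarith
  qed
  obtain \<gamma> where \<gamma>: "\<And>s. f s (z t0) - f t0 (z t0) = \<gamma> s * (s - t0)" "isCont \<gamma> t0" "\<gamma> t0 = ft"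
    using ft unfolding CARAT_DERIV by blast
  show ?thesis unfolding CARAT_DERIV
  proof (intro exI[of _ "\<lambda>s. - \<gamma> s / ?\<psi> s"] conjI allI)
    show "isCont (\<lambda>s. - \<gamma> s / ?\<psi> s) t0" using \<psi>pos[of t0] by (intro continuous_intros \<gamma> \<psi>) auto
    show "- \<gamma> t0 / ?\<psi> t0 = - ft / fm t0 (z t0)" using mean_slope(3)[OF d fm] \<gamma>(3) by simp
    fix s
    have "(z s - z t0) * ?\<psi> s + \<gamma> s * (s - t0) = 0"
      using mean_slope(1)[OF d fm, of s "z s" "z t0"] \<gamma>(1)[of s] eq[of s] eq[of t0] by simp
    then show "z s - z t0 = - \<gamma> s / ?\<psi> s * (s - t0)" using \<psi>pos[of s] by (simp add: field_simps)
  qed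
qed

section \<open>Integrals of a bounded density in one of its variables\<close>

definition partial_prim :: "(real \<Rightarrow> real \<Rightarrow> real) \<Rightarrow> real \<Rightarrow> real \<Rightarrow> real" where
  "partial_prim D t x = (\<integral>y. indicator {0..x} y * D t y \<partial>lborel)"

context
  fixes D :: "real \<Rightarrow> real \<Rightarrow> real" and M :: real
  assumes D: "(\<lambda>q. D (fst q) (snd q)) \<in> borel_measurable borel" and M: "\<And>t x. \<bar>D t x\<bar> \<le> M"
begin

lemma slice_measurable: "D t \<in> borel_measurable borel" "(\<lambda>t. D t x) \<in> borel_measurable borel"
  using measurable_compose[OF _ D, of "\<lambda>x. (t, x)" borel] measurable_compose[OF _ D, of "\<lambda>t. (t, x)" borel]
  by simp_all

lemma partial_prim_measurable: "(\<lambda>q. partial_prim D (fst q) (snd q)) \<in> borel_measurable borel"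
proof -
  have [measurable]: "(\<lambda>q. D (fst q) (snd q)) \<in> borel_measurable (borel \<Otimes>\<^sub>M borel)" using D by (simp add: borel_prod)
  have "(\<lambda>q. \<integral>y. indicator {0..snd q} y * D (fst q) y \<partial>lborel) \<in> borel_measurable (borel \<Otimes>\<^sub>M borel)"
  proof (rule lborel.borel_measurable_lebesgue_integral)
    have "(\<lambda>p. D (fst (fst p)) (snd p)) \<in> borel_measurable ((borel \<Otimes>\<^sub>M borel) \<Otimes>\<^sub>M lborel)"
      using measurable_compose[OF _ D[unfolded borel_prod[symmetric]], of "\<lambda>p. (fst (fst p), snd p)" "(borel \<Otimes>\<^sub>M borel) \<Otimes>\<^sub>M lborel"]
      by simp
    moreover have "(\<lambda>p::(real \<times> real) \<times> real. if 0 \<le> snd p \<and> snd p \<le> snd (fst p) then 1 else 0 :: real)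
        \<in> borel_measurable ((borel \<Otimes>\<^sub>M borel) \<Otimes>\<^sub>M lborel)" by measurable
    ultimately have "(\<lambda>p. (if 0 \<le> snd p \<and> snd p \<le> snd (fst p) then 1 else 0) * D (fst (fst p)) (snd p))
        \<in> borel_measurable ((borel \<Otimes>\<^sub>M borel) \<Otimes>\<^sub>M lborel)" by (intro borel_measurable_times)
    moreover have "(\<lambda>(q :: real \<times> real, y). indicator {0..snd q} y * D (fst q) y)
        = (\<lambda>p. (if 0 \<le> snd p \<and> snd p \<le> snd (fst p) then 1 else 0) * D (fst (fst p)) (snd p))"
      by (auto simp: fun_eq_iff indicator_def)
    ultimately show "(\<lambda>(q, y). indicator {0..snd q} y * D (fst q) y) \<in> borel_measurable ((borel \<Otimes>\<^sub>M borel) \<Otimes>\<^sub>M lborel)"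
      by simp
  qed
  then show ?thesis by (simp add: partial_prim_def borel_prod)
qed

lemma D_integrable: "D t integrable_on {a..b}" "(\<lambda>t. D t x) integrable_on {a..b}"
  by (rule bounded_borel_integrable[OF slice_measurable(1) M], rule bounded_borel_integrable[OF slice_measurable(2) M])

lemma partial_prim_integral: "partial_prim D t x = integral {0..x} (D t)"
  using set_borel_integral_eq_integral(2)[OF bounded_borel_abs_integrable[OF slice_measurable(1) M, of 0 x t]]
  by (simp add: partial_prim_def set_lebesgue_integral_def)

lemma partial_prim_bound: "0 \<le> x \<Longrightarrow> \<bar>partial_prim D t x\<bar> \<le> M * x"
proof -
  assume x: "0 \<le> x"
  have "0 \<le> M" using M[of 0 0] by linarith
  from has_integral_bound[OF this, of "D t" _ 0 x] D_integrable(1)[of t 0 x] M x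
  show ?thesis unfolding partial_prim_integral by (metis box_real(2) content_real diff_zero integrable_integral real_norm_def)
qed

lemma partial_prim_lac: "lac 0 l (partial_prim D t) (D t)"
  unfolding lac_def
proof (intro conjI allI impI slice_measurable)
  show "\<exists>M. \<forall>x\<in>{0..l}. \<bar>D t x\<bar> \<le> M" using M by blast
  fix s x assume "0 \<le> s \<and> s \<le> x \<and> x \<le> l"
  then have "integral {s..x} (D t) = partial_prim D t x - partial_prim D t s"
    using Henstock_Kurzweil_Integration.integral_combine[of 0 s x "D t"] D_integrable(1)
    unfolding partial_prim_integral by simp
  then show "(D t has_integral partial_prim D t x - partial_prim D t s) {s..x}"
    using integrable_integral[OF D_integrable(1)[of t s x]] by simp
qed

text \<open>Fubini in terms of gauge integrals; it allows time integration under an integral over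
  space, which is how the rate acquires a time derivative.\<close>

lemma partial_prim_swap:
  "integral {s..t} (\<lambda>r. partial_prim D r x) = integral {0..x} (\<lambda>y. integral {s..t} (\<lambda>r. D r y))"
proof -
  let ?f = "\<lambda>(r, y). (indicator {s..t} r * indicator {0..x} y) * D r y"
  have f: "integrable (lborel \<Otimes>\<^sub>M lborel) ?f"
  proof (rule Bochner_Integration.integrable_bound)
    have i: "integrable lborel (\<lambda>r. indicator {a..b} r :: real)" for a b :: real
      by (rule integrable_real_indicator) (auto simp: emeasure_lborel_Icc_eq)
    show "integrable (lborel \<Otimes>\<^sub>M lborel) (\<lambda>(r, y). (M * indicator {s..t} r) * indicator {0..x} y)"
      by (rule integrable_times_lborel[OF integrable_mult_right[OF i] i])
    have "(\<lambda>p. D (fst p) (snd p)) \<in> borel_measurable (lborel \<Otimes>\<^sub>M lborel)"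
      using D by (simp add: lborel_prod)
    then show "?f \<in> borel_measurable (lborel \<Otimes>\<^sub>M lborel)" unfolding split_beta by measurable
    have "0 \<le> M" using M[of 0 0] by linarith
    then show "AE p in lborel \<Otimes>\<^sub>M lborel. norm (?f p) \<le> norm ((\<lambda>(r, y). (M * indicator {s..t} r) * indicator {0..x} y) p)"
      using M by (intro AE_I2) (auto simp: indicator_def split: prod.splits)
  qed
  have "integral {s..t} (\<lambda>r. partial_prim D r x) = (\<integral>r. indicator {s..t} r * partial_prim D r x \<partial>lborel)"
  proof -
    have m: "(\<lambda>r. partial_prim D r x) \<in> borel_measurable borel"
      using measurable_compose[OF _ partial_prim_measurable, of "\<lambda>t. (t, x)" borel] by simp
    have b: "\<bar>partial_prim D r x\<bar> \<le> M * \<bar>x\<bar>" for r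
    proof (cases "0 \<le> x")
      case False
      then have "partial_prim D r x = 0" by (simp add: partial_prim_def)
      moreover have "0 \<le> M" using M[of 0 0] by linarith
      ultimately show ?thesis by simp
    qed (use partial_prim_bound[of x r] in simp)
    show ?thesis using set_borel_integral_eq_integral(2)[OF bounded_borel_abs_integrable[OF m b, of s t]]
      by (simp add: set_lebesgue_integral_def)
  qed
  also have "\<dots> = (\<integral>r. (\<integral>y. ?f (r, y) \<partial>lborel) \<partial>lborel)"
    unfolding partial_prim_def by (simp add: mult.assoc)
  also have "\<dots> = (\<integral>y. (\<integral>r. ?f (r, y) \<partial>lborel) \<partial>lborel)"
    using lborel_pair.Fubini_integral[of "\<lambda>r y. ?f (r, y)"] f by simp
  also have "\<dots> = (\<integral>y. indicator {0..x} y * integral {s..t} (\<lambda>r. D r y) \<partial>lborel)"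
  proof (rule Bochner_Integration.integral_cong[OF refl])
    fix y
    have "(\<integral>r. ?f (r, y) \<partial>lborel) = (\<integral>r. indicator {0..x} y * (indicator {s..t} r * D r y) \<partial>lborel)"
      by (rule Bochner_Integration.integral_cong) auto
    also have "\<dots> = indicator {0..x} y * (LINT r:{s..t}|lborel. D r y)"
      by (simp add: set_lebesgue_integral_def)
    also have "(LINT r:{s..t}|lborel. D r y) = integral {s..t} (\<lambda>r. D r y)"
      by (rule set_borel_integral_eq_integral(2)[OF bounded_borel_abs_integrable[OF slice_measurable(2) M]])
    finally show "(\<integral>r. ?f (r, y) \<partial>lborel) = indicator {0..x} y * integral {s..t} (\<lambda>r. D r y)" .
  qed
  also have "\<dots> = integral {0..x} (\<lambda>y. integral {s..t} (\<lambda>r. D r y))"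
  proof -
    have m: "(\<lambda>y. integral {s..t} (\<lambda>r. D r y)) \<in> borel_measurable borel"
    proof -
      have "(\<lambda>y. \<integral>r. indicator {s..t} r * D r y \<partial>lborel) \<in> borel_measurable borel"
      proof (rule lborel.borel_measurable_lebesgue_integral)
        have "(\<lambda>p. D (snd p) (fst p)) \<in> borel_measurable (borel \<Otimes>\<^sub>M lborel)"
          using measurable_compose[OF _ D[unfolded borel_prod[symmetric]], of "\<lambda>p. (snd p, fst p)" "borel \<Otimes>\<^sub>M lborel"] by simp
        then show "(\<lambda>(y, r). indicator {s..t} r * D r y) \<in> borel_measurable (borel \<Otimes>\<^sub>M lborel)"
          unfolding split_beta by measurable
      qed
      then show ?thesis
        using set_borel_integral_eq_integral(2)[OF bounded_borel_abs_integrable[OF slice_measurable(2) M, of s t]]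
        by (simp add: set_lebesgue_integral_def)
    qed
    have b: "\<bar>integral {s..t} (\<lambda>r. D r y)\<bar> \<le> M * \<bar>t - s\<bar>" for y
    proof (cases "s \<le> t")
      case True
      have "0 \<le> M" using M[of 0 0] by linarith
      from has_integral_bound[OF this, of "\<lambda>r. D r y" _ s t] D_integrable(2)[of y s t] M True
      show ?thesis by (metis abs_of_nonneg box_real(2) content_real diff_ge_0_iff_ge integrable_integral real_norm_def)
    qed (use M[of 0 0] in simp)
    show ?thesis using set_borel_integral_eq_integral(2)[OF bounded_borel_abs_integrable[OF m b, of 0 x]]
      by (simp add: set_lebesgue_integral_def)
  qed
  finally show ?thesis .
qed

end

text \<open>\<open>U\<close> bounds the untruncated area for all labels, also outside the fibre,
  which keeps the modified reciprocal area away from 0 on the whole plane. \<open>E0\<close> and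
  \<open>E1\<close> collect the corners of the inlet and initial data.\<close>

locale fibre_evolution = fibre_trunc +
  fixes T \<Lambda> U :: real and c S0d S1d dvin dvL :: "real \<Rightarrow> real" and E0 E1 :: "real set"
  assumes T: "0 < T" and c_cont: "continuous_on UNIV c" and c_nonneg: "\<And>t. 0 \<le> c t"
    and c_fixed: "\<And>t. t \<in> {0..T} \<Longrightarrow> c t = F (prim c) t"
    and U: "0 < U" "\<And>t m. b m + prim c (\<tau> m) - prim c t \<le> U"
    and untruncated: "\<And>t m. t \<in> {0..T} \<Longrightarrow> - N t \<le> m \<Longrightarrow> m \<le> mL (prim c) t \<Longrightarrow>
       \<delta> \<le> b m - (prim c t - prim c (\<tau> m))"
    and E01: "finite E0" "finite E1"
    and S0d: "\<And>t. t \<notin> E0 \<Longrightarrow> (S0 has_real_derivative S0d t) (at t)" "S0d \<in> borel_measurable borel" "\<And>t. \<bar>S0d t\<bar> \<le> \<Lambda>"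
    and S1d: "\<And>t. t \<notin> E1 \<Longrightarrow> (S1 has_real_derivative S1d t) (at t)" "S1d \<in> borel_measurable borel" "\<And>t. \<bar>S1d t\<bar> \<le> \<Lambda>"
    and dvin: "lac 0 T vin dvin" and dvL: "lac 0 T vL dvL"
begin

definition "C = prim c"
text \<open>The part of the area that belongs to the particle alone: the area at time
  \<open>t\<close> is \<open>a m - C t\<close>.\<close>

definition "a m = b m + C (\<tau> m)"
definition "\<kappa> y = 1 / (max \<delta> y)\<^sup>2"
text \<open>The reciprocal \<open>1 / y\<close> for y >= \<delta>, continued below \<delta> by its
  tangent line. Unlike the reciprocal of a truncated area it is continuously differentiable, with
  derivative \<open>- \<kappa>\<close>.\<close>

definition "\<Theta> y = 1 / \<delta> - (prim \<kappa> y - prim \<kappa> \<delta>)"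
definition "h t m = \<Theta> (a m - C t)"
text \<open>Time enters only through the parameter \<open>y = C t\<close>, so time derivatives of
  positions reduce to the chain rule for \<open>C\<close> and \<open>N\<close>.\<close>

definition "g y m = prim (\<lambda>m. \<Theta> (a m - y)) m"
definition "gy y m = prim (\<lambda>m. \<kappa> (a m - y)) m"
text \<open>The position of the label \<open>m\<close>, measured from the inlet label
  \<open>- N t\<close>.\<close>

definition "H t m = g (C t) m - g (C t) (- N t)"
text \<open>The time derivative of \<open>H\<close> at a fixed label, that is, the velocity of the
  particle; the term with \<open>q\<close> stems from the moving inlet label.\<close>

definition "V t m = c t * (gy (C t) m - gy (C t) (- N t)) + q t * h t (- N t)"
definition "lab t x = inv (H t) x"
definition "A t x = 1 / h t (lab t x)"
definition "v t x = V t (lab t x)"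
text \<open>In Eulerian terms the integral of 1 / A over [0, x], so that the velocity is
  \<open>vin + c * K\<close>.\<close>

definition "K t x = gy (C t) (lab t x) - gy (C t) (- N t)"

lemma C_cont: "continuous_on S C" unfolding C_def by (rule continuous_on_prim[OF c_cont])
lemma C_deriv: "(C has_real_derivative c t) (at t)" unfolding C_def by (rule prim_deriv[OF c_cont])
lemma C_mono: "s \<le> t \<Longrightarrow> C s \<le> C t" using prim_lower[OF c_cont c_nonneg, of s t] by (simp add: C_def)
lemma C_0 [simp]: "C 0 = 0" by (simp add: C_def)

lemma a_cont: "continuous_on S a"
  unfolding a_def by (intro continuous_intros b_cont continuous_on_compose2[OF C_cont \<tau>_cont]) auto

lemma \<kappa>_pos: "0 < \<kappa> y" using \<delta> by (simp add: \<kappa>_def)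
lemma \<kappa>_cont: "continuous_on S \<kappa>"
  unfolding \<kappa>_def using \<delta> by (intro continuous_intros) auto

lemma \<Theta>_deriv: "(\<Theta> has_real_derivative - \<kappa> y) (at y)"
  unfolding \<Theta>_def using prim_deriv[OF \<kappa>_cont] by (auto intro!: derivative_eq_intros)

lemma \<Theta>_cont: "continuous_on S \<Theta>"
  using \<Theta>_deriv by (meson DERIV_continuous continuous_at_imp_continuous_on)

text \<open>For y >= \<delta> the function \<open>- 1 / y\<close> is an antiderivative of \<kappa>,
  and the value at \<delta> is \<open>1 / \<delta>\<close>.\<close>

lemma \<Theta>_eq: "\<delta> \<le> y \<Longrightarrow> \<Theta> y = 1 / y"
proof -
  assume y: "\<delta> \<le> y"
  have e: "((\<lambda>x. - 1 / x) has_real_derivative \<kappa> x) (at x)" if "\<delta> < x" for x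
    using that \<delta> by (auto intro!: derivative_eq_intros simp: \<kappa>_def power2_eq_square)
  have c: "continuous_on {\<delta>..y} (\<lambda>x. - 1 / x)" using \<delta> by (intro continuous_intros) auto
  have "prim \<kappa> y - prim \<kappa> \<delta> \<le> - 1 / y - - 1 / \<delta>"
    by (rule deriv_mono_le[OF y continuous_on_prim[OF \<kappa>_cont] c prim_deriv[OF \<kappa>_cont] e]) auto
  moreover have "- 1 / y - - 1 / \<delta> \<le> prim \<kappa> y - prim \<kappa> \<delta>"
    by (rule deriv_mono_le[OF y c continuous_on_prim[OF \<kappa>_cont] e prim_deriv[OF \<kappa>_cont]]) auto
  ultimately show ?thesis by (simp add: \<Theta>_def)
qed

lemma \<Theta>_lower: "y \<le> U \<Longrightarrow> 1 / max \<delta> U \<le> \<Theta> y"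
proof -
  assume "y \<le> U"
  then have "0 * (max \<delta> U - y) \<le> prim \<kappa> (max \<delta> U) - prim \<kappa> y"
    by (intro prim_lower[OF \<kappa>_cont]) (auto simp: \<kappa>_pos less_imp_le)
  then show ?thesis using \<Theta>_eq[of "max \<delta> U"] by (simp add: \<Theta>_def)
qed

definition "h0 = 1 / max \<delta> U"

lemma h0: "0 < h0" "h0 \<le> h t m"
  using U(2)[of m t] \<delta> by (auto simp: h0_def h_def a_def C_def intro!: \<Theta>_lower)

lemma h_pos: "0 < h t m" using h0 by (meson order_less_le_trans)

lemma h_joint_cont: "continuous_on UNIV (\<lambda>q. h (fst q) (snd q))"
  unfolding h_def
  by (intro continuous_on_compose2[OF \<Theta>_cont] continuous_intros continuous_on_compose2[OF a_cont]
      continuous_on_compose2[OF C_cont]) auto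

lemma \<Theta>_joint_cont: "continuous_on UNIV (\<lambda>q. \<Theta> (a (snd q) - fst q))"
  by (intro continuous_on_compose2[OF \<Theta>_cont] continuous_intros continuous_on_compose2[OF a_cont]) auto

lemma \<kappa>_joint_cont: "continuous_on UNIV (\<lambda>q. \<kappa> (a (snd q) - fst q))"
  by (intro continuous_on_compose2[OF \<kappa>_cont] continuous_intros continuous_on_compose2[OF a_cont]) auto

lemma \<Theta>_slice_cont: "continuous_on S (\<lambda>m. \<Theta> (a m - y))"
  by (intro continuous_on_compose2[OF \<Theta>_cont] continuous_intros a_cont) auto

lemma \<kappa>_slice_cont: "continuous_on S (\<lambda>m. \<kappa> (a m - y))"
  by (intro continuous_on_compose2[OF \<kappa>_cont] continuous_intros a_cont) auto

lemma g_deriv_m: "(g y has_real_derivative \<Theta> (a m - y)) (at m)"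
  unfolding g_def[abs_def] by (rule prim_deriv[OF \<Theta>_slice_cont])

lemma gy_deriv_m: "(gy y has_real_derivative \<kappa> (a m - y)) (at m)"
  unfolding gy_def[abs_def] by (rule prim_deriv[OF \<kappa>_slice_cont])

lemma g_deriv_y: "((\<lambda>y. g y m) has_real_derivative gy y m) (at y)"
  unfolding g_def gy_def
proof (rule prim_param_deriv)
  show "((\<lambda>y. \<Theta> (a m - y)) has_real_derivative \<kappa> (a m - y)) (at y)" for y m
  proof -
    have "((\<lambda>y. a m - y) has_real_derivative - 1) (at y)" by (auto intro!: derivative_eq_intros)
    from DERIV_chain2[OF \<Theta>_deriv this] show ?thesis by simp
  qed
qed (use \<Theta>_slice_cont \<kappa>_joint_cont in auto)

lemma gy_joint_cont: "continuous_on UNIV (\<lambda>q. gy (fst q) (snd q))"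
  unfolding gy_def by (rule continuous_on_prim_joint[OF \<kappa>_joint_cont])

lemma g_joint_cont: "continuous_on UNIV (\<lambda>q. g (fst q) (snd q))"
  unfolding g_def by (rule continuous_on_prim_joint[OF \<Theta>_joint_cont])

lemma H_joint_cont: "continuous_on UNIV (\<lambda>q. H (fst q) (snd q))"
  unfolding H_def
  by (intro continuous_intros continuous_on_compose_pair[OF g_joint_cont] continuous_on_compose2[OF C_cont] continuous_on_compose2[OF N_cont]) auto

lemma H_deriv_m: "(H t has_real_derivative h t m) (at m)"
  unfolding H_def[abs_def] h_def by (auto intro!: derivative_eq_intros g_deriv_m)

lemma H_deriv_t: "((\<lambda>t. H t m) has_real_derivative V t m) (at t)"
proof -
  have 1: "((\<lambda>t. g (C t) m) has_real_derivative gy (C t) m * c t) (at t)"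
    by (rule DERIV_chain2[OF g_deriv_y C_deriv])
  have 2: "((\<lambda>t. g (C t) (- N t)) has_real_derivative gy (C t) (- N t) * c t + \<Theta> (a (- N t) - C t) * (- q t)) (at t)"
    by (rule total_deriv[OF g_deriv_m \<Theta>_joint_cont g_deriv_y C_deriv DERIV_minus[OF N_deriv]])
  show ?thesis unfolding H_def
    by (rule DERIV_cong[OF DERIV_diff[OF 1 2]]) (simp add: V_def h_def algebra_simps)
qed

lemma H_slope: "x \<le> y \<Longrightarrow> h0 * (y - x) \<le> H t y - H t x"
proof -
  assume "x \<le> y"
  have "h0 * y - h0 * x \<le> H t y - H t x"
    by (rule deriv_mono_le[OF \<open>x \<le> y\<close>, where f'="\<lambda>_. h0" and g'="h t"])
      (use h0 H_deriv_m in \<open>auto intro!: derivative_eq_intros continuous_intros continuous_on_compose_pair[OF H_joint_cont]\<close>)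
  then show ?thesis by (simp add: right_diff_distrib)
qed

lemma H_bij: "bij (H t)" "strict_mono (H t)"
proof -
  have "continuous_on UNIV (H t)" by (intro continuous_on_compose_pair[OF H_joint_cont] continuous_intros)
  then show "bij (H t)" "strict_mono (H t)" using slope_bij[OF _ h0(1) H_slope] by auto
qed

lemma H_lab: "H t (lab t x) = x" and lab_H: "lab t (H t m) = m"
  using H_bij(1)[of t] by (simp_all add: lab_def bij_is_surj surj_f_inv_f bij_is_inj)

lemma lab_joint_cont: "continuous_on UNIV (\<lambda>q. lab (fst q) (snd q))"
  unfolding lab_def by (rule continuous_on_inv_joint[OF H_joint_cont h0(1) H_slope])

lemma lab_le_iff: "lab t x \<le> lab t y \<longleftrightarrow> x \<le> y"
  using H_bij(2)[of t] H_lab[of t x] H_lab[of t y] by (metis strict_mono_less_eq)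

lemma lab_deriv_x: "(lab t has_real_derivative A t x) (at x)"
proof -
  have c: "isCont (lab t) x"
  proof -
    have "continuous_on UNIV (lab t)" by (intro continuous_on_compose_pair[OF lab_joint_cont] continuous_intros)
    then show ?thesis by (simp add: continuous_on_eq_continuous_at)
  qed
  have hc: "continuous_on UNIV (\<lambda>q::real \<times> real. h t (snd q))"
    by (intro continuous_on_compose_pair[OF h_joint_cont] continuous_intros)
  have "(lab t has_real_derivative - (-1) / h t (lab t x)) (at x)"
  \<comment> \<open>The label solves H t m - x = 0, with the space variable in the role of the
    parameter.\<close>
  proof (rule implicit_deriv[where f="\<lambda>x m. H t m - x" and fm="\<lambda>x m. h t m" and k=0])
    show "((\<lambda>m. H t m - y) has_real_derivative h t m) (at m)" for y m
      by (auto intro!: derivative_eq_intros H_deriv_m)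
    show "((\<lambda>x'. H t (lab t x) - x') has_real_derivative -1) (at x)" by (auto intro!: derivative_eq_intros)
  qed (use hc h_pos c H_lab in auto)
  then show ?thesis by (simp add: A_def)
qed

lemma lab_deriv_t: "((\<lambda>t. lab t x) has_real_derivative - (v t x * A t x)) (at t)"
proof -
  have c: "isCont (\<lambda>t. lab t x) t"
  proof -
    have "continuous_on UNIV (\<lambda>t. lab t x)" by (intro continuous_on_compose_pair[OF lab_joint_cont] continuous_intros)
    then show ?thesis by (simp add: continuous_on_eq_continuous_at)
  qed
  have "((\<lambda>t. lab t x) has_real_derivative - V t (lab t x) / h t (lab t x)) (at t)"
    by (rule implicit_deriv[OF H_deriv_m h_joint_cont h_pos H_deriv_t c H_lab])
  then show ?thesis by (simp add: A_def v_def)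
qed

lemma V_joint_cont: "continuous_on UNIV (\<lambda>q. V (fst q) (snd q))"
  unfolding V_def
  by (intro continuous_intros continuous_on_compose_pair[OF gy_joint_cont] continuous_on_compose_pair[OF h_joint_cont] continuous_on_compose2[OF C_cont]
     continuous_on_compose2[OF N_cont] continuous_on_compose2[OF c_cont] continuous_on_compose2[OF q_cont]) auto

lemma v_joint_cont: "continuous_on UNIV (\<lambda>q. v (fst q) (snd q))"
  unfolding v_def by (intro continuous_on_compose_pair[OF V_joint_cont] lab_joint_cont continuous_intros)

lemma A_joint_cont: "continuous_on UNIV (\<lambda>q. A (fst q) (snd q))"
  unfolding A_def using h_pos
  by (intro continuous_intros continuous_on_compose_pair[OF h_joint_cont] lab_joint_cont) (auto simp: less_imp_neq[THEN not_sym])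

lemma K_joint_cont: "continuous_on UNIV (\<lambda>q. K (fst q) (snd q))"
  unfolding K_def
  by (intro continuous_intros continuous_on_compose_pair[OF gy_joint_cont] lab_joint_cont continuous_on_compose2[OF C_cont]
     continuous_on_compose2[OF N_cont]) auto

lemma A_pos: "0 < A t x" using h_pos by (simp add: A_def)

lemma lab_inlet: "lab t 0 = - N t"
  using lab_H[of t "- N t"] by (simp add: H_def)

text \<open>Inside the fibre no truncation is active, so the reciprocal area of the fixed point map
  and its continuously differentiable variant coincide.\<close>

lemma w_eq:
  assumes t: "t \<in> {0..T}" and m: "- N t \<le> m" "m \<le> mL C t"
  shows "w C t m = h t m" and "(w C t m)\<^sup>2 = \<kappa> (a m - C t)" and "\<delta> \<le> a m - C t"
proof -
  show d: "\<delta> \<le> a m - C t" using untruncated[OF t m(1)] m(2) by (simp add: a_def C_def)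
  have "C (\<tau> m) \<le> C t" using \<tau>_le_iff[of t m] t m by (intro C_mono) auto
  then have \<alpha>: "\<alpha> C t m = a m - C t" using d by (simp add: \<alpha>_def a_def)
  then show "w C t m = h t m" by (simp add: w_def h_def \<Theta>_eq[OF d])
  show "(w C t m)\<^sup>2 = \<kappa> (a m - C t)" using \<alpha> d by (simp add: w_def \<kappa>_def power_divide)
qed

text \<open>Here the Eulerian picture meets the fixed point problem: on the fibre the integrands
  agree, so \<open>H t\<close> takes the label \<open>mL C t\<close> to the full length
  \<open>L\<close>.\<close>

lemma lab_outlet: "t \<in> {0..T} \<Longrightarrow> lab t L = mL C t"
proof -
  assume t: "t \<in> {0..T}"
  have "H t (mL C t) = integral {- N t..mL C t} (h t)"
    unfolding H_def g_def h_def[abs_def] by (rule prim_diff[OF \<Theta>_slice_cont mL_ge[OF C_cont]])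
  also have "\<dots> = integral {- N t..mL C t} (w C t)"
    by (rule integral_cong) (use w_eq(1)[OF t] in auto)
  also have "\<dots> = L" using X_integral[OF C_cont mL_ge[OF C_cont]] X_mL[OF C_cont] by simp
  finally show ?thesis using lab_H[of t "mL C t"] by simp
qed

lemma lab_range: "t \<in> {0..T} \<Longrightarrow> x \<in> {0..L} \<Longrightarrow> - N t \<le> lab t x \<and> lab t x \<le> mL C t"
  using lab_le_iff[of t 0 x] lab_le_iff[of t x L] by (simp add: lab_inlet lab_outlet)

lemma A_eq: "t \<in> {0..T} \<Longrightarrow> x \<in> {0..L} \<Longrightarrow> A t x = a (lab t x) - C t"
  and A_ge: "t \<in> {0..T} \<Longrightarrow> x \<in> {0..L} \<Longrightarrow> \<delta> \<le> A t x"
  and \<kappa>_eq: "t \<in> {0..T} \<Longrightarrow> x \<in> {0..L} \<Longrightarrow> \<kappa> (a (lab t x) - C t) = 1 / (A t x)\<^sup>2"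
  using lab_range[of t x] w_eq(3)[of t "lab t x"] by (auto simp: A_def h_def \<Theta>_eq \<kappa>_def)

lemma a_inlet: "0 \<le> t \<Longrightarrow> a (- N t) = S0 t + C t"
  using N_nonneg[of t] by (simp add: a_def \<tau>_N b_neg)

lemma h_inlet: "0 \<le> t \<Longrightarrow> q t * h t (- N t) = vin t"
  using S0_bounds(1)[of t] \<delta> Sm by (simp add: h_def a_inlet \<Theta>_eq q_def)

lemma A_inlet: "t \<in> {0..T} \<Longrightarrow> A t 0 = S0 t"
  using A_eq[of t 0] L by (simp add: lab_inlet a_inlet)

lemma v_eq: "t \<in> {0..T} \<Longrightarrow> v t x = vin t + c t * K t x"
  using h_inlet[of t] by (simp add: v_def V_def K_def)

lemma K_inlet: "K t 0 = 0" by (simp add: K_def lab_inlet)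

lemma v_inlet: "t \<in> {0..T} \<Longrightarrow> v t 0 = vin t" by (simp add: v_eq K_inlet)

lemma K_outlet: "t \<in> {0..T} \<Longrightarrow> K t L = I C t"
proof -
  assume t: "t \<in> {0..T}"
  have "K t L = integral {- N t..mL C t} (\<lambda>m. \<kappa> (a m - C t))"
    unfolding K_def gy_def lab_outlet[OF t] by (rule prim_diff[OF \<kappa>_slice_cont mL_ge[OF C_cont]])
  also have "\<dots> = I C t" unfolding I_def
    by (rule integral_cong) (use w_eq(2)[OF t] in auto)
  finally show ?thesis .
qed

lemma c_K: "t \<in> {0..T} \<Longrightarrow> c t = (vL t - vin t) / K t L"
  using c_fixed[of t] by (simp add: K_outlet F_def C_def)

lemma K_outlet_lower: "t \<in> {0..T} \<Longrightarrow> L / SM \<le> K t L"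
  using I_lower[OF C_cont] by (simp add: K_outlet)

lemma v_outlet: "t \<in> {0..T} \<Longrightarrow> v t L = vL t"
proof -
  assume t: "t \<in> {0..T}"
  have "0 < K t L" using I_pos[OF C_cont] by (simp add: K_outlet[OF t])
  then show ?thesis using v_eq[OF t, of L] c_K[OF t] by simp
qed

text \<open>At time 0 the derivative of \<open>y \<mapsto> H 0 (R y)\<close> is (1 / S1 y) * S1 y =
  1 for y >= 0, hence the particle with label \<open>R x\<close> sits at \<open>x\<close>.\<close>

lemma A_initial: "x \<in> {0..L} \<Longrightarrow> A 0 x = S1 x"
proof -
  assume x: "x \<in> {0..L}"
  have "a (R y) = S1 y" if "0 \<le> y" for y
    using R_le_iff[of 0 y] that by (simp add: a_def b_pos \<xi>_R \<tau>_pos)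
  then have hR: "h 0 (R y) = 1 / S1 y" if "0 \<le> y" for y
    using that S1_bounds(1)[of y] \<delta> by (simp add: h_def \<Theta>_eq)
  have d: "((\<lambda>y. H 0 (R y)) has_real_derivative h 0 (R y) * S1 y) (at y)" for y
    by (rule DERIV_chain2[OF H_deriv_m R_deriv])
  have one: "h 0 (R y) * S1 y = 1" if "0 \<le> y" for y using hR[OF that] S1_bounds(1)[of y] Sm by simp
  have cR: "continuous_on S (\<lambda>y. H 0 (R y))" for S by (intro continuous_on_compose_pair[OF H_joint_cont] continuous_intros R_cont)
  have "H 0 (R x) - H 0 (R 0) \<le> x - 0"
    by (rule deriv_mono_le[OF _ cR _ d DERIV_ident]) (use x one in \<open>auto intro!: continuous_intros\<close>)
  moreover have "x - 0 \<le> H 0 (R x) - H 0 (R 0)"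
    by (rule deriv_mono_le[OF _ _ cR DERIV_ident d]) (use x one in \<open>auto intro!: continuous_intros\<close>)
  moreover have "H 0 (R 0) = 0" by (simp add: H_def)
  ultimately have "H 0 (R x) = x" by simp
  then have "lab 0 x = R x" using lab_H[of 0 "R x"] by simp
  then show ?thesis using hR[of x] x by (simp add: A_def)
qed

lemma K_deriv_x: "t \<in> {0..T} \<Longrightarrow> x \<in> {0..L} \<Longrightarrow> (K t has_real_derivative 1 / A t x) (at x)"
proof -
  assume tx: "t \<in> {0..T}" "x \<in> {0..L}"
  have "((\<lambda>x. gy (C t) (lab t x)) has_real_derivative \<kappa> (a (lab t x) - C t) * A t x) (at x)"
    by (rule DERIV_chain2[OF gy_deriv_m lab_deriv_x])
  moreover have "\<kappa> (a (lab t x) - C t) * A t x = 1 / A t x"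
    using \<kappa>_eq[OF tx] A_pos[of t x] by (simp add: power2_eq_square)
  ultimately show ?thesis unfolding K_def[abs_def] by (auto intro!: derivative_eq_intros)
qed

lemma K_nonneg: "t \<in> {0..T} \<Longrightarrow> x \<in> {0..L} \<Longrightarrow> 0 \<le> K t x"
proof -
  assume tx: "t \<in> {0..T}" "x \<in> {0..L}"
  have "0 - 0 \<le> K t x - K t 0"
    by (rule deriv_mono_le[where f="\<lambda>_. 0" and f'="\<lambda>_. 0" and g'="\<lambda>x. 1 / A t x"])
      (use tx A_pos K_deriv_x in \<open>auto intro!: continuous_on_compose_pair[OF K_joint_cont] continuous_intros less_imp_le\<close>)
  then show ?thesis by (simp add: K_inlet)
qed

lemma v_ge: "t \<in> {0..T} \<Longrightarrow> x \<in> {0..L} \<Longrightarrow> vm \<le> v t x"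
  using v_eq[of t x] v_bounds(1)[of t] K_nonneg[of t x] c_nonneg[of t] by (smt (verit) mult_nonneg_nonneg)

text \<open>The derivative of \<open>a\<close>, from \<xi>' = 1 / S1 for initial particles and
  \<tau>' = - 1 / q for entering ones.\<close>

definition "ad m = (if 0 < m then S1d (\<xi> m) / S1 (\<xi> m) else - (S0d (\<tau> m) + c (\<tau> m)) / q (\<tau> m))"
text \<open>The labels at which \<open>a\<close> may have a corner: the particle that separates
  initial from entering ones, and the particles that start at a corner of the data.\<close>

definition "E = {0} \<union> R ` E1 \<union> (\<lambda>t. - N t) ` E0"

lemma E_finite: "finite E" using E01 by (simp add: E_def)

lemma ad_measurable: "ad \<in> borel_measurable borel"
proof -
  have [measurable]: "\<xi> \<in> borel_measurable borel" "\<tau> \<in> borel_measurable borel" "S1 \<in> borel_measurable borel"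
      "q \<in> borel_measurable borel" "c \<in> borel_measurable borel" "S0d \<in> borel_measurable borel" "S1d \<in> borel_measurable borel"
    by (auto intro!: borel_measurable_continuous_onI \<xi>_cont \<tau>_cont S1_cont q_cont c_cont S0d S1d)
  show ?thesis unfolding ad_def by measurable
qed

lemma a_deriv:
  assumes m: "m \<notin> E"
  shows "(a has_real_derivative ad m) (at m)"
proof (cases "0 < m")
  case True
  have cont: "isCont (inv R) m"
    using \<xi>_cont[of "{0<..}"] True
      continuous_on_eq[OF \<xi>_cont[of "{0<..}"], of "inv R"]
    by (auto simp: \<xi>_def max_def continuous_on_eq_continuous_at)
  have dR: "(inv R has_real_derivative inverse (S1 (inv R m))) (at m)"
    using S1_bounds(1)[of "inv R m"] Sm cont
    by (intro DERIV_inverse_function[where a="m - 1" and b="m + 1", OF R_deriv]) auto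
  have "inv R m \<notin> E1"
  proof
    assume "inv R m \<in> E1"
    then have "R (inv R m) \<in> E" unfolding E_def by blast
    then show False using m by simp
  qed
  from DERIV_chain2[OF S1d(1)[OF this] dR]
  have "((\<lambda>m. S1 (inv R m)) has_real_derivative ad m) (at m)"
    using True by (simp add: ad_def \<xi>_def max_def divide_inverse)
  moreover have "\<forall>\<^sub>F m in nhds m. m \<in> {0<..}" by (rule eventually_nhds_in_open) (use True in auto)
  then have ev: "\<forall>\<^sub>F m in nhds m. S1 (inv R m) = a m"
    by eventually_elim (simp add: a_def b_pos \<tau>_pos \<xi>_def max_def)
  ultimately show ?thesis using DERIV_cong_ev[OF refl ev refl] by blast
next
  case False
  then have m0: "m < 0" using m by (auto simp: E_def)
  have cont: "isCont (inv N) (- m)"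
  proof -
    have "continuous_on {0<..} (\<lambda>y. \<tau> (- y))" by (intro continuous_on_compose2[OF \<tau>_cont] continuous_intros) auto
    then have "continuous_on {0<..} (inv N)" by (rule continuous_on_eq) (auto simp: \<tau>_def max_def)
    then show ?thesis using m0 by (simp add: continuous_on_eq_continuous_at)
  qed
  have dN: "(inv N has_real_derivative inverse (q (inv N (- m)))) (at (- m))"
    using q_pos[of "inv N (- m)"] cont
    by (intro DERIV_inverse_function[where a="- m - 1" and b="- m + 1", OF N_deriv]) auto
  have dN': "((\<lambda>m. inv N (- m)) has_real_derivative inverse (q (inv N (- m))) * (- 1)) (at m)"
    by (rule DERIV_chain2[where f="inv N" and g=uminus, OF dN]) (auto intro!: derivative_eq_intros)
  have "inv N (- m) \<notin> E0"
  proof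
    assume "inv N (- m) \<in> E0"
    then have "- N (inv N (- m)) \<in> E" unfolding E_def by blast
    then show False using m by simp
  qed
  from DERIV_add[OF DERIV_chain2[where f=S0 and g="\<lambda>m. inv N (- m)", OF S0d(1)[OF this] dN']
      DERIV_chain2[where f=C and g="\<lambda>m. inv N (- m)", OF C_deriv dN']]
  have "((\<lambda>m. S0 (inv N (- m)) + C (inv N (- m))) has_real_derivative ad m) (at m)"
    using m0 by (simp add: ad_def \<tau>_def max_def divide_inverse algebra_simps)
  moreover have "\<forall>\<^sub>F m in nhds m. m \<in> {..<0}" by (rule eventually_nhds_in_open) (use m0 in auto)
  then have ev: "\<forall>\<^sub>F m in nhds m. S0 (inv N (- m)) + C (inv N (- m)) = a m"
    by eventually_elim (simp add: a_def b_neg \<tau>_def max_def)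
  ultimately show ?thesis using DERIV_cong_ev[OF refl ev refl] by blast
qed

section \<open>Densities of the Eulerian fields\<close>

lemma joint_bounded:
  assumes "continuous_on UNIV (\<lambda>q. f (fst q) (snd q) :: real)"
  obtains M where "0 \<le> M" "\<And>t x. t \<in> {0..T} \<Longrightarrow> x \<in> {0..L} \<Longrightarrow> \<bar>f t x\<bar> \<le> M"
proof -
  have "compact ({0..T} \<times> {0..L})" by (intro compact_Times compact_Icc)
  then have "bounded ((\<lambda>q. f (fst q) (snd q)) ` ({0..T} \<times> {0..L}))"
    using assms by (intro compact_imp_bounded compact_continuous_image) (auto intro: continuous_on_subset)
  then obtain M where M: "\<forall>q\<in>{0..T} \<times> {0..L}. \<bar>f (fst q) (snd q)\<bar> \<le> M"
    by (auto simp: bounded_iff)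
  have "\<bar>f t x\<bar> \<le> max 0 M" if "t \<in> {0..T}" "x \<in> {0..L}" for t x
    using bspec[OF M, of "(t, x)"] that by auto
  then show thesis by (intro that[of "max 0 M"]) auto
qed

lemma ad_bounded: obtains M where "0 \<le> M" "\<And>t x. t \<in> {0..T} \<Longrightarrow> x \<in> {0..L} \<Longrightarrow> \<bar>ad (lab t x)\<bar> \<le> M"
proof -
  obtain Mc where Mc: "0 \<le> Mc" "\<And>t. t \<in> {0..T} \<Longrightarrow> \<bar>c t\<bar> \<le> Mc"
    by (rule cont_bounded_Icc[OF continuous_on_subset[OF c_cont subset_UNIV], of 0 T]) (rule that)
  have \<Lambda>0: "0 \<le> \<Lambda>" using S0d(3)[of 0] by linarith
  define M where "M = \<Lambda> / Sm + (\<Lambda> + Mc) / (vm * Sm)"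
  have M: "\<Lambda> / Sm \<le> M" "(\<Lambda> + Mc) / (vm * Sm) \<le> M" using \<Lambda>0 Mc(1) Sm vmSm by (auto simp: M_def)
  have "\<bar>ad (lab t x)\<bar> \<le> M" if tx: "t \<in> {0..T}" "x \<in> {0..L}" for t x
  proof (cases "0 < lab t x")
    case True
    have "\<bar>S1d (\<xi> (lab t x))\<bar> / \<bar>S1 (\<xi> (lab t x))\<bar> \<le> \<Lambda> / Sm"
      using S1d(3) S1_bounds(1)[of "\<xi> (lab t x)"] Sm \<Lambda>0 by (intro frac_le) auto
    then show ?thesis using True M by (simp add: ad_def abs_divide)
  next
    case False
    have "\<tau> (lab t x) \<in> {0..T}" using \<tau>_le_iff[of t "lab t x"] lab_range[OF tx] tx \<tau>_nonneg[of "lab t x"] by auto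
    then have "\<bar>S0d (\<tau> (lab t x)) + c (\<tau> (lab t x))\<bar> \<le> \<Lambda> + Mc"
      using S0d(3)[of "\<tau> (lab t x)"] Mc(2) by (meson abs_triangle_ineq add_mono order_trans)
    then have "\<bar>S0d (\<tau> (lab t x)) + c (\<tau> (lab t x))\<bar> / \<bar>q (\<tau> (lab t x))\<bar> \<le> (\<Lambda> + Mc) / (vm * Sm)"
      using q_lower[of "\<tau> (lab t x)"] vmSm by (intro frac_le) auto
    moreover have "\<bar>ad (lab t x)\<bar> = \<bar>S0d (\<tau> (lab t x)) + c (\<tau> (lab t x))\<bar> / \<bar>q (\<tau> (lab t x))\<bar>"
      using False by (simp only: ad_def if_False abs_divide abs_minus_cancel)
    ultimately show ?thesis using M by linarith
  qed
  moreover have "0 \<le> M" using M(1) \<Lambda>0 Sm by (meson divide_nonneg_pos order_trans)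
  ultimately show thesis using that by blast
qed

text \<open>Cutting off outside the closed rectangle makes the densities bounded everywhere.\<close>

definition "cutoff f t x = (if t \<in> {0..T} \<and> x \<in> {0..L} then f t x else (0::real))"

lemma cutoff_in [simp]: "t \<in> {0..T} \<Longrightarrow> x \<in> {0..L} \<Longrightarrow> cutoff f t x = f t x" by (auto simp: cutoff_def)

lemma cutoff_measurable:
  assumes "(\<lambda>q. f (fst q) (snd q)) \<in> borel_measurable borel"
  shows "(\<lambda>q. cutoff f (fst q) (snd q)) \<in> borel_measurable borel"
proof -
  have [measurable]: "(\<lambda>q. f (fst q) (snd q)) \<in> borel_measurable (borel \<Otimes>\<^sub>M borel)" using assms by (simp add: borel_prod)
  have "(\<lambda>q. cutoff f (fst q) (snd q)) \<in> borel_measurable (borel \<Otimes>\<^sub>M borel)"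
    unfolding cutoff_def by measurable
  then show ?thesis by (simp add: borel_prod)
qed

definition "Ax = cutoff (\<lambda>t x. ad (lab t x) * A t x)"
text \<open>The chain rule for A = a (lab) - C, where the label at a fixed point decreases at the
  rate v A.\<close>

definition "At = cutoff (\<lambda>t x. - (ad (lab t x) * (v t x * A t x)) - c t)"
definition "Dt = cutoff (\<lambda>t x. - At t x / (A t x)\<^sup>2)"

lemma joint_measurable: "continuous_on UNIV (\<lambda>q. f (fst q) (snd q) :: real) \<Longrightarrow> (\<lambda>q. f (fst q) (snd q)) \<in> borel_measurable borel"
  by (rule borel_measurable_continuous_onI)

lemma measurable_facts [measurable]:
  "(\<lambda>q. ad (lab (fst q) (snd q))) \<in> borel_measurable borel"
  "(\<lambda>q. A (fst q) (snd q)) \<in> borel_measurable borel"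
  "(\<lambda>q. v (fst q) (snd q)) \<in> borel_measurable borel"
  "(\<lambda>q. K (fst q) (snd q)) \<in> borel_measurable borel"
  "(\<lambda>q::real \<times> real. c (fst q)) \<in> borel_measurable borel"
proof -
  show "(\<lambda>q::real \<times> real. c (fst q)) \<in> borel_measurable borel"
    by (intro borel_measurable_continuous_onI continuous_on_compose2[OF c_cont] continuous_intros) auto
qed (use measurable_compose[OF joint_measurable[OF lab_joint_cont] ad_measurable]
    joint_measurable[OF A_joint_cont] joint_measurable[OF v_joint_cont] joint_measurable[OF K_joint_cont] in auto)

lemma Ax_measurable: "(\<lambda>q. Ax (fst q) (snd q)) \<in> borel_measurable borel"
  unfolding Ax_def by (rule cutoff_measurable) measurable

lemma At_measurable: "(\<lambda>q. At (fst q) (snd q)) \<in> borel_measurable borel"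
  unfolding At_def by (rule cutoff_measurable) measurable

lemma Dt_measurable: "(\<lambda>q. Dt (fst q) (snd q)) \<in> borel_measurable borel"
  unfolding Dt_def by (rule cutoff_measurable) (use At_measurable in measurable)

lemma cutoff_bounded:
  assumes "\<And>t x. t \<in> {0..T} \<Longrightarrow> x \<in> {0..L} \<Longrightarrow> \<bar>f t x\<bar> \<le> M" "0 \<le> M"
  shows "\<bar>cutoff f t x\<bar> \<le> M"
  using assms by (simp add: cutoff_def)

lemma Ax_bounded: "\<exists>M. \<forall>t x. \<bar>Ax t x\<bar> \<le> M"
proof -
  obtain M1 where M1: "0 \<le> M1" "\<And>t x. t \<in> {0..T} \<Longrightarrow> x \<in> {0..L} \<Longrightarrow> \<bar>ad (lab t x)\<bar> \<le> M1" by (rule ad_bounded) (rule that)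
  obtain M2 where M2: "0 \<le> M2" "\<And>t x. t \<in> {0..T} \<Longrightarrow> x \<in> {0..L} \<Longrightarrow> \<bar>A t x\<bar> \<le> M2" by (rule joint_bounded[OF A_joint_cont]) (rule that)
  have "\<bar>Ax t x\<bar> \<le> M1 * M2" for t x
    unfolding Ax_def by (rule cutoff_bounded) (use M1 M2 in \<open>auto simp: abs_mult intro!: mult_mono\<close>)
  then show ?thesis by blast
qed

lemma At_bounded: "\<exists>M\<ge>0. \<forall>t x. \<bar>At t x\<bar> \<le> M"
proof -
  obtain M1 where M1: "0 \<le> M1" "\<And>t x. t \<in> {0..T} \<Longrightarrow> x \<in> {0..L} \<Longrightarrow> \<bar>ad (lab t x)\<bar> \<le> M1" by (rule ad_bounded) (rule that)
  have cvA: "continuous_on UNIV (\<lambda>q. v (fst q) (snd q) * A (fst q) (snd q))" by (intro continuous_intros v_joint_cont A_joint_cont)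
  obtain M2 where M2: "0 \<le> M2" "\<And>t x. t \<in> {0..T} \<Longrightarrow> x \<in> {0..L} \<Longrightarrow> \<bar>v t x * A t x\<bar> \<le> M2"
    by (rule joint_bounded[of "\<lambda>t x. v t x * A t x", OF cvA]) (rule that)
  have cc: "continuous_on UNIV (\<lambda>q::real \<times> real. c (fst q))" by (intro continuous_on_compose2[OF c_cont] continuous_intros) auto
  obtain M3 where M3: "0 \<le> M3" "\<And>t x::real. t \<in> {0..T} \<Longrightarrow> x \<in> {0..L} \<Longrightarrow> \<bar>c t\<bar> \<le> M3"
    by (rule joint_bounded[of "\<lambda>t x. c t", OF cc]) (rule that)
  have "\<bar>At t x\<bar> \<le> M1 * M2 + M3" for t x
    unfolding At_def
  proof (rule cutoff_bounded)
    fix t x assume tx: "t \<in> {0..T}" "x \<in> {0..L}"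
    have "\<bar>ad (lab t x) * (v t x * A t x)\<bar> \<le> M1 * M2"
      unfolding abs_mult[of "ad (lab t x)"] by (intro mult_mono M1 M2 tx) auto
    then show "\<bar>- (ad (lab t x) * (v t x * A t x)) - c t\<bar> \<le> M1 * M2 + M3" using M3(2)[OF tx] by linarith
  qed (use M1 M2 M3 in simp)
  moreover have "0 \<le> M1 * M2 + M3" using M1 M2 M3 by simp
  ultimately show ?thesis by blast
qed

lemma Dt_bounded: "\<exists>M\<ge>0. \<forall>t x. \<bar>Dt t x\<bar> \<le> M"
proof -
  obtain M where M: "0 \<le> M" "\<And>t x. \<bar>At t x\<bar> \<le> M" using At_bounded by blast
  have "\<bar>Dt t x\<bar> \<le> M / \<delta>\<^sup>2" for t x
    unfolding Dt_def
  proof (rule cutoff_bounded)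
    fix t x assume tx: "t \<in> {0..T}" "x \<in> {0..L}"
    show "\<bar>- At t x / (A t x)\<^sup>2\<bar> \<le> M / \<delta>\<^sup>2"
      unfolding abs_divide abs_minus by (rule frac_le) (use M A_ge[OF tx] \<delta> in \<open>auto intro!: power_mono\<close>)
  qed (use M in simp)
  then show ?thesis using M by (meson zero_le_divide_iff zero_le_power2)
qed

lemma slice_measurable_of:
  assumes "(\<lambda>q. f (fst q) (snd q) :: real) \<in> borel_measurable borel"
  shows "f (t::real) \<in> borel_measurable borel" "(\<lambda>t. f t (x::real)) \<in> borel_measurable borel"
  using measurable_compose[OF _ assms, of "\<lambda>x. (t, x)" borel] measurable_compose[OF _ assms, of "\<lambda>t. (t, x)" borel] by simp_all

lemma A_lac_x: 
  assumes t: "t \<in> {0..T}" shows "lac 0 L (A t) (Ax t)"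
proof -
  obtain M where M: "\<And>t x. \<bar>Ax t x\<bar> \<le> M" using Ax_bounded by blast
  show ?thesis
  proof (rule lac_deriv[where E="lab t -` E"])
    show "continuous_on {0..L} (A t)" by (intro continuous_on_compose_pair[OF A_joint_cont] continuous_intros)
    show "finite (lab t -` E)"
      by (rule finite_vimageI[OF E_finite]) (metis (no_types) injI H_lab)
    fix x assume x: "0 < x" "x < L" "x \<notin> lab t -` E"
    have "((\<lambda>x. a (lab t x) - C t) has_real_derivative ad (lab t x) * A t x) (at x)"
      using x by (auto intro!: derivative_eq_intros DERIV_chain2[OF a_deriv lab_deriv_x])
    moreover have "\<forall>\<^sub>F y in nhds x. y \<in> {0<..<L}" by (rule eventually_nhds_in_open) (use x in auto)
    then have ev: "\<forall>\<^sub>F y in nhds x. a (lab t y) - C t = A t y"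
      by eventually_elim (use A_eq[OF t] in auto)
    ultimately show "(A t has_real_derivative Ax t x) (at x)"
      using DERIV_cong_ev[OF refl ev refl] x t by (simp add: Ax_def)
  qed (use M slice_measurable_of[OF Ax_measurable] in auto)
qed

text \<open>At a fixed \<open>x\<close> the label strictly decreases in time because the velocity is
  at least \<open>vm > 0\<close>; each of the finitely many exceptional labels is therefore met at
  most once, and the set of exceptional times is finite.\<close>

lemma A_lac_t: 
  assumes x: "x \<in> {0..L}" shows "lac 0 T (\<lambda>t. A t x) (\<lambda>t. At t x)"
proof -
  obtain M where M: "\<And>t x. \<bar>At t x\<bar> \<le> M" using At_bounded by blast
  have anti: "lab t x < lab s x" if st: "0 \<le> s" "s < t" "t \<le> T" for s t
  proof -
    obtain z where z: "s < z" "z < t" "lab t x - lab s x = (t - s) * (- (v z x * A z x))"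
      using MVT2[OF st(2), of "\<lambda>t. lab t x" "\<lambda>t. - (v t x * A t x)"] lab_deriv_t by blast
    have "0 < v z x" using v_ge[of z x] x z st vm by (auto intro: order_less_le_trans)
    then have "0 < (t - s) * (v z x * A z x)" using A_pos[of z x] st by simp
    then show ?thesis using z by simp
  qed
  have inj: "inj_on (\<lambda>t. lab t x) {0..T}"
  proof (rule inj_onI)
    fix s t assume st: "s \<in> {0..T}" "t \<in> {0..T}" "lab s x = lab t x"
    show "s = t" using anti[of s t] anti[of t s] st by (cases s t rule: linorder_cases) auto
  qed
  show ?thesis
  proof (rule lac_deriv[where E="(\<lambda>t. lab t x) -` E \<inter> {0..T}"])
    show "continuous_on {0..T} (\<lambda>t. A t x)" by (intro continuous_on_compose_pair[OF A_joint_cont] continuous_intros)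
    show "finite ((\<lambda>t. lab t x) -` E \<inter> {0..T})"
      by (rule finite_vimage_IntI[OF E_finite inj])
    fix t assume t: "0 < t" "t < T" "t \<notin> (\<lambda>t. lab t x) -` E \<inter> {0..T}"
    have "((\<lambda>t. a (lab t x) - C t) has_real_derivative ad (lab t x) * (- (v t x * A t x)) - c t) (at t)"
    proof (rule DERIV_diff[OF DERIV_chain2[where f=a and g="\<lambda>t. lab t x", OF a_deriv lab_deriv_t] C_deriv])
      show "lab t x \<notin> E" using t by auto
    qed
    moreover have "\<forall>\<^sub>F y in nhds t. y \<in> {0<..<T}" by (rule eventually_nhds_in_open) (use t in auto)
    then have ev: "\<forall>\<^sub>F y in nhds t. a (lab y x) - C y = A y x"
      by eventually_elim (use A_eq[OF _ x] in auto)
    ultimately show "((\<lambda>t. A t x) has_real_derivative At t x) (at t)"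
      using DERIV_cong_ev[OF refl ev refl] x t by (simp add: At_def)
  qed (use M slice_measurable_of[OF At_measurable] in auto)
qed

lemma invA_lac_x: "t \<in> {0..T} \<Longrightarrow> lac 0 L (\<lambda>x. 1 / A t x) (\<lambda>x. - Ax t x / (A t x)\<^sup>2)"
  by (rule lac_inverse[OF A_lac_x \<delta>(1)])
    (use A_ge slice_measurable_of(1)[OF Ax_measurable] slice_measurable_of(1)[OF measurable_facts(2)] in auto)

lemma invA_lac_t: "x \<in> {0..L} \<Longrightarrow> lac 0 T (\<lambda>t. 1 / A t x) (\<lambda>t. Dt t x)"
  by (rule lac_inverse[OF A_lac_t \<delta>(1)]) (use A_ge slice_measurable_of(2)[OF Dt_measurable] in \<open>auto simp: Dt_def\<close>)

lemma invA_le: "t \<in> {0..T} \<Longrightarrow> x \<in> {0..L} \<Longrightarrow> \<bar>1 / A t x\<bar> \<le> 1 / \<delta>"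
  using A_ge[of t x] A_pos[of t x] \<delta> by (simp add: frac_le)

lemma K_lac_x: "t \<in> {0..T} \<Longrightarrow> lac 0 L (K t) (\<lambda>x. 1 / A t x)"
  by (rule lac_deriv[where E="{}" and M="1/\<delta>"])
    (use K_deriv_x invA_le slice_measurable_of(1)[OF measurable_facts(2)] in \<open>auto intro!: continuous_on_compose_pair[OF K_joint_cont] continuous_intros\<close>)

lemma v_lac_x: "t \<in> {0..T} \<Longrightarrow> lac 0 L (v t) (\<lambda>x. c t / A t x)"
proof -
  assume t: "t \<in> {0..T}"
  have "lac 0 L (\<lambda>x. vin t + c t * K t x) (\<lambda>x. 0 + c t * (1 / A t x))"
    by (rule lac_add[OF lac_const lac_mult[OF lac_const K_lac_x[OF t]]])
      (use slice_measurable_of(1)[OF measurable_facts(2)] in auto)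
  then have "lac 0 L (\<lambda>x. vin t + c t * K t x) (\<lambda>x. c t / A t x)" by simp
  then show ?thesis by (rule cong_lac) (simp add: v_eq[OF t])
qed

text \<open>The time density of \<open>K\<close>, obtained by differentiating the integral of 1 / A
  over [0, x] under the integral sign.\<close>

definition "Kt = partial_prim Dt"

lemma Kt_measurable: "(\<lambda>q. Kt (fst q) (snd q)) \<in> borel_measurable borel"
  unfolding Kt_def using Dt_bounded partial_prim_measurable[OF Dt_measurable] by blast

lemma Kt_bounded: "\<exists>M\<ge>0. \<forall>t. \<forall>x\<in>{0..L}. \<bar>Kt t x\<bar> \<le> M"
proof -
  obtain M where M: "0 \<le> M" "\<And>t x. \<bar>Dt t x\<bar> \<le> M" using Dt_bounded by blast
  have "\<bar>Kt t x\<bar> \<le> M * L" if "x \<in> {0..L}" for t x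
  proof -
    have "\<bar>Kt t x\<bar> \<le> M * x" unfolding Kt_def using partial_prim_bound[OF Dt_measurable M(2)] that by simp
    also have "\<dots> \<le> M * L" using that M by (intro mult_left_mono) auto
    finally show ?thesis .
  qed
  then show ?thesis using M L by (metis less_imp_le mult_nonneg_nonneg)
qed

lemma Kt_lac_x: "lac 0 L (Kt t) (Dt t)"
  unfolding Kt_def using Dt_bounded partial_prim_lac[OF Dt_measurable] by blast

text \<open>Exchanging the integrations over time and space, the inner time integral of
  \<open>Dt\<close> is the increment of 1 / A, whose space integral is the increment of
  \<open>K\<close>.\<close>

lemma K_lac_t: 
  assumes x: "x \<in> {0..L}" shows "lac 0 T (\<lambda>t. K t x) (\<lambda>t. Kt t x)"
  unfolding lac_def
proof (intro conjI allI impI)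
  show m: "(\<lambda>t. Kt t x) \<in> borel_measurable borel" by (rule slice_measurable_of(2)[OF Kt_measurable])
  obtain M where M: "\<And>t. \<bar>Kt t x\<bar> \<le> M" using Kt_bounded x by blast
  then show "\<exists>M. \<forall>t\<in>{0..T}. \<bar>Kt t x\<bar> \<le> M" by blast
  obtain M' where M': "\<And>t x. \<bar>Dt t x\<bar> \<le> M'" using Dt_bounded by blast
  fix s t assume st: "0 \<le> s \<and> s \<le> t \<and> t \<le> T"
  have int: "((\<lambda>y. 1 / A r y) has_integral K r x) {0..x}" if "r \<in> {0..T}" for r
    using lac_D(2)[OF K_lac_x[OF that], of 0 x] x by (simp add: K_inlet)
  have "integral {s..t} (\<lambda>r. Kt r x) = integral {0..x} (\<lambda>y. integral {s..t} (\<lambda>r. Dt r y))"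
    unfolding Kt_def by (rule partial_prim_swap[OF Dt_measurable M'])
  also have "\<dots> = integral {0..x} (\<lambda>y. 1 / A t y - 1 / A s y)"
  proof (rule integral_cong)
    fix y assume "y \<in> {0..x}"
    then have "y \<in> {0..L}" using x by auto
    from lac_D(2)[OF invA_lac_t[OF this], of s t] st
    show "integral {s..t} (\<lambda>r. Dt r y) = 1 / A t y - 1 / A s y" by (intro integral_unique) auto
  qed
  also have "\<dots> = K t x - K s x"
    using has_integral_diff[OF int[of t] int[of s]] st by (intro integral_unique) auto
  finally have "integral {s..t} (\<lambda>r. Kt r x) = K t x - K s x" .
  moreover have "(\<lambda>r. Kt r x) integrable_on {s..t}" by (rule bounded_borel_integrable[OF m M])
  ultimately show "((\<lambda>r. Kt r x) has_integral K t x - K s x) {s..t}" by (metis integrable_integral)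
qed

definition "cd t = (dvL t - dvin t) / K t L - (vL t - vin t) * Kt t L / (K t L)\<^sup>2"

lemma dv_measurable: "dvin \<in> borel_measurable borel" "dvL \<in> borel_measurable borel"
  using lac_D(1)[OF dvin] lac_D(1)[OF dvL] by auto

lemma cd_measurable: "cd \<in> borel_measurable borel"
proof -
  have "vin \<in> borel_measurable borel" "vL \<in> borel_measurable borel"
    by (auto intro!: borel_measurable_continuous_onI vin_cont vL_cont)
  then show ?thesis unfolding cd_def
    using dv_measurable slice_measurable_of(2)[OF measurable_facts(4), of L] slice_measurable_of(2)[OF Kt_measurable, of L]
    by measurable
qed

text \<open>Regularity of the rate, so far only continuous, is recovered from the fixed point
  relation \<open>c = (vL - vin) / K\<close>: all ingredients at the outlet are Lipschitz in time,
  and the denominator is at least \<open>L / SM\<close>.\<close>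

lemma c_lac: "lac 0 T c cd"
proof -
  have Lin: "L \<in> {0..L}" using L by simp
  have m: "vin \<in> borel_measurable borel" "vL \<in> borel_measurable borel"
    by (auto intro!: borel_measurable_continuous_onI vin_cont vL_cont)
  note KL = slice_measurable_of(2)[OF measurable_facts(4), of L] slice_measurable_of(2)[OF Kt_measurable, of L]
  have 1: "lac 0 T (\<lambda>t. 1 / K t L) (\<lambda>t. - Kt t L / (K t L)\<^sup>2)"
    by (rule lac_inverse[OF K_lac_t[OF Lin], of "L / SM"]) (use L SM K_outlet_lower KL in auto)
  have 2: "lac 0 T (\<lambda>t. vL t + -1 * vin t) (\<lambda>t. dvL t + -1 * dvin t)"
    by (rule lac_add[OF dvL lac_mult[OF lac_const dvin]]) (use dv_measurable in auto)
  have "lac 0 T (\<lambda>t. (vL t + -1 * vin t) * (1 / K t L)) cd"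
    by (rule lac_mult[OF 2 1 cd_measurable]) (simp add: cd_def diff_divide_distrib)
  then show ?thesis by (rule cong_lac) (simp add: c_K)
qed

definition "vt = cutoff (\<lambda>t x. dvin t + (cd t * K t x + c t * Kt t x))"
definition "vtx t x = cd t * (1 / A t x) + c t * Dt t x"

lemma vt_measurable: "(\<lambda>q. vt (fst q) (snd q)) \<in> borel_measurable borel"
  unfolding vt_def
proof (rule cutoff_measurable)
  have [measurable]: "(\<lambda>q::real \<times> real. dvin (fst q)) \<in> borel_measurable borel" "(\<lambda>q::real \<times> real. cd (fst q)) \<in> borel_measurable borel"
    "(\<lambda>q. Kt (fst q) (snd q)) \<in> borel_measurable borel"
    using measurable_compose[OF _ dv_measurable(1), of fst "borel :: (real \<times> real) measure"]
      measurable_compose[OF _ cd_measurable, of fst "borel :: (real \<times> real) measure"] Kt_measurable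
      borel_measurable_continuous_onI[OF continuous_on_fst[OF continuous_on_id]] by auto
  show "(\<lambda>q. dvin (fst q) + (cd (fst q) * K (fst q) (snd q) + c (fst q) * Kt (fst q) (snd q))) \<in> borel_measurable borel"
    by measurable
qed

lemma vtx_measurable: "(\<lambda>q. vtx (fst q) (snd q)) \<in> borel_measurable borel"
  unfolding vtx_def
proof -
  have [measurable]: "(\<lambda>q::real \<times> real. cd (fst q)) \<in> borel_measurable borel"
    "(\<lambda>q. Dt (fst q) (snd q)) \<in> borel_measurable borel"
    using measurable_compose[OF _ cd_measurable, of fst "borel :: (real \<times> real) measure"] Dt_measurable
      borel_measurable_continuous_onI[OF continuous_on_fst[OF continuous_on_id]] by auto
  show "(\<lambda>q. cd (fst q) * (1 / A (fst q) (snd q)) + c (fst q) * Dt (fst q) (snd q)) \<in> borel_measurable borel"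
    by measurable
qed

lemma v_lac_t: 
  assumes x: "x \<in> {0..L}" shows "lac 0 T (\<lambda>t. v t x) (\<lambda>t. vt t x)"
proof -
  have k: "(\<lambda>t. cd t * K t x + c t * Kt t x) \<in> borel_measurable borel"
    using cd_measurable slice_measurable_of(2)[OF measurable_facts(4), of x] slice_measurable_of(2)[OF Kt_measurable, of x]
      borel_measurable_continuous_onI[OF c_cont] by measurable
  have "lac 0 T (\<lambda>t. vin t + c t * K t x) (\<lambda>t. dvin t + (cd t * K t x + c t * Kt t x))"
    by (rule lac_add[OF dvin lac_mult[OF c_lac K_lac_t[OF x] k]]) simp
  then have 1: "lac 0 T (\<lambda>t. v t x) (\<lambda>t. dvin t + (cd t * K t x + c t * Kt t x))"
    by (rule cong_lac) (simp add: v_eq)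
  obtain M where M: "\<forall>t\<in>{0..T}. \<bar>dvin t + (cd t * K t x + c t * Kt t x)\<bar> \<le> M" using lac_bound[OF 1] by blast
  show ?thesis unfolding lac_def
  proof (intro conjI allI impI slice_measurable_of(2)[OF vt_measurable])
    show "\<exists>M. \<forall>t\<in>{0..T}. \<bar>vt t x\<bar> \<le> M" using M x by (auto simp: vt_def)
    fix s t assume st: "0 \<le> s \<and> s \<le> t \<and> t \<le> T"
    show "((\<lambda>t. vt t x) has_integral v t x - v s x) {s..t}"
      by (rule has_integral_eq[OF _ lac_D(2)[OF 1, of s t]]) (use st x in \<open>auto simp: vt_def\<close>)
  qed
qed

lemma cd_bounded: "\<exists>M\<ge>0. \<forall>t\<in>{0..T}. \<bar>cd t\<bar> \<le> M"
  using lac_bound[OF c_lac] by blast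

lemma vtx_bounded: "\<exists>M\<ge>0. \<forall>t\<in>{0..T}. \<forall>x\<in>{0..L}. \<bar>vtx t x\<bar> \<le> M"
proof -
  obtain M1 where M1: "0 \<le> M1" "\<And>t. t \<in> {0..T} \<Longrightarrow> \<bar>cd t\<bar> \<le> M1" using cd_bounded by blast
  obtain M2 where M2: "0 \<le> M2" "\<And>t x. \<bar>Dt t x\<bar> \<le> M2" using Dt_bounded by blast
  obtain M3 where M3: "0 \<le> M3" "\<And>t. t \<in> {0..T} \<Longrightarrow> \<bar>c t\<bar> \<le> M3"
    by (rule cont_bounded_Icc[OF continuous_on_subset[OF c_cont subset_UNIV], of 0 T]) (rule that)
  have "\<bar>vtx t x\<bar> \<le> M1 * (1 / \<delta>) + M3 * M2" if "t \<in> {0..T}" "x \<in> {0..L}" for t x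
  proof -
    have "\<bar>cd t * (1 / A t x)\<bar> \<le> M1 * (1 / \<delta>)" unfolding abs_mult
      by (intro mult_mono M1 invA_le that) auto
    moreover have "\<bar>c t * Dt t x\<bar> \<le> M3 * M2" unfolding abs_mult by (intro mult_mono M3 M2 that) auto
    ultimately show ?thesis unfolding vtx_def by linarith
  qed
  moreover have "0 \<le> M1 * (1 / \<delta>) + M3 * M2" using M1 M2 M3 \<delta> by simp
  ultimately show ?thesis by blast
qed

lemma vt_bounded: "\<exists>M\<ge>0. \<forall>t x. \<bar>vt t x\<bar> \<le> M"
proof -
  obtain M1 where M1: "0 \<le> M1" "\<And>t. t \<in> {0..T} \<Longrightarrow> \<bar>cd t\<bar> \<le> M1" using cd_bounded by blast
  obtain M2 where M2: "0 \<le> M2" "\<And>t x. x \<in> {0..L} \<Longrightarrow> \<bar>Kt t x\<bar> \<le> M2" using Kt_bounded by blast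
  obtain M3 where M3: "0 \<le> M3" "\<And>t. t \<in> {0..T} \<Longrightarrow> \<bar>c t\<bar> \<le> M3"
    by (rule cont_bounded_Icc[OF continuous_on_subset[OF c_cont subset_UNIV], of 0 T]) (rule that)
  obtain M4 where M4: "0 \<le> M4" "\<And>t x. t \<in> {0..T} \<Longrightarrow> x \<in> {0..L} \<Longrightarrow> \<bar>K t x\<bar> \<le> M4"
    by (rule joint_bounded[OF K_joint_cont]) (rule that)
  obtain M5 where M5: "0 \<le> M5" "\<And>t. t \<in> {0..T} \<Longrightarrow> \<bar>dvin t\<bar> \<le> M5" using lac_bound[OF dvin] by blast
  have "\<bar>vt t x\<bar> \<le> M5 + (M1 * M4 + M3 * M2)" for t x
    unfolding vt_def
  proof (rule cutoff_bounded)
    fix t x assume tx: "t \<in> {0..T}" "x \<in> {0..L}"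
    have "\<bar>cd t * K t x\<bar> \<le> M1 * M4" unfolding abs_mult by (intro mult_mono M1 M4 tx) auto
    moreover have "\<bar>c t * Kt t x\<bar> \<le> M3 * M2" unfolding abs_mult by (intro mult_mono M3 M2 tx) auto
    ultimately show "\<bar>dvin t + (cd t * K t x + c t * Kt t x)\<bar> \<le> M5 + (M1 * M4 + M3 * M2)"
      using M5(2)[OF tx(1)] by linarith
  qed (use M1 M2 M3 M4 M5 in simp)
  moreover have "0 \<le> M5 + (M1 * M4 + M3 * M2)" using M1 M2 M3 M4 M5 by simp
  ultimately show ?thesis by blast
qed

text \<open>Yields the mixed second derivative: for a fixed time \<open>vt\<close> depends on
  \<open>x\<close> only through \<open>K\<close> and \<open>Kt\<close>, whose space densities are 1
  / A and \<open>Dt\<close>.\<close>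

lemma vt_lac_x: 
  assumes t: "t \<in> {0..T}" shows "lac 0 L (vt t) (vtx t)"
proof -
  have m: "A t \<in> borel_measurable borel" "Dt t \<in> borel_measurable borel"
    by (rule slice_measurable_of(1)[OF measurable_facts(2)], rule slice_measurable_of(1)[OF Dt_measurable])
  have 1: "lac 0 L (\<lambda>x. cd t * K t x) (\<lambda>x. cd t * (1 / A t x))"
    by (rule lac_mult[OF lac_const K_lac_x[OF t]]) (use m in auto)
  have 2: "lac 0 L (\<lambda>x. c t * Kt t x) (\<lambda>x. c t * Dt t x)"
    by (rule lac_mult[OF lac_const Kt_lac_x]) (use m in auto)
  have "lac 0 L (\<lambda>x. dvin t + (cd t * K t x + c t * Kt t x)) (\<lambda>x. 0 + (cd t * (1 / A t x) + c t * Dt t x))"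
    by (rule lac_add[OF lac_const lac_add[OF 1 2]])
  then have "lac 0 L (\<lambda>x. dvin t + (cd t * K t x + c t * Kt t x)) (vtx t)" by (simp add: vtx_def[abs_def])
  then show ?thesis by (rule cong_lac) (use t in \<open>simp add: vt_def\<close>)
qed

end

section \<open>Weak derivatives from one-dimensional densities\<close>

lemma QT_open: "open (QT T L)"
  unfolding QT_def by (intro open_Times) auto

lemma closure_QT: "0 < T \<Longrightarrow> 0 < L \<Longrightarrow> closure (QT T L) = {0..T} \<times> {0..L}"
  unfolding QT_def by (simp add: closure_Times)

lemma QT_sub: "QT T L \<subseteq> {0..T} \<times> {0..L}" by (auto simp: QT_def)

lemma QT_borel [measurable]: "QT T L \<in> sets borel" by (simp add: QT_open borel_open)

lemma bounded_on_integrable: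
  fixes u :: "real \<times> real \<Rightarrow> real"
  assumes u: "u \<in> borel_measurable borel" and S: "S \<in> sets borel" "S \<subseteq> {0..T} \<times> {0..L}"
    and M: "\<And>q. q \<in> S \<Longrightarrow> \<bar>u q\<bar> \<le> M"
  shows "integrable lborel (\<lambda>q. indicator S q *\<^sub>R u q)"
proof (rule Bochner_Integration.integrable_bound)
  have "bounded S" by (rule bounded_subset[OF _ S(2)]) (intro bounded_Times, auto)
  then have "emeasure lborel S < \<infinity>" by (rule emeasure_bounded_finite)
  then show "integrable lborel (\<lambda>q. indicat_real S q * M)"
    using S by (intro integrable_mult_left integrable_real_indicator) auto
  show "AE q in lborel. norm (indicator S q *\<^sub>R u q) \<le> norm (indicat_real S q * M)"
  proof (rule AE_I2)
    fix q show "norm (indicator S q *\<^sub>R u q) \<le> norm (indicat_real S q * M)"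
      using M[of q] by (cases "q \<in> S") auto
  qed
qed (use u S in measurable)

lemma loc_integrable_bounded:
  fixes u :: "real \<times> real \<Rightarrow> real"
  assumes u: "u \<in> borel_measurable borel" and M: "\<And>q. q \<in> QT T L \<Longrightarrow> \<bar>u q\<bar> \<le> M"
  shows "loc_integrable (QT T L) u"
  unfolding loc_integrable_def
proof (intro allI impI)
  fix K assume K: "compact K \<and> K \<subseteq> QT T L"
  then have Kb: "K \<in> sets borel" "K \<subseteq> {0..T} \<times> {0..L}" using QT_sub by (auto simp: borel_compact)
  have "integrable lborel (\<lambda>q. indicator K q *\<^sub>R u q)"
    by (rule bounded_on_integrable[OF u Kb]) (use K M in auto)
  then show "u absolutely_integrable_on K"
    unfolding set_integrable_def using u Kb by (subst integrable_completion) auto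
qed

lemma Lp_on_bounded:
  fixes u :: "real \<times> real \<Rightarrow> real"
  assumes u: "u \<in> borel_measurable borel" and M: "\<And>q. q \<in> QT T L \<Longrightarrow> \<bar>u q\<bar> \<le> M"
  shows "Lp_on \<infinity> (QT T L) u"
  unfolding Lp_on_def
proof (intro conjI)
  have "u \<in> borel_measurable lebesgue" using u by (intro measurable_completion) simp
  then show "u \<in> borel_measurable (lebesgue_on (QT T L))" by (rule measurable_restrict_space1)
  have "AE x in lebesgue_on (QT T L). \<bar>u x\<bar> \<le> M"
    by (rule AE_I2) (use M in \<open>auto simp: space_restrict_space\<close>)
  then show "if (\<infinity>::ennreal) = \<infinity> then \<exists>C. AE x in lebesgue_on (QT T L). \<bar>u x\<bar> \<le> C
      else integrable (lebesgue_on (QT T L)) (\<lambda>x. \<bar>u x\<bar> powr enn2real \<infinity>)" by auto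
qed

lemma integral_lebesgue_on_borel:
  fixes f :: "real \<times> real \<Rightarrow> real"
  assumes f: "f \<in> borel_measurable borel" and U: "open U"
  shows "(\<integral>q. f q \<partial>lebesgue_on U) = (\<integral>q. indicator U q *\<^sub>R f q \<partial>lborel)"
proof -
  have "(\<integral>q. f q \<partial>lebesgue_on U) = (\<integral>q. indicator U q *\<^sub>R f q \<partial>lebesgue)"
    using U by (subst integral_restrict_space) (auto simp: borel_open)
  also have "\<dots> = (\<integral>q. indicator U q *\<^sub>R f q \<partial>lborel)"
    using f U by (intro integral_completion) (simp add: borel_open)
  finally show ?thesis .
qed

lemma test_fun_measurable: "test_fun U \<phi> \<Longrightarrow> \<phi> \<in> borel_measurable borel"
  unfolding test_fun_def by (intro borel_measurable_continuous_onI smooth_fun_continuous) auto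

lemma test_fun_zero: "test_fun U \<phi> \<Longrightarrow> x \<notin> U \<Longrightarrow> \<phi> x = 0"
  unfolding test_fun_def by blast

text \<open>Collects both sides of the defining identity into one Borel integral over the plane, to
  which Fubini can be applied.\<close>

lemma weak_deriv_bounded:
  fixes u w :: "real \<times> real \<Rightarrow> real"
  assumes u: "u \<in> borel_measurable borel" "\<And>q. q \<in> QT T L \<Longrightarrow> \<bar>u q\<bar> \<le> M"
    and w: "w \<in> borel_measurable borel" "\<And>q. q \<in> QT T L \<Longrightarrow> \<bar>w q\<bar> \<le> M'"
    and b: "b \<in> Basis"
    and int: "\<And>\<phi>. test_fun (QT T L) \<phi> \<Longrightarrow>
      (\<integral>q. indicator (QT T L) q *\<^sub>R (u q * partial_deriv b \<phi> q + w q * \<phi> q) \<partial>lborel) = 0"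
  shows "weak_deriv (QT T L) [b] u w"
  unfolding weak_deriv_def
proof (intro conjI allI impI)
  show "loc_integrable (QT T L) u" by (rule loc_integrable_bounded[OF u])
  show "loc_integrable (QT T L) w" by (rule loc_integrable_bounded[OF w])
  fix \<phi> assume t: "test_fun (QT T L) \<phi>"
  have t': "test_fun (QT T L) (partial_deriv b \<phi>)" using test_fun_iter_partial[OF t, of "[b]"] b by simp
  obtain m where m: "\<And>x. \<bar>\<phi> x\<bar> \<le> m" by (rule test_fun_bounded[OF t]) (rule that)
  obtain m' where m': "\<And>x. \<bar>partial_deriv b \<phi> x\<bar> \<le> m'" by (rule test_fun_bounded[OF t']) (rule that)
  have i1: "integrable lborel (\<lambda>q. indicator (QT T L) q *\<^sub>R (u q * partial_deriv b \<phi> q))"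
  proof (rule bounded_on_integrable[OF _ QT_borel QT_sub])
    show "\<bar>u q * partial_deriv b \<phi> q\<bar> \<le> M * m'" if "q \<in> QT T L" for q
      unfolding abs_mult using u(2)[OF that] m'[of q] abs_ge_zero[of "u q"] by (intro mult_mono) auto
  qed (use u(1) test_fun_measurable[OF t'] in measurable)
  have i2: "integrable lborel (\<lambda>q. indicator (QT T L) q *\<^sub>R (w q * \<phi> q))"
  proof (rule bounded_on_integrable[OF _ QT_borel QT_sub])
    show "\<bar>w q * \<phi> q\<bar> \<le> M' * m" if "q \<in> QT T L" for q
      unfolding abs_mult using w(2)[OF that] m[of q] abs_ge_zero[of "w q"] by (intro mult_mono) auto
  qed (use w(1) test_fun_measurable[OF t] in measurable)
  have "(\<integral>q. u q * partial_deriv b \<phi> q \<partial>lebesgue_on (QT T L)) + (\<integral>q. w q * \<phi> q \<partial>lebesgue_on (QT T L))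
      = (\<integral>q. indicator (QT T L) q *\<^sub>R (u q * partial_deriv b \<phi> q) \<partial>lborel)
        + (\<integral>q. indicator (QT T L) q *\<^sub>R (w q * \<phi> q) \<partial>lborel)"
    using u(1) w(1) test_fun_measurable[OF t] test_fun_measurable[OF t']
    by (subst (1 2) integral_lebesgue_on_borel) (auto simp: QT_open)
  also have "\<dots> = (\<integral>q. indicator (QT T L) q *\<^sub>R (u q * partial_deriv b \<phi> q + w q * \<phi> q) \<partial>lborel)"
    using Bochner_Integration.integral_add[OF i1 i2] by (simp add: distrib_left)
  also have "\<dots> = 0" by (rule int[OF t])
  finally show "(\<integral>q. u q * iter_partial [b] \<phi> q \<partial>lebesgue_on (QT T L))
      = (- 1) ^ length [b] * (\<integral>q. w q * \<phi> q \<partial>lebesgue_on (QT T L))" by simp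
qed

lemma test_fun_slice_deriv:
  fixes \<phi> :: "real \<times> real \<Rightarrow> real"
  assumes "test_fun U \<phi>"
  shows "((\<lambda>t. \<phi> (t, x)) has_real_derivative partial_deriv dir_t \<phi> (t, x)) (at t)"
    and "((\<lambda>x. \<phi> (t, x)) has_real_derivative partial_deriv dir_x \<phi> (t, x)) (at x)"
proof -
  let ?D = "frechet_derivative \<phi> (at (t, x))"
  have d: "(\<phi> has_derivative ?D) (at (t, x))"
    using assms smooth_fun_differentiable frechet_derivative_works unfolding test_fun_def by blast
  then have lin: "linear ?D" by (rule has_derivative_linear)
  have 1: "((\<lambda>t. (t, x)) has_derivative (\<lambda>h. (h, 0))) (at t)" by (auto intro!: derivative_eq_intros)
  have 2: "((\<lambda>x. (t, x)) has_derivative (\<lambda>h. (0, h))) (at x)" by (auto intro!: derivative_eq_intros)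
  have e1: "?D (h, 0) = partial_deriv dir_t \<phi> (t, x) * h" and e2: "?D (0, h) = partial_deriv dir_x \<phi> (t, x) * h" for h
    using linear_scale[OF lin, of h dir_t] linear_scale[OF lin, of h dir_x] by (simp_all add: partial_deriv_def)
  show "((\<lambda>t. \<phi> (t, x)) has_real_derivative partial_deriv dir_t \<phi> (t, x)) (at t)"
    using has_derivative_compose[OF 1 d] unfolding has_field_derivative_def e1 by simp
  show "((\<lambda>x. \<phi> (t, x)) has_real_derivative partial_deriv dir_x \<phi> (t, x)) (at x)"
    using has_derivative_compose[OF 2 d] unfolding has_field_derivative_def e2 by simp
qed

text \<open>The integrand is the density of the product of \<open>f\<close> and \<phi>, which
  vanishes at both ends.\<close>

lemma lac_test_integral:
  fixes \<phi> \<phi>' f d :: "real \<Rightarrow> real"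
  assumes f: "lac 0 T f d" and T: "0 < T" and fm: "f \<in> borel_measurable borel"
    and \<phi>: "\<And>t. (\<phi> has_real_derivative \<phi>' t) (at t)" "continuous_on UNIV \<phi>'" and z: "\<phi> 0 = 0" "\<phi> T = 0"
  shows "(\<integral>t. indicator {0<..<T} t *\<^sub>R (f t * \<phi>' t + d t * \<phi> t) \<partial>lborel) = 0"
proof -
  have \<phi>c: "continuous_on S \<phi>" for S using \<phi>(1) by (meson DERIV_continuous continuous_at_imp_continuous_on)
  obtain m where m: "\<And>t. t \<in> {0..T} \<Longrightarrow> \<bar>\<phi>' t\<bar> \<le> m"
    by (rule cont_bounded_Icc[OF continuous_on_subset[OF \<phi>(2) subset_UNIV], of 0 T]) (rule that)
  have l\<phi>: "lac 0 T \<phi> \<phi>'"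
    by (rule lac_deriv[where E="{}" and M=m]) (use \<phi> \<phi>c m in \<open>auto intro!: borel_measurable_continuous_onI\<close>)
  have k: "(\<lambda>t. d t * \<phi> t + f t * \<phi>' t) \<in> borel_measurable borel"
    using lac_D(1)[OF f] fm borel_measurable_continuous_onI[OF \<phi>c] borel_measurable_continuous_onI[OF \<phi>(2)] by measurable
  have l: "lac 0 T (\<lambda>t. f t * \<phi> t) (\<lambda>t. d t * \<phi> t + f t * \<phi>' t)" by (rule lac_mult[OF f l\<phi> k refl])
  obtain M where M: "\<forall>t\<in>{0..T}. \<bar>d t * \<phi> t + f t * \<phi>' t\<bar> \<le> M" using lac_bound[OF l] by blast
  have "integral {0..T} (\<lambda>t. d t * \<phi> t + f t * \<phi>' t) = 0"
    using lac_D(2)[OF l, of 0 T] T z by (simp add: integral_unique)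
  then have "(LINT t:{0..T}|lborel. d t * \<phi> t + f t * \<phi>' t) = 0"
    using set_borel_integral_eq_integral(2)[OF bounded_borel_abs_integrable[OF k, of 0 T M]] M by auto
  moreover have "(\<integral>t. indicator {0<..<T} t *\<^sub>R (f t * \<phi>' t + d t * \<phi> t) \<partial>lborel) = (LINT t:{0..T}|lborel. d t * \<phi> t + f t * \<phi>' t)"
    unfolding set_lebesgue_integral_def
  proof (rule integral_cong_AE)
    show "AE t in lborel. indicator {0<..<T} t *\<^sub>R (f t * \<phi>' t + d t * \<phi> t) = indicator {0..T} t *\<^sub>R (d t * \<phi> t + f t * \<phi>' t)"
      using AE_lborel_singleton[of 0] AE_lborel_singleton[of T] by eventually_elim (auto simp: indicator_def)
    have "(\<lambda>t. f t * \<phi>' t + d t * \<phi> t) \<in> borel_measurable borel" using k by (simp add: add.commute)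
    then show "(\<lambda>t. indicator {0<..<T} t *\<^sub>R (f t * \<phi>' t + d t * \<phi> t)) \<in> borel_measurable lborel" by measurable
  qed (use k in measurable)
  ultimately show ?thesis by simp
qed

lemma integral_lborel_slices:
  fixes F :: "real \<times> real \<Rightarrow> real"
  assumes "integrable lborel F"
  shows "(\<integral>q. F q \<partial>lborel) = (\<integral>x. (\<integral>t. F (t, x) \<partial>lborel) \<partial>lborel)"
    and "(\<integral>q. F q \<partial>lborel) = (\<integral>t. (\<integral>x. F (t, x) \<partial>lborel) \<partial>lborel)"
proof -
  have F: "integrable (lborel \<Otimes>\<^sub>M lborel) F" using assms by (simp add: lborel_prod)
  have e: "case_prod (\<lambda>t x. F (t, x)) = F" by auto
  show "(\<integral>q. F q \<partial>lborel) = (\<integral>x. (\<integral>t. F (t, x) \<partial>lborel) \<partial>lborel)"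
    using lborel_pair.integral_snd[of "\<lambda>t x. F (t, x)"] F unfolding e by (simp add: lborel_prod)
  show "(\<integral>q. F q \<partial>lborel) = (\<integral>t. (\<integral>x. F (t, x) \<partial>lborel) \<partial>lborel)"
    using lborel_pair.integral_fst'[OF F] by (simp add: lborel_prod)
qed

text \<open>Fubini reduces the planar identity to the lines with \<open>x\<close> fixed, on each of
  which integration by parts holds.\<close>

lemma weak_deriv_t_of_lac:
  fixes u w :: "real \<Rightarrow> real \<Rightarrow> real"
  assumes T: "0 < T" and u: "(\<lambda>q. u (fst q) (snd q)) \<in> borel_measurable borel" "\<And>t x. t \<in> {0..T} \<Longrightarrow> x \<in> {0..L} \<Longrightarrow> \<bar>u t x\<bar> \<le> M"
    and w: "(\<lambda>q. w (fst q) (snd q)) \<in> borel_measurable borel" "\<And>t x. t \<in> {0..T} \<Longrightarrow> x \<in> {0..L} \<Longrightarrow> \<bar>w t x\<bar> \<le> M'"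
    and lac: "\<And>x. x \<in> {0..L} \<Longrightarrow> lac 0 T (\<lambda>t. u t x) (\<lambda>t. w t x)"
  shows "weak_deriv (QT T L) [dir_t] (\<lambda>q. u (fst q) (snd q)) (\<lambda>q. w (fst q) (snd q))"
proof (rule weak_deriv_bounded[OF u(1) _ w(1)])
  show "dir_t \<in> Basis" by (simp add: Basis_real_pair)
  show "\<bar>u (fst q) (snd q)\<bar> \<le> M" "\<bar>w (fst q) (snd q)\<bar> \<le> M'" if "q \<in> QT T L" for q
    using that u(2) w(2) by (auto simp: QT_def)
  fix \<phi> :: "real \<times> real \<Rightarrow> real" assume t: "test_fun (QT T L) \<phi>"
  have t': "test_fun (QT T L) (partial_deriv dir_t \<phi>)" using test_fun_iter_partial[OF t, of "[dir_t]"] by (simp add: Basis_real_pair)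
  let ?F = "\<lambda>q. indicator (QT T L) q *\<^sub>R (u (fst q) (snd q) * partial_deriv dir_t \<phi> q + w (fst q) (snd q) * \<phi> q)"
  obtain m where m: "\<And>x. \<bar>\<phi> x\<bar> \<le> m" by (rule test_fun_bounded[OF t]) (rule that)
  obtain m' where m': "\<And>x. \<bar>partial_deriv dir_t \<phi> x\<bar> \<le> m'" by (rule test_fun_bounded[OF t']) (rule that)
  have Fi: "integrable lborel ?F"
  proof (rule bounded_on_integrable[OF _ QT_borel QT_sub])
    show "\<bar>u (fst q) (snd q) * partial_deriv dir_t \<phi> q + w (fst q) (snd q) * \<phi> q\<bar> \<le> M * m' + M' * m" if "q \<in> QT T L" for q
    proof -
      have q: "fst q \<in> {0..T}" "snd q \<in> {0..L}" using that by (auto simp: QT_def)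
      have "\<bar>u (fst q) (snd q) * partial_deriv dir_t \<phi> q\<bar> \<le> M * m'"
        unfolding abs_mult using u(2)[OF q] m'[of q] abs_ge_zero[of "u (fst q) (snd q)"] by (intro mult_mono) auto
      moreover have "\<bar>w (fst q) (snd q) * \<phi> q\<bar> \<le> M' * m"
        unfolding abs_mult using w(2)[OF q] m[of q] abs_ge_zero[of "w (fst q) (snd q)"] by (intro mult_mono) auto
      ultimately show ?thesis by linarith
    qed
  qed (use u(1) w(1) test_fun_measurable[OF t'] test_fun_measurable[OF t] in measurable)
  then have "(\<integral>q. ?F q \<partial>lborel) = (\<integral>x. (\<integral>t. ?F (t, x) \<partial>lborel) \<partial>lborel)"
    by (rule integral_lborel_slices(1))
  also have "\<dots> = (\<integral>x. 0 \<partial>(lborel :: real measure))"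
  proof (rule Bochner_Integration.integral_cong[OF refl])
    fix x :: real
    show "(\<integral>t. ?F (t, x) \<partial>lborel) = 0"
    proof (cases "x \<in> {0<..<L}")
      case True
      then have x: "x \<in> {0..L}" by auto
      have "(\<integral>t. ?F (t, x) \<partial>lborel) = (\<integral>t. indicator {0<..<T} t *\<^sub>R (u t x * partial_deriv dir_t \<phi> (t, x) + w t x * \<phi> (t, x)) \<partial>lborel)"
        using True by (intro Bochner_Integration.integral_cong) (auto simp: QT_def indicator_def)
      also have "\<dots> = 0"
      proof (rule lac_test_integral[OF lac[OF x] T _ test_fun_slice_deriv(1)[OF t]])
        show "(\<lambda>t. u t x) \<in> borel_measurable borel"
          using measurable_compose[OF _ u(1), of "\<lambda>t. (t, x)" borel] by simp
        have "continuous_on UNIV (partial_deriv dir_t \<phi>)"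
          using t' smooth_fun_continuous unfolding test_fun_def by blast
        then show "continuous_on UNIV (\<lambda>t. partial_deriv dir_t \<phi> (t, x))"
          by (rule continuous_on_compose2) (auto intro!: continuous_intros)
      qed (auto intro!: test_fun_zero[OF t] simp: QT_def)
      finally show ?thesis .
    next
      case False
      then have "(\<integral>t. ?F (t, x) \<partial>lborel) = (\<integral>t. 0 \<partial>(lborel :: real measure))"
        by (intro Bochner_Integration.integral_cong) (auto simp: QT_def indicator_def)
      then show ?thesis by simp
    qed
  qed
  finally show "(\<integral>q. ?F q \<partial>lborel) = 0" by simp
qed

lemma weak_deriv_x_of_lac:
  fixes u w :: "real \<Rightarrow> real \<Rightarrow> real"
  assumes L: "0 < L" and u: "(\<lambda>q. u (fst q) (snd q)) \<in> borel_measurable borel" "\<And>t x. t \<in> {0..T} \<Longrightarrow> x \<in> {0..L} \<Longrightarrow> \<bar>u t x\<bar> \<le> M"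
    and w: "(\<lambda>q. w (fst q) (snd q)) \<in> borel_measurable borel" "\<And>t x. t \<in> {0..T} \<Longrightarrow> x \<in> {0..L} \<Longrightarrow> \<bar>w t x\<bar> \<le> M'"
    and lac: "\<And>t. t \<in> {0..T} \<Longrightarrow> lac 0 L (u t) (w t)"
  shows "weak_deriv (QT T L) [dir_x] (\<lambda>q. u (fst q) (snd q)) (\<lambda>q. w (fst q) (snd q))"
proof (rule weak_deriv_bounded[OF u(1) _ w(1)])
  show "dir_x \<in> Basis" by (simp add: Basis_real_pair)
  show "\<bar>u (fst q) (snd q)\<bar> \<le> M" "\<bar>w (fst q) (snd q)\<bar> \<le> M'" if "q \<in> QT T L" for q
    using that u(2) w(2) by (auto simp: QT_def)
  fix \<phi> :: "real \<times> real \<Rightarrow> real" assume t: "test_fun (QT T L) \<phi>"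
  have t': "test_fun (QT T L) (partial_deriv dir_x \<phi>)" using test_fun_iter_partial[OF t, of "[dir_x]"] by (simp add: Basis_real_pair)
  let ?F = "\<lambda>q. indicator (QT T L) q *\<^sub>R (u (fst q) (snd q) * partial_deriv dir_x \<phi> q + w (fst q) (snd q) * \<phi> q)"
  obtain m where m: "\<And>x. \<bar>\<phi> x\<bar> \<le> m" by (rule test_fun_bounded[OF t]) (rule that)
  obtain m' where m': "\<And>x. \<bar>partial_deriv dir_x \<phi> x\<bar> \<le> m'" by (rule test_fun_bounded[OF t']) (rule that)
  have Fi: "integrable lborel ?F"
  proof (rule bounded_on_integrable[OF _ QT_borel QT_sub])
    show "\<bar>u (fst q) (snd q) * partial_deriv dir_x \<phi> q + w (fst q) (snd q) * \<phi> q\<bar> \<le> M * m' + M' * m" if "q \<in> QT T L" for q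
    proof -
      have q: "fst q \<in> {0..T}" "snd q \<in> {0..L}" using that by (auto simp: QT_def)
      have "\<bar>u (fst q) (snd q) * partial_deriv dir_x \<phi> q\<bar> \<le> M * m'"
        unfolding abs_mult using u(2)[OF q] m'[of q] abs_ge_zero[of "u (fst q) (snd q)"] by (intro mult_mono) auto
      moreover have "\<bar>w (fst q) (snd q) * \<phi> q\<bar> \<le> M' * m"
        unfolding abs_mult using w(2)[OF q] m[of q] abs_ge_zero[of "w (fst q) (snd q)"] by (intro mult_mono) auto
      ultimately show ?thesis by linarith
    qed
  qed (use u(1) w(1) test_fun_measurable[OF t'] test_fun_measurable[OF t] in measurable)
  then have "(\<integral>q. ?F q \<partial>lborel) = (\<integral>t. (\<integral>x. ?F (t, x) \<partial>lborel) \<partial>lborel)"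
    by (rule integral_lborel_slices(2))
  also have "\<dots> = (\<integral>t. 0 \<partial>(lborel :: real measure))"
  proof (rule Bochner_Integration.integral_cong[OF refl])
    fix s :: real
    show "(\<integral>x. ?F (s, x) \<partial>lborel) = 0"
    proof (cases "s \<in> {0<..<T}")
      case True
      then have s: "s \<in> {0..T}" by auto
      have "(\<integral>x. ?F (s, x) \<partial>lborel) = (\<integral>x. indicator {0<..<L} x *\<^sub>R (u s x * partial_deriv dir_x \<phi> (s, x) + w s x * \<phi> (s, x)) \<partial>lborel)"
        using True by (intro Bochner_Integration.integral_cong) (auto simp: QT_def indicator_def)
      also have "\<dots> = 0"
      proof (rule lac_test_integral[OF lac[OF s] L _ test_fun_slice_deriv(2)[OF t]])
        show "u s \<in> borel_measurable borel"
          using measurable_compose[OF _ u(1), of "\<lambda>x. (s, x)" borel] by simp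
        have "continuous_on UNIV (partial_deriv dir_x \<phi>)"
          using t' smooth_fun_continuous unfolding test_fun_def by blast
        then show "continuous_on UNIV (\<lambda>x. partial_deriv dir_x \<phi> (s, x))"
          by (rule continuous_on_compose2) (auto intro!: continuous_intros)
      qed (auto intro!: test_fun_zero[OF t] simp: QT_def)
      finally show ?thesis .
    next
      case False
      then have "(\<integral>x. ?F (s, x) \<partial>lborel) = (\<integral>x. 0 \<partial>(lborel :: real measure))"
        by (intro Bochner_Integration.integral_cong) (auto simp: QT_def indicator_def)
      then show ?thesis by simp
    qed
  qed
  finally show "(\<integral>q. ?F q \<partial>lborel) = 0" by simp
qed

lemma weak_deriv_Nil: "loc_integrable U u \<Longrightarrow> weak_deriv U [] u u"
  by (simp add: weak_deriv_def)

section \<open>Weak derivatives of the constructed fields\<close>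

context fibre_evolution
begin

lemma A_bound: obtains M where "0 \<le> M" "\<And>t x. t \<in> {0..T} \<Longrightarrow> x \<in> {0..L} \<Longrightarrow> \<bar>A t x\<bar> \<le> M"
  by (rule joint_bounded[OF A_joint_cont]) (rule that)

lemma v_bound: obtains M where "0 \<le> M" "\<And>t x. t \<in> {0..T} \<Longrightarrow> x \<in> {0..L} \<Longrightarrow> \<bar>v t x\<bar> \<le> M"
  by (rule joint_bounded[OF v_joint_cont]) (rule that)

lemma c_bound: obtains M where "0 \<le> M" "\<And>t. t \<in> {0..T} \<Longrightarrow> \<bar>c t\<bar> \<le> M"
  by (rule cont_bounded_Icc[OF continuous_on_subset[OF c_cont subset_UNIV], of 0 T]) (rule that)

definition "vx t x = c t * (1 / A t x)"
definition "vxx t x = c t * (- Ax t x / (A t x)\<^sup>2)"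
definition "flux_x t x = vx t x * A t x + v t x * Ax t x"

lemma vx_measurable: "(\<lambda>q. vx (fst q) (snd q)) \<in> borel_measurable borel"
  unfolding vx_def by measurable

lemma vxx_measurable: "(\<lambda>q. vxx (fst q) (snd q)) \<in> borel_measurable borel"
  unfolding vxx_def using Ax_measurable by measurable

lemma flux_x_measurable: "(\<lambda>q. flux_x (fst q) (snd q)) \<in> borel_measurable borel"
  unfolding flux_x_def using Ax_measurable vx_measurable by measurable

lemma vx_bound: obtains M where "0 \<le> M" "\<And>t x. t \<in> {0..T} \<Longrightarrow> x \<in> {0..L} \<Longrightarrow> \<bar>vx t x\<bar> \<le> M"
proof -
  obtain M1 where M1: "0 \<le> M1" "\<And>t. t \<in> {0..T} \<Longrightarrow> \<bar>c t\<bar> \<le> M1" by (rule c_bound) (rule that)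
  have "\<bar>vx t x\<bar> \<le> M1 * (1 / \<delta>)" if "t \<in> {0..T}" "x \<in> {0..L}" for t x
    unfolding vx_def abs_mult by (intro mult_mono M1 invA_le that) auto
  moreover have "0 \<le> M1 * (1 / \<delta>)" using M1 \<delta> by simp
  ultimately show thesis using that by blast
qed

lemma vxx_bound: obtains M where "0 \<le> M" "\<And>t x. t \<in> {0..T} \<Longrightarrow> x \<in> {0..L} \<Longrightarrow> \<bar>vxx t x\<bar> \<le> M"
proof -
  obtain M1 where M1: "0 \<le> M1" "\<And>t. t \<in> {0..T} \<Longrightarrow> \<bar>c t\<bar> \<le> M1" by (rule c_bound) (rule that)
  obtain M2 where M2: "\<And>t x. \<bar>Ax t x\<bar> \<le> M2" using Ax_bounded by blast
  have M20: "0 \<le> M2" using M2[of 0 0] by linarith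
  have "\<bar>vxx t x\<bar> \<le> M1 * (M2 / \<delta>\<^sup>2)" if tx: "t \<in> {0..T}" "x \<in> {0..L}" for t x
  proof -
    have "\<bar>- Ax t x / (A t x)\<^sup>2\<bar> \<le> M2 / \<delta>\<^sup>2"
      unfolding abs_divide abs_minus by (rule frac_le) (use M2 M20 A_ge[OF tx] \<delta> in \<open>auto intro!: power_mono\<close>)
    then show ?thesis unfolding vxx_def abs_mult[of "c t"] by (intro mult_mono M1 tx) auto
  qed
  moreover have "0 \<le> M1 * (M2 / \<delta>\<^sup>2)" using M1 M20 by simp
  ultimately show thesis using that by blast
qed

lemma vx_lac_x: "t \<in> {0..T} \<Longrightarrow> lac 0 L (vx t) (vxx t)"
proof -
  assume t: "t \<in> {0..T}"
  have "lac 0 L (\<lambda>x. c t * (1 / A t x)) (vxx t)"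
    by (rule lac_mult[OF lac_const invA_lac_x[OF t] slice_measurable_of(1)[OF vxx_measurable]]) (simp add: vxx_def)
  then show ?thesis by (simp add: vx_def[abs_def])
qed

lemma flux_lac_x: "t \<in> {0..T} \<Longrightarrow> lac 0 L (\<lambda>x. v t x * A t x) (flux_x t)"
  using v_lac_x[of t] by (intro lac_mult[OF _ A_lac_x slice_measurable_of(1)[OF flux_x_measurable]])
    (auto simp: flux_x_def vx_def)

lemma weak_A_t: "weak_deriv (QT T L) [dir_t] (\<lambda>q. A (fst q) (snd q)) (\<lambda>q. At (fst q) (snd q))"
proof -
  obtain M where M: "0 \<le> M" "\<And>t x. t \<in> {0..T} \<Longrightarrow> x \<in> {0..L} \<Longrightarrow> \<bar>A t x\<bar> \<le> M" by (rule A_bound) (rule that)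
  obtain M' where M': "\<And>t x. \<bar>At t x\<bar> \<le> M'" using At_bounded by blast
  show ?thesis by (rule weak_deriv_t_of_lac[OF T measurable_facts(2) M(2) At_measurable M' A_lac_t]) auto
qed

lemma weak_A_x: "weak_deriv (QT T L) [dir_x] (\<lambda>q. A (fst q) (snd q)) (\<lambda>q. Ax (fst q) (snd q))"
proof -
  obtain M where M: "0 \<le> M" "\<And>t x. t \<in> {0..T} \<Longrightarrow> x \<in> {0..L} \<Longrightarrow> \<bar>A t x\<bar> \<le> M" by (rule A_bound) (rule that)
  obtain M' where M': "\<And>t x. \<bar>Ax t x\<bar> \<le> M'" using Ax_bounded by blast
  show ?thesis by (rule weak_deriv_x_of_lac[OF L measurable_facts(2) M(2) Ax_measurable M' A_lac_x]) auto
qed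

lemma weak_v_t: "weak_deriv (QT T L) [dir_t] (\<lambda>q. v (fst q) (snd q)) (\<lambda>q. vt (fst q) (snd q))"
proof -
  obtain M where M: "0 \<le> M" "\<And>t x. t \<in> {0..T} \<Longrightarrow> x \<in> {0..L} \<Longrightarrow> \<bar>v t x\<bar> \<le> M" by (rule v_bound) (rule that)
  obtain M' where M': "\<And>t x. \<bar>vt t x\<bar> \<le> M'" using vt_bounded by blast
  show ?thesis by (rule weak_deriv_t_of_lac[OF T measurable_facts(3) M(2) vt_measurable M' v_lac_t]) auto
qed

lemma weak_v_x: "weak_deriv (QT T L) [dir_x] (\<lambda>q. v (fst q) (snd q)) (\<lambda>q. vx (fst q) (snd q))"
proof -
  obtain M where M: "0 \<le> M" "\<And>t x. t \<in> {0..T} \<Longrightarrow> x \<in> {0..L} \<Longrightarrow> \<bar>v t x\<bar> \<le> M" by (rule v_bound) (rule that)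
  obtain M' where M': "0 \<le> M'" "\<And>t x. t \<in> {0..T} \<Longrightarrow> x \<in> {0..L} \<Longrightarrow> \<bar>vx t x\<bar> \<le> M'" by (rule vx_bound) (rule that)
  show ?thesis
    by (rule weak_deriv_x_of_lac[OF L measurable_facts(3) M(2) vx_measurable M'(2)])
      (use v_lac_x in \<open>auto simp: vx_def[abs_def]\<close>)
qed

lemma weak_vt_x: "weak_deriv (QT T L) [dir_x] (\<lambda>q. vt (fst q) (snd q)) (\<lambda>q. vtx (fst q) (snd q))"
proof -
  obtain M where M: "\<And>t x. \<bar>vt t x\<bar> \<le> M" using vt_bounded by blast
  obtain M' where M': "0 \<le> M'" "\<forall>t\<in>{0..T}. \<forall>x\<in>{0..L}. \<bar>vtx t x\<bar> \<le> M'" using vtx_bounded by blast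
  show ?thesis
    by (rule weak_deriv_x_of_lac[where M'=M', OF L vt_measurable M vtx_measurable _ vt_lac_x]) (use M' in auto)
qed

lemma weak_vx_x: "weak_deriv (QT T L) [dir_x] (\<lambda>q. vx (fst q) (snd q)) (\<lambda>q. vxx (fst q) (snd q))"
proof -
  obtain M where M: "0 \<le> M" "\<And>t x. t \<in> {0..T} \<Longrightarrow> x \<in> {0..L} \<Longrightarrow> \<bar>vx t x\<bar> \<le> M" by (rule vx_bound) (rule that)
  obtain M' where M': "0 \<le> M'" "\<And>t x. t \<in> {0..T} \<Longrightarrow> x \<in> {0..L} \<Longrightarrow> \<bar>vxx t x\<bar> \<le> M'" by (rule vxx_bound) (rule that)
  show ?thesis
    by (rule weak_deriv_x_of_lac[OF L vx_measurable M(2) vxx_measurable M'(2) vx_lac_x]) auto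
qed

lemma flux_bounds:
  obtains M M' where "\<And>t x. t \<in> {0..T} \<Longrightarrow> x \<in> {0..L} \<Longrightarrow> \<bar>v t x * A t x\<bar> \<le> M"
    "\<And>t x. t \<in> {0..T} \<Longrightarrow> x \<in> {0..L} \<Longrightarrow> \<bar>flux_x t x\<bar> \<le> M'"
proof -
  obtain M1 where M1: "0 \<le> M1" "\<And>t x. t \<in> {0..T} \<Longrightarrow> x \<in> {0..L} \<Longrightarrow> \<bar>A t x\<bar> \<le> M1" by (rule A_bound) (rule that)
  obtain M2 where M2: "0 \<le> M2" "\<And>t x. t \<in> {0..T} \<Longrightarrow> x \<in> {0..L} \<Longrightarrow> \<bar>v t x\<bar> \<le> M2" by (rule v_bound) (rule that)
  obtain M3 where M3: "0 \<le> M3" "\<And>t x. t \<in> {0..T} \<Longrightarrow> x \<in> {0..L} \<Longrightarrow> \<bar>vx t x\<bar> \<le> M3" by (rule vx_bound) (rule that)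
  obtain M4 where M4: "\<And>t x. \<bar>Ax t x\<bar> \<le> M4" using Ax_bounded by blast
  have "\<bar>v t x * A t x\<bar> \<le> M2 * M1" if "t \<in> {0..T}" "x \<in> {0..L}" for t x
    unfolding abs_mult by (intro mult_mono M1 M2 that) auto
  moreover have "\<bar>flux_x t x\<bar> \<le> M3 * M1 + M2 * M4" if tx: "t \<in> {0..T}" "x \<in> {0..L}" for t x
  proof -
    have "\<bar>vx t x * A t x\<bar> \<le> M3 * M1" unfolding abs_mult by (intro mult_mono M1 M3 tx) auto
    moreover have "\<bar>v t x * Ax t x\<bar> \<le> M2 * M4" unfolding abs_mult by (intro mult_mono M2 M4 tx) auto
    ultimately show ?thesis unfolding flux_x_def by linarith
  qed
  ultimately show thesis using that by blast
qed

lemma weak_flux_x: "weak_deriv (QT T L) [dir_x] (\<lambda>q. v (fst q) (snd q) * A (fst q) (snd q)) (\<lambda>q. flux_x (fst q) (snd q))"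
proof -
  obtain M M' where M: "\<And>t x. t \<in> {0..T} \<Longrightarrow> x \<in> {0..L} \<Longrightarrow> \<bar>v t x * A t x\<bar> \<le> M"
    "\<And>t x. t \<in> {0..T} \<Longrightarrow> x \<in> {0..L} \<Longrightarrow> \<bar>flux_x t x\<bar> \<le> M'" by (rule flux_bounds) (rule that)
  have m: "(\<lambda>q. v (fst q) (snd q) * A (fst q) (snd q)) \<in> borel_measurable borel" by measurable
  show ?thesis
    by (rule weak_deriv_x_of_lac[where u="\<lambda>t x. v t x * A t x" and w=flux_x, OF L m M(1) flux_x_measurable M(2) flux_lac_x]) auto
qed

text \<open>By construction A v_x equals the rate \<open>c\<close>, which does not depend on
  \<open>x\<close>.\<close>

lemma weak_stress_x: "weak_deriv (QT T L) [dir_x] (\<lambda>q. 3 * \<mu> * A (fst q) (snd q) * vx (fst q) (snd q)) (\<lambda>q. 0)"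
proof -
  have e: "3 * \<mu> * A t x * vx t x = 3 * \<mu> * c t" for t x using A_pos[of t x] by (simp add: vx_def)
  obtain M1 where M1: "0 \<le> M1" "\<And>t. t \<in> {0..T} \<Longrightarrow> \<bar>c t\<bar> \<le> M1" by (rule c_bound) (rule that)
  have "weak_deriv (QT T L) [dir_x] (\<lambda>q. 3 * \<mu> * c (fst q)) (\<lambda>q. 0)"
  proof (rule weak_deriv_x_of_lac[where u="\<lambda>t x. 3 * \<mu> * c t" and w="\<lambda>t x. 0" and M="\<bar>3 * \<mu>\<bar> * M1" and M'=0, OF L])
    show "\<bar>3 * \<mu> * c t\<bar> \<le> \<bar>3 * \<mu>\<bar> * M1" if "t \<in> {0..T}" for t
      unfolding abs_mult[of "3 * \<mu>"] by (intro mult_mono M1 that) auto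
  qed auto
  then show ?thesis unfolding e .
qed

theorem solution:
  "strong_solution \<mu> T L S0 S1 vin vL (\<lambda>q. A (fst q) (snd q)) (\<lambda>q. v (fst q) (snd q))" (is ?S)
  "Lp_on \<infinity> (QT T L) (\<lambda>q. A (fst q) (snd q))" (is ?A)
  "weak_deriv_in_Linf (QT T L) [dir_t] (\<lambda>q. A (fst q) (snd q))" (is ?At)
  "weak_deriv_in_Linf (QT T L) [dir_x] (\<lambda>q. A (fst q) (snd q))" (is ?Ax)
  "Lp_on \<infinity> (QT T L) (\<lambda>q. v (fst q) (snd q))" (is ?v)
  "weak_deriv_in_Linf (QT T L) [dir_t] (\<lambda>q. v (fst q) (snd q))" (is ?vt)
  "weak_deriv_in_Linf (QT T L) [dir_t, dir_x] (\<lambda>q. v (fst q) (snd q))" (is ?vtx)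
  "weak_deriv_in_Linf (QT T L) [dir_x, dir_x] (\<lambda>q. v (fst q) (snd q))" (is ?vxx)
proof -
  have Lp: "Lp_on \<infinity> (QT T L) (\<lambda>q. f (fst q) (snd q))"
    if "(\<lambda>q. f (fst q) (snd q)) \<in> borel_measurable borel" "\<And>t x. t \<in> {0..T} \<Longrightarrow> x \<in> {0..L} \<Longrightarrow> \<bar>f t x\<bar> \<le> M" for f :: "real \<Rightarrow> real \<Rightarrow> real" and M
    by (rule Lp_on_bounded[OF that(1), of _ _ M]) (use that(2) in \<open>auto simp: QT_def\<close>)
  show A: ?A by (rule A_bound, rule Lp[OF measurable_facts(2)])
  show v: ?v by (rule v_bound, rule Lp[OF measurable_facts(3)])
  have LAx: "Lp_on \<infinity> (QT T L) (\<lambda>q. Ax (fst q) (snd q))" using Ax_bounded Lp[OF Ax_measurable] by blast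
  have LAt: "Lp_on \<infinity> (QT T L) (\<lambda>q. At (fst q) (snd q))" using At_bounded Lp[OF At_measurable] by blast
  have Lvt: "Lp_on \<infinity> (QT T L) (\<lambda>q. vt (fst q) (snd q))" using vt_bounded Lp[OF vt_measurable] by blast
  have Lvx: "Lp_on \<infinity> (QT T L) (\<lambda>q. vx (fst q) (snd q))" by (rule vx_bound, rule Lp[OF vx_measurable])
  have Lvxx: "Lp_on \<infinity> (QT T L) (\<lambda>q. vxx (fst q) (snd q))" by (rule vxx_bound, rule Lp[OF vxx_measurable])
  have Lvtx: "Lp_on \<infinity> (QT T L) (\<lambda>q. vtx (fst q) (snd q))" using vtx_bounded Lp[OF vtx_measurable] by blast
  show At: ?At unfolding weak_deriv_in_Linf_def using LAt weak_A_t by blast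
  show Ax: ?Ax unfolding weak_deriv_in_Linf_def using LAx weak_A_x by blast
  show vt: ?vt unfolding weak_deriv_in_Linf_def using Lvt weak_v_t by blast
  have vx: "weak_deriv_in_Linf (QT T L) [dir_x] (\<lambda>q. v (fst q) (snd q))"
    unfolding weak_deriv_in_Linf_def using Lvx weak_v_x by blast
  show vtx: ?vtx unfolding weak_deriv_in_Linf_def
    using Lvtx weak_deriv_append[OF weak_v_t weak_vt_x] by (auto simp: Basis_real_pair)
  show vxx: ?vxx unfolding weak_deriv_in_Linf_def
    using Lvxx weak_deriv_append[OF weak_v_x weak_vx_x] by (auto simp: Basis_real_pair)
  have sob: "sobolev 1 \<infinity> (QT T L) (\<lambda>q. A (fst q) (snd q))"
    unfolding sobolev_def
  proof (intro conjI allI impI A)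
    fix bs :: "(real \<times> real) list" assume "set bs \<subseteq> Basis \<and> length bs \<le> 1"
    then have "bs = [] \<or> bs = [dir_t] \<or> bs = [dir_x]"
      by (cases bs) (auto simp: Basis_real_pair)
    then show "\<exists>w. Lp_on \<infinity> (QT T L) w \<and> weak_deriv (QT T L) bs (\<lambda>q. A (fst q) (snd q)) w"
    proof (elim disjE)
      assume "bs = []"
      moreover have "loc_integrable (QT T L) (\<lambda>q. A (fst q) (snd q))" using weak_A_t by (simp add: weak_deriv_def)
      ultimately show ?thesis using A weak_deriv_Nil by blast
    qed (use At Ax in \<open>auto simp: weak_deriv_in_Linf_def\<close>)
  qed
  have pde: "solves_pde \<mu> (QT T L) (\<lambda>q. A (fst q) (snd q)) (\<lambda>q. v (fst q) (snd q))"
    unfolding solves_pde_def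
  proof (intro conjI)
    \<comment> \<open>For the chosen densities the balance holds at every point: the space
      derivative of the flux is c + v A times the slope of \<open>a\<close>, the exact negative of
      \<open>At\<close>.\<close>
    have "AE q in lebesgue_on (QT T L). At (fst q) (snd q) + flux_x (fst q) (snd q) = 0"
    proof (rule AE_I2)
      fix q assume "q \<in> space (lebesgue_on (QT T L))"
      then have "fst q \<in> {0..T}" "snd q \<in> {0..L}" by (auto simp: QT_def)
      then show "At (fst q) (snd q) + flux_x (fst q) (snd q) = 0"
        using A_pos[of "fst q" "snd q"] by (simp add: At_def flux_x_def vx_def Ax_def)
    qed
    then show "\<exists>Aq F. weak_deriv (QT T L) [dir_t] (\<lambda>q. A (fst q) (snd q)) Aq \<and>
        weak_deriv (QT T L) [dir_x] (\<lambda>q. v (fst q) (snd q) * A (fst q) (snd q)) F \<and>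
        (AE q in lebesgue_on (QT T L). Aq q + F q = 0)"
      using weak_A_t weak_flux_x by blast
    show "\<exists>vq G. weak_deriv (QT T L) [dir_x] (\<lambda>q. v (fst q) (snd q)) vq \<and>
        weak_deriv (QT T L) [dir_x] (\<lambda>q. 3 * \<mu> * A (fst q) (snd q) * vq q) G \<and>
        (AE q in lebesgue_on (QT T L). G q = 0)"
      using weak_v_x weak_stress_x by fastforce
  qed
  show ?S unfolding strong_solution_def
    using continuous_on_subset[OF A_joint_cont] continuous_on_subset[OF v_joint_cont] sob v vt vx vtx vxx pde A_pos
    by (auto simp: A_inlet v_inlet v_outlet A_initial)
qed

end

section \<open>Slices of weak derivatives\<close>

text \<open>Curried, so that either variable can be frozen, and stated for the product measure,
  where Fubini applies. Integrability is asked on closed boxes only, as for weak derivatives in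
  general.\<close>

definition loc_int2 :: "real \<Rightarrow> real \<Rightarrow> (real \<Rightarrow> real \<Rightarrow> real) \<Rightarrow> bool" where
  "loc_int2 T L w \<longleftrightarrow> (\<lambda>q. w (fst q) (snd q)) \<in> borel_measurable borel \<and>
     (\<forall>a b c d. 0 < a \<and> b < T \<and> 0 < c \<and> d < L \<longrightarrow>
        integrable (lborel \<Otimes>\<^sub>M lborel) (\<lambda>(p, y). indicator {a..b} p * indicator {c..d} y * w p y))"

lemma loc_int2_measurable:
  assumes "loc_int2 T L w"
  shows "(\<lambda>q. w (fst q) (snd q)) \<in> borel_measurable (lborel \<Otimes>\<^sub>M lborel)"
    and "w p \<in> borel_measurable borel" and "(\<lambda>p. w p y) \<in> borel_measurable borel"
  using assms slice_measurable[of w]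
    measurable_compose[of "\<lambda>y. (p, y)" borel borel "\<lambda>q. w (fst q) (snd q)" borel]
    measurable_compose[of "\<lambda>p. (p, y)" borel borel "\<lambda>q. w (fst q) (snd q)" borel]
  by (auto simp: loc_int2_def lborel_prod)

lemma loc_int2_swap: "loc_int2 T L w \<Longrightarrow> loc_int2 L T (\<lambda>y p. w p y)"
proof -
  assume w: "loc_int2 T L w"
  have sw: "(\<lambda>q :: real \<times> real. (snd q, fst q)) \<in> borel_measurable borel"
    by (intro borel_measurable_continuous_onI continuous_intros)
  have "(\<lambda>q. w (snd q) (fst q)) \<in> borel_measurable borel"
    using measurable_compose[OF sw, of "\<lambda>q. w (fst q) (snd q)" borel] w by (simp add: loc_int2_def)
  moreover have "integrable (lborel \<Otimes>\<^sub>M lborel) (\<lambda>(y, p). indicator {a..b} y * indicator {c..d} p * w p y)"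
    if "0 < a" "b < L" "0 < c" "d < T" for a b c d
  proof -
    have "integrable (lborel \<Otimes>\<^sub>M lborel) (\<lambda>(p, y). indicator {c..d} p * indicator {a..b} y * w p y)"
      using w that by (simp add: loc_int2_def)
    from lborel_pair.integrable_product_swap[OF this] show ?thesis
      by (simp add: split_beta mult.commute mult.left_commute)
  qed
  ultimately show ?thesis unfolding loc_int2_def by blast
qed

lemma loc_int2_weighted:
  assumes w: "loc_int2 T L w" and \<alpha>: "test1 0 T \<alpha>" and cd: "0 < c" "d < L"
    and h: "h \<in> borel_measurable borel" "\<And>y. \<bar>h y\<bar> \<le> M" "\<And>y. y \<notin> {c..d} \<Longrightarrow> h y = 0"
  shows "integrable (lborel \<Otimes>\<^sub>M lborel) (\<lambda>(p, y). \<alpha> p * h y * w p y)"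
proof -
  obtain a b where ab: "smooth1 \<alpha>" "0 < a" "b < T" "\<And>x. x \<notin> {a..b} \<Longrightarrow> \<alpha> x = 0"
    by (rule test1E[OF \<alpha>]) (rule that)
  obtain m where m: "m \<ge> 0" "\<And>x. \<bar>\<alpha> x\<bar> \<le> m" by (rule test1_bounded[OF \<alpha>]) (rule that)
  have i: "integrable (lborel \<Otimes>\<^sub>M lborel) (\<lambda>q. m * M * (case q of (p, y) \<Rightarrow> indicator {a..b} p * indicator {c..d} y * w p y))"
    using w ab cd unfolding loc_int2_def by (intro integrable_mult_right) blast
  show ?thesis
  proof (rule Bochner_Integration.integrable_bound[OF i])
    show "(\<lambda>(p, y). \<alpha> p * h y * w p y) \<in> borel_measurable (lborel \<Otimes>\<^sub>M lborel)"
      using loc_int2_measurable(1)[OF w] test1_measurable[OF \<alpha>] h(1) unfolding split_beta by measurable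
    show "AE q in lborel \<Otimes>\<^sub>M lborel. norm (case q of (p, y) \<Rightarrow> \<alpha> p * h y * w p y)
       \<le> norm (m * M * (case q of (p, y) \<Rightarrow> indicator {a..b} p * indicator {c..d} y * w p y))"
    proof (rule AE_I2, clarify)
      fix p y
      show "norm (\<alpha> p * h y * w p y) \<le> norm (m * M * (indicator {a..b} p * indicator {c..d} y * w p y))"
      proof (cases "p \<in> {a..b} \<and> y \<in> {c..d}")
        case True
        have "\<bar>\<alpha> p\<bar> * \<bar>h y\<bar> \<le> m * M" by (intro mult_mono m h) auto
        moreover have "0 \<le> M" using h(2)[of 0] by linarith
        ultimately show ?thesis using True m(1) by (simp add: abs_mult mult_right_mono)
      next
        case False
        then have z: "\<alpha> p * h y = 0" using ab(4)[of p] h(3)[of y] by auto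
        show ?thesis unfolding z by simp
      qed
    qed
  qed
qed

lemma loc_int2_slice_integral:
  assumes w: "loc_int2 T L w" and cd: "0 < c" "d < L"
  shows "loc_int 0 T (\<lambda>p. \<integral>y. indicator {c..d} y * w p y \<partial>lborel)"
  unfolding loc_int_def
proof (intro conjI allI impI)
  show "(\<lambda>p. \<integral>y. indicator {c..d} y * w p y \<partial>lborel) \<in> borel_measurable borel"
  proof (rule lborel.borel_measurable_lebesgue_integral)
    have "(\<lambda>q. w (fst q) (snd q)) \<in> borel_measurable (borel \<Otimes>\<^sub>M lborel)"
      using w by (simp add: loc_int2_def borel_prod measurable_def sets_pair_measure space_pair_measure flip: borel_prod)
    then show "(\<lambda>(p, y). indicator {c..d} y * w p y) \<in> borel_measurable (borel \<Otimes>\<^sub>M lborel)"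
      unfolding split_beta by measurable
  qed
  fix a b :: real assume ab: "0 < a \<and> b < T"
  then have "integrable (lborel \<Otimes>\<^sub>M lborel) (\<lambda>(p, y). indicator {a..b} p * indicator {c..d} y * w p y)"
    using w cd by (simp add: loc_int2_def)
  from lborel_pair.integrable_fst'[OF this]
  show "set_integrable lborel {a..b} (\<lambda>p. \<integral>y. indicator {c..d} y * w p y \<partial>lborel)"
    unfolding set_integrable_def by (simp add: mult.assoc)
qed

text \<open>Integrability is local in the first variable too, so Fubini is applied on countably many
  compact intervals that exhaust (0, T).\<close>

lemma AE_slice_integrable:
  assumes w: "loc_int2 T L w" and cd: "0 < c" "d < L"
  shows "AE p in lborel. p \<in> {0<..<T} \<longrightarrow> set_integrable lborel {c..d} (w p)"
proof -
  have "AE p in lborel. p \<in> {0 + 1 / real (Suc n)..T - 1 / real (Suc n)} \<longrightarrow> set_integrable lborel {c..d} (w p)" for n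
  proof -
    have n: "0 < 0 + 1 / real (Suc n)" "T - 1 / real (Suc n) < T" by auto
    then have "integrable (lborel \<Otimes>\<^sub>M lborel) (\<lambda>(p, y). indicator {0 + 1 / real (Suc n)..T - 1 / real (Suc n)} p * indicator {c..d} y * w p y)"
      using w cd unfolding loc_int2_def by blast
    from lborel_pair.AE_integrable_fst'[OF this] show ?thesis
      by eventually_elim (auto simp: set_integrable_def)
  qed
  then have "AE p in lborel. \<forall>n. p \<in> {0 + 1 / real (Suc n)..T - 1 / real (Suc n)} \<longrightarrow> set_integrable lborel {c..d} (w p)"
    by (subst AE_all_countable) blast
  then show ?thesis
  proof eventually_elim
    case (elim p)
    show ?case
    proof
      assume p: "p \<in> {0<..<T}"
      then have "0 < min p (T - p)" by simp
      then obtain n where "1 / real (Suc n) < min p (T - p)" using nat_approx_posE by (metis of_nat_Suc)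
      then show "set_integrable lborel {c..d} (w p)" by (auto intro!: elim[rule_format, of n])
    qed
  qed
qed

text \<open>Testing against \<open>\<alpha>\<close> in the first variable only yields a function of the second one, whose
  weak derivative is one-dimensional.\<close>

lemma tested_slice:
  fixes w :: "real \<Rightarrow> real \<Rightarrow> real"
  assumes w: "loc_int2 T L w" and \<alpha>: "test1 0 T \<alpha>"
  defines "W \<equiv> \<lambda>y. \<integral>p. \<alpha> p * w p y \<partial>lborel"
  shows "loc_int 0 L W"
    and "test1 0 L \<beta> \<Longrightarrow> (\<integral>y. W y * \<beta> y \<partial>lborel) = (\<integral>q. w (fst q) (snd q) * (\<alpha> (fst q) * \<beta> (snd q)) \<partial>lborel)"
    and "0 < c \<Longrightarrow> d < L \<Longrightarrow> (LINT y:{c..d}|lborel. W y) = (\<integral>p. (\<integral>y. indicator {c..d} y * w p y \<partial>lborel) * \<alpha> p \<partial>lborel)"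
proof -
  show "loc_int 0 L W"
    unfolding loc_int_def
  proof (intro conjI allI impI)
    show "W \<in> borel_measurable borel" unfolding W_def
    proof (rule lborel.borel_measurable_lebesgue_integral)
      have "(\<lambda>q. w (snd q) (fst q)) \<in> borel_measurable (borel \<Otimes>\<^sub>M lborel)"
        using loc_int2_swap[OF w] by (simp add: loc_int2_def borel_prod measurable_def sets_pair_measure space_pair_measure flip: borel_prod)
      then show "(\<lambda>(y, p). \<alpha> p * w p y) \<in> borel_measurable (borel \<Otimes>\<^sub>M lborel)"
        using test1_measurable[OF \<alpha>] unfolding split_beta by measurable
    qed
    fix c d :: real assume cd: "0 < c \<and> d < L"
    have "integrable (lborel \<Otimes>\<^sub>M lborel) (\<lambda>(p, y). \<alpha> p * indicator {c..d} y * w p y)"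
      by (rule loc_int2_weighted[OF w \<alpha>, of c d _ 1]) (use cd in \<open>auto simp: indicator_def\<close>)
    from lborel_pair.integrable_snd[OF this]
    have "integrable lborel (\<lambda>y. \<integral>p. indicator {c..d} y * (\<alpha> p * w p y) \<partial>lborel)" by (simp add: ac_simps)
    then show "set_integrable lborel {c..d} W"
      unfolding set_integrable_def W_def by simp
  qed
  show "(\<integral>y. W y * \<beta> y \<partial>lborel) = (\<integral>q. w (fst q) (snd q) * (\<alpha> (fst q) * \<beta> (snd q)) \<partial>lborel)" if \<beta>: "test1 0 L \<beta>"
  proof -
    obtain a b where ab: "smooth1 \<beta>" "0 < a" "b < L" "\<And>x. x \<notin> {a..b} \<Longrightarrow> \<beta> x = 0"
      by (rule test1E[OF \<beta>]) (rule that)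
    obtain m where m: "m \<ge> 0" "\<And>x. \<bar>\<beta> x\<bar> \<le> m" by (rule test1_bounded[OF \<beta>]) (rule that)
    have i: "integrable (lborel \<Otimes>\<^sub>M lborel) (\<lambda>(p, y). \<alpha> p * \<beta> y * w p y)"
      by (rule loc_int2_weighted[OF w \<alpha> ab(2,3) test1_measurable[OF \<beta>] m(2) ab(4)])
    have "(\<integral>y. W y * \<beta> y \<partial>lborel) = (\<integral>y. (\<integral>p. \<alpha> p * \<beta> y * w p y \<partial>lborel) \<partial>lborel)"
      unfolding W_def by (simp add: ac_simps flip: integral_mult_right_zero)
    also have "\<dots> = (\<integral>q. (case q of (p, y) \<Rightarrow> \<alpha> p * \<beta> y * w p y) \<partial>(lborel \<Otimes>\<^sub>M lborel))"
      by (rule lborel_pair.integral_snd[OF i])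
    finally show ?thesis by (simp add: lborel_prod split_beta ac_simps)
  qed
  show "(LINT y:{c..d}|lborel. W y) = (\<integral>p. (\<integral>y. indicator {c..d} y * w p y \<partial>lborel) * \<alpha> p \<partial>lborel)" if cd: "0 < c" "d < L"
  proof -
    have i: "integrable (lborel \<Otimes>\<^sub>M lborel) (\<lambda>(p, y). \<alpha> p * indicator {c..d} y * w p y)"
      by (rule loc_int2_weighted[OF w \<alpha>, of c d _ 1]) (use cd in \<open>auto simp: indicator_def\<close>)
    have "(LINT y:{c..d}|lborel. W y) = (\<integral>y. (\<integral>p. \<alpha> p * indicator {c..d} y * w p y \<partial>lborel) \<partial>lborel)"
      unfolding W_def set_lebesgue_integral_def by (simp add: ac_simps flip: integral_mult_right_zero)
    also have "\<dots> = (\<integral>p. (\<integral>y. \<alpha> p * indicator {c..d} y * w p y \<partial>lborel) \<partial>lborel)"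
      by (rule lborel_pair.Fubini_integral[OF i])
    also have "\<dots> = (\<integral>p. (\<integral>y. indicator {c..d} y * w p y \<partial>lborel) * \<alpha> p \<partial>lborel)"
      by (simp add: ac_simps flip: integral_mult_right_zero)
    finally show ?thesis .
  qed
qed

text \<open>Tested against \<alpha> in the first variable, \<open>u\<close> becomes a continuous
  function of the second one with a weak derivative, whose increments are known. As \<alpha> is
  arbitrary, the fundamental lemma removes it again.\<close>

lemma slice_increment:
  assumes u: "loc_int2 T L u" "continuous_on (QT T L) (\<lambda>q. u (fst q) (snd q))" and w: "loc_int2 T L w"
    and weak: "\<And>\<alpha> \<beta>. test1 0 T \<alpha> \<Longrightarrow> test1 0 L \<beta> \<Longrightarrow>
      (\<integral>q. u (fst q) (snd q) * (\<alpha> (fst q) * deriv \<beta> (snd q)) \<partial>lborel) = - (\<integral>q. w (fst q) (snd q) * (\<alpha> (fst q) * \<beta> (snd q)) \<partial>lborel)"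
    and x: "0 < x1" "x1 \<le> x2" "x2 < L"
  shows "AE p in lborel. p \<in> {0<..<T} \<longrightarrow> u p x2 - u p x1 = (\<integral>y. indicator {x1..x2} y * w p y \<partial>lborel)"
proof -
  define f where "f p = (u p x2 - u p x1) - (\<integral>y. indicator {x1..x2} y * w p y \<partial>lborel)" for p
  have uc: "continuous_on {0<..<T} (\<lambda>p. u p y)" if "0 < y" "y < L" for y
  proof -
    have "continuous_on {0<..<T} (\<lambda>p. (\<lambda>q. u (fst q) (snd q)) (p, y))"
      by (rule continuous_on_compose2[OF u(2)]) (use that in \<open>auto simp: QT_def intro!: continuous_intros\<close>)
    then show ?thesis by simp
  qed
  have lu: "loc_int 0 T (\<lambda>p. u p y)" if "0 < y" "y < L" for y
    by (rule loc_int_continuous[OF loc_int2_measurable(3)[OF u(1)] uc[OF that]])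
  have lf: "loc_int 0 T f" unfolding f_def
    using x by (intro loc_int_diff lu loc_int2_slice_integral[OF w]) auto
  have "AE p in lborel. p \<in> {0<..<T} \<longrightarrow> f p = 0"
  proof (rule fundamental_lemma[OF lf])
    fix \<alpha> assume \<alpha>: "test1 0 T \<alpha>"
    obtain a b where ab: "smooth1 \<alpha>" "0 < a" "b < T" "\<And>x. x \<notin> {a..b} \<Longrightarrow> \<alpha> x = 0"
      by (rule test1E[OF \<alpha>]) (rule that)
    define U where "U y = (\<integral>p. \<alpha> p * u p y \<partial>lborel)" for y
    define W where "W y = (\<integral>p. \<alpha> p * w p y \<partial>lborel)" for y
    have lU: "loc_int 0 L U" and lW: "loc_int 0 L W"
      unfolding U_def W_def using tested_slice(1)[OF _ \<alpha>] u(1) w by auto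
    have Uc: "continuous_on {0<..<L} U"
    proof -
      have "continuous_on {0<..<L} (\<lambda>y. integral (cbox a b) (\<lambda>p. \<alpha> p * u p y))"
      proof (rule integral_continuous_on_param)
        have "continuous_on ({0<..<L} \<times> cbox a b) (\<lambda>q. u (snd q) (fst q))"
        proof -
          have "continuous_on ({0<..<L} \<times> cbox a b) (\<lambda>q. (\<lambda>q. u (fst q) (snd q)) (snd q, fst q))"
            by (rule continuous_on_compose2[OF u(2)]) (use ab(2,3) in \<open>auto simp: QT_def intro!: continuous_intros\<close>)
          then show ?thesis by simp
        qed
        moreover have "continuous_on ({0<..<L} \<times> cbox a b) (\<lambda>q. \<alpha> (snd q))"
          by (rule continuous_on_compose2[OF smooth1_continuous[OF ab(1), of UNIV]]) (auto intro!: continuous_intros)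
        ultimately show "continuous_on ({0<..<L} \<times> cbox a b) (\<lambda>(y, p). \<alpha> p * u p y)"
          unfolding split_beta by (intro continuous_on_mult)
      qed
      moreover have "integral (cbox a b) (\<lambda>p. \<alpha> p * u p y) = U y" if y: "y \<in> {0<..<L}" for y
      proof -
        have c: "continuous_on {a..b} (\<lambda>p. \<alpha> p * u p y)"
          using y ab by (intro continuous_intros smooth1_continuous continuous_on_subset[OF uc]) auto
        have "U y = (LINT p:{a..b}|lborel. \<alpha> p * u p y)"
          unfolding U_def set_lebesgue_integral_def
        proof (rule Bochner_Integration.integral_cong[OF refl])
          fix p show "\<alpha> p * u p y = indicator {a..b} p *\<^sub>R (\<alpha> p * u p y)" using ab(4)[of p] by (cases "p \<in> {a..b}") auto
        qed
        also have "\<dots> = integral {a..b} (\<lambda>p. \<alpha> p * u p y)"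
          by (rule set_borel_integral_eq_integral(2), rule borel_integrable_atLeastAtMost'[OF c])
        finally show ?thesis by simp
      qed
      ultimately show ?thesis by (rule continuous_on_eq) auto
    qed
    have "U x2 - U x1 = (LINT y:{x1..x2}|lborel. W y)"
    proof (rule weak_deriv_increment[OF loc_int_measurable[OF lU] Uc lW _ x])
      fix \<beta> assume \<beta>: "test1 0 L \<beta>"
      show "(\<integral>y. U y * deriv \<beta> y \<partial>lborel) = - (\<integral>y. W y * \<beta> y \<partial>lborel)"
        using tested_slice(2)[OF u(1) \<alpha> test1_deriv[OF \<beta>]] tested_slice(2)[OF w \<alpha> \<beta>] weak[OF \<alpha> \<beta>]
        unfolding U_def W_def by simp
    qed
    also have "\<dots> = (\<integral>p. (\<integral>y. indicator {x1..x2} y * w p y \<partial>lborel) * \<alpha> p \<partial>lborel)"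
      unfolding W_def by (rule tested_slice(3)[OF w \<alpha> x(1,3)])
    finally have e: "U x2 - U x1 = (\<integral>p. (\<integral>y. indicator {x1..x2} y * w p y \<partial>lborel) * \<alpha> p \<partial>lborel)" .
    have i1: "integrable lborel (\<lambda>p. (u p x2 - u p x1) * \<alpha> p)"
      by (rule loc_int_test1_integrable[OF loc_int_diff[OF lu lu] \<alpha>]) (use x in auto)
    have i2: "integrable lborel (\<lambda>p. u p y * \<alpha> p)" if "0 < y" "y < L" for y
      by (rule loc_int_test1_integrable[OF lu \<alpha>]) (use that in auto)
    have i3: "integrable lborel (\<lambda>p. (\<integral>y. indicator {x1..x2} y * w p y \<partial>lborel) * \<alpha> p)"
      by (rule loc_int_test1_integrable[OF loc_int2_slice_integral[OF w x(1,3)] \<alpha>])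
    have "(\<integral>p. f p * \<alpha> p \<partial>lborel) = (\<integral>p. (u p x2 - u p x1) * \<alpha> p \<partial>lborel) - (\<integral>p. (\<integral>y. indicator {x1..x2} y * w p y \<partial>lborel) * \<alpha> p \<partial>lborel)"
      unfolding f_def left_diff_distrib[of "u _ x2 - u _ x1"] by (rule Bochner_Integration.integral_diff[OF i1 i3])
    also have "(\<integral>p. (u p x2 - u p x1) * \<alpha> p \<partial>lborel) = U x2 - U x1"
      using Bochner_Integration.integral_diff[OF i2[of x2] i2[of x1]] x by (simp add: U_def algebra_simps)
    finally show "(\<integral>p. f p * \<alpha> p \<partial>lborel) = 0" using e by simp
  qed
  then show ?thesis by eventually_elim (auto simp: f_def)
qed

text \<open>Rational end points suffice because the primitive is continuous; countably many
  intervals are what a statement almost everywhere in a parameter can provide.\<close>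

lemma AE_const_of_rational_intervals:
  fixes h :: "real \<Rightarrow> real"
  assumes h: "set_integrable lborel {lo..hi} h"
    and z: "\<And>c d. c \<in> \<rat> \<Longrightarrow> d \<in> \<rat> \<Longrightarrow> lo < c \<Longrightarrow> c \<le> d \<Longrightarrow> d < hi \<Longrightarrow> (LINT y:{c..d}|lborel. h y) = 0"
  shows "AE y in lborel. y \<in> {lo..hi} \<longrightarrow> h y = 0"
proof (cases "lo < hi")
  case True
  define k where "k y = indicator {lo..hi} y *\<^sub>R h y" for y
  have k: "integrable lborel k" using h unfolding set_integrable_def k_def .
  define P where "P x = (\<integral>y. indicator {..x} y * k y \<partial>lborel)" for x
  have Pc: "continuous_on S P" for S unfolding P_def by (rule primitive_cont[OF k])
  have ik: "integrable lborel (\<lambda>y. indicator {..x} y * k y)" for x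
    using integrable_mult_indicator[OF _ k, of "{..x}"] by simp
  have Pd: "P d - P c = (LINT y:{c..d}|lborel. h y)" if "lo \<le> c" "c \<le> d" "d \<le> hi" for c d
  proof -
    have "P d - P c = (\<integral>y. indicator {..d} y * k y - indicator {..c} y * k y \<partial>lborel)"
      unfolding P_def by (rule Bochner_Integration.integral_diff[OF ik ik, symmetric])
    also have "\<dots> = (LINT y:{c..d}|lborel. h y)" unfolding set_lebesgue_integral_def
    proof (rule integral_cong_AE)
      have "(\<lambda>y. indicator {c..d} y *\<^sub>R k y) \<in> borel_measurable lborel" using k by measurable
      moreover have "(\<lambda>y. indicator {c..d} y *\<^sub>R k y) = (\<lambda>y. indicator {c..d} y *\<^sub>R h y)"
        using that by (auto simp: k_def indicator_def fun_eq_iff)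
      ultimately show "(\<lambda>y. indicator {c..d} y *\<^sub>R h y) \<in> borel_measurable lborel" by simp
      show "AE y in lborel. indicator {..d} y * k y - indicator {..c} y * k y = indicator {c..d} y *\<^sub>R h y"
        using AE_lborel_singleton[of c] by eventually_elim (use that in \<open>auto simp: k_def indicator_def\<close>)
    qed (use ik in measurable)
    finally show ?thesis .
  qed
  have eq: "P x = P y" if xy: "lo < x" "x \<le> y" "y < hi" for x y
  proof (rule ccontr)
    assume ne: "P x \<noteq> P y"
    then have lt: "x < y" using xy by (cases "x = y") auto
    define e where "e = \<bar>P x - P y\<bar> / 2"
    have e: "e > 0" using ne by (simp add: e_def)
    have "isCont P x" "isCont P y" using Pc[of UNIV] by (auto simp: continuous_on_eq_continuous_at)
    then obtain d1 d2 where d: "d1 > 0" "\<And>z. \<bar>z - x\<bar> < d1 \<Longrightarrow> \<bar>P z - P x\<bar> < e" "d2 > 0" "\<And>z. \<bar>z - y\<bar> < d2 \<Longrightarrow> \<bar>P z - P y\<bar> < e"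
      using e unfolding continuous_at_eps_delta dist_real_def by metis
    obtain c where c: "c \<in> \<rat>" "x < c" "c < min (x + d1) y" using Rats_dense_in_real[of x "min (x + d1) y"] d lt by auto
    obtain c' where c': "c' \<in> \<rat>" "max c (y - d2) < c'" "c' < y" using Rats_dense_in_real[of "max c (y - d2)" y] d c by auto
    have "P c' - P c = 0" using Pd[of c c'] z[OF c(1) c'(1)] c c' xy by auto
    moreover have "\<bar>P c - P x\<bar> < e" "\<bar>P c' - P y\<bar> < e" using d(2)[of c] d(4)[of c'] c c' by auto
    moreover have "\<bar>P x - P y\<bar> = 2 * e" by (simp add: e_def)
    ultimately show False by linarith
  qed
  have const: "P s = P t" if "s \<in> {lo..hi}" "t \<in> {lo..hi}" for s t
    by (rule constant_on_Icc[OF Pc eq True that])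
  show ?thesis
  proof (rule AE_zero_of_intervals[OF h])
    fix c d assume cd: "lo \<le> c" "c \<le> d" "d \<le> hi"
    have "P d = P c" by (rule const) (use cd in auto)
    then show "(LINT y:{c..d}|lborel. h y) = 0" using Pd[OF cd] by simp
  qed
next
  case False
  have "AE y in lborel. y \<noteq> lo" by (rule AE_lborel_singleton)
  then show ?thesis by eventually_elim (use False in auto)
qed

text \<open>Integrals over a variable interval are compared with the one over the middle third,
  first after testing in \<open>p\<close>, then for almost every \<open>p\<close>. The candidate for
  the constant is the mean over that third.\<close>

lemma slice_const:
  assumes L: "0 < L" and g: "loc_int2 T L g"
    and weak: "\<And>\<alpha> \<beta>. test1 0 T \<alpha> \<Longrightarrow> test1 0 L \<beta> \<Longrightarrow>
      (\<integral>q. g (fst q) (snd q) * (\<alpha> (fst q) * deriv \<beta> (snd q)) \<partial>lborel) = 0"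
    and x: "0 < lo" "hi < L"
  shows "AE p in lborel. p \<in> {0<..<T} \<longrightarrow> (\<exists>k. AE y in lborel. y \<in> {lo..hi} \<longrightarrow> g p y = k)"
proof -
  define \<Gamma> where "\<Gamma> c d p = (\<integral>y. indicator {c..d} y * g p y \<partial>lborel)" for c d p
  define b b' where "b = L / 3" and "b' = 2 * L / 3"
  have b: "0 < b" "b < b'" "b' < L" using L by (auto simp: b_def b'_def)
  have one: "AE p in lborel. p \<in> {0<..<T} \<longrightarrow> (b' - b) * \<Gamma> c d p - (d - c) * \<Gamma> b b' p = 0" if cd: "0 < c" "c \<le> d" "d < L" for c d
  proof (rule fundamental_lemma)
    have l: "loc_int 0 T (\<Gamma> c d)" "loc_int 0 T (\<Gamma> b b')"
      unfolding \<Gamma>_def using loc_int2_slice_integral[OF g] cd b by auto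
    have lm: "loc_int 0 T (\<lambda>p. k * f p)" if "loc_int 0 T f" for k f
      using that unfolding loc_int_def by (auto intro: set_integrable_mult_right)
    show "loc_int 0 T (\<lambda>p. (b' - b) * \<Gamma> c d p - (d - c) * \<Gamma> b b' p)"
      by (intro loc_int_diff lm l)
    fix \<alpha> assume \<alpha>: "test1 0 T \<alpha>"
    define G where "G y = (\<integral>p. \<alpha> p * g p y \<partial>lborel)" for y
    have lG: "loc_int 0 L G" unfolding G_def by (rule tested_slice(1)[OF g \<alpha>])
    have "(b' - b) * (LINT y:{c..d}|lborel. G y) = (d - c) * (LINT y:{b..b'}|lborel. G y)"
    proof (rule weak_deriv_zero_const[OF lG])
      fix \<beta> assume \<beta>: "test1 0 L \<beta>"
      show "(\<integral>y. G y * deriv \<beta> y \<partial>lborel) = 0"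
        using tested_slice(2)[OF g \<alpha> test1_deriv[OF \<beta>]] weak[OF \<alpha> \<beta>] unfolding G_def by simp
    qed (use cd b in auto)
    then have e: "(b' - b) * (\<integral>p. \<Gamma> c d p * \<alpha> p \<partial>lborel) = (d - c) * (\<integral>p. \<Gamma> b b' p * \<alpha> p \<partial>lborel)"
      unfolding G_def \<Gamma>_def using tested_slice(3)[OF g \<alpha>] cd b by simp
    have i: "integrable lborel (\<lambda>p. \<Gamma> c d p * \<alpha> p)" "integrable lborel (\<lambda>p. \<Gamma> b b' p * \<alpha> p)"
      using loc_int_test1_integrable[OF _ \<alpha>] l by auto
    have "(\<integral>p. ((b' - b) * \<Gamma> c d p - (d - c) * \<Gamma> b b' p) * \<alpha> p \<partial>lborel)
       = (\<integral>p. (b' - b) * (\<Gamma> c d p * \<alpha> p) - (d - c) * (\<Gamma> b b' p * \<alpha> p) \<partial>lborel)"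
      by (simp add: left_diff_distrib mult.assoc)
    also have "\<dots> = (b' - b) * (\<integral>p. \<Gamma> c d p * \<alpha> p \<partial>lborel) - (d - c) * (\<integral>p. \<Gamma> b b' p * \<alpha> p \<partial>lborel)"
      using i by simp
    finally show "(\<integral>p. ((b' - b) * \<Gamma> c d p - (d - c) * \<Gamma> b b' p) * \<alpha> p \<partial>lborel) = 0" using e by simp
  qed
  \<comment> \<open>Restricting to rational intervals gives a single null set of times that works
    for all of them.\<close>
  define S where "S = {q :: real \<times> real. q \<in> \<rat> \<times> \<rat> \<and> 0 < fst q \<and> fst q \<le> snd q \<and> snd q < L}"
  have "countable S"
    by (rule countable_subset[of _ "\<rat> \<times> \<rat>"]) (auto simp: S_def countable_rat)
  then have "AE p in lborel. \<forall>q\<in>S. p \<in> {0<..<T} \<longrightarrow> (b' - b) * \<Gamma> (fst q) (snd q) p - (snd q - fst q) * \<Gamma> b b' p = 0"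
    by (subst AE_ball_countable) (use one in \<open>auto simp: S_def\<close>)
  moreover note AE_slice_integrable[OF g x]
  ultimately show ?thesis
  proof eventually_elim
    case (elim p)
    show ?case
    proof
      assume p: "p \<in> {0<..<T}"
      define k where "k = \<Gamma> b b' p / (b' - b)"
      have i: "set_integrable lborel {lo..hi} (g p)" using elim p by simp
      have ik: "set_integrable lborel {c..d} (\<lambda>_. k)" for c d :: real
        by (rule borel_integrable_atLeastAtMost') auto
      have "AE y in lborel. y \<in> {lo..hi} \<longrightarrow> g p y - k = 0"
      proof (rule AE_const_of_rational_intervals)
        show "set_integrable lborel {lo..hi} (\<lambda>y. g p y - k)" by (rule set_integral_diff(1)[OF i ik])
        fix c d assume cd: "c \<in> \<rat>" "d \<in> \<rat>" "lo < c" "c \<le> d" "d < hi"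
        then have "(c, d) \<in> S" using x by (auto simp: S_def)
        then have e: "(b' - b) * \<Gamma> c d p = (d - c) * \<Gamma> b b' p" using elim p by auto
        have ic: "set_integrable lborel {c..d} (g p)" by (rule set_integrable_subset[OF i]) (use cd in auto)
        have "(LINT y:{c..d}|lborel. g p y - k) = (LINT y:{c..d}|lborel. g p y) - (LINT y:{c..d}|lborel. k)"
          by (rule set_integral_diff(2)[OF ic ik])
        also have "(LINT y:{c..d}|lborel. g p y) = \<Gamma> c d p" by (simp add: \<Gamma>_def set_lebesgue_integral_def)
        also have "(LINT y:{c..d}|lborel. k) = (d - c) * k" using cd by (simp add: set_lebesgue_integral_def)
        also have "\<Gamma> c d p - (d - c) * k = 0" using e b by (simp add: k_def field_simps)
        finally show "(LINT y:{c..d}|lborel. g p y - k) = 0" .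
      qed
      then show "\<exists>k. AE y in lborel. y \<in> {lo..hi} \<longrightarrow> g p y = k" by auto
    qed
  qed
qed

text \<open>The integral of the continuous function \<open>(f s)\<^sup>2\<close> over a compact
  interval around \<open>t\<close> is 0. This upgrades identities for almost every time to
  identities for every time.\<close>

lemma AE_zero_continuous:
  fixes f :: "real \<Rightarrow> real"
  assumes f: "continuous_on {0<..<T} f" and ae: "AE t in lborel. t \<in> {0<..<T} \<longrightarrow> f t = 0" and t: "t \<in> {0<..<T}"
  shows "f t = 0"
proof -
  define a b where "a = t / 2" and "b = (t + T) / 2"
  have ab: "0 < a" "a < t" "t < b" "b < T" using t by (auto simp: a_def b_def)
  have c: "continuous_on {a..b} (\<lambda>s. (f s)\<^sup>2)" using ab by (intro continuous_intros continuous_on_subset[OF f]) auto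
  have "integral {a..b} (\<lambda>s. (f s)\<^sup>2) = (LINT s:{a..b}|lborel. (f s)\<^sup>2)"
    by (rule set_borel_integral_eq_integral(2)[OF borel_integrable_atLeastAtMost'[OF c], symmetric])
  also have "\<dots> = (\<integral>s. 0 \<partial>(lborel :: real measure))"
    unfolding set_lebesgue_integral_def
  proof (rule integral_cong_AE)
    show "(\<lambda>s. indicator {a..b} s *\<^sub>R (f s)\<^sup>2) \<in> borel_measurable lborel"
      using borel_integrable_atLeastAtMost'[OF c] unfolding set_integrable_def by (rule borel_measurable_integrable)
    show "AE s in lborel. indicator {a..b} s *\<^sub>R (f s)\<^sup>2 = 0"
      using ae by eventually_elim (use ab in \<open>auto simp: indicator_def\<close>)
  qed simp
  finally have "integral {a..b} (\<lambda>s. (f s)\<^sup>2) = 0" by simp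
  then have "(f t)\<^sup>2 = 0" using integral_eq_0_iff[OF c] ab by auto
  then show ?thesis by simp
qed

section \<open>Solutions along particle paths\<close>

text \<open>A solution described by its integrated equations: \<open>mass_balance\<close> is the
  first equation integrated from the inlet, and \<open>c_eq\<close> is the second one integrated
  over [0, L]. The bound from below by \<delta> on the whole plane makes labels and positions
  inverse to each other.\<close>

locale fibre_classical = fibre_trunc +
  fixes T :: real and c :: "real \<Rightarrow> real" and A :: "real \<Rightarrow> real \<Rightarrow> real"
  assumes T: "0 < T" and c_cont: "continuous_on UNIV c" and c_nonneg: "\<And>t. 0 \<le> c t"
    and A_cont: "continuous_on UNIV (\<lambda>q. A (fst q) (snd q))" and A_ge: "\<And>t x. \<delta> \<le> A t x"
    and A_inlet: "\<And>t. t \<in> {0..T} \<Longrightarrow> A t 0 = S0 t" and A_initial: "\<And>x. x \<in> {0..L} \<Longrightarrow> A 0 x = S1 x"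
    and c_eq: "\<And>t. t \<in> {0..T} \<Longrightarrow> c t = (vL t - vin t) / prim (\<lambda>y. 1 / A t y) L"
    and mass_balance: "\<And>t x. t \<in> {0<..<T} \<Longrightarrow> x \<in> {0..L} \<Longrightarrow>
      ((\<lambda>t. prim (A t) x - N t) has_real_derivative - ((vin t + c t * prim (\<lambda>y. 1 / A t y) x) * A t x)) (at t)"
begin

definition "C = prim c"
definition "P t x = prim (\<lambda>y. 1 / A t y) x"
definition "v t x = vin t + c t * P t x"
text \<open>The label of the point \<open>x\<close>, normalized like the labels of the fixed point
  problem: \<open>- N t\<close> at the inlet.\<close>

definition "mass t x = prim (A t) x - N t"
definition "pos t m = inv (mass t) m"

lemma A_pos: "0 < A t x" using A_ge[of t x] \<delta> by linarith
lemma C_cont: "continuous_on S C" unfolding C_def by (rule continuous_on_prim[OF c_cont])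
lemma C_deriv: "(C has_real_derivative c t) (at t)" unfolding C_def by (rule prim_deriv[OF c_cont])
lemma C_mono: "s \<le> t \<Longrightarrow> C s \<le> C t" using prim_lower[OF c_cont c_nonneg, of s t] by (simp add: C_def)

lemma A_slice_cont: "continuous_on S (A t)" by (intro continuous_on_compose_pair[OF A_cont] continuous_intros)

lemma invA_cont: "continuous_on UNIV (\<lambda>q. 1 / A (fst q) (snd q))"
  using A_pos by (intro continuous_intros A_cont) (auto simp: less_imp_neq[THEN not_sym])

lemma invA_slice_cont: "continuous_on S (\<lambda>y. 1 / A t y)"
  using A_pos by (intro continuous_intros A_slice_cont) (auto simp: less_imp_neq[THEN not_sym])

lemma P_cont: "continuous_on UNIV (\<lambda>q. P (fst q) (snd q))"
  unfolding P_def by (rule continuous_on_prim_joint[OF invA_cont])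

lemma v_cont: "continuous_on UNIV (\<lambda>q. v (fst q) (snd q))"
  unfolding v_def
  by (intro continuous_intros P_cont continuous_on_compose2[OF vin_cont] continuous_on_compose2[OF c_cont]) auto

lemma P_deriv: "(P t has_real_derivative 1 / A t x) (at x)"
  unfolding P_def[abs_def] by (rule prim_deriv[OF invA_slice_cont])

lemma mass_cont: "continuous_on UNIV (\<lambda>q. mass (fst q) (snd q))"
  unfolding mass_def by (intro continuous_intros continuous_on_prim_joint[OF A_cont] continuous_on_compose2[OF N_cont]) auto

lemma mass_deriv_x: "(mass t has_real_derivative A t x) (at x)"
  unfolding mass_def[abs_def] using prim_deriv[OF A_slice_cont] by (auto intro!: derivative_eq_intros)

lemma mass_deriv_t: "t \<in> {0<..<T} \<Longrightarrow> x \<in> {0..L} \<Longrightarrow> ((\<lambda>t. mass t x) has_real_derivative - (v t x * A t x)) (at t)"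
  using mass_balance[of t x] by (simp add: mass_def v_def P_def)

lemma mass_slope: "x \<le> y \<Longrightarrow> \<delta> * (y - x) \<le> mass t y - mass t x"
  using prim_lower[OF A_slice_cont[of UNIV t] A_ge] by (simp add: mass_def)

lemma mass_bij: "bij (mass t)" "strict_mono (mass t)"
proof -
  have "continuous_on UNIV (mass t)" by (intro continuous_on_compose_pair[OF mass_cont] continuous_intros)
  then show "bij (mass t)" "strict_mono (mass t)" using slope_bij[OF _ \<delta>(1) mass_slope] by auto
qed

lemma mass_pos: "mass t (pos t m) = m" and pos_mass: "pos t (mass t x) = x"
  using mass_bij(1)[of t] by (simp_all add: pos_def bij_is_surj surj_f_inv_f bij_is_inj)

lemma mass_le_iff: "mass t x \<le> mass t y \<longleftrightarrow> x \<le> y"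
  using mass_bij(2)[of t] by (simp add: strict_mono_less_eq)

lemma pos_le_iff: "pos t m \<le> x \<longleftrightarrow> m \<le> mass t x" "x \<le> pos t m \<longleftrightarrow> mass t x \<le> m"
  using mass_le_iff[of t "pos t m" x] mass_le_iff[of t x "pos t m"] by (auto simp: mass_pos)

lemma pos_cont: "continuous_on UNIV (\<lambda>q. pos (fst q) (snd q))"
  unfolding pos_def by (rule continuous_on_inv_joint[OF mass_cont \<delta>(1) mass_slope])

lemma mass_inlet: "mass t 0 = - N t" by (simp add: mass_def)

definition "w' t m = 1 / A t (pos t m)"

lemma w'_cont: "continuous_on UNIV (\<lambda>q. w' (fst q) (snd q))"
  unfolding w'_def by (intro continuous_on_compose_pair[OF invA_cont] pos_cont continuous_intros)

lemma w'_pos: "0 < w' t m" using A_pos by (simp add: w'_def)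

lemma pos_deriv_m: "(pos t has_real_derivative w' t m) (at m)"
proof -
  have c: "isCont (pos t) m"
  proof -
    have "continuous_on UNIV (pos t)" by (intro continuous_on_compose_pair[OF pos_cont] continuous_intros)
    then show ?thesis by (simp add: continuous_on_eq_continuous_at)
  qed
  have hc: "continuous_on UNIV (\<lambda>q::real \<times> real. A t (snd q))"
    by (intro continuous_on_compose_pair[OF A_cont] continuous_intros)
  have "(pos t has_real_derivative - (-1) / A t (pos t m)) (at m)"
  proof (rule implicit_deriv[where f="\<lambda>m x. mass t x - m" and fm="\<lambda>m x. A t x" and k=0])
    show "((\<lambda>x. mass t x - y) has_real_derivative A t x) (at x)" for y x
      by (auto intro!: derivative_eq_intros mass_deriv_x)
    show "((\<lambda>m'. mass t (pos t m) - m') has_real_derivative -1) (at m)" by (auto intro!: derivative_eq_intros)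
  qed (use hc A_pos c mass_pos in auto)
  then show ?thesis by (simp add: w'_def)
qed

lemma pos_deriv_t:
  assumes "t \<in> {0<..<T}" "pos t m \<in> {0..L}"
  shows "((\<lambda>t. pos t m) has_real_derivative v t (pos t m)) (at t)"
proof -
  have c: "isCont (\<lambda>t. pos t m) t"
  proof -
    have "continuous_on UNIV (\<lambda>t. pos t m)" by (intro continuous_on_compose_pair[OF pos_cont] continuous_intros)
    then show ?thesis by (simp add: continuous_on_eq_continuous_at)
  qed
  have "((\<lambda>t. pos t m) has_real_derivative - (- (v t (pos t m) * A t (pos t m))) / A t (pos t m)) (at t)"
    by (rule implicit_deriv[OF mass_deriv_x A_cont A_pos mass_deriv_t[OF assms] c mass_pos])
  then show ?thesis using A_pos[of t "pos t m"] by simp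
qed

lemma P_nonneg: "0 \<le> x \<Longrightarrow> 0 \<le> P t x"
  using prim_lower[OF invA_slice_cont[of UNIV t], of 0 0 x] A_pos by (simp add: P_def less_imp_le)

lemma v_ge: "0 \<le> x \<Longrightarrow> vm \<le> v t x"
  using v_bounds(1)[of t] c_nonneg[of t] P_nonneg[of x t] unfolding v_def by (smt (verit) mult_nonneg_nonneg)

lemma mass_outlet_mono: "0 \<le> s \<Longrightarrow> s \<le> t \<Longrightarrow> t \<le> T \<Longrightarrow> mass t L \<le> mass s L"
proof -
  assume st: "0 \<le> s" "s \<le> t" "t \<le> T"
  have "mass t L - mass s L \<le> 0 - 0"
  proof (rule deriv_mono_le[OF st(2)])
    show "continuous_on {s..t} (\<lambda>t. mass t L)" by (intro continuous_on_compose_pair[OF mass_cont] continuous_intros)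
    fix r assume r: "s < r" "r < t"
    show "((\<lambda>t. mass t L) has_real_derivative - (v r L * A r L)) (at r)"
      by (rule mass_deriv_t) (use r st L in auto)
    show "((\<lambda>t. 0) has_real_derivative 0) (at r)" by simp
    show "- (v r L * A r L) \<le> 0" using v_ge[of L r] vm L A_pos[of r L] by simp
  qed simp
  then show ?thesis by simp
qed

text \<open>The inlet label and the outlet label both decrease in time, so a particle that has
  entered by \<open>s0\<close> and has not left by \<open>t\<close> is inside at all times
  between.\<close>

lemma path_inside:
  assumes t: "t \<in> {0..T}" and m: "- N s0 \<le> m" "m \<le> mass t L" and s: "0 \<le> s0" "s0 \<le> s" "s \<le> t"
  shows "pos s m \<in> {0..L}"
proof -
  have "N s0 \<le> N s" using s by simp
  then have "- N s \<le> m" using m by linarith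
  then show ?thesis using m mass_outlet_mono[of s t] t s pos_le_iff(2)[of 0 s m] pos_le_iff(1)[of s m L]
    by (simp add: mass_inlet)
qed

text \<open>Both sides are differentiated in the label: the position of a particle integrates its
  velocity, and \<open>w'\<close> is the derivative of the position with respect to the label.\<close>

lemma w'_evolution:
  assumes t: "t \<in> {0..T}" and s0: "0 \<le> s0" "s0 \<le> t" and m: "- N s0 \<le> m" "m < mass t L"
  shows "w' t m - w' s0 m = integral {s0..t} (\<lambda>r. c r * (w' r m)\<^sup>2)"
proof -
  define J where "J = {- N s0..mass t L}"
  have id: "pos t m' - pos s0 m' = integral {s0..t} (\<lambda>r. v r (pos r m'))" if m': "m' \<in> J" for m'
  proof -
    have "((\<lambda>r. v r (pos r m')) has_integral (pos t m' - pos s0 m')) {s0..t}"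
    proof (rule fundamental_theorem_of_calculus_interior[OF s0(2)])
      show "continuous_on {s0..t} (\<lambda>r. pos r m')" by (intro continuous_on_compose_pair[OF pos_cont] continuous_intros)
      fix r assume r: "r \<in> {s0<..<t}"
      have "pos r m' \<in> {0..L}" by (rule path_inside[OF t _ _ s0(1)]) (use m' r in \<open>auto simp: J_def\<close>)
      then show "((\<lambda>r. pos r m') has_vector_derivative v r (pos r m')) (at r)"
        using pos_deriv_t[of r m'] r s0 t by (simp add: has_real_derivative_iff_has_vector_derivative)
    qed
    then show ?thesis by (simp add: integral_unique)
  qed
  have dR: "((\<lambda>m. integral (cbox s0 t) (\<lambda>r. v r (pos r m))) has_real_derivative integral (cbox s0 t) (\<lambda>r. c r * (w' r m)\<^sup>2)) (at m within UNIV)"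
  proof (rule leibniz_rule_field_derivative)
    fix x r
    have "((\<lambda>m. v r (pos r m)) has_real_derivative c r * (1 / A r (pos r x) * w' r x)) (at x)"
      unfolding v_def by (auto intro!: derivative_eq_intros DERIV_chain2[OF P_deriv pos_deriv_m])
    then show "((\<lambda>m. v r (pos r m)) has_real_derivative c r * (w' r x)\<^sup>2) (at x within UNIV)"
      by (simp add: w'_def power2_eq_square)
  next
    show "(\<lambda>r. v r (pos r x)) integrable_on cbox s0 t" for x
      by (intro integrable_continuous continuous_on_compose_pair[OF v_cont] continuous_on_compose_pair[OF pos_cont] continuous_intros)
    have "continuous_on (UNIV \<times> cbox s0 t) (\<lambda>q. c (snd q) * (w' (snd q) (fst q))\<^sup>2)"
      by (intro continuous_intros continuous_on_compose_pair[OF w'_cont] continuous_on_compose2[OF c_cont]) auto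
    then show "continuous_on (UNIV \<times> cbox s0 t) (\<lambda>(m, r). c r * (w' r m)\<^sup>2)" by (simp add: split_beta)
  qed auto
  have dL: "((\<lambda>m. pos t m - pos s0 m) has_real_derivative w' t m - w' s0 m) (at m)"
    by (intro DERIV_diff pos_deriv_m)
  have mJ: "m \<in> J" using m by (simp add: J_def)
  \<comment> \<open>The identity to be differentiated is known for labels in \<open>J\<close> only,
    so both derivatives are taken within this interval; being nondegenerate, it determines them
    uniquely.\<close>
  have "((\<lambda>m. integral (cbox s0 t) (\<lambda>r. v r (pos r m))) has_vector_derivative w' t m - w' s0 m) (at m within J)"
  proof (rule has_vector_derivative_transform[OF mJ])
    show "((\<lambda>m. pos t m - pos s0 m) has_vector_derivative w' t m - w' s0 m) (at m within J)"
      using dL by (simp add: has_real_derivative_iff_has_vector_derivative has_vector_derivative_at_within)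
  qed (use id in simp)
  moreover have "((\<lambda>m. integral (cbox s0 t) (\<lambda>r. v r (pos r m))) has_vector_derivative integral (cbox s0 t) (\<lambda>r. c r * (w' r m)\<^sup>2)) (at m within J)"
    using dR by (simp add: has_real_derivative_iff_has_vector_derivative has_vector_derivative_at_within)
  moreover have "- N s0 < mass t L" using m by simp
  ultimately show ?thesis
    using vector_derivative_unique_within_closed_interval[of "- N s0" "mass t L" m] mJ unfolding J_def by simp
qed

lemma pos_start:
  assumes "t \<in> {0..T}" "- N t \<le> m" "m \<le> mass t L"
  shows "A (\<tau> m) (pos (\<tau> m) m) = b m"
proof (cases "m \<le> 0")
  case True
  have \<tau>: "\<tau> m \<le> t" using \<tau>_le_iff[of t m] assms by simp
  have "mass (\<tau> m) 0 = m" using True by (simp add: mass_inlet N_\<tau>)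
  then have "pos (\<tau> m) m = 0" using pos_mass[of "\<tau> m" 0] by simp
  then show ?thesis using True A_inlet[of "\<tau> m"] \<tau> \<tau>_nonneg[of m] assms by (simp add: b_neg)
next
  case False
  then have \<tau>0: "\<tau> m = 0" by (simp add: \<tau>_pos)
  have inside: "pos 0 m \<in> {0..L}"
    by (rule path_inside[OF assms(1), of 0]) (use False assms in auto)
  have "mass 0 x = R x" if x: "x \<in> {0..L}" for x
  proof -
    have "prim (A 0) x = integral {0..x} (A 0)" using prim_diff[OF A_slice_cont, of 0 x 0] x by simp
    also have "\<dots> = integral {0..x} S1" by (rule integral_cong) (use A_initial x in auto)
    also have "\<dots> = R x" using prim_diff[OF S1_cont, of 0 x] x by (simp add: R_def)
    finally show ?thesis by (simp add: mass_def)
  qed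
  then have "R (pos 0 m) = m" using inside mass_pos[of 0 m] by simp
  then have "\<xi> m = pos 0 m" using \<xi>_R[of "pos 0 m"] inside by simp
  then show ?thesis using False inside A_initial \<tau>0 by (simp add: b_pos)
qed

text \<open>Along a path the reciprocal area solves the Riccati equation with right side c w^2, so
  the area itself decreases at the rate \<open>c\<close>.\<close>

lemma A_along_path:
  assumes t: "t \<in> {0..T}" and m: "- N t \<le> m" "m \<le> mass t L"
  shows "A t (pos t m) = b m - (C t - C (\<tau> m))"
proof -
  have open_case: "A t (pos t m) = b m - (C t - C (\<tau> m))" if m: "- N t < m" "m < mass t L" for m
  proof -
    define s0 where "s0 = \<tau> m"
    have s0: "0 \<le> s0" "s0 \<le> t" using \<tau>_nonneg[of m] \<tau>_le_iff[of t m] t m by (auto simp: s0_def)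
    have ns0: "- N s0 \<le> m" by (simp add: s0_def N_\<tau>)
    have cc: "continuous_on S (\<lambda>r. c r * (w' r m)\<^sup>2)" for S
      by (intro continuous_intros continuous_on_compose_pair[OF w'_cont] continuous_on_subset[OF c_cont]) auto
    have evo: "w' r m = w' s0 m + (prim (\<lambda>r. c r * (w' r m)\<^sup>2) r - prim (\<lambda>r. c r * (w' r m)\<^sup>2) s0)" if r: "s0 \<le> r" "r \<le> t" for r
    proof -
      have "w' r m - w' s0 m = integral {s0..r} (\<lambda>r. c r * (w' r m)\<^sup>2)"
        by (rule w'_evolution) (use r s0 t m ns0 mass_outlet_mono[of r t] in auto)
      then show ?thesis using prim_diff[OF cc r(1)] by simp
    qed
    have wd: "((\<lambda>r. w' r m) has_real_derivative c r * (w' r m)\<^sup>2) (at r)" if r: "s0 < r" "r < t" for r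
    proof -
      have "((\<lambda>r. w' s0 m + (prim (\<lambda>r. c r * (w' r m)\<^sup>2) r - prim (\<lambda>r. c r * (w' r m)\<^sup>2) s0)) has_real_derivative c r * (w' r m)\<^sup>2) (at r)"
        by (auto intro!: derivative_eq_intros prim_deriv[OF cc])
      moreover have "\<forall>\<^sub>F r in nhds r. r \<in> {s0<..<t}" by (rule eventually_nhds_in_open) (use r in auto)
      then have ev: "\<forall>\<^sub>F r in nhds r. w' s0 m + (prim (\<lambda>r. c r * (w' r m)\<^sup>2) r - prim (\<lambda>r. c r * (w' r m)\<^sup>2) s0) = w' r m"
        by eventually_elim (rule evo[symmetric], auto)
      ultimately show ?thesis using DERIV_cong_ev[OF refl ev refl] by blast
    qed
    \<comment> \<open>The first integral of the Riccati equation.\<close>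
    define e where "e r = 1 / w' r m + C r" for r
    have ec: "continuous_on S e" for S
      unfolding e_def using w'_pos
      by (intro continuous_intros continuous_on_compose_pair[OF w'_cont] C_cont) (auto simp: less_imp_neq[THEN not_sym])
    have ed: "(e has_real_derivative 0) (at r)" if r: "s0 < r" "r < t" for r
      unfolding e_def using w'_pos[of r m]
      by (auto intro!: derivative_eq_intros wd[OF r] C_deriv simp: power2_eq_square)
    have "e t = e s0"
    proof (cases "s0 = t")
      case False
      then show ?thesis using DERIV_isconst_end[of s0 t e] s0 ec ed by auto
    qed simp
    then have "A t (pos t m) + C t = A s0 (pos s0 m) + C s0" by (simp add: e_def w'_def)
    moreover have "A s0 (pos s0 m) = b m"
      unfolding s0_def by (rule pos_start[OF t]) (use m in auto)
    ultimately show ?thesis by (simp add: s0_def)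
  qed
  have lt: "- N t < mass t L" using mass_bij(2)[of t] L mass_inlet[of t] by (metis strict_mono_less)
  \<comment> \<open>The two end labels of the fibre are reached by continuity.\<close>
  define e where "e m = A t (pos t m) - (b m - (C t - C (\<tau> m)))" for m
  have ec: "continuous_on {- N t..mass t L} e"
    unfolding e_def
    by (intro continuous_intros continuous_on_compose_pair[OF A_cont] continuous_on_compose_pair[OF pos_cont] b_cont continuous_on_compose2[OF C_cont \<tau>_cont]) auto
  have "e s = e t'" if "- N t < s" "s \<le> t'" "t' < mass t L" for s t'
    using open_case[of s] open_case[of t'] that by (simp add: e_def)
  then have "e m = e ((- N t + mass t L) / 2)"
    using constant_on_Icc[OF ec _ lt, of m "(- N t + mass t L) / 2"] m lt by auto
  also have "\<dots> = 0" using open_case[of "(- N t + mass t L) / 2"] lt by (simp add: e_def)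
  finally show ?thesis by (simp add: e_def)
qed

lemma \<alpha>_eq:
  assumes t: "t \<in> {0..T}" and m: "- N t \<le> m" "m \<le> mass t L"
  shows "\<alpha> C t m = A t (pos t m)" and "w C t m = w' t m"
proof -
  have "C (\<tau> m) \<le> C t" using \<tau>_le_iff[of t m] t m by (intro C_mono) auto
  then show "\<alpha> C t m = A t (pos t m)"
    using A_along_path[OF assms] A_ge[of t "pos t m"] by (simp add: \<alpha>_def)
  then show "w C t m = w' t m" by (simp add: w_def w'_def)
qed

lemma w_integral:
  assumes t: "t \<in> {0..T}" and x: "x \<in> {0..L}"
  shows "integral {- N t..mass t x} (w C t) = x"
proof -
  have le: "- N t \<le> mass t x" using mass_le_iff[of t 0 x] x by (simp add: mass_inlet)
  have "(w' t has_integral (pos t (mass t x) - pos t (- N t))) {- N t..mass t x}"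
    using pos_deriv_m by (intro fundamental_theorem_of_calculus[OF le])
      (simp add: has_real_derivative_iff_has_vector_derivative has_vector_derivative_at_within)
  then have "integral {- N t..mass t x} (w' t) = x"
    using pos_mass[of t x] pos_mass[of t 0] by (simp add: mass_inlet integral_unique)
  moreover have "integral {- N t..mass t x} (w C t) = integral {- N t..mass t x} (w' t)"
    by (rule integral_cong) (use \<alpha>_eq(2)[OF t] mass_le_iff[of t x L] x in auto)
  ultimately show ?thesis by simp
qed

lemma mL_eq: "t \<in> {0..T} \<Longrightarrow> mL C t = mass t L"
  using mL_eqI[OF C_cont, of t "mass t L"] w_integral[of t L] mass_le_iff[of t 0 L] L by (simp add: mass_inlet)

text \<open>The substitution x = pos t m turns the integral of 1 / A over [0, L] into that of the
  squared reciprocal area over the labels, which is \<open>I\<close>.\<close>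

lemma c_fixed: 
  assumes t: "t \<in> {0..T}"
  shows "c t = F C t"
proof -
  have le: "- N t \<le> mass t L" using mass_le_iff[of t 0 L] L by (simp add: mass_inlet)
  have "((\<lambda>m. P t (pos t m)) has_real_derivative 1 / A t (pos t m) * w' t m) (at m)" for m
    by (rule DERIV_chain2[OF P_deriv pos_deriv_m])
  then have "((\<lambda>m. P t (pos t m)) has_vector_derivative (w' t m)\<^sup>2) (at m within {- N t..mass t L})" for m
    by (simp add: has_real_derivative_iff_has_vector_derivative has_vector_derivative_at_within w'_def power2_eq_square)
  then have "((\<lambda>m. (w' t m)\<^sup>2) has_integral (P t (pos t (mass t L)) - P t (pos t (- N t)))) {- N t..mass t L}"
    by (intro fundamental_theorem_of_calculus[OF le])
  then have "integral {- N t..mass t L} (\<lambda>m. (w' t m)\<^sup>2) = P t L"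
    using pos_mass[of t L] pos_mass[of t 0] by (simp add: mass_inlet integral_unique P_def)
  moreover have "I C t = integral {- N t..mass t L} (\<lambda>m. (w' t m)\<^sup>2)"
    unfolding I_def mL_eq[OF t] by (rule integral_cong) (use \<alpha>_eq(2)[OF t] in auto)
  ultimately show ?thesis using c_eq[OF t] by (simp add: F_def P_def)
qed

lemma C_fixed: "t \<in> {0..T} \<Longrightarrow> C t = prim (F C) t"
proof -
  assume t: "t \<in> {0..T}"
  have "C t = integral {0..t} c" using prim_diff[OF c_cont, of 0 t] t by (simp add: C_def)
  also have "\<dots> = integral {0..t} (F C)" by (rule integral_cong) (use c_fixed t in auto)
  also have "\<dots> = prim (F C) t" using prim_diff[OF F_cont[OF C_cont], of 0 t] t by simp
  finally show ?thesis .
qed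

lemma A_eq_\<alpha>: "t \<in> {0..T} \<Longrightarrow> x \<in> {0..L} \<Longrightarrow> A t x = \<alpha> C t (mass t x)"
  using \<alpha>_eq(1)[of t "mass t x"] mass_le_iff[of t 0 x] mass_le_iff[of t x L] by (simp add: pos_mass mass_inlet)

lemma mass_ge: "x \<in> {0..L} \<Longrightarrow> - N t \<le> mass t x"
  using mass_le_iff[of t 0 x] by (simp add: mass_inlet)

end

section \<open>Uniqueness\<close>

text \<open>With a common \<delta> both solutions give fixed points of one and the same map, so
  \<open>C\<close> agrees. It determines the area as a function of the label and the position of
  each label; the label of a point, and then its area and the rate, follow.\<close>

lemma classical_unique:
  assumes 1: "fibre_classical L vm VM Sm SM vin vL S0 S1 \<delta> T c1 A1"
    and 2: "fibre_classical L vm VM Sm SM vin vL S0 S1 \<delta> T c2 A2"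
    and t: "t \<in> {0..T}" and x: "x \<in> {0..L}"
  shows "A1 t x = A2 t x" and "c1 t = c2 t"
proof -
  interpret s1: fibre_classical L vm VM Sm SM vin vL S0 S1 \<delta> T c1 A1 by (rule 1)
  interpret s2: fibre_classical L vm VM Sm SM vin vL S0 S1 \<delta> T c2 A2 by (rule 2)
  have C: "s1.C s = s2.C s" if "s \<in> {0..T}" for s
    by (rule s1.fixed_point_unique[OF s1.C_cont s2.C_cont _ s1.C_fixed s2.C_fixed that]) (use s1.T in auto)
  have C0: "\<forall>s\<in>{0..t}. \<bar>s1.C s - s2.C s\<bar> \<le> 0" using C t by auto
  have \<alpha>: "s1.\<alpha> s1.C t m = s1.\<alpha> s2.C t m" if "- s1.N t \<le> m" for m
    using s1.\<alpha>_diff[OF _ that C0] t by simp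
  have w: "s1.w s1.C t m = s1.w s2.C t m" if "- s1.N t \<le> m" for m
    using \<alpha>[OF that] by (simp add: s1.w_def)
  have "s1.X s1.C t (s2.mass t x) = x"
  proof -
    have "s1.X s1.C t (s2.mass t x) = integral {- s1.N t..s2.mass t x} (s1.w s1.C t)"
      by (rule s1.X_integral[OF s1.C_cont s2.mass_ge[OF x]])
    also have "\<dots> = integral {- s1.N t..s2.mass t x} (s1.w s2.C t)"
      by (rule integral_cong) (simp add: w)
    finally show ?thesis using s2.w_integral[OF t x] by simp
  qed
  moreover have "s1.X s1.C t (s1.mass t x) = x"
    using s1.X_integral[OF s1.C_cont s1.mass_ge[OF x]] s1.w_integral[OF t x] by simp
  ultimately have "s1.mass t x = s2.mass t x"
    using s1.X_bij(1)[OF s1.C_cont, of t] by (metis bij_is_inj inv_f_f)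
  then show "A1 t x = A2 t x"
    using s1.A_eq_\<alpha>[OF t x] s2.A_eq_\<alpha>[OF t x] \<alpha>[OF s1.mass_ge[OF x]] by simp
  have "s1.F s1.C t = s1.F s2.C t"
    by (rule s1.F_cong[OF s1.C_cont s2.C_cont]) (use t C in auto)
  then show "c1 t = c2 t" using s1.c_fixed[OF t] s2.c_fixed[OF t] by simp
qed

section \<open>Integral identities for strong solutions\<close>

lemma box_set_integrable_loc_int2:
  fixes w :: "real \<times> real \<Rightarrow> real"
  assumes m: "w \<in> borel_measurable borel" and i: "\<And>K. compact K \<Longrightarrow> K \<subseteq> QT T L \<Longrightarrow> set_integrable lborel K w"
  shows "loc_int2 T L (\<lambda>t x. w (t, x))"
  unfolding loc_int2_def
proof (intro conjI allI impI)
  show "(\<lambda>q. w (fst q, snd q)) \<in> borel_measurable borel" using m by simp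
  fix a b c d :: real assume abcd: "0 < a \<and> b < T \<and> 0 < c \<and> d < L"
  have "set_integrable lborel ({a..b} \<times> {c..d}) w"
    by (rule i) (use abcd in \<open>auto simp: QT_def intro!: compact_Times\<close>)
  moreover have "indicator ({a..b} \<times> {c..d}) q *\<^sub>R w q = (case q of (p, y) \<Rightarrow> indicator {a..b} p * indicator {c..d} y * w (p, y))" for q
    by (cases q) (auto simp: indicator_def)
  ultimately show "integrable (lborel \<Otimes>\<^sub>M lborel) (\<lambda>(p, y). indicator {a..b} p * indicator {c..d} y * w (p, y))"
    unfolding set_integrable_def by (simp add: lborel_prod)
qed

lemma AE_lebesgue_borel_iff:
  fixes f :: "'a::euclidean_space \<Rightarrow> real"
  assumes "f \<in> borel_measurable borel" "AE x in lebesgue. f x = 0"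
  shows "AE x in lborel. f x = 0"
  using assms by (subst (asm) AE_completion_iff) auto

lemma AE_lebesgue_on_QT: "(AE q in lebesgue_on (QT T L). P q) \<longleftrightarrow> (AE q in lebesgue. q \<in> QT T L \<longrightarrow> P q)"
  by (rule AE_restrict_space_iff) simp

lemma weak_deriv_rep2:
  fixes u w :: "real \<times> real \<Rightarrow> real"
  assumes "weak_deriv (QT T L) [b] u w"
  obtains w' where "loc_int2 T L w'" "AE q in lebesgue. q \<in> QT T L \<longrightarrow> w q = w' (fst q) (snd q)"
    "\<And>q. q \<notin> QT T L \<Longrightarrow> w' (fst q) (snd q) = 0"
    "\<forall>\<phi>. test_fun (QT T L) \<phi> \<longrightarrow> (\<integral>q. u q * partial_deriv b \<phi> q \<partial>lebesgue_on (QT T L)) = - (\<integral>q. w' (fst q) (snd q) * \<phi> q \<partial>lborel)"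
proof -
  have lw: "loc_integrable (QT T L) w" using assms by (simp add: weak_deriv_def)
  obtain w' where w': "w' \<in> borel_measurable borel" "AE x in lebesgue. x \<in> QT T L \<longrightarrow> w x = w' x"
    "\<And>x. x \<notin> QT T L \<Longrightarrow> w' x = 0" "\<And>K. compact K \<Longrightarrow> K \<subseteq> QT T L \<Longrightarrow> set_integrable lborel K w'"
    "\<And>\<psi>. \<psi> \<in> borel_measurable borel \<Longrightarrow>
       (\<integral>x. w x * \<psi> x \<partial>lebesgue_on (QT T L)) = (\<integral>x. w' x * \<psi> x \<partial>lborel)"
    by (rule loc_integrable_borel_rep[OF QT_open lw]) (rule that)
  show thesis
  proof (rule that[of "\<lambda>t x. w' (t, x)"])
    show "loc_int2 T L (\<lambda>t x. w' (t, x))" by (rule box_set_integrable_loc_int2[OF w'(1,4)])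
    show "\<forall>\<phi>. test_fun (QT T L) \<phi> \<longrightarrow> (\<integral>q. u q * partial_deriv b \<phi> q \<partial>lebesgue_on (QT T L)) = - (\<integral>q. w' (fst q, snd q) * \<phi> q \<partial>lborel)"
      using assms w'(5)[OF test_fun_measurable] by (simp add: weak_deriv_def)
  qed (use w'(2,3) in auto)
qed

lemma loc_int2_continuous:
  fixes u :: "real \<times> real \<Rightarrow> real"
  assumes u: "continuous_on (QT T L) u"
  shows "loc_int2 T L (\<lambda>t x. indicator (QT T L) (t, x) * u (t, x))"
proof (rule box_set_integrable_loc_int2)
  let ?u = "\<lambda>q. indicator (QT T L) q * u q"
  show m: "?u \<in> borel_measurable borel"
    using integral_lebesgue_on_continuous(1)[OF QT_open u, of "\<lambda>_. 0"] by simp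
  fix K assume K: "compact K" "K \<subseteq> QT T L"
  have "bounded (u ` K)" by (intro compact_imp_bounded compact_continuous_image continuous_on_subset[OF u] K)
  then obtain M where M: "\<forall>q\<in>K. \<bar>u q\<bar> \<le> M" by (auto simp: bounded_iff)
  show "set_integrable lborel K ?u" unfolding set_integrable_def
    by (rule bounded_on_integrable[OF m borel_compact[OF K(1)] subset_trans[OF K(2) QT_sub], where M=M])
      (use M in \<open>auto simp: indicator_def\<close>)
qed

lemma test_fun_QT_prod:
  assumes "test1 0 T \<alpha>" "test1 0 L \<beta>"
  shows "test_fun (QT T L) (\<lambda>q. \<alpha> (fst q) * \<beta> (snd q))"
    and "partial_deriv dir_t (\<lambda>q. \<alpha> (fst q) * \<beta> (snd q)) = (\<lambda>q. deriv \<alpha> (fst q) * \<beta> (snd q))"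
    and "partial_deriv dir_x (\<lambda>q. \<alpha> (fst q) * \<beta> (snd q)) = (\<lambda>q. \<alpha> (fst q) * deriv \<beta> (snd q))"
proof -
  obtain a b where ab: "smooth1 \<alpha>" "0 < a" "b < T" "\<And>x. x \<notin> {a..b} \<Longrightarrow> \<alpha> x = 0"
    by (rule test1E[OF assms(1)]) (rule that)
  obtain c d where cd: "smooth1 \<beta>" "0 < c" "d < L" "\<And>x. x \<notin> {c..d} \<Longrightarrow> \<beta> x = 0"
    by (rule test1E[OF assms(2)]) (rule that)
  show "test_fun (QT T L) (\<lambda>q. \<alpha> (fst q) * \<beta> (snd q))"
    by (rule test_fun_prod[OF ab(1) cd(1) _ ab(4) cd(4)]) (use ab cd in \<open>auto simp: QT_def\<close>)
  show "partial_deriv dir_t (\<lambda>q. \<alpha> (fst q) * \<beta> (snd q)) = (\<lambda>q. deriv \<alpha> (fst q) * \<beta> (snd q))"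
    "partial_deriv dir_x (\<lambda>q. \<alpha> (fst q) * \<beta> (snd q)) = (\<lambda>q. \<alpha> (fst q) * deriv \<beta> (snd q))"
    by (rule partial_deriv_prod[OF ab(1) cd(1)])+
qed

lemma prod_measurable:
  assumes "test1 0 T \<alpha>" "test1 0 L \<beta>"
  shows "(\<lambda>q. \<alpha> (fst q) * \<beta> (snd q)) \<in> borel_measurable borel"
  by (rule test_fun_measurable[OF test_fun_QT_prod(1)[OF assms]])

lemma integral_lborel_swap:
  fixes f :: "real \<times> real \<Rightarrow> real"
  assumes "f \<in> borel_measurable borel"
  shows "(\<integral>q. f (snd q, fst q) \<partial>lborel) = (\<integral>q. f q \<partial>lborel)"
proof -
  have m: "f \<in> borel_measurable (lborel \<Otimes>\<^sub>M lborel)" using assms by (simp add: lborel_prod)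
  have "(\<lambda>q. f (snd q, fst q)) = (\<lambda>(x, y). f (y, x))" by (auto simp: fun_eq_iff)
  with lborel_pair.integral_product_swap[OF m] show ?thesis unfolding lborel_prod by simp
qed

lemma x_increment:
  fixes u :: "real \<times> real \<Rightarrow> real"
  assumes u: "continuous_on (QT T L) u"
    and w': "loc_int2 T L w'"
      "\<forall>\<phi>. test_fun (QT T L) \<phi> \<longrightarrow> (\<integral>q. u q * partial_deriv dir_x \<phi> q \<partial>lebesgue_on (QT T L)) = - (\<integral>q. w' (fst q) (snd q) * \<phi> q \<partial>lborel)"
    and x: "0 < x1" "x1 \<le> x2" "x2 < L"
  shows "AE t in lborel. t \<in> {0<..<T} \<longrightarrow> u (t, x2) - u (t, x1) = (\<integral>y. indicator {x1..x2} y * w' t y \<partial>lborel)"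
proof -
  define u' where "u' t x = indicator (QT T L) (t, x) * u (t, x)" for t x
  have lu: "loc_int2 T L u'" unfolding u'_def by (rule loc_int2_continuous[OF u])
  have uc: "continuous_on (QT T L) (\<lambda>q. u' (fst q) (snd q))"
    by (rule continuous_on_eq[OF u]) (simp add: u'_def)
  have "AE t in lborel. t \<in> {0<..<T} \<longrightarrow> u' t x2 - u' t x1 = (\<integral>y. indicator {x1..x2} y * w' t y \<partial>lborel)"
  proof (rule slice_increment[OF lu uc w'(1) _ x])
    fix \<alpha> \<beta> assume ab: "test1 0 T \<alpha>" "test1 0 L \<beta>"
    show "(\<integral>q. u' (fst q) (snd q) * (\<alpha> (fst q) * deriv \<beta> (snd q)) \<partial>lborel) = - (\<integral>q. w' (fst q) (snd q) * (\<alpha> (fst q) * \<beta> (snd q)) \<partial>lborel)"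
      using integral_lebesgue_on_continuous(2)[OF QT_open u prod_measurable[OF ab(1) test1_deriv[OF ab(2)]]]
        w'(2)[rule_format, OF test_fun_QT_prod(1)[OF ab]] test_fun_QT_prod(3)[OF ab] by (simp add: u'_def)
  qed
  then show ?thesis by eventually_elim (use x in \<open>auto simp: u'_def QT_def\<close>)
qed

lemma t_increment:
  fixes u :: "real \<times> real \<Rightarrow> real"
  assumes u: "continuous_on (QT T L) u"
    and w': "loc_int2 T L w'"
      "\<forall>\<phi>. test_fun (QT T L) \<phi> \<longrightarrow> (\<integral>q. u q * partial_deriv dir_t \<phi> q \<partial>lebesgue_on (QT T L)) = - (\<integral>q. w' (fst q) (snd q) * \<phi> q \<partial>lborel)"
    and t: "0 < t1" "t1 \<le> t2" "t2 < T"
  shows "AE x in lborel. x \<in> {0<..<L} \<longrightarrow> u (t2, x) - u (t1, x) = (\<integral>s. indicator {t1..t2} s * w' s x \<partial>lborel)"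
proof -
  define u' where "u' t x = indicator (QT T L) (t, x) * u (t, x)" for t x
  have lu: "loc_int2 T L u'" unfolding u'_def by (rule loc_int2_continuous[OF u])
  have "continuous_on (QT L T) (\<lambda>q. u (snd q, fst q))"
    by (rule continuous_on_compose2[OF u]) (auto simp: QT_def intro!: continuous_intros)
  then have uc: "continuous_on (QT L T) (\<lambda>q. u' (snd q) (fst q))"
    by (rule continuous_on_eq) (auto simp: u'_def QT_def)
  have "AE x in lborel. x \<in> {0<..<L} \<longrightarrow> u' t2 x - u' t1 x = (\<integral>s. indicator {t1..t2} s * w' s x \<partial>lborel)"
  proof (rule slice_increment[where u="\<lambda>x t. u' t x" and w="\<lambda>x t. w' t x", OF loc_int2_swap[OF lu] uc loc_int2_swap[OF w'(1)] _ t])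
    fix \<beta> \<alpha> assume ab: "test1 0 L \<beta>" "test1 0 T \<alpha>"
    have m: "(\<lambda>q. u' (fst q) (snd q) * (deriv \<alpha> (fst q) * \<beta> (snd q))) \<in> borel_measurable borel"
      "(\<lambda>q. w' (fst q) (snd q) * (\<alpha> (fst q) * \<beta> (snd q))) \<in> borel_measurable borel"
      using lu w'(1) prod_measurable[OF test1_deriv[OF ab(2)] ab(1)] prod_measurable[OF ab(2,1)]
      unfolding loc_int2_def by (auto intro: borel_measurable_times)
    have "(\<integral>q. u' (snd q) (fst q) * (\<beta> (fst q) * deriv \<alpha> (snd q)) \<partial>lborel) = (\<integral>q. u' (fst q) (snd q) * (deriv \<alpha> (fst q) * \<beta> (snd q)) \<partial>lborel)"
      using integral_lborel_swap[OF m(1)] by (simp add: mult.commute)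
    also have "\<dots> = - (\<integral>q. w' (fst q) (snd q) * (\<alpha> (fst q) * \<beta> (snd q)) \<partial>lborel)"
      using integral_lebesgue_on_continuous(2)[OF QT_open u prod_measurable[OF test1_deriv[OF ab(2)] ab(1)]]
        w'(2)[rule_format, OF test_fun_QT_prod(1)[OF ab(2,1)]] test_fun_QT_prod(2)[OF ab(2,1)] by (simp add: u'_def)
    also have "\<dots> = - (\<integral>q. w' (snd q) (fst q) * (\<beta> (fst q) * \<alpha> (snd q)) \<partial>lborel)"
      using integral_lborel_swap[OF m(2)] by (simp add: mult.commute)
    finally show "(\<integral>q. u' (snd q) (fst q) * (\<beta> (fst q) * deriv \<alpha> (snd q)) \<partial>lborel) = - (\<integral>q. w' (snd q) (fst q) * (\<beta> (fst q) * \<alpha> (snd q)) \<partial>lborel)" .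
  qed
  then show ?thesis by eventually_elim (use t in \<open>auto simp: u'_def QT_def\<close>)
qed

text \<open>Both integrals are double integrals over the box, one of the time derivative of
  \<open>A\<close> and one of the space derivative of the flux, and the sum of these vanishes almost
  everywhere.\<close>

lemma box_balance:
  fixes A f :: "real \<times> real \<Rightarrow> real"
  assumes A: "continuous_on (QT T L) A" and f: "continuous_on (QT T L) f"
    and At: "weak_deriv (QT T L) [dir_t] A At" and fx: "weak_deriv (QT T L) [dir_x] f fx"
    and bal: "AE q in lebesgue_on (QT T L). At q + fx q = 0"
    and t: "0 < t1" "t1 \<le> t2" "t2 < T" and x: "0 < x1" "x1 \<le> x2" "x2 < L"
  shows "integral {x1..x2} (\<lambda>x. A (t2, x) - A (t1, x)) + integral {t1..t2} (\<lambda>s. f (s, x2) - f (s, x1)) = 0"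
proof -
  obtain a where a: "loc_int2 T L a" "AE q in lebesgue. q \<in> QT T L \<longrightarrow> At q = a (fst q) (snd q)"
    "\<And>q. q \<notin> QT T L \<Longrightarrow> a (fst q) (snd q) = 0"
    "\<forall>\<phi>. test_fun (QT T L) \<phi> \<longrightarrow> (\<integral>q. A q * partial_deriv dir_t \<phi> q \<partial>lebesgue_on (QT T L)) = - (\<integral>q. a (fst q) (snd q) * \<phi> q \<partial>lborel)"
    by (rule weak_deriv_rep2[OF At]) (rule that)
  obtain b where b: "loc_int2 T L b" "AE q in lebesgue. q \<in> QT T L \<longrightarrow> fx q = b (fst q) (snd q)"
    "\<And>q. q \<notin> QT T L \<Longrightarrow> b (fst q) (snd q) = 0"
    "\<forall>\<phi>. test_fun (QT T L) \<phi> \<longrightarrow> (\<integral>q. f q * partial_deriv dir_x \<phi> q \<partial>lebesgue_on (QT T L)) = - (\<integral>q. b (fst q) (snd q) * \<phi> q \<partial>lborel)"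
    by (rule weak_deriv_rep2[OF fx]) (rule that)
  have m: "(\<lambda>q. a (fst q) (snd q)) \<in> borel_measurable borel" "(\<lambda>q. b (fst q) (snd q)) \<in> borel_measurable borel"
    using a(1) b(1) by (auto simp: loc_int2_def)
  have "AE q in lebesgue. q \<in> QT T L \<longrightarrow> At q + fx q = 0" using bal by (simp add: AE_lebesgue_on_QT)
  then have "AE q in lebesgue. a (fst q) (snd q) + b (fst q) (snd q) = 0"
    using a(2) b(2) by eventually_elim (use a(3) b(3) in fastforce)
  then have ab: "AE q in lborel. a (fst q) (snd q) + b (fst q) (snd q) = 0"
    by (rule AE_lebesgue_borel_iff[rotated]) (use m in measurable)
  let ?box = "\<lambda>w. \<lambda>q :: real \<times> real. indicator {t1..t2} (fst q) * indicator {x1..x2} (snd q) * (w (fst q) (snd q) :: real)"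
  have box: "integrable lborel (?box w)" if "loc_int2 T L w" for w
  proof -
    have "integrable (lborel \<Otimes>\<^sub>M lborel) (\<lambda>(p, y). indicator {t1..t2} p * indicator {x1..x2} y * w p y)"
      using that t x unfolding loc_int2_def by blast
    moreover have "(\<lambda>(p, y). indicator {t1..t2} p * indicator {x1..x2} y * w p y) = ?box w" by auto
    ultimately show ?thesis unfolding lborel_prod by simp
  qed
  have ia: "integrable lborel (?box a)" and ib: "integrable lborel (?box b)"
    by (rule box[OF a(1)] box[OF b(1)])+
  have zero: "(\<integral>q. ?box a q \<partial>lborel) + (\<integral>q. ?box b q \<partial>lborel) = 0"
  proof -
    have "(\<integral>q. ?box a q \<partial>lborel) = (\<integral>q. - ?box b q \<partial>lborel)"
    proof (rule integral_cong_AE)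
      show "AE q in lborel. ?box a q = - ?box b q"
        using ab by eventually_elim (simp add: eq_neg_iff_add_eq_0 flip: distrib_left)
    qed (use ia ib in auto)
    then show ?thesis by simp
  qed
  have "integral {x1..x2} (\<lambda>x. A (t2, x) - A (t1, x)) = (\<integral>q. ?box a q \<partial>lborel)"
  proof -
    have c: "continuous_on {x1..x2} (\<lambda>x. A (t2, x) - A (t1, x))"
      using t x by (intro continuous_intros continuous_on_compose2[OF A]) (auto simp: QT_def)
    have "integral {x1..x2} (\<lambda>x. A (t2, x) - A (t1, x)) = (LINT x:{x1..x2}|lborel. A (t2, x) - A (t1, x))"
      by (rule set_borel_integral_eq_integral(2)[OF borel_integrable_atLeastAtMost'[OF c], symmetric])
    also have "\<dots> = (\<integral>x. (\<integral>s. ?box a (s, x) \<partial>lborel) \<partial>lborel)"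
      unfolding set_lebesgue_integral_def
    proof (rule integral_cong_AE)
      show "(\<lambda>x. indicator {x1..x2} x *\<^sub>R (A (t2, x) - A (t1, x))) \<in> borel_measurable lborel"
        using borel_integrable_atLeastAtMost'[OF c] unfolding set_integrable_def by (rule borel_measurable_integrable)
      have "(\<lambda>x. \<integral>s. indicator {t1..t2} s * a s x \<partial>lborel) \<in> borel_measurable borel"
        using loc_int2_slice_integral[OF loc_int2_swap[OF a(1)] t(1,3)] by (rule loc_int_measurable)
      then show "(\<lambda>x. \<integral>s. ?box a (s, x) \<partial>lborel) \<in> borel_measurable lborel"
        by (simp add: mult.assoc mult.left_commute[of "indicator {t1..t2} _"])
      show "AE x in lborel. indicator {x1..x2} x *\<^sub>R (A (t2, x) - A (t1, x)) = (\<integral>s. ?box a (s, x) \<partial>lborel)"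
        using t_increment[OF A a(1,4) t]
      proof eventually_elim
        case (elim y)
        show ?case
        proof (cases "y \<in> {x1..x2}")
          case True
          then show ?thesis using elim x by (simp add: mult.assoc)
        qed simp
      qed
    qed
    also have "\<dots> = (\<integral>q. ?box a q \<partial>lborel)" by (rule integral_lborel_slices(1)[OF ia, symmetric])
    finally show ?thesis .
  qed
  moreover have "integral {t1..t2} (\<lambda>s. f (s, x2) - f (s, x1)) = (\<integral>q. ?box b q \<partial>lborel)"
  proof -
    have c: "continuous_on {t1..t2} (\<lambda>s. f (s, x2) - f (s, x1))"
      using t x by (intro continuous_intros continuous_on_compose2[OF f]) (auto simp: QT_def)
    have "integral {t1..t2} (\<lambda>s. f (s, x2) - f (s, x1)) = (LINT s:{t1..t2}|lborel. f (s, x2) - f (s, x1))"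
      by (rule set_borel_integral_eq_integral(2)[OF borel_integrable_atLeastAtMost'[OF c], symmetric])
    also have "\<dots> = (\<integral>s. (\<integral>x. ?box b (s, x) \<partial>lborel) \<partial>lborel)"
      unfolding set_lebesgue_integral_def
    proof (rule integral_cong_AE)
      show "(\<lambda>s. indicator {t1..t2} s *\<^sub>R (f (s, x2) - f (s, x1))) \<in> borel_measurable lborel"
        using borel_integrable_atLeastAtMost'[OF c] unfolding set_integrable_def by (rule borel_measurable_integrable)
      have "(\<lambda>s. \<integral>x. indicator {x1..x2} x * b s x \<partial>lborel) \<in> borel_measurable borel"
        using loc_int2_slice_integral[OF b(1) x(1,3)] by (rule loc_int_measurable)
      then show "(\<lambda>s. \<integral>x. ?box b (s, x) \<partial>lborel) \<in> borel_measurable lborel"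
        by (simp add: mult.assoc)
      show "AE s in lborel. indicator {t1..t2} s *\<^sub>R (f (s, x2) - f (s, x1)) = (\<integral>x. ?box b (s, x) \<partial>lborel)"
        using x_increment[OF f b(1,4) x]
      proof eventually_elim
        case (elim s)
        show ?case
        proof (cases "s \<in> {t1..t2}")
          case True
          then show ?thesis using elim t by (simp add: mult.assoc)
        qed simp
      qed
    qed
    also have "\<dots> = (\<integral>q. ?box b q \<partial>lborel)" by (rule integral_lborel_slices(2)[OF ib, symmetric])
    finally show ?thesis .
  qed
  ultimately show ?thesis using zero by simp
qed

lemma set_integral_AE_scaled:
  fixes f h :: "real \<Rightarrow> real"
  assumes f: "f \<in> borel_measurable borel" and h: "continuous_on {a..b} h"
    and ae: "AE y in lborel. y \<in> {a..b} \<longrightarrow> f y = k * h y"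
  shows "(\<integral>y. indicator {a..b} y * f y \<partial>lborel) = k * integral {a..b} h"
proof -
  have i: "set_integrable lborel {a..b} h" by (rule borel_integrable_atLeastAtMost'[OF h])
  have "(\<integral>y. indicator {a..b} y * f y \<partial>lborel) = (\<integral>y. k * (indicator {a..b} y *\<^sub>R h y) \<partial>lborel)"
  proof (rule integral_cong_AE)
    show "(\<lambda>y. k * (indicator {a..b} y *\<^sub>R h y)) \<in> borel_measurable lborel"
      using i unfolding set_integrable_def by (intro borel_measurable_times borel_measurable_integrable) auto
    show "AE y in lborel. indicator {a..b} y * f y = k * (indicator {a..b} y *\<^sub>R h y)"
      using ae by eventually_elim (auto simp: indicator_def)
  qed (use f in measurable)
  also have "\<dots> = k * integral {a..b} h"
    using set_borel_integral_eq_integral(2)[OF i] by (simp add: set_lebesgue_integral_def)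
  finally show ?thesis .
qed

text \<open>The second equation says that \<open>A v\<^sub>x\<close> depends on time only, so the increments of \<open>v\<close>
  are proportional to those of \<open>\<integral> 1 / A\<close>.\<close>

lemma proportional_increments:
  fixes A v :: "real \<times> real \<Rightarrow> real"
  assumes \<mu>: "0 < \<mu>" and L: "0 < L" and A: "continuous_on (QT T L) A" "\<And>q. q \<in> QT T L \<Longrightarrow> 0 < A q"
    and v: "continuous_on (QT T L) v" and vx: "weak_deriv (QT T L) [dir_x] v vx"
    and G: "weak_deriv (QT T L) [dir_x] (\<lambda>q. 3 * \<mu> * A q * vx q) G" "AE q in lebesgue_on (QT T L). G q = 0"
    and x: "0 < x1" "x1 \<le> x2" "x2 < L" and y: "0 < y1" "y1 \<le> y2" "y2 < L" and t: "t \<in> {0<..<T}"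
  shows "(v (t, x2) - v (t, x1)) * integral {y1..y2} (\<lambda>y. 1 / A (t, y)) =
    (v (t, y2) - v (t, y1)) * integral {x1..x2} (\<lambda>y. 1 / A (t, y))"
proof -
  obtain w where w: "loc_int2 T L w" "AE q in lebesgue. q \<in> QT T L \<longrightarrow> vx q = w (fst q) (snd q)"
    "\<And>q. q \<notin> QT T L \<Longrightarrow> w (fst q) (snd q) = 0"
    "\<forall>\<phi>. test_fun (QT T L) \<phi> \<longrightarrow> (\<integral>q. v q * partial_deriv dir_x \<phi> q \<partial>lebesgue_on (QT T L)) = - (\<integral>q. w (fst q) (snd q) * \<phi> q \<partial>lborel)"
    by (rule weak_deriv_rep2[OF vx]) (rule that)
  have lg: "loc_integrable (QT T L) (\<lambda>q. 3 * \<mu> * A q * vx q)" using G(1) by (simp add: weak_deriv_def)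
  obtain g where g: "g \<in> borel_measurable borel" "AE q in lebesgue. q \<in> QT T L \<longrightarrow> 3 * \<mu> * A q * vx q = g q"
    "\<And>q. q \<notin> QT T L \<Longrightarrow> g q = 0" "\<And>K. compact K \<Longrightarrow> K \<subseteq> QT T L \<Longrightarrow> set_integrable lborel K g"
    "\<And>\<psi>. \<psi> \<in> borel_measurable borel \<Longrightarrow>
       (\<integral>q. (3 * \<mu> * A q * vx q) * \<psi> q \<partial>lebesgue_on (QT T L)) = (\<integral>q. g q * \<psi> q \<partial>lborel)"
    by (rule loc_integrable_borel_rep[OF QT_open lg]) (rule that)
  define A' where "A' q = indicator (QT T L) q *\<^sub>R A q" for q
  have A'm: "A' \<in> borel_measurable borel"
    unfolding A'_def using integral_lebesgue_on_continuous(1)[OF QT_open A(1), of "\<lambda>_. 0"] by simp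
  have wm: "(\<lambda>q. w (fst q) (snd q)) \<in> borel_measurable borel" using w(1) by (simp add: loc_int2_def)
  have "AE q in lebesgue. g q - 3 * \<mu> * A' q * w (fst q) (snd q) = 0"
    using w(2) g(2)
  proof eventually_elim
    case (elim q)
    then show ?case using w(3)[of q] g(3)[of q] by (cases "q \<in> QT T L") (auto simp: A'_def)
  qed
  then have "AE q in lborel. g q - 3 * \<mu> * A' q * w (fst q) (snd q) = 0"
    by (rule AE_lebesgue_borel_iff[rotated]) (use g(1) A'm wm in measurable)
  then have "AE q in lborel \<Otimes>\<^sub>M lborel. g q - 3 * \<mu> * A' q * w (fst q) (snd q) = 0" unfolding lborel_prod .
  from lborel_pair.AE_pair[OF this]
  have gw: "AE s in lborel. AE y in lborel. g (s, y) - 3 * \<mu> * A' (s, y) * w s y = 0" by simp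
  \<comment> \<open>An interval that contains both given ones, so that the same constant serves for
    the two increments.\<close>
  define lo hi where "lo = min x1 y1" and "hi = max x2 y2"
  have lohi: "0 < lo" "hi < L" "lo \<le> x1" "lo \<le> y1" "x2 \<le> hi" "y2 \<le> hi" using x y by (auto simp: lo_def hi_def)
  have gc: "AE s in lborel. s \<in> {0<..<T} \<longrightarrow> (\<exists>k. AE y in lborel. y \<in> {lo..hi} \<longrightarrow> g (s, y) = k)"
  proof (rule slice_const[where g="\<lambda>t x. g (t, x)", OF L _ _ lohi(1,2)])
    show "loc_int2 T L (\<lambda>t x. g (t, x))" by (rule box_set_integrable_loc_int2[OF g(1,4)])
    fix \<alpha> \<beta> assume ab: "test1 0 T \<alpha>" "test1 0 L \<beta>"
    have Gz: "(\<integral>q. G q * (\<alpha> (fst q) * \<beta> (snd q)) \<partial>lebesgue_on (QT T L)) = 0"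
    proof -
      have "AE q in lebesgue_on (QT T L). G q * (\<alpha> (fst q) * \<beta> (snd q)) = 0"
        using G(2) by eventually_elim simp
      then show ?thesis by (rule integral_eq_zero_AE)
    qed
    have "(\<integral>q. g q * (\<alpha> (fst q) * deriv \<beta> (snd q)) \<partial>lborel) = (\<integral>q. (3 * \<mu> * A q * vx q) * (\<alpha> (fst q) * deriv \<beta> (snd q)) \<partial>lebesgue_on (QT T L))"
      by (rule g(5)[OF prod_measurable[OF ab(1) test1_deriv[OF ab(2)]], symmetric])
    also have "\<dots> = - (\<integral>q. G q * (\<alpha> (fst q) * \<beta> (snd q)) \<partial>lebesgue_on (QT T L))"
      using G(1)[unfolded weak_deriv_def, THEN conjunct2, THEN conjunct2, rule_format, OF test_fun_QT_prod(1)[OF ab]]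
      by (simp add: test_fun_QT_prod(3)[OF ab])
    finally show "(\<integral>q. g (fst q, snd q) * (\<alpha> (fst q) * deriv \<beta> (snd q)) \<partial>lborel) = 0" using Gz by simp
  qed
  define P where "P a b s = integral {a..b} (\<lambda>y. 1 / A (s, y))" for a b s
  \<comment> \<open>Cross-multiplication eliminates the unknown constant, which is determined for
    almost every time only; what remains is continuous in time and can be extended to every
    time.\<close>
  define f where "f s = (v (s, x2) - v (s, x1)) * P y1 y2 s - (v (s, y2) - v (s, y1)) * P x1 x2 s" for s
  have Ac: "continuous_on {a..b} (\<lambda>y. 1 / A (s, y))" if "0 < a" "b < L" "s \<in> {0<..<T}" for a b s
  proof (intro continuous_intros continuous_on_compose2[OF A(1)])
    have "0 < A (s, y)" if y: "y \<in> {a..b}" for y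
      by (rule A(2)) (use y \<open>0 < a\<close> \<open>b < L\<close> \<open>s \<in> _\<close> in \<open>auto simp: QT_def\<close>)
    then show "\<forall>y\<in>{a..b}. A (s, y) \<noteq> 0" by fastforce
  qed (use that in \<open>auto simp: QT_def\<close>)
  have Pc: "continuous_on {0<..<T} (P a b)" if "0 < a" "b < L" for a b
  proof -
    have "continuous_on {0<..<T} (\<lambda>s. integral (cbox a b) (\<lambda>y. 1 / A (s, y)))"
    proof (rule integral_continuous_on_param)
      have sub: "{0<..<T} \<times> cbox a b \<subseteq> QT T L" using that by (auto simp: QT_def)
      have "continuous_on ({0<..<T} \<times> cbox a b) (\<lambda>q. 1 / A q)"
        using sub A(2) by (intro continuous_intros continuous_on_subset[OF A(1)]) force+
      then show "continuous_on ({0<..<T} \<times> cbox a b) (\<lambda>(s, y). 1 / A (s, y))" by (simp add: split_beta)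
    qed
    then show ?thesis by (simp add: P_def[abs_def])
  qed
  have vc: "continuous_on {0<..<T} (\<lambda>s. v (s, z))" if "0 < z" "z < L" for z
    by (rule continuous_on_compose2[OF v]) (use that in \<open>auto simp: QT_def intro!: continuous_intros\<close>)
  have fc: "continuous_on {0<..<T} f"
    unfolding f_def using x y by (intro continuous_intros Pc vc) auto
  have "AE s in lborel. s \<in> {0<..<T} \<longrightarrow> f s = 0"
    using gw gc x_increment[OF v w(1,4) x] x_increment[OF v w(1,4) y]
  proof eventually_elim
    case (elim s)
    show ?case
    proof
      assume s: "s \<in> {0<..<T}"
      then obtain k where k: "AE y in lborel. y \<in> {lo..hi} \<longrightarrow> g (s, y) = k" using elim by blast
      \<comment> \<open>Solving 3 \<mu> A v_x = k for v_x; this uses positivity of the area and of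
        \<mu>.\<close>
      have wk: "AE y in lborel. y \<in> {lo..hi} \<longrightarrow> w s y = k / (3 * \<mu>) * (1 / A (s, y))"
        using k elim(1)
      proof eventually_elim
        case (elim y)
        show ?case
        proof
          assume y: "y \<in> {lo..hi}"
          then have Q: "(s, y) \<in> QT T L" using s lohi by (auto simp: QT_def)
          then show "w s y = k / (3 * \<mu>) * (1 / A (s, y))"
            using elim y A(2)[OF Q] \<mu> by (simp add: A'_def field_simps)
        qed
      qed
      have int: "(\<integral>y. indicator {a..b} y * w s y \<partial>lborel) = k / (3 * \<mu>) * P a b s" if ab: "lo \<le> a" "b \<le> hi" for a b
        unfolding P_def
      proof (rule set_integral_AE_scaled)
        show "w s \<in> borel_measurable borel" by (rule loc_int2_measurable(2)[OF w(1)])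
        show "continuous_on {a..b} (\<lambda>y. 1 / A (s, y))" by (rule Ac) (use ab lohi s in auto)
        show "AE y in lborel. y \<in> {a..b} \<longrightarrow> w s y = k / (3 * \<mu>) * (1 / A (s, y))"
          using wk by eventually_elim (use ab in auto)
      qed
      have "v (s, x2) - v (s, x1) = k / (3 * \<mu>) * P x1 x2 s" "v (s, y2) - v (s, y1) = k / (3 * \<mu>) * P y1 y2 s"
        using elim(3,4) s int[of x1 x2] int[of y1 y2] lohi by auto
      then show "f s = 0" by (simp add: f_def)
    qed
  qed
  then have "f t = 0" by (rule AE_zero_continuous[OF fc _ t])
  then show ?thesis by (simp add: f_def P_def)
qed

text \<open>The essential bound on v_x bounds the increments for almost every time, and continuity
  of \<open>v\<close> for every time.\<close>

lemma x_lipschitz: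
  fixes v :: "real \<times> real \<Rightarrow> real"
  assumes v: "continuous_on (QT T L) v" and vx: "weak_deriv_in_Linf (QT T L) [dir_x] v"
  obtains M where "0 < M" "\<And>t x1 x2. t \<in> {0<..<T} \<Longrightarrow> 0 < x1 \<Longrightarrow> x1 \<le> x2 \<Longrightarrow> x2 < L \<Longrightarrow> \<bar>v (t, x2) - v (t, x1)\<bar> \<le> M * (x2 - x1)"
proof -
  obtain z where z: "Lp_on \<infinity> (QT T L) z" "weak_deriv (QT T L) [dir_x] v z"
    using vx unfolding weak_deriv_in_Linf_def by blast
  obtain w where w: "loc_int2 T L w" "AE q in lebesgue. q \<in> QT T L \<longrightarrow> z q = w (fst q) (snd q)"
    "\<And>q. q \<notin> QT T L \<Longrightarrow> w (fst q) (snd q) = 0"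
    "\<forall>\<phi>. test_fun (QT T L) \<phi> \<longrightarrow> (\<integral>q. v q * partial_deriv dir_x \<phi> q \<partial>lebesgue_on (QT T L)) = - (\<integral>q. w (fst q) (snd q) * \<phi> q \<partial>lborel)"
    by (rule weak_deriv_rep2[OF z(2)]) (rule that)
  obtain C where "AE q in lebesgue_on (QT T L). \<bar>z q\<bar> \<le> C" using z(1) unfolding Lp_on_def by auto
  then have C: "AE q in lebesgue. q \<in> QT T L \<longrightarrow> \<bar>z q\<bar> \<le> C" by (simp add: AE_lebesgue_on_QT)
  define M where "M = max 1 C"
  have M: "0 < M" "C \<le> M" by (auto simp: M_def)
  have wm: "(\<lambda>q. w (fst q) (snd q)) \<in> borel_measurable borel" using w(1) by (simp add: loc_int2_def)
  \<comment> \<open>The inequality is written as the vanishing of a Borel function so that it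
    transfers from Lebesgue to Borel measure and to the slices.\<close>
  have "AE q in lebesgue. max 0 (\<bar>w (fst q) (snd q)\<bar> - M) = 0"
    using C w(2)
  proof eventually_elim
    case (elim q)
    then show ?case using w(3)[of q] M by (cases "q \<in> QT T L") auto
  qed
  then have "AE q in lborel. max 0 (\<bar>w (fst q) (snd q)\<bar> - M) = 0"
    by (rule AE_lebesgue_borel_iff[rotated]) (use wm in measurable)
  then have "AE q in lborel \<Otimes>\<^sub>M lborel. max 0 (\<bar>w (fst q) (snd q)\<bar> - M) = 0" unfolding lborel_prod .
  from lborel_pair.AE_pair[OF this]
  have wb: "AE s in lborel. AE y in lborel. max 0 (\<bar>w s y\<bar> - M) = 0" by simp
  have "\<bar>v (t, x2) - v (t, x1)\<bar> \<le> M * (x2 - x1)" if t: "t \<in> {0<..<T}" and x: "0 < x1" "x1 \<le> x2" "x2 < L" for t x1 x2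
  proof -
    define f where "f s = max 0 (\<bar>v (s, x2) - v (s, x1)\<bar> - M * (x2 - x1))" for s
    have vc: "continuous_on {0<..<T} (\<lambda>s. v (s, y))" if "0 < y" "y < L" for y
      by (rule continuous_on_compose2[OF v]) (use that in \<open>auto simp: QT_def intro!: continuous_intros\<close>)
    have fc: "continuous_on {0<..<T} f" unfolding f_def using x by (intro continuous_intros vc) auto
    have "AE s in lborel. s \<in> {0<..<T} \<longrightarrow> f s = 0"
      using wb x_increment[OF v w(1,4) x]
    proof eventually_elim
      case (elim s)
      show ?case
      proof
        assume s: "s \<in> {0<..<T}"
        have ic: "integrable lborel (\<lambda>y. indicat_real {x1..x2} y * M)"
          by (intro integrable_mult_left integrable_real_indicator) (auto simp: emeasure_lborel_Icc_eq)
        have "\<bar>\<integral>y. indicator {x1..x2} y * w s y \<partial>lborel\<bar> \<le> (\<integral>y. indicat_real {x1..x2} y * M \<partial>lborel)"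
        proof -
          have "AE y in lborel. norm (indicator {x1..x2} y * w s y) \<le> indicat_real {x1..x2} y * M"
            using elim(1) by eventually_elim (auto simp: indicator_def)
          moreover have "integrable lborel (\<lambda>y. indicator {x1..x2} y * w s y)"
            by (rule Bochner_Integration.integrable_bound[OF ic])
              (use calculation loc_int2_measurable(2)[OF w(1), of s] M in \<open>auto elim!: eventually_mono\<close>)
          ultimately have "(\<integral>y. norm (indicator {x1..x2} y * w s y) \<partial>lborel) \<le> (\<integral>y. indicat_real {x1..x2} y * M \<partial>lborel)"
            by (intro integral_mono_AE integrable_norm ic)
          with integral_norm_bound[of lborel "\<lambda>y. indicator {x1..x2} y * w s y"] show ?thesis
            unfolding real_norm_def by (rule order_trans)
        qed
        also have "\<dots> = M * (x2 - x1)" using x by simp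
        finally show "f s = 0" using elim(2) s by (simp add: f_def)
      qed
    qed
    then have "f t = 0" by (rule AE_zero_continuous[OF fc _ t])
    then show ?thesis by (simp add: f_def)
  qed
  with M(1) show thesis by (rule that)
qed

lemma continuous_on_closed_rectangle:
  assumes "continuous_on ({0..T} \<times> {0..L}) (f :: real \<times> real \<Rightarrow> real)" "continuous_on S y" "continuous_on S z"
    and "\<And>s. s \<in> S \<Longrightarrow> y s \<in> {0..T}" "\<And>s. s \<in> S \<Longrightarrow> z s \<in> {0..L}"
  shows "continuous_on S (\<lambda>s. f (y s, z s))"
  by (rule continuous_on_compose2[OF assms(1)]) (use assms in \<open>auto intro!: continuous_intros\<close>)

lemma zero_on_Icc:
  fixes e :: "real \<Rightarrow> real"
  assumes "continuous_on {a..b} e" "a < b" "\<And>s. a < s \<Longrightarrow> s < b \<Longrightarrow> e s = 0" "s \<in> {a..b}"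
  shows "e s = 0"
proof -
  have "e s = e ((a + b) / 2)" by (rule constant_on_Icc[OF assms(1) _ assms(2,4)]) (use assms(2,3) in auto)
  then show ?thesis using assms(2,3) by simp
qed

section \<open>Strong solutions solve the fixed point problem\<close>

locale strong_data = fibre +
  fixes \<mu> T :: real and A v :: "real \<times> real \<Rightarrow> real"
  assumes \<mu>: "0 < \<mu>" and T: "0 < T" and strict: "\<And>t. t \<in> {0<..<T} \<Longrightarrow> vin t < vL t"
    and sol: "strong_solution \<mu> T L S0 S1 vin vL A v"
begin

lemma cont: "continuous_on ({0..T} \<times> {0..L}) A" "continuous_on ({0..T} \<times> {0..L}) v"
  using sol unfolding strong_solution_def closure_QT[OF T L] by auto

lemma cont_QT: "continuous_on (QT T L) A" "continuous_on (QT T L) v" "continuous_on (QT T L) (\<lambda>q. v q * A q)"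
  using cont by (auto intro!: continuous_intros intro: continuous_on_subset[OF _ QT_sub])

lemma pos: "z \<in> QT T L \<Longrightarrow> 0 < A z"
  using sol by (simp add: strong_solution_def)

lemma slice_cont:
  "t \<in> {0..T} \<Longrightarrow> continuous_on {0..L} (\<lambda>x. A (t, x))" "t \<in> {0..T} \<Longrightarrow> continuous_on {0..L} (\<lambda>x. v (t, x))"
  "x \<in> {0..L} \<Longrightarrow> continuous_on {0..T} (\<lambda>t. A (t, x))" "x \<in> {0..L} \<Longrightarrow> continuous_on {0..T} (\<lambda>t. v (t, x))"
  by (auto intro!: continuous_on_closed_rectangle[OF cont(1)] continuous_on_closed_rectangle[OF cont(2)] continuous_intros)

lemma A_inlet: "A (t, 0) = S0 t" and v_inlet: "v (t, 0) = vin t" and v_outlet: "v (t, L) = vL t" if "t \<in> {0..T}"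
proof -
  have "A (t, 0) - S0 t = 0"
    by (rule zero_on_Icc[OF _ T _ that]) (use sol L in \<open>auto simp: strong_solution_def intro!: continuous_intros slice_cont continuous_on_subset[OF S0_cont]\<close>)
  moreover have "v (t, 0) - vin t = 0"
    by (rule zero_on_Icc[OF _ T _ that]) (use sol L in \<open>auto simp: strong_solution_def intro!: continuous_intros slice_cont continuous_on_subset[OF vin_cont]\<close>)
  moreover have "v (t, L) - vL t = 0"
    by (rule zero_on_Icc[OF _ T _ that]) (use sol L in \<open>auto simp: strong_solution_def intro!: continuous_intros slice_cont continuous_on_subset[OF vL_cont]\<close>)
  ultimately show "A (t, 0) = S0 t" "v (t, 0) = vin t" "v (t, L) = vL t" by auto
qed

lemma A_initial: "A (0, x) = S1 x" if "x \<in> {0..L}"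
proof -
  have "A (0, x) - S1 x = 0"
    by (rule zero_on_Icc[OF _ L _ that]) (use sol T in \<open>auto simp: strong_solution_def intro!: continuous_intros slice_cont continuous_on_subset[OF S1_cont]\<close>)
  then show ?thesis by simp
qed

lemma proportional:
  assumes "0 < x1" "x1 \<le> x2" "x2 < L" "0 < y1" "y1 \<le> y2" "y2 < L" "t \<in> {0<..<T}"
  shows "(v (t, x2) - v (t, x1)) * integral {y1..y2} (\<lambda>y. 1 / A (t, y)) =
    (v (t, y2) - v (t, y1)) * integral {x1..x2} (\<lambda>y. 1 / A (t, y))"
proof -
  obtain vx G where vx: "weak_deriv (QT T L) [dir_x] v vx" and
    G: "weak_deriv (QT T L) [dir_x] (\<lambda>q. 3 * \<mu> * A q * vx q) G" "AE q in lebesgue_on (QT T L). G q = 0"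
    using sol unfolding strong_solution_def solves_pde_def by blast
  show ?thesis by (rule proportional_increments[OF \<mu> L cont_QT(1) pos cont_QT(2) vx G assms])
qed

lemma balance:
  assumes "0 < t1" "t1 \<le> t2" "t2 < T" "0 < x1" "x1 \<le> x2" "x2 < L"
  shows "integral {x1..x2} (\<lambda>x. A (t2, x) - A (t1, x)) +
    integral {t1..t2} (\<lambda>s. v (s, x2) * A (s, x2) - v (s, x1) * A (s, x1)) = 0"
proof -
  obtain At G where "weak_deriv (QT T L) [dir_t] A At" "weak_deriv (QT T L) [dir_x] (\<lambda>q. v q * A q) G"
    "AE q in lebesgue_on (QT T L). At q + G q = 0"
    using sol unfolding strong_solution_def solves_pde_def by blast
  from box_balance[OF cont_QT(1,3) this assms] show ?thesis by simp
qed

lemma invA_pos: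
  assumes "t \<in> {0<..<T}" "0 < x1" "x1 < x2" "x2 < L"
  shows "continuous_on {x1..x2} (\<lambda>y. 1 / A (t, y))" "0 < integral {x1..x2} (\<lambda>y. 1 / A (t, y))"
proof -
  have p: "0 < A (t, y)" if "y \<in> {x1..x2}" for y by (rule pos) (use assms that in \<open>auto simp: QT_def\<close>)
  then have nz: "\<forall>y\<in>{x1..x2}. A (t, y) \<noteq> 0" by fastforce
  show c: "continuous_on {x1..x2} (\<lambda>y. 1 / A (t, y))"
    by (intro continuous_intros continuous_on_subset[OF slice_cont(1)] nz) (use assms in auto)
  have "0 \<le> integral {x1..x2} (\<lambda>y. 1 / A (t, y))"
    by (rule integral_nonneg) (use p in \<open>auto intro!: integrable_continuous_real c simp: less_imp_le\<close>)
  moreover have "integral {x1..x2} (\<lambda>y. 1 / A (t, y)) \<noteq> 0"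
    using integral_eq_0_iff[OF c assms(3)] p[of x1] p nz assms(3) by (auto simp: less_imp_le)
  ultimately show "0 < integral {x1..x2} (\<lambda>y. 1 / A (t, y))" by simp
qed

text \<open>If \<open>A\<close> vanished at the outlet, then \<open>v\<^sub>x\<close>, a nonzero multiple of \<open>1 / A\<close>, would be unbounded.\<close>

lemma pos_outlet:
  assumes t: "t \<in> {0<..<T}"
  shows "0 < A (t, L)"
proof (rule ccontr)
  assume np: "\<not> 0 < A (t, L)"
  obtain M where M: "0 < M" "\<And>t x1 x2. t \<in> {0<..<T} \<Longrightarrow> 0 < x1 \<Longrightarrow> x1 \<le> x2 \<Longrightarrow> x2 < L \<Longrightarrow> \<bar>v (t, x2) - v (t, x1)\<bar> \<le> M * (x2 - x1)"
    by (rule x_lipschitz[OF cont_QT(2)]) (use sol in \<open>auto simp: strong_solution_def\<close>)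
  define y1 y2 where "y1 = L / 3" and "y2 = 2 * L / 3"
  have y: "0 < y1" "y1 < y2" "y2 < L" using L by (auto simp: y1_def y2_def)
  define J D where "J = integral {y1..y2} (\<lambda>y. 1 / A (t, y))" and "D = v (t, y2) - v (t, y1)"
  have J: "0 < J" unfolding J_def by (rule invA_pos(2)[OF t y])
  have rel: "(v (t, x2) - v (t, x1)) * J = D * integral {x1..x2} (\<lambda>y. 1 / A (t, y))" if "0 < x1" "x1 \<le> x2" "x2 < L" for x1 x2
    unfolding J_def D_def by (rule proportional) (use that y t in auto)
  \<comment> \<open>If \<open>D\<close> were 0, proportionality would make the velocity constant in
    \<open>x\<close>, against vin < vL.\<close>
  have "D \<noteq> 0"
  proof
    assume "D = 0"
    then have "v (t, x1) = v (t, x2)" if "0 < x1" "x1 \<le> x2" "x2 < L" for x1 x2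
      using rel[OF that] J by simp
    from constant_on_Icc[OF slice_cont(2) this L, of 0 L] have "v (t, 0) = v (t, L)" using t L by auto
    then show False using v_inlet[of t] v_outlet[of t] strict[OF t] t by auto
  qed
  \<comment> \<open>Where the area is below \<open>e\<close>, the slope |D| / (J A) of the velocity
    is at least 2 M, twice its Lipschitz constant.\<close>
  define e where "e = \<bar>D\<bar> / (2 * M * J)"
  have e: "0 < e" using \<open>D \<noteq> 0\<close> M J by (simp add: e_def)
  have "continuous (at L within {0..L}) (\<lambda>x. A (t, x))"
    using slice_cont(1)[of t] t L by (simp add: continuous_on_eq_continuous_within)
  then obtain d where d: "0 < d" "\<forall>x\<in>{0..L}. dist x L < d \<longrightarrow> dist (A (t, x)) (A (t, L)) < e"
    unfolding continuous_within_eps_delta using e by blast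
  \<comment> \<open>A nondegenerate interval inside (0, L) so close to the outlet that the area on
    it is below \<open>e\<close>.\<close>
  define x1 x2 where "x1 = L - min d L / 2" and "x2 = L - min d L / 4"
  have x: "0 < x1" "x1 < x2" "x2 < L" "L - x1 < d" using d(1) L by (auto simp: x1_def x2_def min_def)
  have small: "1 / e \<le> 1 / A (t, y)" if "y \<in> {x1..x2}" for y
  proof -
    have "dist (A (t, y)) (A (t, L)) < e" using d(2) that x by (auto simp: dist_real_def)
    moreover have "0 < A (t, y)" by (rule pos) (use that x t in \<open>auto simp: QT_def\<close>)
    ultimately show ?thesis using np e by (intro divide_left_mono) (auto simp: dist_real_def abs_less_iff)
  qed
  have "integral {x1..x2} (\<lambda>_. 1 / e) \<le> integral {x1..x2} (\<lambda>y. 1 / A (t, y))"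
    by (rule integral_le) (use small in \<open>auto intro!: integrable_continuous_real invA_pos(1)[OF t x(1,2,3)]\<close>)
  then have "(x2 - x1) / e \<le> integral {x1..x2} (\<lambda>y. 1 / A (t, y))" using x by simp
  then have "\<bar>D\<bar> * ((x2 - x1) / e) \<le> \<bar>D\<bar> * integral {x1..x2} (\<lambda>y. 1 / A (t, y))" by (rule mult_left_mono) simp
  also have "\<dots> = \<bar>v (t, x2) - v (t, x1)\<bar> * J"
    using arg_cong[OF rel[of x1 x2], of abs] x J invA_pos(2)[OF t x(1,2,3)] by (simp add: abs_mult)
  also have "\<dots> \<le> M * (x2 - x1) * J" using M(2)[OF t, of x1 x2] x J by simp
  also have "\<bar>D\<bar> * ((x2 - x1) / e) = 2 * (M * (x2 - x1) * J)"
    using \<open>D \<noteq> 0\<close> M J by (simp add: e_def field_simps)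
  finally show False using M J x by simp
qed

text \<open>On the initial line and at the inlet the data are positive. The final time is left out,
  since the equations give no positivity there directly.\<close>

lemma pos_closed:
  assumes "t \<in> {0..<T}" "x \<in> {0..L}"
  shows "0 < A (t, x)"
proof -
  consider "t = 0" | "0 < t" "x = 0" | "0 < t" "x = L" | "0 < t" "0 < x" "x < L" using assms by force
  then show ?thesis
  proof cases
    case 1
    then show ?thesis using A_initial[OF assms(2)] S1_bounds(1)[of x] Sm by simp
  next
    case 2
    then show ?thesis using A_inlet[of t] S0_bounds(1)[of t] Sm assms by simp
  next
    case 3
    then show ?thesis using pos_outlet[of t] assms by simp
  next
    case 4
    then show ?thesis using pos[of "(t, x)"] assms by (simp add: QT_def)
  qed
qed

text \<open>On [0, T'] the area is continuous and positive, so compactness bounds it below. The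
  conclusion covers all smaller \<delta> as well, which lets two solutions share one truncation
  level.\<close>

lemma classical:
  assumes T': "0 < T'" "T' < T"
  obtains c B \<delta>0 where "0 < \<delta>0" "\<delta>0 \<le> Sm"
    "\<forall>\<delta>. 0 < \<delta> \<and> \<delta> \<le> \<delta>0 \<longrightarrow> fibre_classical L vm VM Sm SM vin vL S0 S1 \<delta> T' c B"
    "\<forall>t\<in>{0..T'}. \<forall>x\<in>{0..L}. A (t, x) = B t x"
    "\<forall>t\<in>{0..T'}. \<forall>x\<in>{0..L}. v (t, x) = vin t + c t * prim (\<lambda>y. 1 / B t y) x"
proof -
  let ?Q = "{0..T'} \<times> {0..L}"
  have Qc: "compact ?Q" by (intro compact_Times compact_Icc)
  have AQ: "continuous_on ?Q A" by (rule continuous_on_subset[OF cont(1)]) (use T' in auto)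
  obtain q0 where q0: "q0 \<in> ?Q" "\<forall>q\<in>?Q. A q0 \<le> A q"
    using continuous_attains_inf[OF Qc _ AQ] T' L by fastforce
  obtain q1 where q1: "q1 \<in> ?Q" "\<forall>q\<in>?Q. A q \<le> A q1"
    using continuous_attains_sup[OF Qc _ AQ] T' L by fastforce
  define \<delta>0 where "\<delta>0 = min Sm (A q0)"
  have Aq0: "0 < A q0" using pos_closed[of "fst q0" "snd q0"] q0(1) T' by (auto simp: mem_Times_iff)
  have \<delta>0: "0 < \<delta>0" "\<delta>0 \<le> Sm" using Sm Aq0 by (auto simp: \<delta>0_def)
  define k where "k = clamp_real 0 T'"
  have kin: "k t \<in> {0..T'}" for t unfolding k_def by (rule clamp_real_in) (use T' in simp)
  have kid: "k t = t" if "t \<in> {0..T'}" for t using that by (simp add: k_def clamp_real_id)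
  have kc: "continuous_on S k" for S unfolding k_def by (intro continuous_intros)
  define l where "l = clamp_real 0 L"
  have lin: "l t \<in> {0..L}" for t unfolding l_def by (rule clamp_real_in) (use L in simp)
  have lid: "l t = t" if "t \<in> {0..L}" for t using that by (simp add: l_def clamp_real_id)
  have lc: "continuous_on S l" for S unfolding l_def by (intro continuous_intros)
  define B where "B t x = A (k t, l x)" for t x
  have B_eq: "B t x = A (t, x)" if "t \<in> {0..T'}" "x \<in> {0..L}" for t x using that by (simp add: B_def kid lid)
  have Bc: "continuous_on UNIV (\<lambda>q. B (fst q) (snd q))" unfolding B_def
    by (rule continuous_on_compose2[OF AQ])
      (use kin lin in \<open>auto intro!: continuous_intros continuous_on_compose2[OF kc] continuous_on_compose2[OF lc]\<close>)
  have B_ge: "\<delta>0 \<le> B t x" "B t x \<le> A q1" for t x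
    using q0(2) q1(2) kin[of t] lin[of x] by (auto simp: B_def \<delta>0_def min_le_iff_disj)
  have B_pos: "0 < B t x" for t x using B_ge(1)[of t x] \<delta>0 by linarith
  have Bxc: "continuous_on S (B t)" for S t
    by (intro continuous_on_compose_pair[OF Bc] continuous_intros)
  have iBc: "continuous_on UNIV (\<lambda>q. 1 / B (fst q) (snd q))"
    using B_pos by (intro continuous_intros Bc) (auto simp: less_imp_neq[THEN not_sym])
  have iBxc: "continuous_on S (\<lambda>y. 1 / B t y)" for S t
    by (rule continuous_on_compose_pair[OF iBc]) (intro continuous_intros)+
  define J where "J t x = prim (\<lambda>y. 1 / B t y) x" for t x
  have Jc: "continuous_on UNIV (\<lambda>q. J (fst q) (snd q))"
    unfolding J_def by (rule continuous_on_prim_joint[OF iBc])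
  have Jpos: "J t x1 < J t x2" if "x1 < x2" for t x1 x2
  proof -
    have "1 / A q1 \<le> 1 / B t y" for y 
      using B_ge(2)[of t y] B_pos[of t y] by (intro divide_left_mono mult_pos_pos) auto
    from prim_lower[OF iBxc this, of x1 x2] have "1 / A q1 * (x2 - x1) \<le> J t x2 - J t x1" using that by (simp add: J_def)
    moreover have "0 < 1 / A q1 * (x2 - x1)" using that less_le_trans[OF B_pos B_ge(2)] by simp
    ultimately show ?thesis by linarith
  qed
  have J0: "J t 0 = 0" for t by (simp add: J_def)
  have JL: "0 < J t L" for t using Jpos[OF L, of t] by (simp add: J0)
  have J_diff: "J t x2 - J t x1 = integral {x1..x2} (\<lambda>y. 1 / B t y)" if "x1 \<le> x2" for t x1 x2
    unfolding J_def by (rule prim_diff[OF iBxc that])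
  define c where "c t = (vL (k t) - vin (k t)) / J t L" for t
  have cc: "continuous_on S c" for S unfolding c_def
    using JL by (intro continuous_intros continuous_on_compose2[OF vL_cont kc] continuous_on_compose2[OF vin_cont kc]
      continuous_on_compose_pair[OF Jc]) (auto simp: less_imp_neq[THEN not_sym])
  have c0: "0 \<le> c t" for t using v_bounds(2)[of "k t"] JL[of t] by (simp add: c_def)
  have v_open: "v (t, x) = vin t + c t * J t x" if t: "0 < t" "t \<le> T'" and x: "x \<in> {0..L}" for t x
  proof -
    have t1: "t \<in> {0<..<T}" "t \<in> {0..T'}" using t T' by auto
    define y1 y2 where "y1 = L / 3" and "y2 = 2 * L / 3"
    have y: "0 < y1" "y1 < y2" "y2 < L" using L by (auto simp: y1_def y2_def)
    define D P where "D = v (t, y2) - v (t, y1)" and "P = J t y2 - J t y1"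
    have P: "0 < P" using Jpos[OF y(2)] by (simp add: P_def)
    have int: "integral {x1..x2} (\<lambda>y. 1 / A (t, y)) = J t x2 - J t x1" if "0 < x1" "x1 \<le> x2" "x2 < L" for x1 x2
      unfolding J_diff[OF that(2)] by (rule integral_cong) (use that t1 in \<open>auto simp: B_eq\<close>)
    \<comment> \<open>Proportionality says that \<open>e\<close> is constant; its values at 0 and at
      L give the rate \<open>D / P\<close> in terms of the boundary velocities.\<close>
    define e where "e x = v (t, x) * P - D * J t x" for x
    have ec: "continuous_on {0..L} e" unfolding e_def
      by (intro continuous_intros slice_cont continuous_on_compose_pair[OF Jc]) (use t1 in auto)
    have cst: "e x1 = e x2" if "0 < x1" "x1 \<le> x2" "x2 < L" for x1 x2
      using proportional[OF that y(1) less_imp_le[OF y(2)] y(3) t1(1)] int[OF that] int[OF y(1) less_imp_le[OF y(2)] y(3)]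
      by (simp add: e_def D_def P_def algebra_simps)
    have ex: "e z = e 0" if "z \<in> {0..L}" for z by (rule constant_on_Icc[OF ec cst L that]) (use L in auto)
    have "v (t, L) * P - D * J t L = v (t, 0) * P" using ex[of L] L by (simp add: e_def J0)
    then have "(vL t - vin t) * P = D * J t L" using v_inlet[of t] v_outlet[of t] t1 by (simp add: algebra_simps)
    then have ct: "c t = D / P" using JL[of t] P kid[OF t1(2)] by (simp add: c_def field_simps)
    have "v (t, x) * P - D * J t x = v (t, 0) * P" using ex[OF x] by (simp add: e_def J0)
    then show ?thesis using v_inlet[of t] t1 P by (simp add: ct field_simps)
  qed
  have v_eq: "v (t, x) = vin t + c t * J t x" if t: "t \<in> {0..T'}" and x: "x \<in> {0..L}" for t x
  proof -
    have "v (t, x) - (vin t + c t * J t x) = 0"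
    proof (rule zero_on_Icc[OF _ T'(1) _ t])
      show "continuous_on {0..T'} (\<lambda>t. v (t, x) - (vin t + c t * J t x))"
        by (intro continuous_intros cc continuous_on_subset[OF vin_cont] continuous_on_compose_pair[OF Jc]
          continuous_on_subset[OF slice_cont(4)[OF x]]) (use T' in auto)
    qed (use v_open x in auto)
    then show ?thesis by simp
  qed
  \<comment> \<open>The flux, with the space variable first so that \<open>prim (f x)\<close>
    integrates it over time.\<close>
  define f where "f x t = (vin t + c t * J t x) * B t x" for x t
  have fc: "continuous_on UNIV (\<lambda>q. f (fst q) (snd q))" unfolding f_def
    by (intro continuous_intros continuous_on_compose2[OF vin_cont] continuous_on_compose2[OF cc]
      continuous_on_compose_pair[OF Jc] continuous_on_compose_pair[OF Bc]) auto
  have fxc: "continuous_on S (f x)" for S x by (intro continuous_on_compose_pair[OF fc] continuous_intros)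
  have Fc: "continuous_on UNIV (\<lambda>q. prim (f (fst q)) (snd q))" by (rule continuous_on_prim_joint[OF fc])
  have Pc: "continuous_on UNIV (\<lambda>q. prim (B (fst q)) (snd q))" by (rule continuous_on_prim_joint[OF Bc])
  \<comment> \<open>The label of \<open>x\<close> plus the mass that has flowed past it. The balance
    over boxes makes this constant in time, so the time derivative of the label is minus the
    flux.\<close>
  define g where "g t x = prim (B t) x - N t + prim (f x) t" for t x
  have g_const: "g t2 x = g t1 x" if t: "0 < t1" "t1 \<le> t2" "t2 \<le> T'" and x: "x \<in> {0..L}" for t1 t2 x
  proof -
    define e where "e x = prim (B t2) x - prim (B t1) x + (prim (f x) t2 - prim (f x) t1)" for x
    have ec: "continuous_on {0..L} e" unfolding e_def
      by (intro continuous_intros continuous_on_compose_pair[OF Fc] continuous_on_compose_pair[OF Pc])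
    have "e x1 = e x2" if xx: "0 < x1" "x1 \<le> x2" "x2 < L" for x1 x2
    proof -
      have "(prim (B t2) x2 - prim (B t2) x1) - (prim (B t1) x2 - prim (B t1) x1) = integral {x1..x2} (\<lambda>x. B t2 x - B t1 x)"
        unfolding prim_diff[OF Bxc xx(2)] by (rule integral_diff[symmetric]) (intro integrable_continuous_real Bxc)+
      also have "\<dots> = integral {x1..x2} (\<lambda>x. A (t2, x) - A (t1, x))"
        by (rule integral_cong) (use t xx in \<open>simp add: B_eq\<close>)
      moreover have "(prim (f x2) t2 - prim (f x2) t1) - (prim (f x1) t2 - prim (f x1) t1) = integral {t1..t2} (\<lambda>s. f x2 s - f x1 s)"
        unfolding prim_diff[OF fxc t(2)] by (rule integral_diff[symmetric]) (intro integrable_continuous_real fxc)+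
      moreover have "\<dots> = integral {t1..t2} (\<lambda>s. v (s, x2) * A (s, x2) - v (s, x1) * A (s, x1))"
        by (rule integral_cong) (use t xx in \<open>simp add: B_eq v_eq f_def\<close>)
      ultimately show ?thesis using balance[OF t(1,2) le_less_trans[OF t(3) T'(2)] xx] by (simp add: e_def)
    qed
    from constant_on_Icc[OF ec this L x, of 0] have "e x = e 0" using L by simp
    \<comment> \<open>At the inlet the flux is the prescribed one, and so the term
      \<open>- N t\<close> cancels it.\<close>
    moreover have "prim (f 0) t2 - prim (f 0) t1 = N t2 - N t1"
    proof -
      have "integral {t1..t2} (f 0) = integral {t1..t2} q"
        by (rule integral_cong) (use t L T' in \<open>simp add: f_def J0 q_def B_eq A_inlet\<close>)
      then show ?thesis unfolding prim_diff[OF fxc t(2)] N_def prim_diff[OF q_cont t(2)] .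
    qed
    ultimately show ?thesis by (simp add: e_def g_def)
  qed
  have mass: "((\<lambda>t. prim (B t) x - N t) has_real_derivative - ((vin t + c t * prim (\<lambda>y. 1 / B t y) x) * B t x)) (at t)"
    if t: "t \<in> {0<..<T'}" and x: "x \<in> {0..L}" for t x
  proof -
    have "((\<lambda>s. g t x - prim (f x) s) has_real_derivative - f x t) (at t)"
      using prim_deriv[OF fxc, of x t] by (auto intro!: derivative_eq_intros)
    moreover have "\<forall>\<^sub>F s in nhds t. g t x - prim (f x) s = prim (B s) x - N s"
    proof -
      have "\<forall>\<^sub>F s in nhds t. s \<in> {0<..<T'}" using t by (intro eventually_nhds_in_open) auto
      then show ?thesis
      proof eventually_elim
        case (elim s)
        then have "g s x = g t x" using g_const[of s t x] g_const[of t s x] t x by (cases "s \<le> t") auto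
        then show ?case by (simp add: g_def)
      qed
    qed
    ultimately show ?thesis
      using DERIV_cong_ev[of t t "\<lambda>s. g t x - prim (f x) s" "\<lambda>s. prim (B s) x - N s" "- f x t" "- f x t"]
      by (simp add: f_def J_def)
  qed
  have "fibre_classical L vm VM Sm SM vin vL S0 S1 \<delta> T' c B" if \<delta>: "0 < \<delta>" "\<delta> \<le> \<delta>0" for \<delta>
  proof unfold_locales
    show "0 < \<delta>" "\<delta> \<le> Sm" using \<delta> \<delta>0 by auto
    show "0 < T'" by (rule T')
    show "continuous_on UNIV c" by (rule cc)
    show "0 \<le> c t" for t by (rule c0)
    show "continuous_on UNIV (\<lambda>q. B (fst q) (snd q))" by (rule Bc)
    show "\<delta> \<le> B t x" for t x using \<delta> B_ge(1)[of t x] by linarith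
    show "B t 0 = S0 t" if "t \<in> {0..T'}" for t using that T' L by (simp add: B_eq A_inlet)
    show "B 0 x = S1 x" if "x \<in> {0..L}" for x using that T' by (simp add: B_eq A_initial)
    show "c t = (vL t - vin t) / prim (\<lambda>y. 1 / B t y) L" if "t \<in> {0..T'}" for t
      using kid[OF that] by (simp add: c_def J_def)
  qed (rule mass)
  moreover have "\<forall>t\<in>{0..T'}. \<forall>x\<in>{0..L}. A (t, x) = B t x" using B_eq by simp
  moreover have "\<forall>t\<in>{0..T'}. \<forall>x\<in>{0..L}. v (t, x) = vin t + c t * prim (\<lambda>y. 1 / B t y) x" using v_eq by (simp add: J_def)
  ultimately show thesis using \<delta>0 that by blast
qed

end

text \<open>At each time t < T both solutions are classical on [0, t] with the smaller of their two
  levels \<delta>; continuity covers the times 0 and T.\<close>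

lemma strong_unique:
  assumes 1: "strong_data L vm VM Sm SM vin vL S0 S1 \<mu> T A1 v1" and 2: "strong_data L vm VM Sm SM vin vL S0 S1 \<mu> T A2 v2"
    and q: "q \<in> closure (QT T L)"
  shows "A1 q = A2 q \<and> v1 q = v2 q"
proof -
  interpret s1: strong_data L vm VM Sm SM vin vL S0 S1 \<mu> T A1 v1 by (rule 1)
  interpret s2: strong_data L vm VM Sm SM vin vL S0 S1 \<mu> T A2 v2 by (rule 2)
  have eq: "A1 (t, x) = A2 (t, x) \<and> v1 (t, x) = v2 (t, x)" if t: "0 < t" "t < T" and x: "x \<in> {0..L}" for t x
  proof -
    obtain c1 B1 \<delta>1 where c1: "0 < \<delta>1" "\<delta>1 \<le> Sm"
      "\<forall>\<delta>. 0 < \<delta> \<and> \<delta> \<le> \<delta>1 \<longrightarrow> fibre_classical L vm VM Sm SM vin vL S0 S1 \<delta> t c1 B1"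
      "\<forall>s\<in>{0..t}. \<forall>x\<in>{0..L}. A1 (s, x) = B1 s x"
      "\<forall>s\<in>{0..t}. \<forall>x\<in>{0..L}. v1 (s, x) = vin s + c1 s * prim (\<lambda>y. 1 / B1 s y) x"
      by (rule s1.classical[OF t])
    obtain c2 B2 \<delta>2 where c2: "0 < \<delta>2" "\<delta>2 \<le> Sm"
      "\<forall>\<delta>. 0 < \<delta> \<and> \<delta> \<le> \<delta>2 \<longrightarrow> fibre_classical L vm VM Sm SM vin vL S0 S1 \<delta> t c2 B2"
      "\<forall>s\<in>{0..t}. \<forall>x\<in>{0..L}. A2 (s, x) = B2 s x"
      "\<forall>s\<in>{0..t}. \<forall>x\<in>{0..L}. v2 (s, x) = vin s + c2 s * prim (\<lambda>y. 1 / B2 s y) x"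
      by (rule s2.classical[OF t])
    have f: "fibre_classical L vm VM Sm SM vin vL S0 S1 (min \<delta>1 \<delta>2) t c1 B1" "fibre_classical L vm VM Sm SM vin vL S0 S1 (min \<delta>1 \<delta>2) t c2 B2"
      using c1(1,3) c2(1,3) by auto
    have tt: "t \<in> {0..t}" using t by simp
    have B: "B1 t y = B2 t y" if "y \<in> {0..L}" for y by (rule classical_unique(1)[OF f tt that])
    have "c1 t = c2 t" by (rule classical_unique(2)[OF f tt x])
    moreover have "prim (\<lambda>y. 1 / B1 t y) x = prim (\<lambda>y. 1 / B2 t y) x"
    proof -
      have "integral {0..x} (\<lambda>y. 1 / B1 t y) = integral {0..x} (\<lambda>y. 1 / B2 t y)"
        by (rule integral_cong) (use B x in auto)
      then show ?thesis using x by (cases "x = 0") (auto simp: prim_def)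
    qed
    ultimately show ?thesis using c1(4,5) c2(4,5) B[OF x] tt x by simp
  qed
  obtain t x where tx: "q = (t, x)" "t \<in> {0..T}" "x \<in> {0..L}"
    using q unfolding closure_QT[OF s1.T s1.L] by auto
  have "A1 (t, x) - A2 (t, x) = 0"
    by (rule zero_on_Icc[OF _ s1.T _ tx(2)]) (use eq tx(3) in \<open>auto intro!: continuous_intros s1.slice_cont s2.slice_cont\<close>)
  moreover have "v1 (t, x) - v2 (t, x) = 0"
    by (rule zero_on_Icc[OF _ s1.T _ tx(2)]) (use eq tx(3) in \<open>auto intro!: continuous_intros s1.slice_cont s2.slice_cont\<close>)
  ultimately show ?thesis using tx(1) by simp
qed

section \<open>Freezing the data and conclusion\<close>

lemma le_on_Icc:
  fixes f g :: "real \<Rightarrow> real"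
  assumes "continuous_on {a..b} f" "continuous_on {a..b} g" "a < b"
    "\<And>t. t \<in> {a<..<b} \<Longrightarrow> f t \<le> g t" "t \<in> {a..b}"
  shows "f t \<le> g t"
proof -
  have "max 0 (f t - g t) = 0"
    by (rule zero_on_Icc[OF _ assms(3) _ assms(5)]) (use assms(4) in \<open>auto intro!: continuous_intros assms(1,2)\<close>)
  then show ?thesis by simp
qed

text \<open>Freezing a continuously differentiable function outside [0, T] creates corners at the
  two end points only and preserves the Lipschitz constant.\<close>

lemma C1_clamp:
  fixes f :: "real \<Rightarrow> real"
  assumes T: "0 < T" and f: "continuous_on {0..T} f" and D: "continuous_on {0..T} D"
    and fD: "\<And>t. t \<in> {0<..<T} \<Longrightarrow> (f has_real_derivative D t) (at t)"
  obtains d \<Lambda> where "0 \<le> \<Lambda>" "\<And>t. t \<notin> {0, T} \<Longrightarrow> ((\<lambda>t. f (clamp_real 0 T t)) has_real_derivative d t) (at t)"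
    "d \<in> borel_measurable borel" "\<And>t. \<bar>d t\<bar> \<le> \<Lambda>"
    "\<And>s t. \<bar>f (clamp_real 0 T s) - f (clamp_real 0 T t)\<bar> \<le> \<Lambda> * \<bar>s - t\<bar>"
proof -
  obtain \<Lambda> where \<Lambda>: "\<Lambda> \<ge> 0" "\<And>t. t \<in> {0..T} \<Longrightarrow> \<bar>D t\<bar> \<le> \<Lambda>" by (rule cont_bounded_Icc[OF D]) (rule that)
  let ?k = "clamp_real 0 T"
  have k: "?k t \<in> {0..T}" for t by (rule clamp_real_in) (use T in simp)
  define d where "d t = indicator {0<..<T} t * D (?k t)" for t
  have dm: "d \<in> borel_measurable borel"
    unfolding d_def
    by (intro borel_measurable_times borel_measurable_indicator borel_measurable_continuous_onI continuous_on_compose_clamp[OF D])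
      (use T in auto)
  have db: "\<bar>d t\<bar> \<le> \<Lambda>" for t using \<Lambda>(1) \<Lambda>(2)[OF k] by (auto simp: d_def indicator_def abs_mult)
  have "lac 0 T f d"
    by (rule lac_deriv[OF f finite.emptyI _ dm db]) (use fD in \<open>auto simp: d_def clamp_real_id\<close>)
  note lip = lac_lipschitz[OF this db]
  have L: "\<bar>f (?k s) - f (?k t)\<bar> \<le> \<Lambda> * \<bar>s - t\<bar>" for s t
  proof -
    have "\<bar>f (?k s) - f (?k t)\<bar> \<le> \<Lambda> * \<bar>?k s - ?k t\<bar>"
      using lip[of "?k s" "?k t"] lip[of "?k t" "?k s"] k[of s] k[of t]
      by (cases "?k s \<le> ?k t") (auto simp: abs_minus_commute)
    also have "\<dots> \<le> \<Lambda> * \<bar>s - t\<bar>" by (rule mult_left_mono[OF abs_clamp_real_diff \<Lambda>(1)])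
    finally show ?thesis .
  qed
  have der: "((\<lambda>t. f (?k t)) has_real_derivative d t) (at t)" if t: "t \<notin> {0, T}" for t
  proof -
    have cong: "((\<lambda>t. f (?k t)) has_real_derivative d t) (at t)"
      if "(h has_real_derivative d t) (at t)" "open S" "t \<in> S" "\<And>s. s \<in> S \<Longrightarrow> h s = f (?k s)" for h S
      using has_field_derivative_transform_within_open[OF that(1,2,3)] that(4) by simp
    consider "t < 0" | "0 < t" "t < T" | "T < t" using t by force
    then show ?thesis
    proof cases
      case 1
      show ?thesis by (rule cong[of "\<lambda>_. f 0" "{..<0}"]) (use 1 T in \<open>auto simp: d_def clamp_real_def\<close>)
    next
      case 2
      show ?thesis by (rule cong[of f "{0<..<T}"]) (use 2 fD[of t] in \<open>auto simp: d_def clamp_real_id\<close>)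
    next
      case 3
      show ?thesis by (rule cong[of "\<lambda>_. f T" "{T<..}"]) (use 3 T in \<open>auto simp: d_def clamp_real_def\<close>)
    qed
  qed
  show thesis by (rule that[OF \<Lambda>(1) der dm db L])
qed

lemma strong_solution_cong:
  assumes "\<And>t. t \<in> {0<..<T} \<Longrightarrow> S0 t = S0' t" "\<And>t. t \<in> {0<..<T} \<Longrightarrow> vin t = vin' t" "\<And>t. t \<in> {0<..<T} \<Longrightarrow> vL t = vL' t"
    "\<And>x. x \<in> {0<..<L} \<Longrightarrow> S1 x = S1' x"
  shows "strong_solution \<mu> T L S0 S1 vin vL A v \<longleftrightarrow> strong_solution \<mu> T L S0' S1' vin' vL' A v"
proof -
  have "(\<forall>t\<in>{0<..<T}. A (t, 0) = S0 t \<and> v (t, 0) = vin t \<and> v (t, L) = vL t) \<longleftrightarrow>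
      (\<forall>t\<in>{0<..<T}. A (t, 0) = S0' t \<and> v (t, 0) = vin' t \<and> v (t, L) = vL' t)"
    "(\<forall>x\<in>{0<..<L}. A (0, x) = S1 x) \<longleftrightarrow> (\<forall>x\<in>{0<..<L}. A (0, x) = S1' x)"
    using assms by auto
  then show ?thesis by (simp only: strong_solution_def)
qed

theorem theorem3:
  fixes L T \<mu> vm VM Sm SM :: real
    and vin vL S0 S1 :: "real \<Rightarrow> real"
  assumes "L > 0" and "T > 0" and "\<mu> > 0"
    and "continuous_on {0..T} S0" and "sobolev 2 \<infinity> {0<..<T} S0"
    and "continuous_on {0..L} S1" and "sobolev 2 2 {0<..<L} S1"
    and "continuous_on {0..T} vin" and "sobolev 1 \<infinity> {0<..<T} vin"
    and "continuous_on {0..T} vL" and "sobolev 1 \<infinity> {0<..<T} vL"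
    and "0 < vm" and "\<And>t. t \<in> {0<..<T} \<Longrightarrow> vm \<le> vin t \<and> vin t < vL t \<and> vL t \<le> VM"
    and "0 < Sm" and "\<And>t. t \<in> {0<..<T} \<Longrightarrow> Sm \<le> S0 t \<and> S0 t \<le> SM"
    and "\<And>x. x \<in> {0<..<L} \<Longrightarrow> Sm \<le> S1 x \<and> S1 x \<le> SM"
    and "S0 0 = S1 0"
  shows "\<exists>A v. strong_solution \<mu> T L S0 S1 vin vL A v \<and>
           (Lp_on \<infinity> (QT T L) A \<and>
            weak_deriv_in_Linf (QT T L) [dir_t] A \<and>
            weak_deriv_in_Linf (QT T L) [dir_x] A \<and>
            Lp_on \<infinity> (QT T L) v \<and>
            weak_deriv_in_Linf (QT T L) [dir_t] v \<and>
            weak_deriv_in_Linf (QT T L) [dir_t, dir_x] v \<and>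
            weak_deriv_in_Linf (QT T L) [dir_x, dir_x] v) \<and>
           (\<forall>A' v'. strong_solution \<mu> T L S0 S1 vin vL A' v' \<longrightarrow>
              (\<forall>q\<in>closure (QT T L). A' q = A q \<and> v' q = v q))"
proof -
  let ?vin = "\<lambda>t. vin (clamp_real 0 T t)" and ?vL = "\<lambda>t. vL (clamp_real 0 T t)"
  let ?S0 = "\<lambda>t. S0 (clamp_real 0 T t)" and ?S1 = "\<lambda>x. S1 (clamp_real 0 L x)"
  note LT = \<open>L > 0\<close> \<open>T > 0\<close>
  have kT: "clamp_real 0 T t \<in> {0..T}" and kL: "clamp_real 0 L t \<in> {0..L}" for t
    using LT by (intro clamp_real_in; simp)+
  have vb: "vm \<le> vin t" "vin t \<le> vL t" "vL t \<le> VM" "Sm \<le> S0 t" "S0 t \<le> SM" if "t \<in> {0..T}" for t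
    by (rule le_on_Icc[OF _ _ LT(2) _ that]; use assms(4,8,10,13,15) in \<open>auto simp: less_imp_le\<close>)+
  have Sb: "Sm \<le> S1 x" "S1 x \<le> SM" if "x \<in> {0..L}" for x
    by (rule le_on_Icc[OF _ _ LT(1) _ that]; use assms(6,16) in auto)+
  interpret fibre L vm VM Sm SM ?vin ?vL ?S0 ?S1
    by unfold_locales (use assms vb[OF kT] Sb[OF kL] in \<open>auto intro!: continuous_on_compose_clamp simp: clamp_real_id\<close>)
  \<comment> \<open>A strong solution refers to the data on the open intervals only, where freezing
    changes nothing.\<close>
  have cong: "strong_solution \<mu> T L S0 S1 vin vL A v \<longleftrightarrow> strong_solution \<mu> T L ?S0 ?S1 ?vin ?vL A v" for A v
    by (rule strong_solution_cong) (auto simp: clamp_real_id)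
  have data: "strong_data L vm VM Sm SM ?vin ?vL ?S0 ?S1 \<mu> T A v" if "strong_solution \<mu> T L S0 S1 vin vL A v" for A v
    by unfold_locales (use that assms cong in \<open>auto simp: clamp_real_id\<close>)
  obtain D0 where D0: "continuous_on {0..T} D0" "\<And>t. t \<in> {0<..<T} \<Longrightarrow> (S0 has_real_derivative D0 t) (at t)"
    by (rule sobolev_2_C1[OF LT(2) assms(4) disjI1[OF refl] assms(5)]) (rule that)
  obtain D1 where D1: "continuous_on {0..L} D1" "\<And>x. x \<in> {0<..<L} \<Longrightarrow> (S1 has_real_derivative D1 x) (at x)"
    by (rule sobolev_2_C1[OF LT(1) assms(6) disjI2[OF refl] assms(7)]) (rule that)
  obtain d0 \<Lambda>0 where d0: "0 \<le> \<Lambda>0" "\<And>t. t \<notin> {0, T} \<Longrightarrow> (?S0 has_real_derivative d0 t) (at t)"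
    "d0 \<in> borel_measurable borel" "\<And>t. \<bar>d0 t\<bar> \<le> \<Lambda>0" "\<And>s t. \<bar>?S0 s - ?S0 t\<bar> \<le> \<Lambda>0 * \<bar>s - t\<bar>"
    by (rule C1_clamp[OF LT(2) assms(4) D0]) (assumption, rule that)
  obtain d1 \<Lambda>1 where d1: "0 \<le> \<Lambda>1" "\<And>t. t \<notin> {0, L} \<Longrightarrow> (?S1 has_real_derivative d1 t) (at t)"
    "d1 \<in> borel_measurable borel" "\<And>t. \<bar>d1 t\<bar> \<le> \<Lambda>1" "\<And>s t. \<bar>?S1 s - ?S1 t\<bar> \<le> \<Lambda>1 * \<bar>s - t\<bar>"
    by (rule C1_clamp[OF LT(1) assms(6) D1]) (assumption, rule that)
  obtain dvin where dvin: "lac 0 T vin dvin" by (rule sobolev_1_Linf_lac[OF LT(2) assms(8,9)])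
  obtain dvL where dvL: "lac 0 T vL dvL" by (rule sobolev_1_Linf_lac[OF LT(2) assms(10,11)])
  \<comment> \<open>One Lipschitz constant for the inlet and the initial area.\<close>
  define \<Lambda> where "\<Lambda> = max \<Lambda>0 \<Lambda>1"
  have \<Lambda>: "0 \<le> \<Lambda>" "\<Lambda>0 \<le> \<Lambda>" "\<Lambda>1 \<le> \<Lambda>" using d0(1) by (auto simp: \<Lambda>_def)
  \<comment> \<open>This level depends on the data and on T alone, so it can be fixed before the
    fixed point is taken; no area of the fixed point falls below it.\<close>
  define \<delta> where "\<delta> = floor_bound \<Lambda> T"
  interpret fibre_trunc L vm VM Sm SM ?vin ?vL ?S0 ?S1 \<delta>
    by unfold_locales (use floor_bound LT in \<open>auto simp: \<delta>_def\<close>)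
  obtain c where c: "continuous_on UNIV c" "\<And>t. 0 \<le> c t" "\<And>t. c t \<le> VM * SM / L"
    "\<And>t. t \<in> {0..T} \<Longrightarrow> c t = F (prim c) t" "\<exists>M. \<forall>t. \<bar>prim c t\<bar> \<le> M"
    by (rule fixed_point_density[OF LT(2)]) (rule that)
  obtain M where M: "\<And>t. \<bar>prim c t\<bar> \<le> M" using c(5) by blast
  have lip: "\<bar>?S0 s - ?S0 t\<bar> \<le> \<Lambda> * \<bar>s - t\<bar>" "\<bar>?S1 s - ?S1 t\<bar> \<le> \<Lambda> * \<bar>s - t\<bar>" for s t
    using order_trans[OF d0(5) mult_right_mono[OF \<Lambda>(2)]] order_trans[OF d1(5) mult_right_mono[OF \<Lambda>(3)]] by auto
  \<comment> \<open>Since \<open>prim c\<close> is bounded by \<open>M\<close> on the whole line,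
    \<open>SM + 2 * M\<close> dominates the area of every label at every time. The corner sets are
    the end points at which the data are frozen.\<close>
  interpret fibre_evolution L vm VM Sm SM ?vin ?vL ?S0 ?S1 \<delta> T \<Lambda> "SM + 2 * M" c d0 d1 dvin dvL "{0, T}" "{0, L}"
  proof unfold_locales
    show "0 < T" by (rule LT)
    show "continuous_on UNIV c" "\<And>t. 0 \<le> c t" "\<And>t. t \<in> {0..T} \<Longrightarrow> c t = F (prim c) t" by (rule c)+
    show "0 < SM + 2 * M" using SM M[of 0] by simp
    show "b m + prim c (\<tau> m) - prim c t \<le> SM + 2 * M" for t m
      using b_bounds[of m] M[of "\<tau> m"] M[of t] by (simp add: abs_le_iff)
    show "\<delta> \<le> b m - (prim c t - prim c (\<tau> m))" if "t \<in> {0..T}" "- N t \<le> m" "m \<le> mL (prim c) t" for t m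
      by (rule no_truncation[OF LT(2) \<Lambda>(1) lip \<delta>_def c(1-4) that])
    show "(?S0 has_real_derivative d0 t) (at t)" if "t \<notin> {0, T}" for t by (rule d0(2)[OF that])
    show "(?S1 has_real_derivative d1 t) (at t)" if "t \<notin> {0, L}" for t by (rule d1(2)[OF that])
    show "d0 \<in> borel_measurable borel" "d1 \<in> borel_measurable borel" by (rule d0 d1)+
    show "\<bar>d0 t\<bar> \<le> \<Lambda>" "\<bar>d1 t\<bar> \<le> \<Lambda>" for t using d0(4)[of t] d1(4)[of t] \<Lambda> by linarith+
    show "lac 0 T ?vin dvin" by (rule cong_lac[OF dvin]) (simp add: clamp_real_id)
    show "lac 0 T ?vL dvL" by (rule cong_lac[OF dvL]) (simp add: clamp_real_id)
  qed auto
  let ?A = "\<lambda>q. A (fst q) (snd q)" and ?v = "\<lambda>q. v (fst q) (snd q)"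
  have sol: "strong_solution \<mu> T L S0 S1 vin vL ?A ?v" unfolding cong by (rule solution)
  have "A' q = ?A q \<and> v' q = ?v q" if "strong_solution \<mu> T L S0 S1 vin vL A' v'" "q \<in> closure (QT T L)" for A' v' q
    by (rule strong_unique[OF data[OF that(1)] data[OF sol] that(2)])
  then show ?thesis using sol solution(2-8) by (intro exI[of _ ?A] exI[of _ ?v]) blast
qed

end
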